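(* Let $F,\Sigma\in\mathbb{R}^{d\times d}$, $H\in\mathbb{R}^{k\times d}$, $\Gamma\in\mathbb{R}^{k\times k}$, where $(H,F)$ is a c-detectable pair and $\Sigma,\Gamma$ are symmetric positive definite. For $\nu\in\mathcal{P}_2(\mathbb{R}^d)$, let $(X_t^\nu)_{t\ge0}$ be the solution of the continuous-time mean-field ensemble Kalman filter (defined in the context) with initial datum $X_0\sim\nu$, and let $\pi_t^\nu$ be its conditional law given $(Z_s^\dagger)_{s\le t}$; recall that $\mathrm{Cov}(\pi_t^\nu)$ is independent of $(Z_t^\dagger)_{t\ge0}$. Then for any $\mu\in\mathcal{P}_2(\mathbb{R}^d)$ with $\mathrm{Cov}(\mu)\succ0$ and all $t\ge 0$, $$W_2(\pi_t^\mu,\pi_t^{\mathcal{G}\mu};\mathrm{Cov}(\pi_t^\mu))\le\exp\left(-\frac12\int_0^t\beta_c(\mathrm{Cov}(\pi_s^\mu))\,ds\right)W_2(\mu,\mathcal{G}\mu;\mathrm{Cov}(\mu))$$ for every sample path of $(Z_t^\dagger)_{t\ge0}$, where $\beta_c$, mapping symmetric positive definite $d\times d$ matrices to strictly positive reals, is defined by $$\beta_c(C):=\lambda_{\min}\left(C^{1/2}H^T\Gamma^{-1}HC^{1/2}+C^{-1/2}\Sigma C^{-1/2}\right).$$ Moreover, there is $\beta_0>0$ depending on $\mathrm{Cov}(\mu)$ such that $\beta_c(\mathrm{Cov}(\pi_t^\mu))\ge\beta_0$ for all $t\ge0$, and thus $$W_2(\pi_t^\mu,\pi_t^{\mathcal{G}\mu};\mathrm{Cov}(\pi_t^\mu))\le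 e^{-\frac12\beta_0t}\,W_2(\mu,\mathcal{G}\mu;\mathrm{Cov}(\mu))\quad\text{for all }t\ge0.$$
   Context: $\mathcal{P}_2(\mathbb{R}^d)$: Borel probability measures on $\mathbb{R}^d$ with finite second moments; $\mathrm{Cov}$ denotes the covariance matrix; $\lambda_{\min}(S)$ is the smallest eigenvalue of a symmetric matrix $S$. The Gaussian projection of $\mu\in\mathcal{P}_2(\mathbb{R}^d)$ is $\mathcal{G}\mu:=N(m,\mathrm{Cov}(\mu))$ with $m$ the mean of $\mu$. For $M$ symmetric positive definite, $|v|_M^2:=v^TM^{-1}v$ and $W_2(\mu,\nu;M):=\inf_{\gamma\in\Pi(\mu,\nu)}\left(\iint|x-y|_M^2\,d\gamma(x,y)\right)^{1/2}$, where $\Pi(\mu,\nu)$ is the set of couplings of $\mu,\nu$. A pair $(H,F)$ is c-detectable if there exists $K\in\mathbb{R}^{d\times k}$ such that all eigenvalues of $F-KH$ have strictly negative real part. Signal-observation model: $dX_t^\dagger=FX_t^\dagger\,dt+\sqrt{\Sigma}\,dB_t^\dagger$, $dZ_t^\dagger=HX_t^\dagger\,dt+\sqrt{\Gamma}\,dW_t^\dagger$, where $B^\dagger,W^\dagger$ are standard Brownian motions independent of each other and of the initial datum $X_0^\dagger$. Continuous-time mean-field ensemble Kalman filter (MFEnKF): with $X_0\sim\mu$, $$dX_t=FX_t\,dt+\sqrt{\Sigma}\,dB_t-\mathrm{Cov}(\pi_t^\mu)H^T\Gamma^{-1}\left(HX_t\,dt+\sqrt{\Gamma}\,dW_t-dZ_t^\dagger\right),$$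 where $B,W$ are standard Brownian motions independent of each other, of $X_0$, and of the observation $Z^\dagger$ (and $X_0$ is independent of $Z^\dagger$), and $\pi_t^\mu$ is the conditional law of $X_t$ given $(Z_s^\dagger)_{s\le t}$. The covariance $C_t=\mathrm{Cov}(\pi_t^\mu)$ solves $\dot C_t=C_tF^T+FC_t+\Sigma-C_tH^T\Gamma^{-1}HC_t$, $C_0=\mathrm{Cov}(\mu)$. All MFEnKF distributions being compared are driven by the same observation path. *)

theory Defs
  imports "HOL-Probability.Probability"
begin

section \<open>Matrices\<close>

definition pos_def :: "real^'n^'n \<Rightarrow> bool" where
  "pos_def A \<longleftrightarrow> transpose A = A \<and> (\<forall>v. v \<noteq> 0 \<longrightarrow> 0 < v \<bullet> (A *v v))"

definition pos_semidef :: "real^'n^'n \<Rightarrow> bool" where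
  "pos_semidef A \<longleftrightarrow> transpose A = A \<and> (\<forall>v. 0 \<le> v \<bullet> (A *v v))"

text \<open>Only meaningful for positive semidefinite arguments, where the root exists and is unique.\<close>

definition sqrtm :: "real^'n^'n \<Rightarrow> real^'n^'n" where
  "sqrtm A = (THE S. pos_semidef S \<and> S ** S = A)"

definition eigenvalues :: "'a::field^'n^'n \<Rightarrow> 'a set" where
  "eigenvalues A = {c. \<exists>v. v \<noteq> 0 \<and> A *v v = c *s v}"

definition lambda_min :: "real^'n^'n \<Rightarrow> real" where
  "lambda_min S = Min (eigenvalues S)"

definition complex_matrix :: "real^'n^'m \<Rightarrow> complex^'n^'m" where
  "complex_matrix A = (\<chi> i j. complex_of_real (A $ i $ j))"

definition c_detectable :: "real^'d^'k \<Rightarrow> real^'d^'d \<Rightarrow> bool" where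
  "c_detectable H F \<longleftrightarrow>
     (\<exists>K :: real^'k^'d. \<forall>c \<in> eigenvalues (complex_matrix (F - K ** H)). Re c < 0)"

definition beta_c :: "real^'d^'k \<Rightarrow> real^'k^'k \<Rightarrow> real^'d^'d \<Rightarrow> real^'d^'d \<Rightarrow> real" where
  "beta_c H \<Gamma> \<Sigma> C =
     lambda_min (sqrtm C ** transpose H ** matrix_inv \<Gamma> ** H ** sqrtm C
                 + matrix_inv (sqrtm C) ** \<Sigma> ** matrix_inv (sqrtm C))"


section \<open>Measures with finite second moment and weighted Wasserstein distance\<close>

definition P2 :: "(real^'d) measure set" where
  "P2 = {\<mu>. prob_space \<mu> \<and> sets \<mu> = sets borel \<and> integrable \<mu> (\<lambda>x. (norm x)\<^sup>2)}"

definition mean :: "(real^'d) measure \<Rightarrow> real^'d" where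
  "mean \<mu> = (\<integral>x. x \<partial>\<mu>)"

definition Cov :: "(real^'d) measure \<Rightarrow> real^'d^'d" where
  "Cov \<mu> = (\<chi> i j. \<integral>x. (x $ i - mean \<mu> $ i) * (x $ j - mean \<mu> $ j) \<partial>\<mu>)"

definition std_gaussian :: "(real^'d) measure" where
  "std_gaussian = density lborel (\<lambda>x. ennreal (\<Prod>i\<in>UNIV. std_normal_density (x $ i)))"

text \<open>The law of \<open>m + C\<^sup>1\<^sup>/\<^sup>2 \<xi>\<close> with \<open>\<xi>\<close> standard normal, so that degenerate \<open>C\<close> is covered.\<close>

definition gaussian :: "real^'d \<Rightarrow> real^'d^'d \<Rightarrow> (real^'d) measure" where
  "gaussian m C = distr std_gaussian borel (\<lambda>x. m + sqrtm C *v x)"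

definition gaussian_proj :: "(real^'d) measure \<Rightarrow> (real^'d) measure" where
  "gaussian_proj \<mu> = gaussian (mean \<mu>) (Cov \<mu>)"

definition couplings ::
  "(real^'d) measure \<Rightarrow> (real^'d) measure \<Rightarrow> ((real^'d) \<times> (real^'d)) measure set" where
  "couplings \<mu> \<nu> = {\<gamma>. prob_space \<gamma> \<and> sets \<gamma> = sets (borel \<Otimes>\<^sub>M borel)
                      \<and> distr \<gamma> borel fst = \<mu> \<and> distr \<gamma> borel snd = \<nu>}"

definition wnorm_sq :: "real^'d^'d \<Rightarrow> real^'d \<Rightarrow> real" where
  "wnorm_sq M v = v \<bullet> (matrix_inv M *v v)"

text \<open>For \<open>\<mu>, \<nu> \<in> P2\<close> the cost is integrable under every coupling, so that the
  real-valued integral is the right one.\<close>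

definition W2 :: "(real^'d) measure \<Rightarrow> (real^'d) measure \<Rightarrow> real^'d^'d \<Rightarrow> real" where
  "W2 \<mu> \<nu> M = (INF \<gamma> \<in> couplings \<mu> \<nu>. sqrt (\<integral>(x, y). wnorm_sq M (x - y) \<partial>\<gamma>))"


section \<open>Processes\<close>

definition gen_algebra ::
  "'a measure \<Rightarrow> real set \<Rightarrow> (real \<Rightarrow> 'a \<Rightarrow> 'b::topological_space) \<Rightarrow> 'a measure" where
  "gen_algebra M T Y =
     sigma (space M) (\<Union>t\<in>T. {Y t -` A \<inter> space M | A. A \<in> sets borel})"

definition indep3 :: "'a measure \<Rightarrow> 'a measure \<Rightarrow> 'a measure \<Rightarrow> 'a measure \<Rightarrow> bool" where
  "indep3 M G1 G2 G3 \<longleftrightarrow>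
     prob_space.indep_sets M (\<lambda>i::nat. sets ([G1, G2, G3] ! i)) {..<3}"

definition continuous_process :: "'a measure \<Rightarrow> (real \<Rightarrow> 'a \<Rightarrow> real^'n) \<Rightarrow> bool" where
  "continuous_process M Y \<longleftrightarrow>
     (\<forall>t\<ge>0. Y t \<in> borel_measurable M) \<and>
     (\<forall>\<omega>\<in>space M. continuous_on {0..} (\<lambda>t. Y t \<omega>))"

definition brownian_motion :: "'a measure \<Rightarrow> (real \<Rightarrow> 'a \<Rightarrow> real^'n) \<Rightarrow> bool" where
  "brownian_motion M B \<longleftrightarrow>
     continuous_process M B \<and>
     (\<forall>\<omega>\<in>space M. B 0 \<omega> = 0) \<and>
     (\<forall>s\<ge>0. \<forall>t\<ge>s. distr M borel (\<lambda>\<omega>. B t \<omega> - B s \<omega>) = gaussian 0 ((t - s) *\<^sub>R mat 1)) \<and>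
     (\<forall>(n::nat) \<tau>. 0 \<le> \<tau> 0 \<longrightarrow> (\<forall>i<n. \<tau> i \<le> \<tau> (Suc i)) \<longrightarrow>
        prob_space.indep_vars M (\<lambda>_. borel) (\<lambda>i \<omega>. B (\<tau> (Suc i)) \<omega> - B (\<tau> i) \<omega>) {..<n})"

text \<open>\<open>stoch_integral M K J t I\<close> says that \<open>I = \<integral>\<^sub>0\<^sup>t K\<^sub>s dJ\<^sub>s\<close> for a deterministic continuous
  integrand \<open>K\<close>: the left-endpoint Riemann sums converge to \<open>I\<close> in probability as the
  mesh of the partition \<open>0 = \<tau>\<^sub>0 \<le> \<dots> \<le> \<tau>\<^sub>n = t\<close> tends to 0. For a semimartingale \<open>J\<close> this is the
  Ito integral, for a deterministic path it is the Riemann-Stieltjes integral.\<close>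

definition stoch_integral ::
  "'a measure \<Rightarrow> (real \<Rightarrow> real^'k^'d) \<Rightarrow> (real \<Rightarrow> 'a \<Rightarrow> real^'k) \<Rightarrow> real \<Rightarrow> ('a \<Rightarrow> real^'d) \<Rightarrow> bool"
where
  "stoch_integral M K J t I \<longleftrightarrow>
     I \<in> borel_measurable M \<and>
     (\<forall>\<epsilon>>0. \<exists>\<delta>>0. \<forall>(n::nat) \<tau>.
        \<tau> 0 = 0 \<longrightarrow> \<tau> n = t \<longrightarrow> (\<forall>i<n. \<tau> i \<le> \<tau> (Suc i) \<and> \<tau> (Suc i) - \<tau> i < \<delta>) \<longrightarrow>
        measure M {\<eta> \<in> space M.
          norm ((\<Sum>i<n. K (\<tau> i) *v (J (\<tau> (Suc i)) \<eta> - J (\<tau> i) \<eta>)) - I \<eta>) > \<epsilon>} < \<epsilon>)"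

text \<open>\<open>\<kappa>\<close> is a regular conditional law of \<open>Y\<close> given the sub-\<open>\<sigma>\<close>-algebra \<open>G\<close>.\<close>

definition cond_law ::
  "'a measure \<Rightarrow> 'a measure \<Rightarrow> ('a \<Rightarrow> real^'d) \<Rightarrow> ('a \<Rightarrow> (real^'d) measure) \<Rightarrow> bool" where
  "cond_law P G Y \<kappa> \<longleftrightarrow>
     Y \<in> borel_measurable P \<and> subalgebra P G \<and>
     \<kappa> \<in> G \<rightarrow>\<^sub>M prob_algebra borel \<and>
     (\<forall>A\<in>sets borel. AE x in P.
        real_cond_exp P G (indicator (Y -` A \<inter> space P)) x = measure (\<kappa> x) A)"


section \<open>Signal, observation and mean-field ensemble Kalman filter\<close>

definition signal_observation ::
  "real^'d^'d \<Rightarrow> real^'d^'k \<Rightarrow> real^'d^'d \<Rightarrow> real^'k^'k \<Rightarrow> 'o measure \<Rightarrow>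
   (real \<Rightarrow> 'o \<Rightarrow> real^'d) \<Rightarrow> (real \<Rightarrow> 'o \<Rightarrow> real^'d) \<Rightarrow> (real \<Rightarrow> 'o \<Rightarrow> real^'k) \<Rightarrow>
   (real \<Rightarrow> 'o \<Rightarrow> real^'k) \<Rightarrow> bool" where
  "signal_observation F H \<Sigma> \<Gamma> N X B W Z \<longleftrightarrow>
     prob_space N \<and>
     brownian_motion N B \<and> brownian_motion N W \<and>
     indep3 N (gen_algebra N {0} X) (gen_algebra N {0..} B) (gen_algebra N {0..} W) \<and>
     continuous_process N X \<and> continuous_process N Z \<and>
     (AE \<omega> in N. \<forall>t\<ge>0.
        X t \<omega> = X 0 \<omega> + integral {0..t} (\<lambda>s. F *v X s \<omega>) + sqrtm \<Sigma> *v B t \<omega>) \<and>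
     (AE \<omega> in N. \<forall>t\<ge>0.
        Z t \<omega> = Z 0 \<omega> + integral {0..t} (\<lambda>s. H *v X s \<omega>) + sqrtm \<Gamma> *v W t \<omega>)"

text \<open>The filter lives on the product of the space \<open>N\<close> carrying the observation \<open>Z\<close> and a space
  \<open>M\<close> carrying \<open>X0, B, W\<close>, which makes \<open>(X0, B, W)\<close> independent of \<open>Z\<close>. The conditional law
  \<open>\<pi> t \<omega>\<close> of \<open>X t\<close> given \<open>(Z s)\<close> for \<open>s \<le> t\<close> is fixed for every \<open>\<omega>\<close>, not merely almost
  surely, by choosing the version obtained by freezing the observation path. The equation is
  likewise read along each observation path, where \<open>Cov (\<pi> t \<omega>)\<close> is deterministic. With
  the innovation \<open>J t = \<integral>\<^sub>0\<^sup>t H X\<^sub>s ds + \<Gamma>\<^sup>1\<^sup>/\<^sup>2 W\<^sub>t - Z\<^sub>t\<close> and the Kalman gain \<open>K\<close> it is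
  \<open>dX = F X dt + \<Sigma>\<^sup>1\<^sup>/\<^sup>2 dB - K dJ\<close>.\<close>

definition kalman_gain ::
  "real^'d^'k \<Rightarrow> real^'k^'k \<Rightarrow> real^'d^'d \<Rightarrow> real^'k^'d" where
  "kalman_gain H \<Gamma> C = C ** transpose H ** matrix_inv \<Gamma>"

definition mfenkf ::
  "real^'d^'d \<Rightarrow> real^'d^'k \<Rightarrow> real^'d^'d \<Rightarrow> real^'k^'k \<Rightarrow> 'o measure \<Rightarrow> (real \<Rightarrow> 'o \<Rightarrow> real^'k) \<Rightarrow>
   'p measure \<Rightarrow> (real^'d) measure \<Rightarrow> ('p \<Rightarrow> real^'d) \<Rightarrow> (real \<Rightarrow> 'p \<Rightarrow> real^'d) \<Rightarrow>
   (real \<Rightarrow> 'p \<Rightarrow> real^'k) \<Rightarrow> (real \<Rightarrow> 'o \<times> 'p \<Rightarrow> real^'d) \<Rightarrow>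
   (real \<Rightarrow> 'o \<Rightarrow> (real^'d) measure) \<Rightarrow> bool" where
  "mfenkf F H \<Sigma> \<Gamma> N Z M \<nu> X0 B W X \<pi> \<longleftrightarrow>
     prob_space M \<and>
     X0 \<in> borel_measurable M \<and> distr M borel X0 = \<nu> \<and>
     brownian_motion M B \<and> brownian_motion M W \<and>
     indep3 M (gen_algebra M {0} (\<lambda>_. X0)) (gen_algebra M {0..} B) (gen_algebra M {0..} W) \<and>
     continuous_process (N \<Otimes>\<^sub>M M) X \<and>
     (\<forall>t\<ge>0. cond_law (N \<Otimes>\<^sub>M M) (gen_algebra (N \<Otimes>\<^sub>M M) {0..t} (\<lambda>s (\<omega>, \<eta>). Z s \<omega>)) (X t)
               (\<lambda>(\<omega>, \<eta>). \<pi> t \<omega>)) \<and>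
     (\<forall>\<omega>\<in>space N.
        (\<forall>t\<ge>0. \<pi> t \<omega> = distr M borel (\<lambda>\<eta>. X t (\<omega>, \<eta>)) \<and> \<pi> t \<omega> \<in> P2) \<and>
        continuous_on {0..} (\<lambda>t. Cov (\<pi> t \<omega>)) \<and>
        (\<forall>\<eta>\<in>space M. X 0 (\<omega>, \<eta>) = X0 \<eta>) \<and>
        (\<forall>t\<ge>0. \<exists>I.
           stoch_integral M (\<lambda>s. kalman_gain H \<Gamma> (Cov (\<pi> s \<omega>)))
             (\<lambda>s \<eta>. integral {0..s} (\<lambda>r. H *v X r (\<omega>, \<eta>)) + sqrtm \<Gamma> *v W s \<eta> - Z s \<omega>) t I \<and>
           (AE \<eta> in M. X t (\<omega>, \<eta>) =
              X0 \<eta> + integral {0..t} (\<lambda>s. F *v X s (\<omega>, \<eta>)) + sqrtm \<Sigma> *v B t \<eta> - I \<eta>)))"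

end

theory Submission
  imports Defs "HOL-Computational_Algebra.Fundamental_Theorem_Algebra"
begin

text \<open>Nothing is known about a single observation path, so an integral of the gain against it
  need not exist by itself; only left-endpoint sums of the whole innovation converge, and only in
  probability. Hence \<open>\<xi>\<^sub>t\<close> is reached by summation by parts along paths and
  by sums on two scales. Convergence in probability still carries independence and equality of laws;
  the variance comes from mean-square Cauchy sums. The gain contains the covariance being computed,
  of which only continuity is given, so the Riccati equation is read off from the variance. The
  inverse covariance is not differentiated directly. With \<open>C = \<Phi> M \<Phi>\<^sup>T\<close>
  one has \<open>\<Phi>\<^sup>T C\<^sup>-\<^sup>1 \<Phi> = M\<^sup>-\<^sup>1\<close>, and
  \<open>M\<close> increases from \<open>C 0\<close>, so it is bounded below uniformly in time. For
  any gain \<open>L\<close> and the Kalman gain \<open>K\<close>, the Riccati right-hand side is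
  \<open>(F - L H) C + C (F - L H)\<^sup>T + \<Sigma> + L \<Gamma> L\<^sup>T - (K - L) \<Gamma> (K -
  L)\<^sup>T\<close>. Dropping the last term, with \<open>L\<close> from detectability, bounds
  \<open>C\<close> by some \<open>b\<close> for all times; if \<open>s\<close> bounds
  \<open>\<Sigma>\<close> from below, then \<open>\<beta>\<^sub>0 = s / b\<close> works.\<close>

text \<open>Along a fixed observation path the gain is deterministic, so \<open>X\<^sub>t = \<Phi>\<^sub>t X\<^sub>0 + \<xi>\<^sub>t\<close>, where \<open>\<Phi>\<close> is
  the flow of \<open>F - K H\<close> and \<open>\<xi>\<^sub>t\<close>, a limit of linear combinations of Brownian increments, is
  independent of \<open>X\<^sub>0\<close> with a law that depends only on the gain and the observation path.
  Computing the variance of this representation shows that the covariance solves the Riccati equation,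
  whose solution is unique, so the two filters have the same covariance, gain, \<open>\<Phi>\<close> and law of \<open>\<xi>\<close>.
  Coupling them with the same \<open>\<xi>\<close> transports any coupling of the initial laws by \<open>\<Phi>\<^sub>t\<close>, and
  \<open>\<Phi>\<^sup>T C\<^sup>-\<^sup>1 \<Phi>\<close> has derivative \<open>- \<Phi>\<^sup>T (H\<^sup>T \<Gamma>\<^sup>-\<^sup>1 H + C\<^sup>-\<^sup>1 \<Sigma> C\<^sup>-\<^sup>1) \<Phi>\<close>, which is at most
  \<open>- \<beta>\<^sub>c(C) \<Phi>\<^sup>T C\<^sup>-\<^sup>1 \<Phi>\<close>; Gronwall's inequality gives the contraction.
  Completing the square in the gain compares \<open>C\<close> with a Lyapunov equation for a constant stabilizing
  gain, which bounds \<open>C\<close> from above and hence \<open>\<beta>\<^sub>c(C)\<close> from below.\<close>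

section \<open>Symmetric matrices\<close>

declare transpose_matrix_vector [simp del]

lemma inner_matrix_transpose: "x \<bullet> (A *v y) = (transpose A *v x) \<bullet> (y::real^'n)"
  by (simp add: dot_lmul_matrix transpose_matrix_vector)

lemma inner_symmetric_matrix:
  "transpose A = A \<Longrightarrow> x \<bullet> (A *v y) = (A *v x) \<bullet> (y::real^'n)"
  by (metis inner_matrix_transpose)

text \<open>The form attains its minimum on the unit sphere of \<open>W\<close>. If the minimizer
  \<open>u\<close> were not an eigenvector, a small move along the residual
  \<open>r = A u - l u\<close>, which stays in \<open>W\<close> by invariance, would lower the
  quotient.\<close>

lemma rayleigh_minimizer:
  fixes A :: "real^'n^'n"
  assumes sym: "transpose A = A" and W: "subspace W" "W \<noteq> {0}" and inv: "\<And>w. w \<in> W \<Longrightarrow> A *v w \<in> W"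
  shows "\<exists>u\<in>W. norm u = 1 \<and> A *v u = (u \<bullet> (A *v u)) *\<^sub>R u
    \<and> (\<forall>w\<in>W. (u \<bullet> (A *v u)) * (w \<bullet> w) \<le> w \<bullet> (A *v w))"
proof -
  let ?S = "sphere 0 1 \<inter> W"
  have "compact ?S"
    by (intro compact_Int_closed closed_subspace W) auto
  moreover have "?S \<noteq> {}"
  proof -
    obtain w where "w \<in> W" "w \<noteq> 0" using W subspace_0 by blast
    then have "(1 / norm w) *\<^sub>R w \<in> ?S" by (auto simp: W subspace_scale)
    then show ?thesis by blast
  qed
  moreover have "continuous_on ?S (\<lambda>w. w \<bullet> (A *v w))"
    by (intro continuous_intros matrix_vector_mult_linear_continuous_on)
  ultimately obtain u where u: "u \<in> ?S" and min: "\<And>w. w \<in> ?S \<Longrightarrow> u \<bullet> (A *v u) \<le> w \<bullet> (A *v w)"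
    using continuous_attains_inf[of ?S "\<lambda>w. w \<bullet> (A *v w)"] by blast
  define l where "l = u \<bullet> (A *v u)"
  have uW: "u \<in> W" and uu: "u \<bullet> u = 1" using u by (auto simp: norm_eq_1)
  have le: "l * (w \<bullet> w) \<le> w \<bullet> (A *v w)" if "w \<in> W" for w
  proof (cases "w = 0")
    case False
    then have "(1 / norm w) *\<^sub>R w \<in> ?S" using that by (auto simp: W subspace_scale)
    from min[OF this] have "l \<le> (w \<bullet> (A *v w)) / (norm w)\<^sup>2"
      by (simp add: l_def matrix_vector_mult_scaleR power2_eq_square)
    then show ?thesis using False
      by (simp add: field_simps power2_norm_eq_inner)
  qed simp
  define r where "r = A *v u - l *\<^sub>R u"
  have rW: "r \<in> W" unfolding r_def using uW inv W by (simp add: subspace_diff subspace_scale)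
  have key: "0 \<le> 2 * e * (r \<bullet> r) + e\<^sup>2 * (r \<bullet> (A *v r) - l * (r \<bullet> r))" for e
  proof -
    have "u + e *\<^sub>R r \<in> W" using uW rW W by (simp add: subspace_add subspace_scale)
    from le[OF this]
    have "0 \<le> (u + e *\<^sub>R r) \<bullet> (A *v (u + e *\<^sub>R r)) - l * ((u + e *\<^sub>R r) \<bullet> (u + e *\<^sub>R r))" by simp
    also have "\<dots> = (u \<bullet> (A *v u) - l * (u \<bullet> u)) + 2 * e * (r \<bullet> (A *v u) - l * (r \<bullet> u))
        + e\<^sup>2 * (r \<bullet> (A *v r) - l * (r \<bullet> r))"
      using inner_symmetric_matrix[OF sym, of u r]
      by (simp add: matrix_vector_right_distrib matrix_vector_mult_scaleR inner_add_left inner_add_right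
          power2_eq_square algebra_simps inner_commute)
    also have "r \<bullet> (A *v u) - l * (r \<bullet> u) = r \<bullet> r"
      by (simp add: r_def inner_diff_right)
    finally show ?thesis using uu by (simp add: l_def)
  qed
  have "r \<bullet> r = 0"
  proof (rule ccontr)
    assume "r \<bullet> r \<noteq> 0"
    then have pos: "0 < r \<bullet> r" by (simp add: order_less_le)
    define g where "g = r \<bullet> (A *v r) - l * (r \<bullet> r)"
    have g: "0 \<le> g" using le[OF rW] by (simp add: g_def)
    \<comment> \<open>The step nearly minimizes the quadratic polynomial in \<open>key\<close>; the
      summand 1 keeps the denominator positive when \<open>g = 0\<close>.\<close>
    define e where "e = - (r \<bullet> r) / (g + 1)"
    have "2 * e * (r \<bullet> r) + e\<^sup>2 * g < 0"
    proof -
      have "e\<^sup>2 * g \<le> e\<^sup>2 * (g + 1)" by (simp add: mult_left_mono)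
      also have "\<dots> = - e * (r \<bullet> r)" using g by (simp add: e_def power2_eq_square)
      finally have "2 * e * (r \<bullet> r) + e\<^sup>2 * g \<le> e * (r \<bullet> r)" by simp
      also have "\<dots> < 0" using pos g by (simp add: e_def mult_neg_pos divide_neg_pos)
      finally show ?thesis .
    qed
    with key[of e] show False by (simp add: g_def)
  qed
  then have "A *v u = l *\<^sub>R u" by (simp add: r_def)
  with le uW uu show ?thesis unfolding l_def by (metis norm_eq_1)
qed

text \<open>The residual is orthogonal to \<open>B\<close> and lies in its span, hence is orthogonal
  to itself.\<close>

lemma orthonormal_expansion:
  fixes B :: "'a::euclidean_space set"
  assumes "finite B" "pairwise orthogonal B" "\<And>b. b \<in> B \<Longrightarrow> norm b = 1" "x \<in> span B"
  shows "(\<Sum>b\<in>B. (x \<bullet> b) *\<^sub>R b) = x"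
proof -
  define y where "y = x - (\<Sum>b\<in>B. (x \<bullet> b) *\<^sub>R b)"
  have "orthogonal y c" if "c \<in> B" for c
  proof -
    have "(\<Sum>b\<in>B. (x \<bullet> b) * (b \<bullet> c)) = (\<Sum>b\<in>B. if b = c then x \<bullet> c else 0)"
      using assms(2) that assms(3)[OF that]
      by (intro sum.cong refl) (auto simp: pairwise_def orthogonal_def norm_eq_1)
    then show ?thesis using that assms(1)
      by (simp add: y_def orthogonal_def inner_diff_left inner_sum_left)
  qed
  then have "orthogonal y z" if "z \<in> span B" for z
    using that orthogonal_to_span by blast
  moreover have "y \<in> span B" unfolding y_def
    by (intro span_diff assms span_sum span_scale span_base)
  ultimately have "y = 0" by (metis orthogonal_self)
  then show ?thesis by (simp add: y_def)
qed

text \<open>Take an orthonormal set of eigenvectors of greatest cardinality, which exists since the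
  dimension bounds it. Its orthogonal complement is invariant by symmetry, and a nonzero complement
  would contain one more eigenvector by \<open>rayleigh_minimizer\<close>.\<close>

lemma symmetric_orthonormal_eigenbasis:
  fixes A :: "real^'n^'n"
  assumes sym: "transpose A = A"
  shows "\<exists>B. finite B \<and> pairwise orthogonal B \<and> (\<forall>b\<in>B. norm b = 1 \<and> A *v b = (b \<bullet> (A *v b)) *\<^sub>R b)
    \<and> span B = UNIV"
proof -
  define P where "P B \<longleftrightarrow> pairwise orthogonal B \<and> (\<forall>b\<in>B. norm b = 1 \<and> A *v b = (b \<bullet> (A *v b)) *\<^sub>R b)" for B
  have indep: "independent B" if "P B" for B
    using that by (intro pairwise_orthogonal_independent) (auto simp: P_def)
  have card: "card B \<le> DIM(real^'n)" "finite B" if "P B" for B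
    using independent_bound[OF indep[OF that]] by auto
  have "\<exists>B. P B \<and> (\<forall>B'. P B' \<longrightarrow> card B' \<le> card B)"
    by (rule ex_has_greatest_nat[of P "{}" card "DIM(real^'n) + 1"])
      (use card(1) in \<open>auto simp: P_def less_Suc_eq_le\<close>)
  then obtain B where B: "P B" and max: "\<And>B'. P B' \<Longrightarrow> card B' \<le> card B" by blast
  define W where "W = {w. \<forall>b\<in>B. orthogonal w b}"
  have W: "subspace W" unfolding W_def
    by (auto simp: subspace_def orthogonal_def inner_add_left)
  have inv: "A *v w \<in> W" if "w \<in> W" for w
  proof -
    have "(A *v w) \<bullet> b = 0" if b: "b \<in> B" for b
    proof -
      have "(A *v w) \<bullet> b = w \<bullet> (A *v b)" using inner_symmetric_matrix[OF sym] by metis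
      also have "A *v b = (b \<bullet> (A *v b)) *\<^sub>R b" using B b by (simp add: P_def)
      also have "w \<bullet> \<dots> = 0" using \<open>w \<in> W\<close> b by (simp add: W_def orthogonal_def)
      finally show ?thesis .
    qed
    then show ?thesis by (simp add: W_def orthogonal_def)
  qed
  have "W = {0}"
  proof (rule ccontr)
    assume "W \<noteq> {0}"
    from rayleigh_minimizer[OF sym W this inv]
    obtain u where u: "u \<in> W" "norm u = 1" "A *v u = (u \<bullet> (A *v u)) *\<^sub>R u" by blast
    have "P (insert u B)"
      using B u unfolding P_def by (auto simp: pairwise_insert W_def orthogonal_commute)
    moreover have "u \<notin> B"
    proof
      assume "u \<in> B"
      then have "u \<bullet> u = 0" using u by (auto simp: W_def orthogonal_def)
      then show False using u by simp
    qed
    ultimately show False using max[of "insert u B"] card(2)[OF B] by simp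
  qed
  have "span B = UNIV"
  proof (rule ccontr)
    assume "span B \<noteq> UNIV"
    then have "span B \<subset> UNIV" by auto
    then obtain a where "a \<noteq> 0" "\<And>x. x \<in> span B \<Longrightarrow> orthogonal a x"
      using orthogonal_to_subspace_exists_gen[of B UNIV] by auto
    then show False using \<open>W = {0}\<close> by (auto simp: W_def span_base)
  qed
  then show ?thesis using B card(2)[OF B] unfolding P_def by blast
qed

section \<open>Matrices determined by their forms, and matrix square roots\<close>

lemma matrix_eq_inner:
  fixes S T :: "real^'n^'m"
  assumes "\<And>x y. x \<bullet> (S *v y) = x \<bullet> (T *v y)" shows "S = T"
  unfolding matrix_eq
proof
  fix v show "S *v v = T *v v" by (subst vector_eq_ldot[symmetric]) (simp add: assms)
qed

lemma transpose_eq_iff_inner: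
  fixes S :: "real^'n^'n"
  shows "transpose S = S \<longleftrightarrow> (\<forall>x y. x \<bullet> (S *v y) = (S *v x) \<bullet> y)"
proof (intro iffI allI)
  fix x y assume "transpose S = S" then show "x \<bullet> (S *v y) = (S *v x) \<bullet> y"
    by (rule inner_symmetric_matrix)
next
  assume "\<forall>x y. x \<bullet> (S *v y) = (S *v x) \<bullet> y"
  then have "x \<bullet> (transpose S *v y) = x \<bullet> (S *v y)" for x y
    using inner_matrix_transpose[of x "transpose S" y] by simp
  then show "transpose S = S" by (rule matrix_eq_inner)
qed

text \<open>Polarization: the form at \<open>x + y\<close> recovers the bilinear form.\<close>

lemma symmetric_zero_if_form_zero:
  fixes D :: "real^'n^'n"
  assumes "transpose D = D" "\<And>v. v \<bullet> (D *v v) = 0" shows "D = 0"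
proof (rule matrix_eq_inner)
  fix x y
  have "(x + y) \<bullet> (D *v (x + y)) = x \<bullet> (D *v x) + y \<bullet> (D *v y) + 2 * (x \<bullet> (D *v y))"
    using inner_symmetric_matrix[OF assms(1), of x y]
    by (simp add: matrix_vector_right_distrib inner_add_left inner_add_right inner_commute)
  then show "x \<bullet> (D *v y) = x \<bullet> (0 *v y)" using assms(2) by simp
qed

lemma symmetric_matrix_eqI:
  fixes S T :: "real^'n^'n"
  assumes "transpose S = S" "transpose T = T" "\<And>v. v \<bullet> (S *v v) = v \<bullet> (T *v v)" shows "S = T"
proof -
  have "transpose (S - T) = S - T" using assms(1,2)
    by (simp add: transpose_def vec_eq_iff)
  then have "S - T = 0"
    by (rule symmetric_zero_if_form_zero) (simp add: matrix_vector_mult_diff_rdistrib inner_diff_right assms(3))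
  then show ?thesis by simp
qed

text \<open>The root acts on an orthonormal eigenbasis by the square roots of the
  eigenvalues.\<close>

lemma pos_semidef_sqrt_exists:
  fixes A :: "real^'n^'n"
  assumes "pos_semidef A"
  shows "\<exists>S. pos_semidef S \<and> S ** S = A"
proof -
  from assms have sym: "transpose A = A" and pos: "\<And>v. 0 \<le> v \<bullet> (A *v v)" by (auto simp: pos_semidef_def)
  from symmetric_orthonormal_eigenbasis[OF sym] obtain B where B: "finite B" "pairwise orthogonal B"
    "\<And>b. b \<in> B \<Longrightarrow> norm b = 1" "\<And>b. b \<in> B \<Longrightarrow> A *v b = (b \<bullet> (A *v b)) *\<^sub>R b" "span B = UNIV"
    by blast
  define l where "l b = sqrt (b \<bullet> (A *v b))" for b
  define f where "f x = (\<Sum>b\<in>B. (l b * (x \<bullet> b)) *\<^sub>R b)" for x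
  have lin: "linear f" unfolding f_def
    by (intro linear_compose_sum ballI linearI)
      (simp_all add: inner_add_left distrib_left scaleR_add_left mult.left_commute)
  define S where "S = matrix f"
  have Sf: "S *v x = f x" for x unfolding S_def using lin by (simp add: matrix_works)
  have fb: "f b = l b *\<^sub>R b" if "b \<in> B" for b
  proof -
    have "f b = (\<Sum>c\<in>B. if c = b then l b *\<^sub>R b else 0)" unfolding f_def
      using B(2) that B(3)[OF that]
      by (intro sum.cong refl) (auto simp: pairwise_def orthogonal_def norm_eq_1)
    then show ?thesis using that B(1) by simp
  qed
  have sum: "x \<bullet> f y = (\<Sum>b\<in>B. l b * (x \<bullet> b) * (y \<bullet> b))" for x y
    by (simp add: f_def inner_sum_right mult.commute mult.left_commute)
  have "transpose S = S" unfolding transpose_eq_iff_inner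
    by (auto simp: Sf sum inner_commute[of "f _"] intro!: sum.cong)
  moreover have "0 \<le> v \<bullet> (S *v v)" for v
    using pos by (simp add: Sf sum l_def sum_nonneg mult.assoc)
  moreover have "S ** S = A"
  proof (subst matrix_eq, intro allI)
    fix x
    have SSb: "(S ** S) *v b = A *v b" if "b \<in> B" for b
      using fb[OF that] pos[of b] B(4)[OF that]
      by (simp add: Sf matrix_vector_mul_assoc[symmetric] linear_scale[OF lin])
        (simp add: l_def)
    have x: "x = (\<Sum>b\<in>B. (x \<bullet> b) *\<^sub>R b)" 
      using orthonormal_expansion[OF B(1-3)] B(5) by (metis UNIV_I)
    have "M *v x = (\<Sum>b\<in>B. (x \<bullet> b) *\<^sub>R (M *v b))" for M :: "real^'n^'n"
      by (subst x) (simp only: linear_sum[OF matrix_vector_mul_linear] matrix_vector_mult_scaleR)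
    then show "(S ** S) *v x = A *v x" using SSb by simp
  qed
  ultimately show ?thesis by (auto simp: pos_semidef_def)
qed

text \<open>From \<open>S S = T T\<close> the difference \<open>D = S - T\<close> satisfies
  \<open>S D = - D T\<close>. On a unit eigenvector of \<open>D\<close> with eigenvalue
  \<open>l\<close> this reads \<open>l * (u \<bullet> S u + u \<bullet> T u) = 0\<close>. If
  \<open>l\<close> were nonzero, both nonnegative forms would vanish at \<open>u\<close>, and with
  them \<open>u \<bullet> D u = l\<close>.\<close>

lemma pos_semidef_sqrt_unique:
  fixes S T :: "real^'n^'n"
  assumes "pos_semidef S" "pos_semidef T" "S ** S = T ** T"
  shows "S = T"
proof -
  define D where "D = S - T"
  have sym: "transpose D = D" using assms(1,2)
    by (simp add: D_def pos_semidef_def transpose_def vec_eq_iff)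
  have SD: "S *v (D *v v) = - (D *v (T *v v))" for v
  proof -
    have "S *v (S *v v) = T *v (T *v v)" by (simp only: matrix_vector_mul_assoc assms(3))
    then show ?thesis
      by (simp only: D_def matrix_vector_mult_diff_distrib matrix_vector_mult_diff_rdistrib minus_diff_eq)
  qed
  have eig: "l = 0" if u: "norm u = 1" "D *v u = l *\<^sub>R u" for u l
  proof (rule ccontr)
    assume "l \<noteq> 0"
    have "u \<bullet> (S *v (D *v u)) = l * (u \<bullet> (S *v u))"
      by (simp add: u matrix_vector_mult_scaleR)
    moreover have "u \<bullet> (D *v (T *v u)) = l * (u \<bullet> (T *v u))"
      using inner_symmetric_matrix[OF sym, of u "T *v u"] by (simp add: u)
    moreover have "u \<bullet> (S *v (D *v u)) = - (u \<bullet> (D *v (T *v u)))"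
      by (simp add: SD)
    ultimately have "l * (u \<bullet> (S *v u) + u \<bullet> (T *v u)) = 0"
      by (simp only: distrib_left)
    then have "u \<bullet> (S *v u) + u \<bullet> (T *v u) = 0" using \<open>l \<noteq> 0\<close> by simp
    moreover have "0 \<le> u \<bullet> (S *v u)" "0 \<le> u \<bullet> (T *v u)" using assms by (auto simp: pos_semidef_def)
    ultimately have "u \<bullet> (S *v u) = 0" "u \<bullet> (T *v u) = 0" by auto
    then have "u \<bullet> (D *v u) = 0" by (simp add: D_def matrix_vector_mult_diff_rdistrib inner_diff_right)
    then show False using u \<open>l \<noteq> 0\<close> by (simp add: norm_eq_1)
  qed
  from symmetric_orthonormal_eigenbasis[OF sym] obtain B where B: "finite B" "pairwise orthogonal B"
    "\<And>b. b \<in> B \<Longrightarrow> norm b = 1" "\<And>b. b \<in> B \<Longrightarrow> D *v b = (b \<bullet> (D *v b)) *\<^sub>R b" "span B = UNIV"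
    by blast
  have Db: "D *v b = 0" if "b \<in> B" for b
    using eig[OF B(3)[OF that] B(4)[OF that]] B(4)[OF that] by simp
  have "D *v x = 0" for x
  proof -
    have x: "x = (\<Sum>b\<in>B. (x \<bullet> b) *\<^sub>R b)" 
      using orthonormal_expansion[OF B(1-3)] B(5) by (metis UNIV_I)
    show ?thesis
      by (subst x) (simp add: linear_sum[OF matrix_vector_mul_linear] matrix_vector_mult_scaleR Db)
  qed
  then have "D = 0" by (simp add: matrix_eq)
  then show ?thesis by (simp add: D_def)
qed

lemma sqrtm:
  assumes "pos_semidef A"
  shows "pos_semidef (sqrtm A)" "sqrtm A ** sqrtm A = A"
proof -
  have "\<exists>!S. pos_semidef S \<and> S ** S = A"
    using pos_semidef_sqrt_exists[OF assms] pos_semidef_sqrt_unique by metis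
  from theI'[OF this] show "pos_semidef (sqrtm A)" "sqrtm A ** sqrtm A = A"
    by (auto simp: sqrtm_def)
qed

lemma transpose_sqrtm: "pos_semidef A \<Longrightarrow> transpose (sqrtm A) = sqrtm A"
  using sqrtm(1) by (auto simp: pos_semidef_def)

lemma pos_def_imp_semidef: "pos_def A \<Longrightarrow> pos_semidef A"
  unfolding pos_semidef_def
proof (intro conjI allI)
  fix v assume A: "pos_def A"
  then show "transpose A = A" by (simp add: pos_def_def)
  show "0 \<le> v \<bullet> (A *v v)" using A by (cases "v = 0") (auto simp: pos_def_def intro: less_imp_le)
qed

text \<open>Finiteness gives meaning to the \<open>Min\<close> in \<open>lambda_min\<close>.
  Eigenvectors chosen for distinct eigenvalues are orthogonal, hence independent, and their number
  is bounded by the dimension.\<close>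

lemma finite_eigenvalues_symmetric:
  fixes A :: "real^'n^'n"
  assumes sym: "transpose A = A"
  shows "finite (eigenvalues A)"
proof -
  define f where "f c = (SOME v. v \<noteq> 0 \<and> A *v v = c *\<^sub>R v)" for c
  have f: "f c \<noteq> 0 \<and> A *v f c = c *\<^sub>R f c" if "c \<in> eigenvalues A" for c
    unfolding f_def by (rule someI_ex) (use that in \<open>auto simp: eigenvalues_def scalar_mult_eq_scaleR\<close>)
  have "inj_on f (eigenvalues A)"
    by (rule inj_onI) (metis f scaleR_cancel_right)
  moreover have "pairwise orthogonal (f ` eigenvalues A)"
  proof (rule pairwiseI, clarify)
    fix c d assume c: "c \<in> eigenvalues A" and d: "d \<in> eigenvalues A" and ne: "f c \<noteq> f d"
    have "f c \<bullet> (A *v f d) = (A *v f c) \<bullet> f d" by (rule inner_symmetric_matrix[OF sym])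
    then have "d * (f c \<bullet> f d) = c * (f c \<bullet> f d)" using f[OF c] f[OF d] by simp
    then show "orthogonal (f c) (f d)" using ne by (auto simp: orthogonal_def)
  qed
  then have "independent (f ` eigenvalues A)"
    using f by (intro pairwise_orthogonal_independent) force+
  then have "finite (f ` eigenvalues A)" using independent_bound by blast
  ultimately show ?thesis using finite_imageD by blast
qed

text \<open>The minimal Rayleigh quotient is itself an eigenvalue and bounds every other one from
  below. From here on \<open>lambda_min\<close> is used only through this variational
  description.\<close>

lemma lambda_min_symmetric:
  fixes A :: "real^'n^'n"
  assumes sym: "transpose A = A"
  shows "lambda_min A * (w \<bullet> w) \<le> w \<bullet> (A *v w)" "\<exists>u. norm u = 1 \<and> u \<bullet> (A *v u) = lambda_min A"
proof -
  have "(UNIV :: (real^'n) set) \<noteq> {0}"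
    by (metis UNIV_I axis_eq_0_iff singletonD zero_neq_one[where 'a=real])
  from rayleigh_minimizer[OF sym subspace_UNIV this] obtain u where u: "norm u = 1"
    "A *v u = (u \<bullet> (A *v u)) *\<^sub>R u" and min: "\<And>w. (u \<bullet> (A *v u)) * (w \<bullet> w) \<le> w \<bullet> (A *v w)" by auto
  have mem: "u \<bullet> (A *v u) \<in> eigenvalues A"
    unfolding eigenvalues_def using u by (auto simp: scalar_mult_eq_scaleR intro!: exI[of _ u])
  have "lambda_min A = u \<bullet> (A *v u)" unfolding lambda_min_def
  proof (rule Min_eqI[OF finite_eigenvalues_symmetric[OF sym] _ mem])
    fix c assume "c \<in> eigenvalues A"
    then obtain v where v: "v \<noteq> 0" "A *v v = c *\<^sub>R v" by (auto simp: eigenvalues_def scalar_mult_eq_scaleR)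
    with min[of v] show "u \<bullet> (A *v u) \<le> c" by simp
  qed
  with u min show "lambda_min A * (w \<bullet> w) \<le> w \<bullet> (A *v w)" "\<exists>u. norm u = 1 \<and> u \<bullet> (A *v u) = lambda_min A"
    by auto
qed

section \<open>Inverses of positive definite matrices\<close>

lemma matrix_inv_left_right:
  fixes A :: "real^'n^'n"
  assumes "invertible A" shows "matrix_inv A ** A = mat 1" "A ** matrix_inv A = mat 1"
  using assms unfolding invertible_def matrix_inv_def by (metis (mono_tags, lifting) someI_ex)+

lemma invertible_if_kernel_trivial:
  fixes A :: "real^'n^'n"
  assumes "\<And>v. A *v v = 0 \<Longrightarrow> v = 0" shows "invertible A"
  using assms matrix_left_invertible_ker[of A] invertible_left_inverse[of A] by auto

lemma pos_def_invertible: "pos_def A \<Longrightarrow> invertible A"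
  by (rule invertible_if_kernel_trivial) (force simp: pos_def_def)

lemma transpose_matrix_inv_symmetric:
  fixes A :: "real^'n^'n"
  assumes "invertible A" "transpose A = A" shows "transpose (matrix_inv A) = matrix_inv A"
proof -
  have "transpose (matrix_inv A) ** A = mat 1"
    by (metis assms matrix_inv_left_right(2) matrix_transpose_mul transpose_mat)
  then show ?thesis
    by (metis assms(1) matrix_inv_left_right(2) matrix_mul_assoc matrix_mul_lid matrix_mul_rid)
qed

lemma pos_def_matrix_inv:
  fixes A :: "real^'n^'n"
  assumes "pos_def A" shows "pos_def (matrix_inv A)"
  unfolding pos_def_def
proof (intro conjI allI impI)
  have inv: "invertible A" using assms by (rule pos_def_invertible)
  have sym: "transpose A = A" using assms by (simp add: pos_def_def)
  show "transpose (matrix_inv A) = matrix_inv A"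
    by (rule transpose_matrix_inv_symmetric[OF inv sym])
  fix v :: "real^'n" assume "v \<noteq> 0"
  have v: "A *v (matrix_inv A *v v) = v" by (simp add: matrix_vector_mul_assoc matrix_inv_left_right[OF inv])
  then have "matrix_inv A *v v \<noteq> 0" using \<open>v \<noteq> 0\<close> by auto
  then have "0 < (matrix_inv A *v v) \<bullet> (A *v (matrix_inv A *v v))" using assms by (auto simp: pos_def_def)
  then show "0 < v \<bullet> (matrix_inv A *v v)" by (simp add: v inner_commute)
qed

lemma pos_def_bounded_below:
  fixes A :: "real^'n^'n"
  assumes "pos_def A" shows "\<exists>l>0. \<forall>w. l * (w \<bullet> w) \<le> w \<bullet> (A *v w)"
proof -
  have sym: "transpose A = A" using assms by (simp add: pos_def_def)
  from lambda_min_symmetric(2)[OF sym] obtain u where u: "norm u = 1" "u \<bullet> (A *v u) = lambda_min A" by blast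
  then have "u \<noteq> 0" by auto
  then have "0 < u \<bullet> (A *v u)" using assms by (simp add: pos_def_def)
  then have "0 < lambda_min A" using u by simp
  with lambda_min_symmetric(1)[OF sym] show ?thesis by blast
qed

section \<open>The rate \<open>beta_c\<close> as a generalized Rayleigh quotient\<close>

lemma matrix_add_rdistrib: "(A + B) ** C = A ** C + B ** (C :: 'a::semiring_1^'n^'m)"
  by (vector matrix_matrix_mult_def sum.distrib[symmetric] field_simps)

text \<open>The substitution \<open>y = C\<^sup>1\<^sup>/\<^sup>2 w\<close> turns the Rayleigh
  quotient of the matrix in \<open>beta_c\<close> into
  \<open>(w \<bullet> Q w) / (w \<bullet> C w)\<close>. So \<open>beta_c\<close> is the minimum of
  this quotient, and square roots of \<open>C\<close> no longer appear in the later
  estimates.\<close>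

lemma beta_c_pos_def:
  fixes H :: "real^'d^'k" and \<Gamma> :: "real^'k^'k" and \<Sigma> C :: "real^'d^'d"
  assumes "pos_def C" "pos_def \<Gamma>" "pos_def \<Sigma>"
  defines "Q \<equiv> \<Sigma> + C ** transpose H ** matrix_inv \<Gamma> ** H ** C"
  shows "beta_c H \<Gamma> \<Sigma> C * (w \<bullet> (C *v w)) \<le> w \<bullet> (Q *v w)"
    and "\<exists>u. u \<noteq> 0 \<and> u \<bullet> (Q *v u) = beta_c H \<Gamma> \<Sigma> C * (u \<bullet> (C *v u))"
proof -
  define R where "R = sqrtm C"
  have C: "pos_semidef C" using assms pos_def_imp_semidef by blast
  have R: "transpose R = R" "R ** R = C" using sqrtm[OF C] transpose_sqrtm[OF C] by (auto simp: R_def)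
  have inv: "invertible R"
  proof (rule invertible_if_kernel_trivial)
    fix v assume "R *v v = 0"
    then have "C *v v = 0" using R(2) by (metis matrix_vector_mul_assoc matrix_vector_mult_0_right)
    then show "v = 0" using assms(1) by (force simp: pos_def_def)
  qed
  define I where "I = matrix_inv R"
  have I: "transpose I = I" "I ** R = mat 1" "R ** I = mat 1"
    using transpose_matrix_inv_symmetric[OF inv R(1)] matrix_inv_left_right[OF inv] by (auto simp: I_def)
  have G: "transpose (matrix_inv \<Gamma>) = matrix_inv \<Gamma>" using pos_def_matrix_inv[OF assms(2)] by (simp add: pos_def_def)
  have S: "transpose \<Sigma> = \<Sigma>" using assms(3) by (simp add: pos_def_def)
  define N where "N = R ** transpose H ** matrix_inv \<Gamma> ** H ** R + I ** \<Sigma> ** I"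
  have b: "beta_c H \<Gamma> \<Sigma> C = lambda_min N" by (simp add: beta_c_def N_def R_def I_def)
  have t: "transpose (a + b) = transpose a + transpose b" for a b :: "real^'d^'d"
    by (simp add: transpose_def vec_eq_iff)
  have symN: "transpose N = N"
    by (simp add: N_def matrix_transpose_mul t R I G S matrix_mul_assoc)
  have eq: "(R *v w) \<bullet> (N *v (R *v w)) = w \<bullet> (Q *v w)" for w
  proof -
    have "(R *v w) \<bullet> (N *v (R *v w)) = w \<bullet> ((R ** N ** R) *v w)"
      using inner_symmetric_matrix[OF R(1), of w "N *v (R *v w)"]
      by (simp add: matrix_vector_mul_assoc matrix_mul_assoc)
    also have "R ** N ** R = R ** R ** transpose H ** matrix_inv \<Gamma> ** H ** (R ** R) + (R ** I) ** \<Sigma> ** (I ** R)"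
      by (simp add: N_def matrix_add_ldistrib matrix_add_rdistrib matrix_mul_assoc)
    also have "\<dots> = Q" by (simp add: R(2) I Q_def)
    finally show ?thesis .
  qed
  have eq2: "(R *v w) \<bullet> (R *v w) = w \<bullet> (C *v w)" for w
    using inner_symmetric_matrix[OF R(1), of w "R *v w"] R(2) by (simp add: matrix_vector_mul_assoc)
  show "beta_c H \<Gamma> \<Sigma> C * (w \<bullet> (C *v w)) \<le> w \<bullet> (Q *v w)"
    using lambda_min_symmetric(1)[OF symN, of "R *v w"] by (simp add: b eq eq2)
  from lambda_min_symmetric(2)[OF symN] obtain y where y: "norm y = 1" "y \<bullet> (N *v y) = lambda_min N" by blast
  define u where "u = I *v y"
  have Ru: "R *v u = y" by (simp add: u_def matrix_vector_mul_assoc I)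
  then have "u \<noteq> 0" using y by auto
  moreover have "u \<bullet> (Q *v u) = beta_c H \<Gamma> \<Sigma> C * (u \<bullet> (C *v u))"
    using eq[of u] eq2[of u] y by (simp add: Ru b norm_eq_1)
  ultimately show "\<exists>u. u \<noteq> 0 \<and> u \<bullet> (Q *v u) = beta_c H \<Gamma> \<Sigma> C * (u \<bullet> (C *v u))" by blast
qed

text \<open>The form is the squared length of \<open>H C u\<close> in the inner product given by the
  inverse of \<open>\<Gamma>\<close>.\<close>

lemma gain_form_nonneg:
  fixes H :: "real^'d^'k" and C :: "real^'d^'d"
  assumes "pos_def \<Gamma>" "transpose C = C"
  shows "0 \<le> u \<bullet> ((C ** transpose H ** matrix_inv \<Gamma> ** H ** C) *v u)"
proof -
  have "u \<bullet> ((C ** transpose H ** matrix_inv \<Gamma> ** H ** C) *v u)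
      = (H *v (C *v u)) \<bullet> (matrix_inv \<Gamma> *v (H *v (C *v u)))"
    using inner_matrix_transpose[of u C "transpose H *v (matrix_inv \<Gamma> *v (H *v (C *v u)))"]
      inner_matrix_transpose[of "C *v u" "transpose H" "matrix_inv \<Gamma> *v (H *v (C *v u))"]
    by (simp add: matrix_vector_mul_assoc matrix_mul_assoc assms)
  then show ?thesis using pos_def_imp_semidef[OF pos_def_matrix_inv[OF assms(1)]] by (simp add: pos_semidef_def)
qed

text \<open>At a minimizer of the quotient the numerator is at least the \<open>\<Sigma>\<close>
  part, hence at least \<open>s * (u \<bullet> u)\<close>, and the denominator is at most
  \<open>c * (u \<bullet> u)\<close>.\<close>

lemma beta_c_ge:
  fixes H :: "real^'d^'k"
  assumes "pos_def C" "pos_def \<Gamma>" "pos_def \<Sigma>"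
    and s: "\<And>w. s * (w \<bullet> w) \<le> w \<bullet> (\<Sigma> *v w)" and c: "\<And>w. w \<bullet> (C *v w) \<le> c * (w \<bullet> w)"
    and "0 < s" "0 < c"
  shows "s / c \<le> beta_c H \<Gamma> \<Sigma> C"
proof -
  from beta_c_pos_def(2)[OF assms(1-3), where H=H] obtain u where u: "u \<noteq> 0"
    "u \<bullet> ((\<Sigma> + C ** transpose H ** matrix_inv \<Gamma> ** H ** C) *v u) = beta_c H \<Gamma> \<Sigma> C * (u \<bullet> (C *v u))" by blast
  have "0 \<le> u \<bullet> ((C ** transpose H ** matrix_inv \<Gamma> ** H ** C) *v u)"
    using assms(1) by (intro gain_form_nonneg[OF assms(2)]) (simp add: pos_def_def)
  then have le: "s * (u \<bullet> u) \<le> beta_c H \<Gamma> \<Sigma> C * (u \<bullet> (C *v u))"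
    using u(2) s[of u] by (simp add: matrix_vector_mult_add_rdistrib inner_add_right)
  moreover have pos: "0 < u \<bullet> (C *v u)" using assms(1) u by (simp add: pos_def_def)
  moreover have "0 < s * (u \<bullet> u)" using u \<open>0 < s\<close> by simp
  ultimately have "0 < beta_c H \<Gamma> \<Sigma> C"
    using zero_less_mult_pos2 le by (metis less_le_trans)
  then have "beta_c H \<Gamma> \<Sigma> C * (u \<bullet> (C *v u)) \<le> beta_c H \<Gamma> \<Sigma> C * (c * (u \<bullet> u))"
    using c[of u] by (simp add: mult_left_mono)
  with le have "s * (u \<bullet> u) \<le> (beta_c H \<Gamma> \<Sigma> C * c) * (u \<bullet> u)" by (simp add: mult.assoc)
  then have "s \<le> beta_c H \<Gamma> \<Sigma> C * c" using u(1) by simp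
  then show ?thesis using \<open>0 < c\<close> by (simp add: pos_divide_le_eq)
qed

lemma form_le_norm:
  fixes A :: "real^'n^'n"
  shows "\<exists>c>0. \<forall>w. w \<bullet> (A *v w) \<le> c * (w \<bullet> w)"
proof -
  obtain c where c: "0 < c" "\<And>x. norm (A *v x) \<le> norm x * c"
    using bounded_linear.pos_bounded[OF matrix_vector_mul_bounded_linear[of A]] by blast
  have "w \<bullet> (A *v w) \<le> c * (w \<bullet> w)" for w
  proof -
    have "w \<bullet> (A *v w) \<le> norm w * norm (A *v w)" by (rule norm_cauchy_schwarz)
    also have "\<dots> \<le> norm w * (norm w * c)" by (simp add: c(2) mult_left_mono)
    finally show ?thesis by (simp add: dot_square_norm power2_eq_square mult.commute mult.left_commute)
  qed
  with c(1) show ?thesis by blast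
qed

lemma beta_c_pos:
  fixes H :: "real^'d^'k"
  assumes "pos_def C" "pos_def \<Gamma>" "pos_def \<Sigma>" shows "0 < beta_c H \<Gamma> \<Sigma> C"
proof -
  obtain s c where sc: "0 < s" "\<And>w. s * (w \<bullet> w) \<le> w \<bullet> (\<Sigma> *v w)" "0 < c" "\<And>w. w \<bullet> (C *v w) \<le> c * (w \<bullet> w)"
    using pos_def_bounded_below[OF assms(3)] form_le_norm[of C] by blast
  have "s / c \<le> beta_c H \<Gamma> \<Sigma> C" by (rule beta_c_ge) (use assms sc in auto)
  moreover have "0 < s / c" using sc by simp
  ultimately show ?thesis by linarith
qed

section \<open>Linear matrix differential equations\<close>

lemma bounded_bilinear_matrix_mult:
  "bounded_bilinear ((**) :: real^'n^'m \<Rightarrow> real^'p^'n \<Rightarrow> real^'p^'m)"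
  unfolding bilinear_conv_bounded_bilinear[symmetric] bilinear_def
  by (auto intro!: linearI simp: matrix_matrix_mult_def vec_eq_iff sum.distrib[symmetric]
      sum_distrib_left algebra_simps)

lemma bounded_bilinear_matrix_vector_mult:
  "bounded_bilinear ((*v) :: real^'n^'m \<Rightarrow> real^'n \<Rightarrow> real^'m)"
  unfolding bilinear_conv_bounded_bilinear[symmetric] bilinear_def
  by (auto intro!: linearI simp: matrix_vector_mult_def vec_eq_iff sum.distrib[symmetric]
      sum_distrib_left algebra_simps)

lemma bounded_linear_transpose: "bounded_linear (transpose :: real^'n^'m \<Rightarrow> real^'m^'n)"
  by (auto intro!: linearI simp: linear_conv_bounded_linear[symmetric] transpose_def vec_eq_iff)

interpretation mm: bounded_bilinear "(**) :: real^'n^'m \<Rightarrow> real^'p^'n \<Rightarrow> real^'p^'m"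
  by (rule bounded_bilinear_matrix_mult)

interpretation mv: bounded_bilinear "(*v) :: real^'n^'m \<Rightarrow> real^'n \<Rightarrow> real^'m"
  by (rule bounded_bilinear_matrix_vector_mult)

lemma transpose_minus: "transpose (- A) = - transpose (A :: 'a::group_add^'n^'m)"
  by (simp add: transpose_def vec_eq_iff)

lemmas matrix_continuous_intros = mm.continuous_on mv.continuous_on bounded_linear.continuous_on[OF bounded_linear_transpose] continuous_intros

section \<open>Calculus on the closed half-line of times, one-sided at 0\<close>

abbreviation has_halfline_derivative (infix "hhd" 50) where
  "(f hhd f') \<equiv> \<forall>t\<ge>0. (f has_vector_derivative f' t) (at t within {0..})"

lemma integral_has_halfline_derivative:
  fixes g :: "real \<Rightarrow> 'a::banach"
  assumes "continuous_on {0..} g"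
  shows "(\<lambda>t. integral {0..t} g) hhd g"
proof (intro allI impI)
  fix t :: real assume t: "0 \<le> t"
  have "((\<lambda>t. integral {0..t} g) has_vector_derivative g t) (at t within {0..t+1})"
    using t by (intro integral_has_vector_derivative continuous_on_subset[OF assms]) auto
  moreover have "at t within {0..t+1} = at t within {0..}"
    by (rule at_within_nhd[of t "{..<t+1}"]) auto
  ultimately show "((\<lambda>t. integral {0..t} g) has_vector_derivative g t) (at t within {0..})" by simp
qed

lemma halfline_derivative_continuous: "f hhd f' \<Longrightarrow> continuous_on {0..} f"
  by (auto simp: continuous_on_eq_continuous_within intro: has_vector_derivative_continuous)

lemma halfline_derivative_subset:
  "f hhd f' \<Longrightarrow> t \<in> {a..b} \<Longrightarrow> 0 \<le> a \<Longrightarrow> (f has_vector_derivative f' t) (at t within {a..b})"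
  by (rule has_vector_derivative_within_subset[of _ _ _ "{0..}"]) auto

lemma halfline_derivative_integral:
  fixes f :: "real \<Rightarrow> 'a::banach"
  assumes "f hhd f'" "0 \<le> a" "a \<le> b" shows "(f' has_integral (f b - f a)) {a..b}"
  using assms by (intro fundamental_theorem_of_calculus) (auto intro!: halfline_derivative_subset)

lemma halfline_derivative_zero:
  fixes f :: "real \<Rightarrow> 'a::real_normed_vector"
  assumes "f hhd (\<lambda>_. 0)" "0 \<le> t" shows "f t = f 0"
proof -
  obtain c where "\<And>x. x \<in> {0..} \<Longrightarrow> f x = c"
    by (rule has_vector_derivative_zero_constant[of "{0..}" f]) (use assms in auto)
  then show ?thesis using assms by simp
qed

lemma halfline_antimono:
  fixes f :: "real \<Rightarrow> real"
  assumes "f hhd f'" "\<And>t. 0 \<le> t \<Longrightarrow> f' t \<le> 0" "0 \<le> t" shows "f t \<le> f 0"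
proof -
  have "\<exists>x\<in>{0..t}. f t - f 0 = (\<lambda>h. h *\<^sub>R f' x) (t - 0)"
    using halfline_derivative_subset[OF assms(1), of _ 0 t] assms(3)
    by (intro mvt_very_simple) (auto simp: has_vector_derivative_def)
  then obtain x where "0 \<le> x" "f t - f 0 = t * f' x" by auto
  moreover have "t * f' x \<le> 0" using assms \<open>0 \<le> x\<close> by (simp add: mult_nonneg_nonpos)
  ultimately show ?thesis by linarith
qed

text \<open>The integrating factor \<open>exp (integral {0..t} b)\<close> makes the product with
  \<open>f\<close> nonincreasing; no sign of \<open>f\<close> or \<open>b\<close> enters.\<close>

lemma halfline_gronwall:
  fixes f b :: "real \<Rightarrow> real"
  assumes "f hhd f'" "continuous_on {0..} b" "\<And>t. 0 \<le> t \<Longrightarrow> f' t \<le> - b t * f t" "0 \<le> t"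
  shows "f t \<le> exp (- integral {0..t} b) * f 0"
proof -
  define e where "e t = exp (integral {0..t} b)" for t
  have e: "(e has_vector_derivative (e t * b t)) (at t within {0..})" if "0 \<le> t" for t
    unfolding e_def has_real_derivative_iff_has_vector_derivative[symmetric]
    using integral_has_halfline_derivative[OF assms(2)] that
    by (intro DERIV_chain2[OF DERIV_exp]) (auto simp: has_real_derivative_iff_has_vector_derivative)
  have "f t * e t \<le> f 0 * e 0"
  proof (rule halfline_antimono[OF _ _ assms(4)])
    show "(\<lambda>t. f t * e t) hhd (\<lambda>t. f t * (e t * b t) + f' t * e t)"
      using assms(1) e bounded_bilinear.has_vector_derivative[OF bounded_bilinear_mult] by blast
    fix s :: real assume "0 \<le> s"
    have "(f' s + b s * f s) * e s \<le> 0"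
      using assms(3)[OF \<open>0 \<le> s\<close>] by (intro mult_nonpos_nonneg) (auto simp: e_def)
    then show "f s * (e s * b s) + f' s * e s \<le> 0" by (simp add: algebra_simps)
  qed
  then have "f t * exp (integral {0..t} b) \<le> f 0" by (simp add: e_def)
  then show ?thesis by (simp add: exp_minus field_simps)
qed

text \<open>Picard iteration in the form of the series of iterated integrals \<open>P n\<close>. It
  converges uniformly on bounded intervals, and since the equation is linear one series serves the
  whole half-line.\<close>

lemma linear_ode_solution_exists:
  fixes A :: "real \<Rightarrow> real^'n^'n"
  assumes A: "continuous_on {0..} A"
  shows "\<exists>\<Phi>. \<Phi> 0 = mat 1 \<and> (\<Phi> hhd (\<lambda>t. A t ** \<Phi> t))"
proof -
  define P :: "nat \<Rightarrow> real \<Rightarrow> real^'n^'n"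
    where "P = rec_nat (\<lambda>_. mat 1) (\<lambda>_ p t. integral {0..t} (\<lambda>s. A s ** p s))"
  have P0: "P 0 t = mat 1" and PS: "P (Suc n) t = integral {0..t} (\<lambda>s. A s ** P n s)" for n t
    by (simp_all add: P_def)
  have Pc: "continuous_on {0..} (P n)" for n
  proof (induction n)
    case 0 then show ?case by (simp add: P0[abs_def])
  next
    case (Suc n)
    then have "continuous_on {0..} (\<lambda>s. A s ** P n s)" by (intro matrix_continuous_intros A)
    from integral_has_halfline_derivative[OF this] show ?case
      unfolding PS[abs_def] by (rule halfline_derivative_continuous)
  qed
  have APc: "continuous_on {0..} (\<lambda>s. A s ** P n s)" for n
    by (intro matrix_continuous_intros A Pc)
  obtain k where k: "0 < k" "\<And>(X :: real^'n^'n) (Y :: real^'n^'n). norm (X ** Y) \<le> norm X * norm Y * k"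
    using mm.pos_bounded by blast
  define \<Phi> where "\<Phi> t = (\<Sum>n. P n t)" for t
  have lim: "uniform_limit {0..T} (\<lambda>n t. \<Sum>i<n. P i t) \<Phi> sequentially" if T: "0 \<le> T" for T
  proof -
    have "bounded (A ` {0..T})"
      by (intro compact_imp_bounded compact_continuous_image continuous_on_subset[OF A]) auto
    then obtain a where a: "0 < a" "\<And>t. t \<in> {0..T} \<Longrightarrow> norm (A t) \<le> a"
      by (auto simp: bounded_pos)
    define c where "c = norm (mat 1 :: real^'n^'n)"
    \<comment> \<open>Here \<open>a\<close> bounds \<open>A\<close> on the interval and
      \<open>k\<close> is the constant of the matrix product. Each integration raises the power of
      \<open>t\<close> by one and divides by the next integer, which builds up the
      factorial.\<close>
    have bd: "t \<in> {0..T} \<Longrightarrow> norm (P n t) \<le> c * (k * a * t) ^ n / fact n" for n t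
    proof (induction n arbitrary: t)
      case (Suc n)
      have t: "0 \<le> t" "t \<le> T" using Suc.prems by auto
      have hi: "((\<lambda>s. k * a * (c * (k * a * s) ^ n / fact n)) has_integral
          (c * (k * a * t) ^ Suc n / fact (Suc n) - c * (k * a * 0) ^ Suc n / fact (Suc n))) {0..t}"
      proof (rule fundamental_theorem_of_calculus[OF t(1)])
        fix s
        have "((\<lambda>s. c * (k * a * s) ^ Suc n / fact (Suc n)) has_real_derivative
            c * (real (Suc n) * (k * a) * (k * a * s) ^ n) / fact (Suc n)) (at s within {0..t})"
          by (intro DERIV_cdivide DERIV_cmult) (auto intro!: derivative_eq_intros simp del: power_Suc of_nat_Suc)
        moreover have "c * (real (Suc n) * (k * a) * (k * a * s) ^ n) / fact (Suc n) = k * a * (c * (k * a * s) ^ n / fact n)"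
          by (simp add: field_simps del: of_nat_Suc)
        ultimately show "((\<lambda>s. c * (k * a * s) ^ Suc n / fact (Suc n)) has_vector_derivative
            k * a * (c * (k * a * s) ^ n / fact n)) (at s within {0..t})"
          by (simp only: has_real_derivative_iff_has_vector_derivative)
      qed
      have "norm (P (Suc n) t) \<le> integral {0..t} (\<lambda>s. k * a * (c * (k * a * s) ^ n / fact n))"
        unfolding PS
      proof (rule integral_norm_bound_integral)
        show "(\<lambda>s. A s ** P n s) integrable_on {0..t}"
          by (intro integrable_continuous_real continuous_on_subset[OF APc]) auto
        show "(\<lambda>s. k * a * (c * (k * a * s) ^ n / fact n)) integrable_on {0..t}" using hi by blast
        fix s assume s: "s \<in> {0..t}"
        have "norm (A s ** P n s) \<le> norm (A s) * norm (P n s) * k" by (rule k)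
        also have "\<dots> \<le> a * (c * (k * a * s) ^ n / fact n) * k"
          using s t k a Suc.IH by (intro mult_right_mono mult_mono) auto
        finally show "norm (A s ** P n s) \<le> k * a * (c * (k * a * s) ^ n / fact n)" by (simp add: ac_simps)
      qed
      with integral_unique[OF hi] show ?case by simp
    qed (simp add: P0 c_def)
    have "norm (P n t) \<le> c * ((k * a * T) ^ n / fact n)" if t: "t \<in> {0..T}" for n t
    proof -
      have "(k * a * t) ^ n \<le> (k * a * T) ^ n" using t k a by (intro power_mono) auto
      then have "c * (k * a * t) ^ n / fact n \<le> c * (k * a * T) ^ n / fact n"
        by (intro divide_right_mono mult_left_mono) (auto simp: c_def)
      with bd[OF t, of n] show ?thesis by simp
    qed
    moreover have "summable (\<lambda>n. c * ((k * a * T) ^ n / fact n))"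
      using summable_exp[of "k * a * T"] by (intro summable_mult) (simp add: divide_inverse mult.commute)
    ultimately have "uniform_limit {0..T} (\<lambda>n t. \<Sum>i<n. P i t) (\<lambda>t. \<Sum>i. P i t) sequentially"
      by (intro Weierstrass_m_test) auto
    then show ?thesis by (simp add: \<Phi>_def[abs_def])
  qed
  have \<Phi>cT: "continuous_on {0..T} \<Phi>" if "0 \<le> T" for T
    by (rule uniform_limit_theorem[OF _ lim[OF that]])
      (auto intro!: always_eventually continuous_on_sum continuous_on_subset[OF Pc])
  have \<Phi>c: "continuous_on {0..} \<Phi>"
    unfolding continuous_on_eq_continuous_within
  proof
    fix t :: real assume t: "t \<in> {0..}"
    have "at t within {0..t+1} = at t within {0..}"
      by (rule at_within_nhd[of t "{..<t+1}"]) auto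
    with \<Phi>cT[of "t+1"] t show "continuous (at t within {0..}) \<Phi>"
      by (force simp: continuous_on_eq_continuous_within continuous_within)
  qed
  \<comment> \<open>Integrating the series termwise only shifts its index by one, so its sum solves
    the integral equation.\<close>
  have eq: "\<Phi> t = mat 1 + integral {0..t} (\<lambda>s. A s ** \<Phi> s)" if t: "0 \<le> t" for t
  proof -
    have "uniform_limit {0..t} (\<lambda>n s. A s ** (\<Sum>i<n. P i s)) (\<lambda>s. A s ** \<Phi> s) sequentially"
      by (intro mm.bounded_uniform_limit uniform_limit_const lim t compact_imp_bounded
          compact_continuous_image \<Phi>cT continuous_on_subset[OF A]) (auto simp: uniform_limit_iff)
    moreover have "continuous_on {0..t} (\<lambda>s. A s ** (\<Sum>i<n. P i s))" for n
      by (intro matrix_continuous_intros continuous_on_subset[OF A] continuous_on_subset[OF Pc]) auto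
    ultimately obtain I J where IJ: "\<And>n. ((\<lambda>s. A s ** (\<Sum>i<n. P i s)) has_integral I n) {0..t}"
      "((\<lambda>s. A s ** \<Phi> s) has_integral J) {0..t}" "I \<longlonglongrightarrow> J"
      by (rule uniform_limit_integral) auto
    have "I n = (\<Sum>i<n. P (Suc i) t)" for n
    proof -
      have "I n = integral {0..t} (\<lambda>s. \<Sum>i<n. A s ** P i s)"
        using integral_unique[OF IJ(1)[of n]] by (simp add: mm.sum_right)
      also have "\<dots> = (\<Sum>i<n. P (Suc i) t)" unfolding PS
        by (intro integral_sum integrable_continuous_real continuous_on_subset[OF APc]) auto
      finally show ?thesis .
    qed
    then have "mat 1 + I n = (\<Sum>i<Suc n. P i t)" for n
      by (simp add: sum.lessThan_Suc_shift P0 del: sum.lessThan_Suc)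
    moreover have "(\<lambda>n. \<Sum>i<n. P i t) \<longlonglongrightarrow> \<Phi> t"
      by (rule tendsto_uniform_limitI[OF lim[OF t]]) (use t in auto)
    then have "(\<lambda>n. \<Sum>i<Suc n. P i t) \<longlonglongrightarrow> \<Phi> t" by (rule LIMSEQ_Suc)
    moreover have "(\<lambda>n. mat 1 + I n) \<longlonglongrightarrow> mat 1 + J" by (intro tendsto_intros IJ)
    ultimately have "\<Phi> t = mat 1 + J" by (simp add: LIMSEQ_unique)
    then show ?thesis using integral_unique[OF IJ(2)] by simp
  qed
  have "(\<lambda>t. mat 1 + integral {0..t} (\<lambda>s. A s ** \<Phi> s)) hhd (\<lambda>t. A t ** \<Phi> t)"
    using integral_has_halfline_derivative[of "\<lambda>s. A s ** \<Phi> s"] A \<Phi>c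
    by (auto intro!: derivative_eq_intros matrix_continuous_intros)
  then have "\<Phi> hhd (\<lambda>t. A t ** \<Phi> t)"
    using eq by (auto intro: has_vector_derivative_transform[where g = \<Phi>])
  moreover have "\<Phi> 0 = mat 1" using eq[of 0] by simp
  ultimately show ?thesis by blast
qed

text \<open>The inverse flow is built as the transpose of the solution of the adjoint equation. Then
  \<open>\<Theta> \<Phi>\<close> has derivative zero, so it stays the identity, and for square
  matrices a left inverse is a right inverse.\<close>

lemma fundamental_solution:
  fixes A :: "real \<Rightarrow> real^'n^'n"
  assumes A: "continuous_on {0..} A"
  obtains \<Phi> \<Theta> where "\<Phi> 0 = mat 1" "\<Theta> 0 = mat 1" "\<Phi> hhd (\<lambda>t. A t ** \<Phi> t)" "\<Theta> hhd (\<lambda>t. - (\<Theta> t ** A t))"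
    "\<And>t. 0 \<le> t \<Longrightarrow> \<Theta> t ** \<Phi> t = mat 1" "\<And>t. 0 \<le> t \<Longrightarrow> \<Phi> t ** \<Theta> t = mat 1"
proof -
  obtain \<Phi> where \<Phi>: "\<Phi> 0 = mat 1" "\<Phi> hhd (\<lambda>t. A t ** \<Phi> t)"
    using linear_ode_solution_exists[OF A] by blast
  have "continuous_on {0..} (\<lambda>t. - transpose (A t))" by (intro matrix_continuous_intros A)
  from linear_ode_solution_exists[OF this] obtain \<Psi> where
    \<Psi>: "\<Psi> 0 = mat 1" "\<Psi> hhd (\<lambda>t. - transpose (A t) ** \<Psi> t)" by blast
  define \<Theta> where "\<Theta> t = transpose (\<Psi> t)" for t
  have \<Theta>: "\<Theta> 0 = mat 1" by (simp add: \<Theta>_def \<Psi>)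
  have \<Theta>': "\<Theta> hhd (\<lambda>t. - (\<Theta> t ** A t))"
  proof (intro allI impI)
    fix t :: real assume "0 \<le> t"
    then have "(\<Theta> has_vector_derivative transpose (- transpose (A t) ** \<Psi> t)) (at t within {0..})"
      unfolding \<Theta>_def using \<Psi>(2) by (intro bounded_linear.has_vector_derivative[OF bounded_linear_transpose]) auto
    then show "(\<Theta> has_vector_derivative - (\<Theta> t ** A t)) (at t within {0..})"
      by (simp add: \<Theta>_def matrix_transpose_mul mm.minus_left mm.minus_right transpose_minus)
  qed
  have "(\<lambda>t. \<Theta> t ** \<Phi> t) hhd (\<lambda>t. 0)"
  proof (intro allI impI)
    fix t :: real assume "0 \<le> t"
    then have "((\<lambda>t. \<Theta> t ** \<Phi> t) has_vector_derivative
        \<Theta> t ** (A t ** \<Phi> t) + - (\<Theta> t ** A t) ** \<Phi> t) (at t within {0..})"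
      using \<Phi> \<Theta>' by (intro mm.has_vector_derivative) auto
    then show "((\<lambda>t. \<Theta> t ** \<Phi> t) has_vector_derivative 0) (at t within {0..})"
      by (simp add: mm.minus_left matrix_mul_assoc)
  qed
  then have 1: "\<Theta> t ** \<Phi> t = mat 1" if "0 \<le> t" for t
    using halfline_derivative_zero[of "\<lambda>t. \<Theta> t ** \<Phi> t" t] that \<Phi> \<Theta> by simp
  then have "\<Phi> t ** \<Theta> t = mat 1" if "0 \<le> t" for t
    using that by (simp add: matrix_left_right_inverse)
  with 1 show ?thesis using that \<Phi> \<Theta> \<Theta>' by blast
qed

text \<open>A minimum over a fixed compact sphere of a jointly continuous quotient depends
  continuously on the parameter. With \<open>b = beta_c\<close> along the covariance this makes the
  exponent in the theorem an honest integral.\<close>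

lemma min_quotient_continuous:
  fixes C Q :: "real \<Rightarrow> real^'n^'n"
  assumes C: "continuous_on {0..} C" and Q: "continuous_on {0..} Q"
    and pos: "\<And>t. 0 \<le> t \<Longrightarrow> pos_def (C t)"
    and le: "\<And>t w. 0 \<le> t \<Longrightarrow> b t * (w \<bullet> (C t *v w)) \<le> w \<bullet> (Q t *v w)"
    and attained: "\<And>t. 0 \<le> t \<Longrightarrow> \<exists>u. u \<noteq> 0 \<and> u \<bullet> (Q t *v u) = b t * (u \<bullet> (C t *v u))"
  shows "continuous_on {0..} b"
  unfolding continuous_on_iff
proof (intro ballI allI impI)
  fix t e :: real assume t: "t \<in> {0..}" and e: "0 < e"
  define f where "f p = (snd p \<bullet> (Q (fst p) *v snd p)) / (snd p \<bullet> (C (fst p) *v snd p))" for p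
  let ?K = "{0..t+1} \<times> sphere 0 1 :: (real \<times> (real^'n)) set"
  have Cpos: "0 < w \<bullet> (C s *v w)" if "0 \<le> s" "norm w = 1" for s and w :: "real^'n"
    using pos[OF that(1)] that(2) unfolding pos_def_def by (metis norm_zero zero_neq_one)
  have "continuous_on ?K f" unfolding f_def
  proof (intro continuous_on_divide continuous_on_inner mv.continuous_on continuous_on_snd continuous_on_id)
    show "continuous_on ?K (\<lambda>x. Q (fst x))" "continuous_on ?K (\<lambda>x. C (fst x))"
      by (auto intro!: continuous_on_compose2[OF Q] continuous_on_compose2[OF C] continuous_on_fst continuous_on_id)
    show "\<forall>x\<in>?K. snd x \<bullet> (C (fst x) *v snd x) \<noteq> 0"
      using Cpos by (auto simp: less_le)
  qed
  then have "uniformly_continuous_on ?K f"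
    by (intro compact_uniformly_continuous compact_Times) auto
  then obtain d where d: "0 < d" "\<And>p q. p \<in> ?K \<Longrightarrow> q \<in> ?K \<Longrightarrow> dist q p < d \<Longrightarrow> dist (f q) (f p) < e"
    using e by (metis uniformly_continuous_on_def)
  \<comment> \<open>The minimizer at time \<open>s\<close> serves as a test vector at time
    \<open>s'\<close>; exchanging the two times gives the other inequality.\<close>
  have key: "b s' < b s + e" if ss: "s \<in> {0..t+1}" "s' \<in> {0..t+1}" "dist s' s < d" for s s'
  proof -
    obtain u where u: "u \<noteq> 0" "u \<bullet> (Q s *v u) = b s * (u \<bullet> (C s *v u))" using attained[of s] ss by auto
    define w where "w = (1 / norm u) *\<^sub>R u"
    have w: "norm w = 1" "w \<bullet> (Q s *v w) = b s * (w \<bullet> (C s *v w))"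
      using u by (simp_all add: w_def matrix_vector_mult_scaleR)
    have "f (s, w) = b s" using w Cpos[of s w] that by (simp add: f_def)
    moreover have "b s' \<le> f (s', w)" using w Cpos[of s' w] le[of s' w] that by (simp add: f_def field_simps)
    moreover have "dist (s', w) (s, w) < d" using that(3) by (simp add: dist_Pair_Pair)
    then have "dist (f (s', w)) (f (s, w)) < e" using that w by (intro d(2)) auto
    ultimately show ?thesis by (simp add: dist_real_def abs_if split: if_splits)
  qed
  show "\<exists>d>0. \<forall>x'\<in>{0..}. dist x' t < d \<longrightarrow> dist (b x') (b t) < e"
  proof (intro exI conjI ballI impI)
    show "0 < min d 1" using d by simp
    fix s assume "s \<in> {0..}" "dist s t < min d 1"
    then have "s \<in> {0..t+1}" "t \<in> {0..t+1}" "dist s t < d" "dist t s < d"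
      using t by (auto simp: dist_real_def abs_if split: if_splits)
    from key[OF this(2,1,3)] key[OF this(1,2,4)] show "dist (b s) (b t) < e"
      by (simp add: dist_real_def abs_if)
  qed
qed

text \<open>This is the derivative of \<open>v \<bullet> M\<^sup>-\<^sup>1 v\<close>, with
  \<open>x\<close> in the role of \<open>M\<^sup>-\<^sup>1 v\<close>. The lower bound
  \<open>l\<close>, uniform in time, makes \<open>x\<close> continuous, and symmetry of
  \<open>M\<close> gives \<open>v \<bullet> (x s - x t) = - (x s \<bullet> ((M s - M t) x
  t))\<close>, in which only \<open>M\<close> is left to differentiate.\<close>

lemma matrix_inverse_form_derivative:
  fixes M :: "real \<Rightarrow> real^'n^'n"
  assumes M: "M hhd M'" and sym: "\<And>t. 0 \<le> t \<Longrightarrow> transpose (M t) = M t"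
    and l: "0 < l" "\<And>t w. 0 \<le> t \<Longrightarrow> l * (w \<bullet> w) \<le> w \<bullet> (M t *v w)"
    and x: "\<And>t. 0 \<le> t \<Longrightarrow> M t *v x t = v"
  shows "(\<lambda>t. v \<bullet> x t) hhd (\<lambda>t. - (x t \<bullet> (M' t *v x t)))"
proof (intro allI impI)
  fix t :: real assume t: "0 \<le> t"
  define m where "m s = M s *v x t" for s
  have m': "(m has_vector_derivative M' t *v x t) (at t within {0..})"
    unfolding m_def using M t mv.has_vector_derivative[of M "M' t" t "{0..}" "\<lambda>_. x t" 0]
    by simp
  have diff: "M s *v (x s - x t) = - (m s - m t)" if "0 \<le> s" for s
    by (simp add: mv.diff_right x that t m_def)
  have bound: "norm (x s - x t) \<le> norm (m s - m t) / l" if s: "0 \<le> s" for s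
  proof (cases "x s = x t")
    case False
    have "l * (norm (x s - x t))\<^sup>2 \<le> (x s - x t) \<bullet> (M s *v (x s - x t))"
      using l(2)[OF s] by (simp add: power2_norm_eq_inner)
    also have "\<dots> \<le> norm (x s - x t) * norm (m s - m t)"
      unfolding diff[OF s] using norm_cauchy_schwarz[of "x s - x t" "- (m s - m t)"]
      by (simp only: norm_minus_cancel)
    finally have "norm (x s - x t) * (l * norm (x s - x t)) \<le> norm (x s - x t) * norm (m s - m t)"
      by (simp add: power2_eq_square mult.left_commute)
    then have "l * norm (x s - x t) \<le> norm (m s - m t)" using False by simp
    then show ?thesis using l(1) by (simp add: field_simps)
  qed (use l in simp)
  have mc: "((\<lambda>s. norm (m s - m t) / l) \<longlongrightarrow> norm (m t - m t) / l) (at t within {0..})"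
    using has_vector_derivative_continuous[OF m'] l by (intro tendsto_intros) (auto simp: continuous_within)
  have "((\<lambda>s. x s - x t) \<longlongrightarrow> 0) (at t within {0..})"
    by (rule Lim_null_comparison[OF _ mc[simplified]])
      (use bound in \<open>auto simp: eventually_at_filter\<close>)
  then have xc: "(x \<longlongrightarrow> x t) (at t within {0..})" by (simp add: Lim_null[symmetric])
  have quot: "((\<lambda>s. (1 / (s - t)) *\<^sub>R (m s - m t)) \<longlongrightarrow> M' t *v x t) (at t within {0..})"
  proof (rule vec_tendstoI)
    fix i
    have "((\<lambda>s. m s $ i) has_field_derivative (M' t *v x t) $ i) (at t within {0..})"
      unfolding has_real_derivative_iff_has_vector_derivative
      by (rule bounded_linear.has_vector_derivative[OF bounded_linear_vec_nth m'])
    then show "((\<lambda>s. ((1 / (s - t)) *\<^sub>R (m s - m t)) $ i) \<longlongrightarrow> (M' t *v x t) $ i) (at t within {0..})"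
      by (simp add: has_field_derivative_iff)
  qed
  have lim: "((\<lambda>s. - (x s \<bullet> ((1 / (s - t)) *\<^sub>R (m s - m t)))) \<longlongrightarrow> - (x t \<bullet> (M' t *v x t))) (at t within {0..})"
    by (intro tendsto_intros xc quot)
  have eq: "- (x s \<bullet> ((1 / (s - t)) *\<^sub>R (m s - m t))) = (v \<bullet> x s - v \<bullet> x t) / (s - t)" if s: "0 \<le> s" for s
  proof -
    have "v \<bullet> (x s - x t) = x s \<bullet> (M s *v (x s - x t))"
      using inner_symmetric_matrix[OF sym[OF s], of "x s" "x s - x t"] x[OF s] by simp
    then show ?thesis by (simp add: diff[OF s] inner_diff_right minus_divide_left)
  qed
  have "((\<lambda>s. (v \<bullet> x s - v \<bullet> x t) / (s - t)) \<longlongrightarrow> - (x t \<bullet> (M' t *v x t))) (at t within {0..})"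
    by (rule Lim_transform_eventually[OF lim]) (use eq in \<open>auto simp: eventually_at_filter\<close>)
  then show "((\<lambda>t. v \<bullet> x t) has_vector_derivative - (x t \<bullet> (M' t *v x t))) (at t within {0..})"
    by (simp add: has_real_derivative_iff_has_vector_derivative[symmetric] has_field_derivative_iff)
qed

section \<open>Hurwitz matrices\<close>

definition exp_decay :: "(real \<Rightarrow> 'a::real_normed_vector) \<Rightarrow> bool" where
  "exp_decay u \<longleftrightarrow> (\<exists>m a. 0 < a \<and> (\<forall>t\<ge>0. norm (u t) \<le> m * exp (- a * t)))"

lemma exp_decay_mono:
  assumes "exp_decay u" "\<And>t. 0 \<le> t \<Longrightarrow> norm (w t) \<le> norm (u t)" shows "exp_decay w"
  using assms unfolding exp_decay_def by (meson order_trans)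

lemma exp_decay_add:
  assumes "exp_decay u" "exp_decay w" shows "exp_decay (\<lambda>t. u t + w t)"
proof -
  obtain m a where u: "0 < a" "\<And>t. 0 \<le> t \<Longrightarrow> norm (u t) \<le> m * exp (- a * t)"
    using assms(1) by (auto simp: exp_decay_def)
  obtain n b where w: "0 < b" "\<And>t. 0 \<le> t \<Longrightarrow> norm (w t) \<le> n * exp (- b * t)"
    using assms(2) by (auto simp: exp_decay_def)
  have mn: "0 \<le> m" "0 \<le> n" using u(2)[of 0] w(2)[of 0] by (auto intro: order_trans[OF norm_ge_zero])
  have "norm (u t + w t) \<le> (m + n) * exp (- min a b * t)" if t: "0 \<le> t" for t
  proof -
    have "m * exp (- a * t) \<le> m * exp (- min a b * t)" "n * exp (- b * t) \<le> n * exp (- min a b * t)"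
      using mn t by (intro mult_left_mono; simp add: mult_right_mono)+
    then show ?thesis using u(2)[OF t] w(2)[OF t] norm_triangle_ineq[of "u t" "w t"]
      by (simp add: distrib_right)
  qed
  then show ?thesis unfolding exp_decay_def using u(1) w(1) by (intro exI[of _ "m+n"] exI[of _ "min a b"]) auto
qed

lemma exp_decay_zero: "exp_decay (\<lambda>_. 0)"
  unfolding exp_decay_def by (intro exI[of _ 0] exI[of _ 1]) auto

lemma exp_decay_sum:
  assumes "finite I" "\<And>i. i \<in> I \<Longrightarrow> exp_decay (u i)" shows "exp_decay (\<lambda>t. \<Sum>i\<in>I. u i t)"
  using assms by (induction I rule: finite_induct) (auto intro: exp_decay_zero exp_decay_add)

text \<open>Complex vectors carry a real inner product, for which multiplication by an imaginary
  number is skew; only the real part of \<open>c\<close> contributes to the energy.\<close>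

lemma inner_complex_scale:
  "(u :: complex^'n) \<bullet> (c *s u) = Re c * (u \<bullet> u)"
  by (simp add: inner_vec_def inner_complex_def sum_distrib_left algebra_simps)

text \<open>Energy estimate for \<open>f = u \<bullet> u\<close>: the scalar part dissipates
  \<open>2 * r * f\<close>, and Young's inequality spends half of it to absorb the coupling with
  \<open>g\<close>.\<close>

lemma perturbed_scalar_ode_decay:
  fixes u g :: "real \<Rightarrow> complex^'n"
  assumes u: "u hhd (\<lambda>t. c *s u t + g t)" and c: "Re c < 0" and g: "exp_decay g"
  shows "exp_decay u"
proof -
  obtain m b where b: "0 < b" and gb: "\<And>t. 0 \<le> t \<Longrightarrow> norm (g t) \<le> m * exp (- b * t)"
    using g by (auto simp: exp_decay_def)
  define r where "r = - Re c"
  have r: "0 < r" using c by (simp add: r_def)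
  \<comment> \<open>The constant comes from Young's inequality with weight \<open>r\<close> applied
    to the bound of \<open>g\<close>. The squared norm then decays at rate \<open>a\<close>, the
    slower of dissipation and forcing, and the norm at half of it.\<close>
  define k where "k = m\<^sup>2 / r"
  define a where "a = min r b"
  define f where "f t = u t \<bullet> u t" for t
  define f' where "f' t = 2 * (u t \<bullet> (c *s u t + g t))" for t
  have f: "f hhd f'"
  proof (intro allI impI)
    fix t :: real assume "0 \<le> t"
    then have "(u has_vector_derivative (c *s u t + g t)) (at t within {0..})" using u by simp
    from bounded_bilinear.has_vector_derivative[OF bounded_bilinear_inner this this]
    show "(f has_vector_derivative f' t) (at t within {0..})"
      by (simp add: f_def[abs_def] f'_def inner_commute)
  qed
  have f'_le: "f' t \<le> - r * f t + k * exp (- 2 * b * t)" if t: "0 \<le> t" for t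
  proof -
    have "2 * (u t \<bullet> g t) \<le> r * f t + (norm (g t))\<^sup>2 / r"
    proof -
      have "0 \<le> (r *\<^sub>R u t - g t) \<bullet> (r *\<^sub>R u t - g t)" by simp
      also have "\<dots> = r * (r * f t) + (norm (g t))\<^sup>2 - r * (2 * (u t \<bullet> g t))"
        by (simp add: f_def power2_norm_eq_inner inner_diff_left inner_diff_right inner_commute)
      also have "\<dots> = r * (r * f t + (norm (g t))\<^sup>2 / r - 2 * (u t \<bullet> g t))"
        using r by (simp add: algebra_simps)
      finally show ?thesis using r by (simp add: zero_le_mult_iff)
    qed
    moreover have "(norm (g t))\<^sup>2 / r \<le> k * exp (- 2 * b * t)"
    proof -
      have "(norm (g t))\<^sup>2 \<le> (m * exp (- b * t))\<^sup>2" using gb[OF t] by (intro power_mono) auto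
      also have "\<dots> = m\<^sup>2 * exp (2 * (- b * t))" by (simp only: power_mult_distrib exp_double)
      also have "2 * (- b * t) = - 2 * b * t" by simp
      finally have "(norm (g t))\<^sup>2 / r \<le> (m\<^sup>2 * exp (- 2 * b * t)) / r" using r by (intro divide_right_mono) auto
      then show ?thesis by (simp add: k_def)
    qed
    moreover have "f' t = - 2 * r * f t + 2 * (u t \<bullet> g t)"
      by (simp add: f'_def inner_add_right inner_complex_scale r_def f_def)
    ultimately show ?thesis by linarith
  qed
  have k0: "0 \<le> k" using r by (simp add: k_def)
  \<comment> \<open>Adding \<open>(k / b) * exp (- b * t)\<close> compensates the forcing term, so
    that the sum is nonincreasing.\<close>
  have le: "f t * exp (a * t) \<le> f 0 + k / b" if t: "0 \<le> t" for t
  proof -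
    have "f t * exp (a * t) + (k / b) * exp (- b * t) \<le> f 0 * exp (a * 0) + (k / b) * exp (- b * 0)"
    proof (rule halfline_antimono[OF _ _ t])
      have "((\<lambda>t. exp (a * t)) has_vector_derivative a * exp (a * t)) (at t within {0..})" for t
        unfolding has_real_derivative_iff_has_vector_derivative[symmetric]
        by (auto intro!: derivative_eq_intros)
      moreover have "((\<lambda>t. (k / b) * exp (- b * t)) has_vector_derivative - k * exp (- b * t)) (at t within {0..})" for t
        unfolding has_real_derivative_iff_has_vector_derivative[symmetric]
        using b by (auto intro!: derivative_eq_intros)
      ultimately show "(\<lambda>t. f t * exp (a * t) + (k / b) * exp (- b * t)) hhd
          (\<lambda>t. (f t * (a * exp (a * t)) + f' t * exp (a * t)) + - k * exp (- b * t))"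
        using f by (intro allI impI has_vector_derivative_add
            bounded_bilinear.has_vector_derivative[OF bounded_bilinear_mult]) auto
      fix s :: real assume s: "0 \<le> s"
      have "f s * (a * exp (a * s)) + f' s * exp (a * s) \<le> (a - r) * f s * exp (a * s) + k * exp (- 2 * b * s) * exp (a * s)"
        using mult_right_mono[OF f'_le[OF s], of "exp (a * s)"] by (simp add: algebra_simps)
      also have "(a - r) * f s * exp (a * s) \<le> 0"
        by (intro mult_nonpos_nonneg) (auto simp: a_def f_def mult_nonpos_nonneg)
      also have "k * exp (- 2 * b * s) * exp (a * s) \<le> k * exp (- b * s)"
      proof -
        have "a * s \<le> b * s" using s by (intro mult_right_mono) (auto simp: a_def)
        then have "- 2 * b * s + a * s \<le> - b * s" by simp
        then show ?thesis using k0 by (simp add: mult.assoc exp_add[symmetric] mult_left_mono)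
      qed
      finally show "(f s * (a * exp (a * s)) + f' s * exp (a * s)) + - k * exp (- b * s) \<le> 0" by simp
    qed
    moreover have "0 \<le> (k / b) * exp (- b * t)" using k0 b by simp
    ultimately show ?thesis by simp
  qed
  have "norm (u t) \<le> sqrt (f 0 + k / b) * exp (- (a / 2) * t)" if t: "0 \<le> t" for t
  proof (rule power2_le_imp_le)
    have "0 \<le> f 0 + k / b" using k0 b by (simp add: f_def)
    then have "(sqrt (f 0 + k / b) * exp (- (a / 2) * t))\<^sup>2 = (f 0 + k / b) * exp (- (a * t))"
      by (simp add: power_mult_distrib exp_double[symmetric])
    also have "\<dots> \<ge> f t" using le[OF t] by (simp add: exp_minus field_simps)
    finally show "(norm (u t))\<^sup>2 \<le> (sqrt (f 0 + k / b) * exp (- (a / 2) * t))\<^sup>2"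
      by (simp add: f_def power2_norm_eq_inner)
    show "0 \<le> sqrt (f 0 + k / b) * exp (- (a / 2) * t)" using \<open>0 \<le> f 0 + k / b\<close> by simp
  qed
  moreover have "0 < a / 2" using r b by (simp add: a_def)
  ultimately show ?thesis unfolding exp_decay_def by blast
qed

text \<open>Instead of a Jordan form, a product of factors \<open>A - c\<close> that annihilates the space is peeled off
  one factor at a time.\<close>

definition shift_apply :: "'a::field^'n^'n \<Rightarrow> 'a \<Rightarrow> 'a^'n \<Rightarrow> 'a^'n" where
  "shift_apply A c w = A *v w - c *s w"

lemma shift_apply_commute: "shift_apply A c (shift_apply A d w) = shift_apply A d (shift_apply A c w)"
  by (simp add: shift_apply_def matrix_vector_mult_diff_distrib vector_scalar_commute
      vector_ssub_ldistrib vector_smult_assoc mult.commute)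

lemma shift_apply_foldr_commute:
  "shift_apply A c (foldr (shift_apply A) L w) = foldr (shift_apply A) L (shift_apply A c w)"
  by (induction L) (simp_all add: shift_apply_commute)

lemma matrix_vector_foldr_commute:
  "A *v (foldr (shift_apply A) L w) = foldr (shift_apply A) L (A *v w)"
  using shift_apply_foldr_commute[of A 0 L w] by (simp add: shift_apply_def)

text \<open>Induction on the degree, splitting a root \<open>c\<close> off \<open>p\<close>. The
  quotient polynomial annihilates the image of \<open>S\<close> under \<open>A - c\<close>, which is
  why \<open>S\<close> is arbitrary. If \<open>c\<close> is not an eigenvalue, its factor is
  injective and commutes with the others, so it can be cancelled; the remaining list consists of
  eigenvalues only.\<close>

lemma annihilating_eigenvalue_list:
  fixes A :: "complex^'n^'n"
  assumes "p \<noteq> 0" "\<And>w. w \<in> S \<Longrightarrow> (\<Sum>i\<le>degree p. coeff p i *s (((*v) A ^^ i) w)) = 0"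
  shows "\<exists>L. set L \<subseteq> eigenvalues A \<and> (\<forall>w\<in>S. foldr (shift_apply A) L w = 0)"
  using assms
proof (induction "degree p" arbitrary: p S)
  case 0
  then have "coeff p 0 \<noteq> 0" using leading_coeff_0_iff[of p] by simp
  have "w = 0" if "w \<in> S" for w
  proof -
    have "coeff p 0 *s w = 0" using 0(3)[OF that] 0(1) by simp
    then show ?thesis using \<open>coeff p 0 \<noteq> 0\<close> by simp
  qed
  then show ?case by (intro exI[of _ "[]"]) auto
next
  case (Suc n)
  have "\<not> constant (poly p)" using Suc(2) by (simp add: constant_degree)
  then obtain c where "poly p c = 0" using fundamental_theorem_of_algebra by blast
  then obtain q where q: "p = [:- c, 1:] * q" by (metis poly_eq_0_iff_dvd dvdE)
  then have "q \<noteq> 0" using Suc(3) by auto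
  then have dq: "degree p = Suc (degree q)" unfolding q by (subst degree_mult_eq) auto
  have pq: "(\<Sum>i\<le>degree q. coeff q i *s (((*v) A ^^ i) (shift_apply A c w))) = 
      (\<Sum>i\<le>degree p. coeff p i *s (((*v) A ^^ i) w))" for w
  proof -
    have lin: "((*v) A ^^ i) (A *v w - c *s w) = ((*v) A ^^ Suc i) w - c *s (((*v) A ^^ i) w)" for i
      by (induction i) (simp_all add: matrix_vector_mult_diff_distrib vector_scalar_commute)
    have cp: "coeff p i = (case i of 0 \<Rightarrow> 0 | Suc j \<Rightarrow> coeff q j) - c * coeff q i" for i
      unfolding q by (simp add: coeff_pCons split: nat.split)
    have "(\<Sum>i\<le>degree p. coeff p i *s (((*v) A ^^ i) w)) =
        (\<Sum>i\<le>degree p. (case i of 0 \<Rightarrow> 0 | Suc j \<Rightarrow> coeff q j) *s (((*v) A ^^ i) w)) -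
        (\<Sum>i\<le>degree p. (c * coeff q i) *s (((*v) A ^^ i) w))"
      by (simp add: cp vector_sub_rdistrib sum_subtractf)
    also have "(\<Sum>i\<le>degree p. (case i of 0 \<Rightarrow> 0 | Suc j \<Rightarrow> coeff q j) *s (((*v) A ^^ i) w)) =
        (\<Sum>i\<le>degree q. coeff q i *s (((*v) A ^^ Suc i) w))"
      unfolding dq by (subst sum.atMost_Suc_shift) simp
    also have "(\<Sum>i\<le>degree p. (c * coeff q i) *s (((*v) A ^^ i) w)) =
        (\<Sum>i\<le>degree q. (c * coeff q i) *s (((*v) A ^^ i) w))"
      unfolding dq by (simp add: coeff_eq_0)
    finally show ?thesis
      by (simp add: shift_apply_def lin vector_ssub_ldistrib sum_subtractf vector_smult_assoc mult.commute
          del: funpow.simps)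
  qed
  have "\<exists>L. set L \<subseteq> eigenvalues A \<and> (\<forall>w\<in>shift_apply A c ` S. foldr (shift_apply A) L w = 0)"
    using Suc(2) dq \<open>q \<noteq> 0\<close> Suc(4) pq by (intro Suc(1)) auto
  then obtain L where L: "set L \<subseteq> eigenvalues A"
    "\<And>w. w \<in> S \<Longrightarrow> foldr (shift_apply A) L (shift_apply A c w) = 0" by auto
  show ?case
  proof (cases "c \<in> eigenvalues A")
    case True
    then show ?thesis using L by (intro exI[of _ "L @ [c]"]) auto
  next
    case False
    have "foldr (shift_apply A) L w = 0" if "w \<in> S" for w
    proof -
      have "shift_apply A c (foldr (shift_apply A) L w) = 0"
        using L(2)[OF that] by (simp add: shift_apply_foldr_commute)
      then show ?thesis using False by (auto simp: shift_apply_def eigenvalues_def)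
    qed
    then show ?thesis using L(1) by blast
  qed
qed

lemma shift_foldr_bounded_linear: "bounded_linear (foldr (shift_apply (A :: complex^'n^'n)) L)"
proof (induction L)
  case (Cons c L)
  have "bounded_linear (shift_apply A c)"
    by (auto intro!: linearI simp: linear_conv_bounded_linear[symmetric] shift_apply_def
        matrix_vector_right_distrib vector_add_ldistrib vec_eq_iff matrix_vector_mult_def sum.distrib
        sum_distrib_left scaleR_sum_right algebra_simps)
  from bounded_linear_compose[OF this Cons] show ?case by simp
qed (simp add: bounded_linear_ident)

text \<open>A partial product \<open>u\<close> of factors applied to \<open>Y\<close> solves
  \<open>u' = c u + (A - c) u\<close>, and the perturbation is the product with one factor more.
  Starting from the full product, which is zero, decay is passed to ever shorter products and
  finally to \<open>Y\<close>.\<close>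

lemma complex_ode_decay:
  fixes A :: "complex^'n^'n"
  assumes "Y hhd (\<lambda>t. A *v Y t)" "\<And>c. c \<in> set L \<Longrightarrow> Re c < 0"
    "\<And>w. foldr (shift_apply A) L w = 0"
  shows "exp_decay Y"
proof -
  have "exp_decay (\<lambda>t. foldr (shift_apply A) L (Y t)) \<Longrightarrow> exp_decay Y"
    using assms(2)
  proof (induction L)
    case (Cons c L)
    let ?u = "\<lambda>t. foldr (shift_apply A) L (Y t)"
    have "?u hhd (\<lambda>t. foldr (shift_apply A) L (A *v Y t))"
      using assms(1) by (auto intro: bounded_linear.has_vector_derivative[OF shift_foldr_bounded_linear])
    then have "?u hhd (\<lambda>t. c *s ?u t + shift_apply A c (?u t))"
      by (simp add: matrix_vector_foldr_commute[symmetric] shift_apply_def)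
    from perturbed_scalar_ode_decay[OF this] Cons show ?case by simp
  qed simp
  then show ?thesis using assms(3) exp_decay_zero by simp
qed

section \<open>Annihilating polynomial and complexification of a real matrix\<close>

lemma matrix_annihilating_polynomial:
  fixes G :: "real^'n^'n"
  shows "\<exists>p. p \<noteq> 0 \<and> (\<forall>w. (\<Sum>i\<le>degree p. coeff p i *\<^sub>R (((*v) G ^^ i) w)) = 0)"
proof -
  define M where "M i = (((**) G) ^^ i) (mat 1)" for i
  have Mw: "M i *v w = ((*v) G ^^ i) w" for i w
    by (induction i) (simp_all add: M_def matrix_vector_mul_assoc[symmetric])
  let ?N = "DIM(real^'n^'n)"
  have "\<exists>c. (\<exists>i\<le>?N. c i \<noteq> 0) \<and> (\<Sum>i\<le>?N. c i *\<^sub>R M i) = 0"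
  proof (cases "inj_on M {..?N}")
    case True
    then have "card (M ` {..?N}) = Suc ?N" by (simp add: card_image)
    then have "dependent (M ` {..?N})" by (intro dependent_biggerset) simp
    then obtain u where u: "\<exists>v\<in>M ` {..?N}. u v \<noteq> 0" "(\<Sum>v\<in>M ` {..?N}. u v *\<^sub>R v) = 0"
      by (subst (asm) dependent_finite) auto
    then show ?thesis using True by (intro exI[of _ "u \<circ> M"]) (auto simp: sum.reindex)
  next
    \<comment> \<open>A set of matrices would not see a repeated power, so equal powers are treated
      apart: they give a dependence with coefficients 1 and -1.\<close>
    case False
    then obtain i j where ij: "i \<le> ?N" "j \<le> ?N" "i \<noteq> j" "M i = M j" by (auto simp: inj_on_def)
    have "(\<Sum>l\<le>?N. (if l = i then 1 else if l = j then - 1 else 0) *\<^sub>R M l) =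
        (\<Sum>l\<le>?N. (if l = i then M i else 0) - (if l = j then M j else 0))"
      using ij by (intro sum.cong) auto
    also have "\<dots> = 0" using ij by (simp add: sum_subtractf)
    finally show ?thesis using ij by (intro exI[of _ "\<lambda>l. if l = i then 1 else if l = j then - 1 else 0"]) auto
  qed
  then obtain c where c: "\<exists>i\<le>?N. c i \<noteq> 0" "(\<Sum>i\<le>?N. c i *\<^sub>R M i) = 0" by blast
  define p where "p = (\<Sum>i\<le>?N. monom (c i) i)"
  have cp: "coeff p i = (if i \<le> ?N then c i else 0)" for i
    by (simp add: p_def coeff_sum)
  have "p \<noteq> 0" using c(1) cp by (metis coeff_0)
  have "degree p \<le> ?N" by (rule degree_le) (simp add: cp)
  have "(\<Sum>i\<le>degree p. coeff p i *\<^sub>R (((*v) G ^^ i) w)) = 0" for w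
  proof -
    have "(\<Sum>i\<le>degree p. coeff p i *\<^sub>R (((*v) G ^^ i) w)) = (\<Sum>i\<le>?N. coeff p i *\<^sub>R (M i *v w))"
      unfolding Mw using \<open>degree p \<le> ?N\<close> by (intro sum.mono_neutral_left) (auto simp: coeff_eq_0)
    also have "\<dots> = (\<Sum>i\<le>?N. c i *\<^sub>R M i) *v w"
      by (simp add: cp mv.sum_left mv.scaleR_left)
    finally show ?thesis by (simp only: c mv.zero_left)
  qed
  with \<open>p \<noteq> 0\<close> show ?thesis by blast
qed

definition complex_vector :: "real^'n \<Rightarrow> complex^'n" where
  "complex_vector v = (\<chi> i. complex_of_real (v $ i))"

lemma norm_complex_vector: "norm (complex_vector v) = norm v"
  by (simp add: norm_vec_def complex_vector_def L2_set_def)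

lemma complex_matrix_vector: "complex_matrix G *v complex_vector w = complex_vector (G *v w)"
  by (simp add: vec_eq_iff complex_matrix_def complex_vector_def matrix_vector_mult_def)

lemma bounded_linear_complex_vector: "bounded_linear complex_vector"
  by (auto intro!: linearI simp: linear_conv_bounded_linear[symmetric] complex_vector_def vec_eq_iff)
    (simp add: scaleR_conv_of_real)

lemma complex_vector_decomposition:
  "\<exists>a b. w = complex_vector a + \<i> *s complex_vector b"
  by (intro exI[of _ "\<chi> i. Re (w $ i)"] exI[of _ "\<chi> i. Im (w $ i)"])
    (simp add: vec_eq_iff complex_vector_def complex_eq_iff)

text \<open>A real annihilating polynomial kills the real vectors inside the complex space and
  hence, splitting into real and imaginary parts, all complex vectors. Decay is then obtained column
  by column.\<close>

lemma hurwitz_fundamental_solution_decay: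
  fixes G :: "real^'n^'n"
  assumes G: "\<And>c. c \<in> eigenvalues (complex_matrix G) \<Longrightarrow> Re c < 0" and \<Phi>: "\<Phi> hhd (\<lambda>t. G ** \<Phi> t)"
  shows "exp_decay \<Phi>"
proof -
  let ?A = "complex_matrix G"
  obtain p where p: "p \<noteq> 0" "\<And>w. (\<Sum>i\<le>degree p. coeff p i *\<^sub>R (((*v) G ^^ i) w)) = 0"
    using matrix_annihilating_polynomial[of G] by blast
  define P where "P = map_poly complex_of_real p"
  have P: "P \<noteq> 0" "degree P = degree p" "coeff P i = complex_of_real (coeff p i)" for i
    using p(1) by (simp_all add: P_def coeff_map_poly map_poly_eq_0_iff degree_map_poly)
  have pow: "((*v) ?A ^^ i) (complex_vector w) = complex_vector (((*v) G ^^ i) w)" for i w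
    by (induction i) (simp_all add: complex_matrix_vector)
  interpret cv: bounded_linear complex_vector by (rule bounded_linear_complex_vector)
  have real: "(\<Sum>i\<le>degree P. coeff P i *s (((*v) ?A ^^ i) (complex_vector w))) = 0" for w
  proof -
    have "c *\<^sub>R complex_vector x = complex_of_real c *s complex_vector x" for c and x :: "real^'n"
      by (simp add: vec_eq_iff complex_vector_def complex_eq_iff)
    then have "(\<Sum>i\<le>degree P. coeff P i *s (((*v) ?A ^^ i) (complex_vector w))) =
      complex_vector (\<Sum>i\<le>degree p. coeff p i *\<^sub>R (((*v) G ^^ i) w))"
      by (simp add: P(2,3) pow cv.sum cv.scaleR)
    then show ?thesis by (simp add: p(2) cv.zero)
  qed
  obtain L where L: "set L \<subseteq> eigenvalues ?A"
      "\<forall>w\<in>range complex_vector. foldr (shift_apply ?A) L w = 0"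
    using annihilating_eigenvalue_list[OF P(1), of "range complex_vector" ?A] real by blast
  have fs: "foldr (shift_apply ?A) L (c *s w) = c *s foldr (shift_apply ?A) L w" for c w
    by (induction L) (simp_all add: shift_apply_def vector_scalar_commute vector_ssub_ldistrib
        vector_smult_assoc mult.commute)
  have kill: "foldr (shift_apply ?A) L w = 0" for w
  proof -
    obtain a b where "w = complex_vector a + \<i> *s complex_vector b"
      using complex_vector_decomposition by blast
    then show ?thesis using L(2) fs linear_add[OF bounded_linear.linear[OF shift_foldr_bounded_linear[of ?A L]]]
      by simp
  qed
  have col: "exp_decay (\<lambda>t. \<Phi> t *v axis j 1)" for j
  proof -
    have "(\<lambda>t. complex_vector (\<Phi> t *v axis j 1)) hhd (\<lambda>t. ?A *v complex_vector (\<Phi> t *v axis j 1))"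
    proof (intro allI impI)
      fix t :: real assume "0 \<le> t"
      then have "((\<lambda>t. \<Phi> t *v axis j 1) has_vector_derivative (\<Phi> t *v 0 + (G ** \<Phi> t) *v axis j 1)) (at t within {0..})"
        using \<Phi> by (intro mv.has_vector_derivative) auto
      from cv.has_vector_derivative[OF this]
      show "((\<lambda>t. complex_vector (\<Phi> t *v axis j 1)) has_vector_derivative ?A *v complex_vector (\<Phi> t *v axis j 1)) (at t within {0..})"
        by (simp add: complex_matrix_vector matrix_vector_mul_assoc)
    qed
    then have "exp_decay (\<lambda>t. complex_vector (\<Phi> t *v axis j 1))"
      using complex_ode_decay[of _ ?A L] kill L(1) G by blast
    then show ?thesis by (rule exp_decay_mono) (simp add: norm_complex_vector)
  qed
  have "exp_decay (\<lambda>t. \<Sum>j\<in>UNIV. norm (\<Phi> t *v axis j 1))"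
    by (intro exp_decay_sum exp_decay_mono[OF col]) auto
  then show ?thesis
  proof (rule exp_decay_mono)
    fix t
    have "norm (\<Phi> t) = norm (transpose (\<Phi> t))"
      unfolding norm_vec_def L2_set_def real_sqrt_eq_iff
      by (simp add: sum_nonneg transpose_def, subst sum.swap, simp)
    also have "\<dots> \<le> (\<Sum>j\<in>UNIV. norm (transpose (\<Phi> t) $ j))"
      unfolding norm_vec_def[of "transpose (\<Phi> t)"] by (rule L2_set_le_sum) auto
    also have "\<dots> = (\<Sum>j\<in>UNIV. norm (\<Phi> t *v axis j 1))"
      by (simp add: matrix_vector_mult_basis column_def transpose_def)
    finally show "norm (\<Phi> t) \<le> norm (\<Sum>j\<in>UNIV. norm (\<Phi> t *v axis j 1))"
      by (simp add: sum_nonneg)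
  qed
qed

text \<open>Comparison by duality: tested against the backward adjoint flow, the terms with
  \<open>A\<close> cancel and only the source \<open>k\<close> remains, integrated against an
  exponentially decaying weight. The bound \<open>b\<close> is chosen before \<open>C\<close>, which
  makes it uniform over all solutions with the same initial bound.\<close>

lemma lyapunov_upper_bound:
  fixes A :: "real^'n^'n"
  assumes A: "\<And>c. c \<in> eigenvalues (complex_matrix A) \<Longrightarrow> Re c < 0" and k: "0 \<le> k" and c: "0 \<le> c"
  shows "\<exists>b>0. \<forall>C C'. (C hhd C') \<longrightarrow> (\<forall>t\<ge>0. transpose (C t) = C t)
    \<longrightarrow> (\<forall>t\<ge>0. \<forall>w. w \<bullet> (C' t *v w) \<le> 2 * (w \<bullet> (A *v (C t *v w))) + k * (w \<bullet> w))
    \<longrightarrow> (\<forall>w. w \<bullet> (C 0 *v w) \<le> c * (w \<bullet> w)) \<longrightarrow> (\<forall>t\<ge>0. \<forall>w. w \<bullet> (C t *v w) \<le> b * (w \<bullet> w))"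
proof -
  obtain \<Phi> \<Theta> where \<Phi>: "\<Phi> 0 = mat 1" "\<Theta> 0 = mat 1" "\<Phi> hhd (\<lambda>t. A ** \<Phi> t)" "\<Theta> hhd (\<lambda>t. - (\<Theta> t ** A))"
    "\<And>t. 0 \<le> t \<Longrightarrow> \<Theta> t ** \<Phi> t = mat 1" "\<And>t. 0 \<le> t \<Longrightarrow> \<Phi> t ** \<Theta> t = mat 1"
    by (rule fundamental_solution[of "\<lambda>_. A"]) auto
  \<comment> \<open>This product is constant, so \<open>A\<close> commutes with its own flow; the
    derivative of \<open>y\<close> below relies on it.\<close>
  have "(\<lambda>t. \<Theta> t ** (A ** \<Phi> t)) hhd (\<lambda>t. 0)"
  proof (intro allI impI)
    fix t :: real assume t: "0 \<le> t"
    have "((\<lambda>t. A ** \<Phi> t) has_vector_derivative (A ** (A ** \<Phi> t) + 0 ** \<Phi> t)) (at t within {0..})"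
      using \<Phi>(3) t by (intro mm.has_vector_derivative) auto
    from mm.has_vector_derivative[OF \<Phi>(4)[rule_format, OF t] this]
    show "((\<lambda>t. \<Theta> t ** (A ** \<Phi> t)) has_vector_derivative 0) (at t within {0..})"
      by (simp add: mm.minus_left mm.zero_left matrix_mul_assoc)
  qed
  then have "\<Theta> t ** (A ** \<Phi> t) = A" if "0 \<le> t" for t
    using halfline_derivative_zero[of "\<lambda>t. \<Theta> t ** (A ** \<Phi> t)" t] that \<Phi> by simp
  then have comm: "A ** \<Phi> t = \<Phi> t ** A" if "0 \<le> t" for t
    using \<Phi>(6)[OF that] that by (metis matrix_mul_assoc matrix_mul_lid)
  obtain m a where a: "0 < a" and m: "\<And>t. 0 \<le> t \<Longrightarrow> norm (\<Phi> t) \<le> m * exp (- a * t)"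
    using hurwitz_fundamental_solution_decay[OF A \<Phi>(3)] by (auto simp: exp_decay_def)
  obtain h where h: "0 < h" "\<And>(X :: real^'n^'n) v. norm (X *v v) \<le> norm X * norm v * h"
    using mv.pos_bounded by blast
  have tn: "norm (transpose X) = norm X" for X :: "real^'n^'n"
    unfolding norm_vec_def L2_set_def real_sqrt_eq_iff
    by (simp add: sum_nonneg transpose_def, subst sum.swap, simp)
  define n where "n = (m * h)\<^sup>2"
  have b2: "(transpose (\<Phi> t) *v v) \<bullet> (transpose (\<Phi> t) *v v) \<le> n * exp (- 2 * a * t) * (v \<bullet> v)" if t: "0 \<le> t" for t v
  proof -
    have "norm (transpose (\<Phi> t) *v v) \<le> (m * exp (- a * t)) * norm v * h"
      by (rule order_trans[OF h(2)]) (use h m[OF t] tn in \<open>auto intro!: mult_right_mono\<close>)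
    then have "(norm (transpose (\<Phi> t) *v v))\<^sup>2 \<le> ((m * exp (- a * t)) * norm v * h)\<^sup>2"
      by (intro power_mono) auto
    also have "\<dots> = n * exp (- 2 * a * t) * (v \<bullet> v)"
      by (simp add: n_def power_mult_distrib power2_norm_eq_inner exp_double[symmetric])
    finally show ?thesis by (simp add: power2_norm_eq_inner)
  qed
  \<comment> \<open>The term \<open>n * c\<close> bounds the transported initial covariance,
    \<open>k * n / (2 * a)\<close> is the integral over all times of
    \<open>k * n * exp (- 2 * a * s)\<close>, and 1 makes \<open>b\<close> strictly
    positive.\<close>
  define b where "b = n * c + k * n / (2 * a) + 1"
  have n0: "0 \<le> n" by (simp add: n_def)
  have key: "v \<bullet> (C T *v v) \<le> b * (v \<bullet> v)"
    if C: "C hhd C'" and sym: "\<And>t. 0 \<le> t \<Longrightarrow> transpose (C t) = C t"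
      and le: "\<And>t w. 0 \<le> t \<Longrightarrow> w \<bullet> (C' t *v w) \<le> 2 * (w \<bullet> (A *v (C t *v w))) + k * (w \<bullet> w)"
      and C0: "\<And>w. w \<bullet> (C 0 *v w) \<le> c * (w \<bullet> w)" and T: "0 \<le> T" for C C' T v
  proof -
    \<comment> \<open>The solution of \<open>y' = - A\<^sup>T y\<close> that ends in
      \<open>v\<close> at time \<open>T\<close>.\<close>
    define y where "y s = transpose (\<Phi> (T - s)) *v v" for s
    have y': "(y has_vector_derivative - (transpose A *v y s)) (at s within {0..T})" if s: "s \<in> {0..T}" for s
    proof -
      have "(\<Phi> has_vector_derivative A ** \<Phi> (T - s)) (at (T - s) within {0..T})"
        using \<Phi>(3) s by (intro halfline_derivative_subset) auto
      moreover have "(\<lambda>s. T - s) ` {0..T} = {0..T}" by (simp add: image_diff_atLeastAtMost)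
      moreover have "((\<lambda>s. T - s) has_vector_derivative - 1) (at s within {0..T})"
        by (auto intro!: derivative_eq_intros)
      ultimately have "(\<Phi> \<circ> (\<lambda>s. T - s) has_vector_derivative (- 1) *\<^sub>R (A ** \<Phi> (T - s))) (at s within {0..T})"
        by (intro vector_diff_chain_within) auto
      then have "((\<lambda>s. transpose (\<Phi> (T - s))) has_vector_derivative transpose (- (A ** \<Phi> (T - s)))) (at s within {0..T})"
        by (intro bounded_linear.has_vector_derivative[OF bounded_linear_transpose]) (simp add: o_def)
      then have "(y has_vector_derivative (transpose (\<Phi> (T - s)) *v 0 + transpose (- (A ** \<Phi> (T - s))) *v v)) (at s within {0..T})"
        unfolding y_def by (intro mv.has_vector_derivative) auto
      also have "transpose (\<Phi> (T - s)) *v 0 + transpose (- (A ** \<Phi> (T - s))) *v v = - (transpose A *v y s)"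
        using s comm[of "T - s"]
        by (simp add: transpose_minus matrix_transpose_mul mv.minus_left y_def matrix_vector_mul_assoc)
      finally show ?thesis .
    qed
    \<comment> \<open>The subtracted term grows exactly at the rate that bounds the source along
      \<open>y\<close>, so \<open>f\<close> is nonincreasing.\<close>
    define f where "f s = y s \<bullet> (C s *v y s) - (k * n * (v \<bullet> v) / (2 * a)) * exp (- 2 * a * (T - s))" for s
    define f' where "f' s = (y s \<bullet> (C s *v (- (transpose A *v y s)) + C' s *v y s) + (- (transpose A *v y s)) \<bullet> (C s *v y s))
        - (k * n * (v \<bullet> v)) * exp (- 2 * a * (T - s))" for s
    have f': "(f has_vector_derivative f' s) (at s within {0..T})" if s: "s \<in> {0..T}" for s
    proof -
      have "((\<lambda>s. (k * n * (v \<bullet> v) / (2 * a)) * exp (- 2 * a * (T - s))) has_vector_derivative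
          (k * n * (v \<bullet> v)) * exp (- 2 * a * (T - s))) (at s within {0..T})"
        unfolding has_real_derivative_iff_has_vector_derivative[symmetric]
        using a by (auto intro!: derivative_eq_intros)
      moreover have "(C has_vector_derivative C' s) (at s within {0..T})"
        using halfline_derivative_subset[OF C s] by simp
      ultimately show ?thesis unfolding f_def f'_def using y'[OF s]
        by (intro has_vector_derivative_diff bounded_bilinear.has_vector_derivative[OF bounded_bilinear_inner]
            mv.has_vector_derivative)
    qed
    have f'0: "f' s \<le> 0" if s: "s \<in> {0..T}" for s
    proof -
      have "y s \<bullet> (C s *v (- (transpose A *v y s)) + C' s *v y s) + (- (transpose A *v y s)) \<bullet> (C s *v y s)
          = y s \<bullet> (C' s *v y s) - 2 * ((transpose A *v y s) \<bullet> (C s *v y s))"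
        using inner_symmetric_matrix[OF sym[of s], of "y s" "transpose A *v y s"] s
        by (simp add: inner_diff_right mv.minus_right inner_commute)
      also have "(transpose A *v y s) \<bullet> (C s *v y s) = y s \<bullet> (A *v (C s *v y s))"
        by (rule inner_matrix_transpose[symmetric])
      also have "y s \<bullet> (C' s *v y s) - 2 * (y s \<bullet> (A *v (C s *v y s))) \<le> k * (y s \<bullet> y s)"
        using le[of s "y s"] s by simp
      also have "\<dots> \<le> k * (n * exp (- 2 * a * (T - s)) * (v \<bullet> v))"
        unfolding y_def using k s by (intro mult_left_mono b2) auto
      finally show ?thesis unfolding f'_def by (simp add: mult.commute mult.left_commute)
    qed
    have "\<exists>x\<in>{0..T}. f T - f 0 = (\<lambda>h. h *\<^sub>R f' x) (T - 0)"
      using f' T by (intro mvt_very_simple) (auto simp: has_vector_derivative_def)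
    then obtain x where "x \<in> {0..T}" "f T - f 0 = T * f' x" by auto
    then have "f T \<le> f 0" using f'0[of x] T mult_nonneg_nonpos[of T "f' x"] by simp
    moreover have "y T = v" by (simp add: y_def \<Phi>)
    ultimately have "v \<bullet> (C T *v v) \<le> y 0 \<bullet> (C 0 *v y 0) + k * n * (v \<bullet> v) / (2 * a)
        - (k * n * (v \<bullet> v) / (2 * a)) * exp (- 2 * a * T)"
      by (simp add: f_def)
    also have "\<dots> \<le> y 0 \<bullet> (C 0 *v y 0) + k * n * (v \<bullet> v) / (2 * a)"
      using k n0 a by simp
    also have "y 0 \<bullet> (C 0 *v y 0) \<le> c * (y 0 \<bullet> y 0)" by (rule C0)
    also have "c * (y 0 \<bullet> y 0) \<le> c * (n * exp (- 2 * a * T) * (v \<bullet> v))"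
      unfolding y_def using b2[OF T] c by (intro mult_left_mono) auto
    also have "\<dots> \<le> c * (n * 1 * (v \<bullet> v))"
      using c n0 a T by (intro mult_left_mono mult_right_mono) auto
    finally have "v \<bullet> (C T *v v) \<le> (n * c + k * n / (2 * a)) * (v \<bullet> v)" by (simp add: algebra_simps)
    also have "\<dots> \<le> b * (v \<bullet> v)" unfolding b_def by (intro mult_right_mono) auto
    finally show ?thesis .
  qed
  have "0 < b" unfolding b_def using n0 c k a by (simp add: add_nonneg_pos)
  then show ?thesis
  proof (intro exI[of _ b] conjI allI impI)
    fix C C' t and w :: "real^'n"
    assume *: "C hhd C'" "\<forall>t\<ge>0. transpose (C t) = C t"
      "\<forall>t\<ge>0. \<forall>w. w \<bullet> (C' t *v w) \<le> 2 * (w \<bullet> (A *v (C t *v w))) + k * (w \<bullet> w)"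
      "\<forall>w. w \<bullet> (C 0 *v w) \<le> c * (w \<bullet> w)" "(0::real) \<le> t"
    show "w \<bullet> (C t *v w) \<le> b * (w \<bullet> w)"
      by (rule key[of C C' t w]) (use * in auto)
  qed
qed

section \<open>Gaussian measures\<close>

lemma bij_betw_axis_Basis: "bij_betw (\<lambda>i :: 'n::finite. axis i (1::real)) UNIV Basis"
  by (auto simp: bij_betw_def inj_on_def axis_eq_axis Basis_vec_def)

text \<open>Lebesgue measure on the vector space is the image of the product over
  \<open>Basis\<close>, so Fubini factors the integral; the proof reindexes coordinates by the unit
  vectors.\<close>

lemma std_gaussian_product:
  fixes g :: "'d::finite \<Rightarrow> real \<Rightarrow> real"
  assumes [measurable]: "\<And>i. g i \<in> borel_measurable borel"
    and int: "\<And>i. integrable lborel (\<lambda>x. std_normal_density x * g i x)"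
  shows "integrable std_gaussian (\<lambda>x. \<Prod>i\<in>UNIV. g i (x $ i))"
    and "(\<integral>x. (\<Prod>i\<in>UNIV. g i (x $ i)) \<partial>std_gaussian) = (\<Prod>i\<in>UNIV. \<integral>x. std_normal_density x * g i x \<partial>lborel)"
proof -
  define ix where "ix = inv_into UNIV (\<lambda>i :: 'd. axis i (1::real))"
  have ix: "ix (axis i 1) = i" for i
    using bij_betw_axis_Basis unfolding ix_def by (intro inv_into_f_f) (auto simp: bij_betw_def)
  have re: "(\<Prod>i\<in>UNIV. h i) = (\<Prod>b\<in>(Basis :: (real^'d) set). h (ix b))" for h :: "'d \<Rightarrow> real"
    using prod.reindex_bij_betw[OF bij_betw_axis_Basis, of "\<lambda>b. h (ix b)"] by (simp add: ix)
  have nth: "x $ ix b = x \<bullet> b" if "b \<in> Basis" for x b :: "real^'d"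
  proof -
    have "b \<in> (\<lambda>i. axis i 1) ` UNIV" using that bij_betw_axis_Basis by (auto simp: bij_betw_def)
    then show ?thesis by (auto simp: ix inner_axis)
  qed
  interpret P: product_sigma_finite "\<lambda>b :: real^'d. lborel :: real measure" by standard
  let ?f = "\<lambda>b x. std_normal_density x * g (ix b) x"
  let ?s = "\<lambda>f. \<Sum>b\<in>(Basis :: (real^'d) set). f b *\<^sub>R b"
  have inn: "(\<Prod>b\<in>Basis. ?f b (?s f \<bullet> b)) = (\<Prod>b\<in>Basis. ?f b (f b))" for f
    by (intro prod.cong refl) simp
  have eq: "(\<Prod>i\<in>UNIV. std_normal_density (x $ i)) * (\<Prod>i\<in>UNIV. g i (x $ i)) = (\<Prod>b\<in>Basis. ?f b (x \<bullet> b))" for x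
    unfolding prod.distrib[symmetric] by (subst re) (auto simp: nth intro!: prod.cong)
  have "integrable (\<Pi>\<^sub>M b\<in>Basis. lborel) (\<lambda>f. \<Prod>b\<in>Basis. ?f b (f b))"
    by (intro P.product_integrable_prod int) auto
  then have "integrable lborel (\<lambda>x. \<Prod>b\<in>(Basis :: (real^'d) set). ?f b (x \<bullet> b))"
    by (subst lborel_eq, subst integrable_distr_eq) (simp_all add: inn)
  then show "integrable std_gaussian (\<lambda>x. \<Prod>i\<in>UNIV. g i (x $ i))"
    unfolding std_gaussian_def by (subst integrable_density) (auto simp: prod_nonneg eq)
  have "(\<integral>x. (\<Prod>i\<in>UNIV. g i (x $ i)) \<partial>std_gaussian) = (\<integral>x. (\<Prod>b\<in>(Basis :: (real^'d) set). ?f b (x \<bullet> b)) \<partial>lborel)"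
    unfolding std_gaussian_def by (subst integral_density) (auto simp: prod_nonneg eq)
  also have "\<dots> = (\<integral>f. (\<Prod>b\<in>(Basis :: (real^'d) set). ?f b (f b)) \<partial>(\<Pi>\<^sub>M b\<in>Basis. lborel))"
    by (subst lborel_eq, subst integral_distr) (simp_all add: inn)
  also have "\<dots> = (\<Prod>b\<in>(Basis :: (real^'d) set). \<integral>x. ?f b x \<partial>lborel)"
    by (intro P.product_integral_prod int) auto
  also have "\<dots> = (\<Prod>i\<in>UNIV. \<integral>x. std_normal_density x * g i x \<partial>lborel)" by (rule re[symmetric])
  finally show "(\<integral>x. (\<Prod>i\<in>UNIV. g i (x $ i)) \<partial>std_gaussian) = (\<Prod>i\<in>UNIV. \<integral>x. std_normal_density x * g i x \<partial>lborel)" .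
qed

lemma sets_std_gaussian [measurable_cong, simp]: "sets std_gaussian = sets borel"
  by (simp add: std_gaussian_def)

lemma space_std_gaussian [simp]: "space std_gaussian = UNIV"
  by (simp add: std_gaussian_def)

lemma std_normal_power_integrals:
  "integrable lborel (\<lambda>x. std_normal_density x * x ^ k)"
  "(\<integral>x. std_normal_density x * 1 \<partial>lborel) = 1" "(\<integral>x. std_normal_density x * x \<partial>lborel) = 0"
  "(\<integral>x. std_normal_density x * x\<^sup>2 \<partial>lborel) = 1"
  using integrable_std_normal_moment[of k] integral_std_normal_moment_even[of 0] integral_std_normal_moment_odd[of 0]
    integral_std_normal_moment_even[of 1] by simp_all

lemma prob_space_std_gaussian: "prob_space (std_gaussian :: (real^'d) measure)"
proof
  have "integrable (std_gaussian :: (real^'d) measure) (\<lambda>x. \<Prod>i\<in>(UNIV::'d set). 1::real)"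
    "(\<integral>x. (\<Prod>i\<in>(UNIV::'d set). 1::real) \<partial>(std_gaussian :: (real^'d) measure)) = 1"
    using std_gaussian_product[of "\<lambda>(_::'d) _. 1"] std_normal_power_integrals(1)[of 0] std_normal_power_integrals(2) by simp_all
  then have int: "integrable (std_gaussian :: (real^'d) measure) (\<lambda>x. 1 :: real)"
    "(\<integral>x. 1 \<partial>(std_gaussian :: (real^'d) measure)) = (1 :: real)" by simp_all
  have "emeasure (std_gaussian :: (real^'d) measure) (space std_gaussian) = (\<integral>\<^sup>+x. ennreal 1 \<partial>(std_gaussian :: (real^'d) measure))" by simp
  also have "\<dots> = 1" using int by (subst nn_integral_eq_integral) simp_all
  finally show "emeasure (std_gaussian :: (real^'d) measure) (space std_gaussian) = 1" .
qed

lemma std_gaussian_coordinate_moments: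
  fixes i j :: "'d::finite"
  shows "integrable (std_gaussian :: (real^'d) measure) (\<lambda>x. x $ i)" "(\<integral>x. x $ i \<partial>(std_gaussian :: (real^'d) measure)) = 0"
    "integrable (std_gaussian :: (real^'d) measure) (\<lambda>x. x $ i * x $ j)"
    "(\<integral>x. x $ i * x $ j \<partial>(std_gaussian :: (real^'d) measure)) = (if i = j then 1 else 0)"
proof -
  have p: "(\<Prod>k\<in>UNIV. (if k = l then h k else 1)) = h l" for h :: "'d \<Rightarrow> real" and l by simp
  have p2: "(\<Prod>k\<in>UNIV. (if k = i then h k else if k = j then h k else 1)) = h i * h j"
    if ij: "i \<noteq> j" for h :: "'d \<Rightarrow> real"
  proof -
    have "(\<Prod>k\<in>UNIV. (if k = i then h k else if k = j then h k else 1)) =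
        (\<Prod>k\<in>UNIV. (if k = i then h k else 1) * (if k = j then h k else 1))"
      using ij by (intro prod.cong) auto
    then show ?thesis by (simp add: prod.distrib)
  qed
  note N = std_normal_power_integrals
  note i0 = N(1)[of 0, simplified] and i1 = N(1)[of 1, simplified]
  let ?g = "\<lambda>k x. if k = i then x else 1"
  have g: "integrable lborel (\<lambda>x. std_normal_density x * ?g k x)"
    "(\<integral>x. std_normal_density x * ?g k x \<partial>lborel) = (if k = i then 0 else 1)" for k
    using i0 i1 N(2,3) by (cases "k = i"; simp)+
  show "integrable (std_gaussian :: (real^'d) measure) (\<lambda>x. x $ i)" "(\<integral>x. x $ i \<partial>(std_gaussian :: (real^'d) measure)) = 0"
    using std_gaussian_product[of ?g] g p[of i] by (simp_all add: p)
  \<comment> \<open>For \<open>i = j\<close> one factor carries the square, otherwise two factors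
    carry one power each; all others are 1.\<close>
  let ?h = "\<lambda>k x. if k = i then (if i = j then x\<^sup>2 else x) else if k = j then x else 1"
  have h: "integrable lborel (\<lambda>x. std_normal_density x * ?h k x)"
    "(\<integral>x. std_normal_density x * ?h k x \<partial>lborel) = (if k = i then (if i = j then 1 else 0) else if k = j then 0 else 1)" for k
    using i0 i1 N(1)[of 2] N(2-4) by (cases "k = i"; cases "k = j"; simp)+
  have prods: "(\<Prod>k\<in>UNIV. ?h k (x $ k)) = x $ i * x $ j" for x :: "real^'d"
    using p2[of "\<lambda>k. x $ k"] by (cases "i = j") (simp_all add: power2_eq_square cong: if_cong)
  have "(\<Prod>k\<in>UNIV. (if k = i then (if i = j then 1 else 0) else if k = j then 0 else 1)) = (if i = j then 1 else (0::real))"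
  proof (cases "i = j")
    case True then show ?thesis by (intro trans[OF prod.neutral]) auto
  qed auto
  with std_gaussian_product[of ?h] h prods
  show "integrable (std_gaussian :: (real^'d) measure) (\<lambda>x. x $ i * x $ j)"
    "(\<integral>x. x $ i * x $ j \<partial>(std_gaussian :: (real^'d) measure)) = (if i = j then 1 else 0)"
    by simp_all
qed

lemma std_gaussian_moments:
  fixes a b :: "real^'d"
  shows "integrable std_gaussian (\<lambda>x. a \<bullet> x)" "(\<integral>x. a \<bullet> x \<partial>std_gaussian) = 0"
    "integrable std_gaussian (\<lambda>x. (a \<bullet> x) * (b \<bullet> x))" "(\<integral>x. (a \<bullet> x) * (b \<bullet> x) \<partial>std_gaussian) = a \<bullet> b"
proof -
  note M = std_gaussian_coordinate_moments[where 'd='d]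
  show "integrable std_gaussian (\<lambda>x. a \<bullet> x)" unfolding inner_vec_def by (simp add: M)
  show "(\<integral>x. a \<bullet> x \<partial>std_gaussian) = 0" unfolding inner_vec_def by (simp add: M)
  have eq: "(a \<bullet> x) * (b \<bullet> x) = (\<Sum>i\<in>UNIV. \<Sum>j\<in>UNIV. (a $ i * b $ j) * (x $ i * x $ j))" for x
    unfolding inner_vec_def sum_product by (intro sum.cong refl) simp
  show "integrable std_gaussian (\<lambda>x. (a \<bullet> x) * (b \<bullet> x))"
    unfolding eq by (intro Bochner_Integration.integrable_sum integrable_mult_right M)
  have "(\<integral>x. (a \<bullet> x) * (b \<bullet> x) \<partial>std_gaussian) = (\<Sum>i\<in>UNIV. \<Sum>j\<in>UNIV. (a $ i * b $ j) * (if i = j then 1 else 0))"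
    unfolding eq by (subst Bochner_Integration.integral_sum, auto intro!: Bochner_Integration.integrable_sum integrable_mult_right M sum.cong)
      (subst Bochner_Integration.integral_sum, auto intro!: integrable_mult_right M sum.cong simp: M)
  also have "\<dots> = a \<bullet> b" by (simp add: inner_vec_def if_distrib cong: if_cong)
  finally show "(\<integral>x. (a \<bullet> x) * (b \<bullet> x) \<partial>std_gaussian) = a \<bullet> b" .
qed

lemma sets_gaussian [measurable_cong, simp]: "sets (gaussian m C) = sets borel"
  by (simp add: gaussian_def)

lemma gaussian_map_measurable [measurable]: "(\<lambda>x. m + (A :: real^'n^'m) *v x) \<in> borel_measurable borel"
  by (intro borel_measurable_continuous_onI continuous_on_add continuous_on_const
      matrix_vector_mult_linear_continuous_on)

lemma prob_space_gaussian: "prob_space (gaussian m C)"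
  unfolding gaussian_def by (intro prob_space.prob_space_distr prob_space_std_gaussian) simp

lemma gaussian_moments:
  fixes C :: "real^'d^'d"
  assumes C: "pos_semidef C"
  shows "integrable (gaussian m C) (\<lambda>x. a \<bullet> (x - m))" "(\<integral>x. a \<bullet> (x - m) \<partial>gaussian m C) = 0"
    "integrable (gaussian m C) (\<lambda>x. (a \<bullet> (x - m)) * (b \<bullet> (x - m)))"
    "(\<integral>x. (a \<bullet> (x - m)) * (b \<bullet> (x - m)) \<partial>gaussian m C) = a \<bullet> (C *v b)"
proof -
  let ?R = "sqrtm C"
  have R: "transpose ?R = ?R" "?R ** ?R = C" using sqrtm[OF C] transpose_sqrtm[OF C] by auto
  have in': "a \<bullet> (?R *v x) = (?R *v a) \<bullet> x" for a x by (rule inner_symmetric_matrix[OF R(1)])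
  note S = std_gaussian_moments[of "?R *v a"] std_gaussian_moments(3,4)[of "?R *v a" "?R *v b"]
  show "integrable (gaussian m C) (\<lambda>x. a \<bullet> (x - m))"
    unfolding gaussian_def by (subst integrable_distr_eq) (auto simp: in' S)
  show "(\<integral>x. a \<bullet> (x - m) \<partial>gaussian m C) = 0"
    unfolding gaussian_def by (subst integral_distr) (auto simp: in' S)
  show "integrable (gaussian m C) (\<lambda>x. (a \<bullet> (x - m)) * (b \<bullet> (x - m)))"
    unfolding gaussian_def by (subst integrable_distr_eq) (auto simp: in' S)
  have "(\<integral>x. (a \<bullet> (x - m)) * (b \<bullet> (x - m)) \<partial>gaussian m C) = (?R *v a) \<bullet> (?R *v b)"
    unfolding gaussian_def by (subst integral_distr) (auto simp: in' S)
  also have "\<dots> = a \<bullet> (C *v b)" unfolding in'[symmetric] by (simp add: matrix_vector_mul_assoc R)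
  finally show "(\<integral>x. (a \<bullet> (x - m)) * (b \<bullet> (x - m)) \<partial>gaussian m C) = a \<bullet> (C *v b)" .
qed

section \<open>Square-integrable measures, means and covariances\<close>

lemma norm_square_eq_sum_inner: "(norm (x :: 'a::euclidean_space))\<^sup>2 = (\<Sum>b\<in>Basis. (b \<bullet> x) * (b \<bullet> x))"
  unfolding power2_norm_eq_inner by (subst euclidean_inner) (simp add: inner_commute)

lemma P2I:
  assumes "prob_space \<mu>" "sets \<mu> = sets borel" "\<And>b. integrable \<mu> (\<lambda>x. (b \<bullet> (x - m)) * (b \<bullet> (x - m)))"
  shows "\<mu> \<in> P2"
proof -
  interpret prob_space \<mu> by fact
  note [measurable_cong] = assms(2)
  have c: "integrable \<mu> (\<lambda>x. (norm (x - m))\<^sup>2)"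
    unfolding norm_square_eq_sum_inner by (intro Bochner_Integration.integrable_sum assms)
  have "integrable \<mu> (\<lambda>x. 2 * (norm (x - m))\<^sup>2 + 2 * (norm m)\<^sup>2)"
    by (intro Bochner_Integration.integrable_add integrable_mult_right c) simp
  then have "integrable \<mu> (\<lambda>x. (norm x)\<^sup>2)"
  proof (rule Bochner_Integration.integrable_bound)
    show "(\<lambda>x. (norm x)\<^sup>2) \<in> borel_measurable \<mu>" by measurable
    have "(norm x)\<^sup>2 \<le> 2 * (norm (x - m))\<^sup>2 + 2 * (norm m)\<^sup>2" for x
    proof -
      have "(norm x)\<^sup>2 \<le> (norm (x - m) + norm m)\<^sup>2"
        using norm_triangle_ineq[of "x - m" m] by (intro power_mono) auto
      also have "\<dots> \<le> 2 * (norm (x - m))\<^sup>2 + 2 * (norm m)\<^sup>2"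
        using sum_squares_bound[of "norm (x - m)" "norm m"] by (simp add: power2_sum)
      finally show ?thesis .
    qed
    then show "AE x in \<mu>. norm ((norm x)\<^sup>2) \<le> norm (2 * (norm (x - m))\<^sup>2 + 2 * (norm m)\<^sup>2)" by auto
  qed
  with assms show ?thesis by (simp add: P2_def)
qed

lemma P2_integrable:
  fixes \<mu> :: "(real^'d) measure"
  assumes "\<mu> \<in> P2"
  shows "integrable \<mu> (\<lambda>x. x)" "integrable \<mu> (\<lambda>x. a \<bullet> x)" "integrable \<mu> (\<lambda>x. (a \<bullet> (x - m)) * (b \<bullet> (x - m)))"
    "integrable \<mu> (\<lambda>x. (norm (x - m))\<^sup>2)"
proof -
  from assms have p: "prob_space \<mu>" and [measurable_cong]: "sets \<mu> = sets borel"
    and i2: "integrable \<mu> (\<lambda>x. (norm x)\<^sup>2)" by (auto simp: P2_def)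
  interpret prob_space \<mu> by fact
  show i1: "integrable \<mu> (\<lambda>x. x)"
  proof (rule Bochner_Integration.integrable_bound)
    show "integrable \<mu> (\<lambda>x. 1 + (norm x)\<^sup>2)" using i2 by simp
    have "norm x \<le> 1 + (norm x)\<^sup>2" for x :: "real^'d"
    proof -
      have "2 * norm x \<le> (norm x)\<^sup>2 + 1" using sum_squares_bound[of "norm x" 1] by simp
      then show ?thesis using norm_ge_zero[of x] by linarith
    qed
    then show "AE x in \<mu>. norm x \<le> norm (1 + (norm x)\<^sup>2)" by auto
  qed measurable
  then show "integrable \<mu> (\<lambda>x. a \<bullet> x)" by (rule integrable_inner_right)
  have b: "integrable \<mu> (\<lambda>x. 2 * (norm x)\<^sup>2 + 2 * (norm m)\<^sup>2)" using i2 by simp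
  show n2: "integrable \<mu> (\<lambda>x. (norm (x - m))\<^sup>2)"
  proof (rule Bochner_Integration.integrable_bound[OF b])
    have "(norm (x - m))\<^sup>2 \<le> 2 * (norm x)\<^sup>2 + 2 * (norm m)\<^sup>2" for x
    proof -
      have "(norm (x - m))\<^sup>2 \<le> (norm x + norm m)\<^sup>2"
        using norm_triangle_ineq4[of x m] by (intro power_mono) auto
      also have "\<dots> \<le> 2 * (norm x)\<^sup>2 + 2 * (norm m)\<^sup>2"
        using sum_squares_bound[of "norm x" "norm m"] by (simp add: power2_sum)
      finally show ?thesis .
    qed
    then show "AE x in \<mu>. norm ((norm (x - m))\<^sup>2) \<le> norm (2 * (norm x)\<^sup>2 + 2 * (norm m)\<^sup>2)" by auto
  qed measurable
  show "integrable \<mu> (\<lambda>x. (a \<bullet> (x - m)) * (b \<bullet> (x - m)))"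
  proof (rule Bochner_Integration.integrable_bound)
    show "integrable \<mu> (\<lambda>x. norm a * norm b * (norm (x - m))\<^sup>2)" using n2 by simp
    have "\<bar>a \<bullet> y\<bar> * \<bar>b \<bullet> y\<bar> \<le> norm a * norm b * (norm y)\<^sup>2" for y
      using mult_mono[OF Cauchy_Schwarz_ineq2[of a y] Cauchy_Schwarz_ineq2[of b y]]
      by (simp add: power2_eq_square mult_ac)
    then show "AE x in \<mu>. norm ((a \<bullet> (x - m)) * (b \<bullet> (x - m))) \<le> norm (norm a * norm b * (norm (x - m))\<^sup>2)"
      by (simp add: abs_mult)
  qed measurable
qed

lemma Cov_form:
  fixes \<mu> :: "(real^'d) measure"
  assumes "\<mu> \<in> P2"
  shows "a \<bullet> (Cov \<mu> *v b) = (\<integral>x. (a \<bullet> (x - mean \<mu>)) * (b \<bullet> (x - mean \<mu>)) \<partial>\<mu>)"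
proof -
  have ij: "integrable \<mu> (\<lambda>x. (x $ i - mean \<mu> $ i) * (x $ j - mean \<mu> $ j))" for i j
    using P2_integrable(3)[OF assms, of "axis i 1" "mean \<mu>" "axis j 1"]
    by (simp add: inner_axis' )
  have eq: "(a \<bullet> (x - mean \<mu>)) * (b \<bullet> (x - mean \<mu>)) =
    (\<Sum>i\<in>UNIV. \<Sum>j\<in>UNIV. (a $ i * b $ j) * ((x $ i - mean \<mu> $ i) * (x $ j - mean \<mu> $ j)))" for x
    unfolding inner_vec_def sum_product by (intro sum.cong refl) simp
  have "(\<integral>x. (a \<bullet> (x - mean \<mu>)) * (b \<bullet> (x - mean \<mu>)) \<partial>\<mu>) =
    (\<Sum>i\<in>UNIV. \<Sum>j\<in>UNIV. (a $ i * b $ j) * Cov \<mu> $ i $ j)"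
    unfolding eq Cov_def
    by (subst Bochner_Integration.integral_sum, auto intro!: Bochner_Integration.integrable_sum integrable_mult_right ij sum.cong)
      (subst Bochner_Integration.integral_sum, auto intro!: integrable_mult_right ij sum.cong)
  then show ?thesis
    by (simp add: inner_vec_def matrix_vector_mult_def sum_distrib_left mult.commute mult.left_commute)
qed

lemma transpose_Cov: "transpose (Cov \<mu>) = Cov \<mu>"
  by (simp add: Cov_def transpose_def vec_eq_iff mult.commute)

lemma mean_inner:
  assumes "\<mu> \<in> P2" shows "a \<bullet> mean \<mu> = (\<integral>x. a \<bullet> x \<partial>\<mu>)"
  unfolding mean_def by (intro integral_inner_right[symmetric] P2_integrable assms)

lemma gaussian_P2:
  fixes C :: "real^'d^'d"
  assumes "pos_semidef C" shows "gaussian m C \<in> P2"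
  by (rule P2I[OF prob_space_gaussian, of _ _ m]) (auto intro: gaussian_moments assms)

lemma mean_gaussian:
  fixes C :: "real^'d^'d"
  assumes "pos_semidef C" shows "mean (gaussian m C) = m"
proof (rule vector_eq_ldot[THEN iffD1, rule_format])
  fix a
  interpret prob_space "gaussian m C" by (rule prob_space_gaussian)
  have "a \<bullet> mean (gaussian m C) - a \<bullet> m = (\<integral>x. a \<bullet> (x - m) \<partial>gaussian m C)"
    using P2_integrable(2)[OF gaussian_P2[OF assms]]
    by (simp add: mean_inner[OF gaussian_P2[OF assms]] inner_diff_right prob_space)
  then show "a \<bullet> mean (gaussian m C) = a \<bullet> m" using gaussian_moments(2)[OF assms] by simp
qed

lemma Cov_gaussian:
  fixes C :: "real^'d^'d"
  assumes "pos_semidef C" shows "Cov (gaussian m C) = C"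
  by (rule matrix_eq_inner)
    (simp add: Cov_form[OF gaussian_P2[OF assms]] mean_gaussian[OF assms] gaussian_moments(4)[OF assms])

section \<open>Convergence in probability\<close>

text \<open>A metric for convergence in probability.\<close>

definition pdist :: "'a measure \<Rightarrow> ('a \<Rightarrow> 'b::real_normed_vector) \<Rightarrow> ('a \<Rightarrow> 'b) \<Rightarrow> real" where
  "pdist M X Y = (\<integral>\<eta>. min 1 (norm (X \<eta> - Y \<eta>)) \<partial>M)"

lemma min_one_add_le: "0 \<le> a \<Longrightarrow> 0 \<le> b \<Longrightarrow> c \<le> a + b \<Longrightarrow> min 1 c \<le> min 1 a + min 1 (b :: real)"
  by (auto simp: min_def)

context prob_space begin

lemma integrable_pdist [simp]:
  fixes X Y :: "'a \<Rightarrow> 'b::euclidean_space"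
  assumes [measurable]: "X \<in> borel_measurable M" "Y \<in> borel_measurable M"
  shows "integrable M (\<lambda>\<eta>. min 1 (norm (X \<eta> - Y \<eta>)))"
  by (rule integrable_const_bound[of _ 1]) auto

lemma pdist_nonneg: "0 \<le> pdist M X Y"
  unfolding pdist_def by (intro Bochner_Integration.integral_nonneg) simp

lemma pdist_triangle:
  fixes X Y Z :: "'a \<Rightarrow> 'b::euclidean_space"
  assumes [measurable]: "X \<in> borel_measurable M" "Y \<in> borel_measurable M" "Z \<in> borel_measurable M"
  shows "pdist M X Z \<le> pdist M X Y + pdist M Y Z"
proof -
  have "min 1 (norm (X \<eta> - Z \<eta>)) \<le> min 1 (norm (X \<eta> - Y \<eta>)) + min 1 (norm (Y \<eta> - Z \<eta>))" for \<eta>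
    using norm_triangle_ineq[of "X \<eta> - Y \<eta>" "Y \<eta> - Z \<eta>"] by (intro min_one_add_le) auto
  then have "pdist M X Z \<le> (\<integral>\<eta>. min 1 (norm (X \<eta> - Y \<eta>)) + min 1 (norm (Y \<eta> - Z \<eta>)) \<partial>M)"
    unfolding pdist_def by (intro integral_mono Bochner_Integration.integrable_add) auto
  then show ?thesis by (simp add: pdist_def)
qed

lemma pdist_cong_AE:
  fixes X Y :: "'a \<Rightarrow> 'b::euclidean_space"
  assumes [measurable]: "X \<in> borel_measurable M" "Y \<in> borel_measurable M" "X' \<in> borel_measurable M" "Y' \<in> borel_measurable M"
    and "AE \<eta> in M. X \<eta> - Y \<eta> = X' \<eta> - Y' \<eta>"
  shows "pdist M X Y = pdist M X' Y'"
  unfolding pdist_def by (intro integral_cong_AE) (use assms(5) in auto)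

lemma pdist_add:
  fixes X Y :: "'a \<Rightarrow> 'b::euclidean_space"
  assumes [measurable]: "X \<in> borel_measurable M" "Y \<in> borel_measurable M" "X' \<in> borel_measurable M" "Y' \<in> borel_measurable M"
  shows "pdist M (\<lambda>\<eta>. X \<eta> + X' \<eta>) (\<lambda>\<eta>. Y \<eta> + Y' \<eta>) \<le> pdist M X Y + pdist M X' Y'"
proof -
  have "min 1 (norm ((X \<eta> + X' \<eta>) - (Y \<eta> + Y' \<eta>))) \<le> min 1 (norm (X \<eta> - Y \<eta>)) + min 1 (norm (X' \<eta> - Y' \<eta>))" for \<eta>
    using norm_triangle_ineq[of "X \<eta> - Y \<eta>" "X' \<eta> - Y' \<eta>"]
    by (intro min_one_add_le) (auto simp: algebra_simps)
  then have "pdist M (\<lambda>\<eta>. X \<eta> + X' \<eta>) (\<lambda>\<eta>. Y \<eta> + Y' \<eta>) \<le>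
      (\<integral>\<eta>. min 1 (norm (X \<eta> - Y \<eta>)) + min 1 (norm (X' \<eta> - Y' \<eta>)) \<partial>M)"
    unfolding pdist_def by (intro integral_mono Bochner_Integration.integrable_add) auto
  then show ?thesis by (simp add: pdist_def)
qed

lemma pdist_sum:
  fixes X Y :: "'i \<Rightarrow> 'a \<Rightarrow> 'b::euclidean_space"
  assumes "finite I" "\<And>i. i \<in> I \<Longrightarrow> X i \<in> borel_measurable M" "\<And>i. i \<in> I \<Longrightarrow> Y i \<in> borel_measurable M"
  shows "pdist M (\<lambda>\<eta>. \<Sum>i\<in>I. X i \<eta>) (\<lambda>\<eta>. \<Sum>i\<in>I. Y i \<eta>) \<le> (\<Sum>i\<in>I. pdist M (X i) (Y i))"
  using assms
proof (induction I rule: finite_induct)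
  case empty then show ?case by (simp add: pdist_def)
next
  case (insert i I)
  then have "pdist M (\<lambda>\<eta>. X i \<eta> + (\<Sum>i\<in>I. X i \<eta>)) (\<lambda>\<eta>. Y i \<eta> + (\<Sum>i\<in>I. Y i \<eta>))
      \<le> pdist M (X i) (Y i) + pdist M (\<lambda>\<eta>. \<Sum>i\<in>I. X i \<eta>) (\<lambda>\<eta>. \<Sum>i\<in>I. Y i \<eta>)"
    by (intro pdist_add) auto
  with insert show ?case by simp
qed

text \<open>Distances are truncated at 1, and \<open>min 1 (c * d) \<le> c * min 1 d\<close> relies
  on \<open>1 \<le> c\<close>.\<close>

lemma pdist_lipschitz:
  fixes X Y :: "'a \<Rightarrow> 'b::euclidean_space" and X' Y' :: "'a \<Rightarrow> 'c::euclidean_space"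
  assumes [measurable]: "X \<in> borel_measurable M" "Y \<in> borel_measurable M" "X' \<in> borel_measurable M" "Y' \<in> borel_measurable M"
    and c: "1 \<le> c" "\<And>\<eta>. \<eta> \<in> space M \<Longrightarrow> norm (X' \<eta> - Y' \<eta>) \<le> c * norm (X \<eta> - Y \<eta>)"
  shows "pdist M X' Y' \<le> c * pdist M X Y"
proof -
  have "min 1 (norm (X' \<eta> - Y' \<eta>)) \<le> c * min 1 (norm (X \<eta> - Y \<eta>))" if "\<eta> \<in> space M" for \<eta>
    using c(1) c(2)[OF that] by (auto simp: min_def)
  then have "pdist M X' Y' \<le> (\<integral>\<eta>. c * min 1 (norm (X \<eta> - Y \<eta>)) \<partial>M)"
    unfolding pdist_def by (intro integral_mono integrable_mult_right) auto
  then show ?thesis by (simp add: pdist_def)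
qed

lemma pdist_tendsto_AE:
  fixes X :: "nat \<Rightarrow> 'a \<Rightarrow> 'b::euclidean_space"
  assumes [measurable]: "\<And>n. X n \<in> borel_measurable M" "Y \<in> borel_measurable M"
    and lim: "AE \<eta> in M. (\<lambda>n. X n \<eta>) \<longlonglongrightarrow> Y \<eta>"
  shows "(\<lambda>n. pdist M (X n) Y) \<longlonglongrightarrow> 0"
proof -
  have "(\<lambda>n. pdist M (X n) Y) \<longlonglongrightarrow> (\<integral>\<eta>. 0 \<partial>M)"
    unfolding pdist_def
  proof (rule integral_dominated_convergence[where w = "\<lambda>_. 1"])
    show "AE \<eta> in M. (\<lambda>n. min 1 (norm (X n \<eta> - Y \<eta>))) \<longlonglongrightarrow> 0"
      using lim
    proof eventually_elim
      case (elim \<eta>)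
      then have "(\<lambda>n. min 1 (norm (X n \<eta> - Y \<eta>))) \<longlonglongrightarrow> min 1 (norm (Y \<eta> - Y \<eta>))"
        by (intro tendsto_intros)
      then show ?case by simp
    qed
  qed auto
  then show ?thesis by simp
qed

text \<open>Connects the metric with the form of convergence in \<open>stoch_integral\<close>, where
  one number bounds both the deviation and its probability: the truncated distance is at most
  \<open>e\<close> off the exceptional event and at most 1 on it.\<close>

lemma pdist_le_of_measure:
  fixes X Y :: "'a \<Rightarrow> 'b::euclidean_space"
  assumes [measurable]: "X \<in> borel_measurable M" "Y \<in> borel_measurable M"
    and "measure M {\<eta> \<in> space M. norm (X \<eta> - Y \<eta>) > e} < e"
  shows "pdist M X Y \<le> 2 * e"
proof -
  let ?A = "{\<eta> \<in> space M. norm (X \<eta> - Y \<eta>) > e}"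
  have e: "0 \<le> e" using assms(3) measure_nonneg[of M ?A] by linarith
  have "pdist M X Y \<le> (\<integral>\<eta>. e + indicator ?A \<eta> \<partial>M)"
    unfolding pdist_def
  proof (rule integral_mono)
    fix \<eta> assume "\<eta> \<in> space M"
    then show "min 1 (norm (X \<eta> - Y \<eta>)) \<le> e + indicator ?A \<eta>" using e by (auto simp: indicator_def min_def)
  qed (auto intro!: integrable_real_indicator Bochner_Integration.integrable_add simp: less_top[symmetric])
  also have "\<dots> = e + measure M (?A \<inter> space M)"
    by (subst Bochner_Integration.integral_add) (auto simp: prob_space less_top[symmetric])
  also have "?A \<inter> space M = ?A" by auto
  finally show ?thesis using assms(3) by linarith
qed

text \<open>In place of Borel-Cantelli: the sum of the truncated distances has finite expectation,
  so it is finite almost surely and its terms tend to zero.\<close>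

lemma pdist_summable_AE_tendsto:
  fixes X :: "nat \<Rightarrow> 'a \<Rightarrow> 'b::euclidean_space"
  assumes [measurable]: "\<And>n. X n \<in> borel_measurable M" "Y \<in> borel_measurable M"
    and s: "summable (\<lambda>n. pdist M (X n) Y)"
  shows "AE \<eta> in M. (\<lambda>n. X n \<eta>) \<longlonglongrightarrow> Y \<eta>"
proof -
  let ?f = "\<lambda>n \<eta>. min 1 (norm (X n \<eta> - Y \<eta>))"
  have "(\<integral>\<^sup>+\<eta>. (\<Sum>n. ennreal (?f n \<eta>)) \<partial>M) = (\<Sum>n. \<integral>\<^sup>+\<eta>. ennreal (?f n \<eta>) \<partial>M)"
    by (rule nn_integral_suminf) measurable
  also have "\<dots> = (\<Sum>n. ennreal (pdist M (X n) Y))"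
    unfolding pdist_def by (intro suminf_cong nn_integral_eq_integral integrable_pdist) auto
  also have "\<dots> < \<infinity>" using s by (simp add: suminf_ennreal2 pdist_nonneg)
  finally have "AE \<eta> in M. (\<Sum>n. ennreal (?f n \<eta>)) \<noteq> \<infinity>"
    by (intro nn_integral_PInf_AE) auto
  then show ?thesis
  proof eventually_elim
    case (elim \<eta>)
    then have "summable (\<lambda>n. ?f n \<eta>)" by (intro summable_suminf_not_top) (auto simp: top_unique)
    then have "(\<lambda>n. ?f n \<eta>) \<longlonglongrightarrow> 0" by (rule summable_LIMSEQ_zero)
    then have ev: "\<forall>\<^sub>F n in sequentially. ?f n \<eta> < 1" by (rule order_tendstoD) simp
    have "(\<lambda>n. norm (X n \<eta> - Y \<eta>)) \<longlonglongrightarrow> 0"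
      by (rule Lim_transform_eventually[OF \<open>(\<lambda>n. ?f n \<eta>) \<longlonglongrightarrow> 0\<close>])
        (use ev in \<open>auto elim!: eventually_mono simp: min_def split: if_splits\<close>)
    then show ?case by (simp add: tendsto_norm_zero_iff LIM_zero_iff)
  qed
qed

text \<open>Bounded Lipschitz functions are the test functions adapted to \<open>pdist\<close>: the
  bound 2 acts where the distance is truncated, the Lipschitz constant elsewhere.\<close>

lemma expectation_lipschitz_pdist:
  fixes X Y :: "'a \<Rightarrow> 'b::euclidean_space" and f :: "'b \<Rightarrow> real"
  assumes [measurable]: "X \<in> borel_measurable M" "Y \<in> borel_measurable M" "f \<in> borel_measurable borel"
    and f: "\<And>x. \<bar>f x\<bar> \<le> 1" "\<And>x y. \<bar>f x - f y\<bar> \<le> c * norm (x - y)"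
  shows "\<bar>expectation (\<lambda>\<eta>. f (X \<eta>)) - expectation (\<lambda>\<eta>. f (Y \<eta>))\<bar> \<le> max 2 c * pdist M X Y"
proof -
  have i: "integrable M (\<lambda>\<eta>. f (X \<eta>))" "integrable M (\<lambda>\<eta>. f (Y \<eta>))"
    by (auto intro!: integrable_const_bound[of _ 1] simp: f)
  have "\<bar>expectation (\<lambda>\<eta>. f (X \<eta>)) - expectation (\<lambda>\<eta>. f (Y \<eta>))\<bar> = \<bar>expectation (\<lambda>\<eta>. f (X \<eta>) - f (Y \<eta>))\<bar>"
    using i by simp
  also have "\<dots> \<le> expectation (\<lambda>\<eta>. \<bar>f (X \<eta>) - f (Y \<eta>)\<bar>)" by (rule integral_abs_bound)
  also have "\<dots> \<le> expectation (\<lambda>\<eta>. max 2 c * min 1 (norm (X \<eta> - Y \<eta>)))"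
  proof (rule integral_mono)
    fix \<eta>
    have "\<bar>f (X \<eta>) - f (Y \<eta>)\<bar> \<le> 2" using f(1)[of "X \<eta>"] f(1)[of "Y \<eta>"] by linarith
    moreover have "\<bar>f (X \<eta>) - f (Y \<eta>)\<bar> \<le> max 2 c * norm (X \<eta> - Y \<eta>)"
      by (rule order_trans[OF f(2)]) (intro mult_right_mono, auto)
    ultimately show "\<bar>f (X \<eta>) - f (Y \<eta>)\<bar> \<le> max 2 c * min 1 (norm (X \<eta> - Y \<eta>))"
      by (auto simp: min_def)
  qed (use i in \<open>auto intro!: integrable_mult_right integrable_pdist\<close>)
  also have "\<dots> = max 2 c * pdist M X Y" by (simp add: pdist_def)
  finally show ?thesis .
qed

end

text \<open>The indicator of an open set is the limit of \<open>min 1 (n * infdist x (- U))\<close>,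
  and open sets form a generator closed under intersection.\<close>

lemma borel_measure_eqI_lipschitz:
  fixes \<mu> \<nu> :: "'b::metric_space measure"
  assumes \<mu>: "prob_space \<mu>" "sets \<mu> = sets borel" and \<nu>: "prob_space \<nu>" "sets \<nu> = sets borel"
    and eq: "\<And>f c. f \<in> borel_measurable borel \<Longrightarrow> (\<And>x. \<bar>f x\<bar> \<le> (1::real)) \<Longrightarrow>
      (\<And>x y. \<bar>f x - f y\<bar> \<le> c * dist x y) \<Longrightarrow> 0 \<le> c \<Longrightarrow> integral\<^sup>L \<mu> f = integral\<^sup>L \<nu> f"
  shows "\<mu> = \<nu>"
proof (rule measure_eqI_generator_eq[where E = "{S. open S}" and \<Omega> = UNIV and A = "\<lambda>_. UNIV"])
  interpret m: prob_space \<mu> by fact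
  interpret n: prob_space \<nu> by fact
  note [measurable_cong] = \<mu>(2) \<nu>(2)
  have sp: "space \<mu> = UNIV" "space \<nu> = UNIV" using sets_eq_imp_space_eq[OF \<mu>(2)] sets_eq_imp_space_eq[OF \<nu>(2)] by auto
  show "Int_stable {S :: 'b set. open S}" by (auto simp: Int_stable_def)
  show "sets \<mu> = sigma_sets UNIV {S. open S}" "sets \<nu> = sigma_sets UNIV {S. open S}"
    by (simp_all add: \<mu> \<nu> borel_def)
  show "emeasure \<mu> UNIV \<noteq> \<infinity>" using m.emeasure_space_1 by (simp add: sp)
  fix U :: "'b set" assume "U \<in> {S. open S}"
  then have U: "open U" and [measurable]: "U \<in> sets borel" by auto
  show "emeasure \<mu> U = emeasure \<nu> U"
  proof (cases "U = UNIV")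
    \<comment> \<open>With an empty complement \<open>infdist\<close> is 0 by convention and the
      approximating functions would all vanish.\<close>
    case True then show ?thesis using m.emeasure_space_1 n.emeasure_space_1 by (simp add: sp)
  next
    case False
    then have ne: "- U \<noteq> {}" by auto
    define f where "f n x = min 1 (real n * infdist x (- U))" for n x
    have meas[measurable]: "f n \<in> borel_measurable borel" for n
      unfolding f_def by (intro borel_measurable_continuous_onI continuous_intros)
    have f1: "\<bar>f n x\<bar> \<le> 1" for n x by (simp add: f_def infdist_nonneg)
    have lip: "\<bar>f n x - f n y\<bar> \<le> real n * dist x y" for n x y
    proof -
      have "\<bar>infdist x (- U) - infdist y (- U)\<bar> \<le> dist x y"
        using infdist_triangle[of x "- U" y] infdist_triangle[of y "- U" x] by (simp add: dist_commute abs_le_iff)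
      then have "\<bar>real n * infdist x (- U) - real n * infdist y (- U)\<bar> \<le> real n * dist x y"
        by (simp add: right_diff_distrib[symmetric] abs_mult mult_left_mono)
      then show ?thesis by (auto simp: f_def min_def abs_if split: if_splits)
    qed
    have lim: "(\<lambda>n. f n x) \<longlonglongrightarrow> indicator U x" for x
    proof (cases "x \<in> U")
      case True
      have "0 < infdist x (- U)" using True U ne infdist_pos_not_in_closed[of "- U" x] by (simp add: closed_Compl)
      then obtain n0 :: nat where "1 < real n0 * infdist x (- U)" using reals_Archimedean3 by blast
      then have "f n x = 1" if "n0 \<le> n" for n
      proof -
        have "real n0 * infdist x (- U) \<le> real n * infdist x (- U)"
          using that \<open>0 < infdist x (- U)\<close> by (intro mult_right_mono) auto
        then show ?thesis using \<open>1 < real n0 * infdist x (- U)\<close> by (simp add: f_def)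
      qed
      then show ?thesis using True by (intro tendsto_eventually) (auto simp: eventually_sequentially)
    next
      case False then show ?thesis by (simp add: f_def)
    qed
    have "(\<lambda>n. integral\<^sup>L \<mu> (f n)) \<longlonglongrightarrow> integral\<^sup>L \<mu> (indicator U)"
      by (rule integral_dominated_convergence[where w = "\<lambda>_. 1"]) (use lim f1 U in auto)
    moreover have "(\<lambda>n. integral\<^sup>L \<nu> (f n)) \<longlonglongrightarrow> integral\<^sup>L \<nu> (indicator U)"
      by (rule integral_dominated_convergence[where w = "\<lambda>_. 1"]) (use lim f1 U in auto)
    moreover have "integral\<^sup>L \<mu> (f n) = integral\<^sup>L \<nu> (f n)" for n
      by (rule eq[OF meas f1 lip]) simp
    ultimately have "integral\<^sup>L \<mu> (indicator U) = (integral\<^sup>L \<nu> (indicator U) :: real)" by (simp add: LIMSEQ_unique)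
    then have "measure \<mu> U = measure \<nu> U" by (simp add: sp)
    then show ?thesis by (simp add: m.emeasure_eq_measure n.emeasure_eq_measure)
  qed
qed auto

lemma distr_pair_snd:
  assumes "prob_space M" "prob_space N" shows "distr (M \<Otimes>\<^sub>M N) N snd = N"
proof (rule measure_eqI)
  interpret M: prob_space M by fact
  interpret N: prob_space N by fact
  interpret pair_prob_space M N ..
  fix A assume "A \<in> sets (distr (M \<Otimes>\<^sub>M N) N snd)"
  then have A: "A \<in> sets N" by simp
  have "snd -` A \<inter> space (M \<Otimes>\<^sub>M N) = space M \<times> A"
    using sets.sets_into_space[OF A] by (auto simp: space_pair_measure)
  then show "emeasure (distr (M \<Otimes>\<^sub>M N) N snd) A = emeasure N A"
    using A by (simp add: emeasure_distr N.emeasure_pair_measure_Times M.emeasure_space_1)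
qed simp

text \<open>Independence survives a limit in probability. The integrals of a bounded Lipschitz
  function under the joint law and under the product law are both approximated by those of
  \<open>U n\<close>, where they agree.\<close>

lemma joint_law_limit:
  fixes X :: "'a \<Rightarrow> 'b::euclidean_space" and U :: "nat \<Rightarrow> 'a \<Rightarrow> 'c::euclidean_space"
  assumes "prob_space M" and [measurable]: "X \<in> borel_measurable M" "\<And>n. U n \<in> borel_measurable M" "V \<in> borel_measurable M"
    and indep: "\<And>n. distr M (borel \<Otimes>\<^sub>M borel) (\<lambda>\<eta>. (X \<eta>, U n \<eta>)) = distr M borel X \<Otimes>\<^sub>M \<rho> n"
    and \<rho>: "\<And>n. \<rho> n = distr M borel (U n)"
    and lim: "(\<lambda>n. pdist M (U n) V) \<longlonglongrightarrow> 0"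
  shows "distr M (borel \<Otimes>\<^sub>M borel) (\<lambda>\<eta>. (X \<eta>, V \<eta>)) = distr M borel X \<Otimes>\<^sub>M distr M borel V"
proof -
  interpret prob_space M by fact
  interpret X: prob_space "distr M borel X" by (rule prob_space_distr) simp
  interpret V: prob_space "distr M borel V" by (rule prob_space_distr) simp
  interpret U: prob_space "distr M borel (U n)" for n by (rule prob_space_distr) simp
  interpret XV: pair_prob_space "distr M borel X" "distr M borel V" ..
  interpret XU: pair_prob_space "distr M borel X" "distr M borel (U n)" for n ..
  interpret MM: pair_prob_space M M ..
  have sets_XV: "sets (distr M borel X \<Otimes>\<^sub>M distr M borel V) = sets borel"
    by (simp add: borel_prod[symmetric] cong: sets_pair_measure_cong)
  show ?thesis
  proof (rule borel_measure_eqI_lipschitz)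
    show "prob_space (distr M (borel \<Otimes>\<^sub>M borel) (\<lambda>\<eta>. (X \<eta>, V \<eta>)))" by (rule prob_space_distr) simp
    show "sets (distr M (borel \<Otimes>\<^sub>M borel) (\<lambda>\<eta>. (X \<eta>, V \<eta>))) = sets borel" by (simp add: borel_prod)
    show "prob_space (distr M borel X \<Otimes>\<^sub>M distr M borel V)" by (rule XV.prob_space_axioms)
    fix f :: "'b \<times> 'c \<Rightarrow> real" and c :: real
    assume f[measurable]: "f \<in> borel_measurable borel" and f1: "\<And>x. \<bar>f x\<bar> \<le> 1"
      and lip: "\<And>x y. \<bar>f x - f y\<bar> \<le> c * dist x y" and c: "0 \<le> c"
    have [measurable]: "f \<in> borel_measurable (borel \<Otimes>\<^sub>M borel)" using f by (simp add: borel_prod)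
    have pairlaw: "integral\<^sup>L (distr M borel X \<Otimes>\<^sub>M distr M borel T) f =
        (\<integral>\<eta>. f (X (fst \<eta>), T (snd \<eta>)) \<partial>(M \<Otimes>\<^sub>M M))" if [measurable]: "T \<in> borel_measurable M" for T
    proof -
      interpret T: prob_space "distr M borel T" by (rule prob_space_distr) simp
      have "distr M borel X \<Otimes>\<^sub>M distr M borel T = distr (M \<Otimes>\<^sub>M M) (borel \<Otimes>\<^sub>M borel) (\<lambda>(x, y). (X x, T y))"
        by (rule pair_measure_distr) (auto intro: T.sigma_finite_measure_axioms)
      then show ?thesis by (simp add: integral_distr case_prod_beta)
    qed
    have diag: "\<bar>integral\<^sup>L (distr M borel X \<Otimes>\<^sub>M \<rho> n) f - (\<integral>\<eta>. f (X \<eta>, V \<eta>) \<partial>M)\<bar> \<le> max 2 c * pdist M (U n) V" for n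
    proof -
      have "integral\<^sup>L (distr M borel X \<Otimes>\<^sub>M \<rho> n) f = (\<integral>\<eta>. f (X \<eta>, U n \<eta>) \<partial>M)"
        unfolding indep[symmetric] by (subst integral_distr) auto
      moreover have "pdist M (\<lambda>\<eta>. (X \<eta>, U n \<eta>)) (\<lambda>\<eta>. (X \<eta>, V \<eta>)) = pdist M (U n) V"
        by (simp add: pdist_def norm_Pair)
      moreover have "\<bar>expectation (\<lambda>\<eta>. f (X \<eta>, U n \<eta>)) - expectation (\<lambda>\<eta>. f (X \<eta>, V \<eta>))\<bar>
          \<le> max 2 c * pdist M (\<lambda>\<eta>. (X \<eta>, U n \<eta>)) (\<lambda>\<eta>. (X \<eta>, V \<eta>))"
        by (rule expectation_lipschitz_pdist) (use f1 lip in \<open>auto simp: dist_norm\<close>)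
      ultimately show ?thesis by simp
    qed
    \<comment> \<open>The product law is realized on the product of \<open>M\<close> with itself.
      There only the second coordinate enters the difference of \<open>U n\<close> and
      \<open>V\<close>, so the distance is the one on \<open>M\<close>.\<close>
    have prod: "\<bar>integral\<^sup>L (distr M borel X \<Otimes>\<^sub>M \<rho> n) f - integral\<^sup>L (distr M borel X \<Otimes>\<^sub>M distr M borel V) f\<bar>
        \<le> max 2 c * pdist M (U n) V" for n
    proof -
      have "pdist (M \<Otimes>\<^sub>M M) (\<lambda>\<eta>. (X (fst \<eta>), U n (snd \<eta>))) (\<lambda>\<eta>. (X (fst \<eta>), V (snd \<eta>))) =
          (\<integral>\<eta>. min 1 (norm (U n (snd \<eta>) - V (snd \<eta>))) \<partial>(M \<Otimes>\<^sub>M M))"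
        by (simp add: pdist_def norm_Pair)
      also have "\<dots> = integral\<^sup>L (distr (M \<Otimes>\<^sub>M M) M snd) (\<lambda>\<eta>. min 1 (norm (U n \<eta> - V \<eta>)))"
        by (subst integral_distr) auto
      also have "distr (M \<Otimes>\<^sub>M M) M snd = M"
        by (rule distr_pair_snd) (rule prob_space_axioms)+
      finally have "pdist (M \<Otimes>\<^sub>M M) (\<lambda>\<eta>. (X (fst \<eta>), U n (snd \<eta>))) (\<lambda>\<eta>. (X (fst \<eta>), V (snd \<eta>))) = pdist M (U n) V"
        by (simp add: pdist_def)
      moreover have "\<bar>MM.expectation (\<lambda>\<eta>. f (X (fst \<eta>), U n (snd \<eta>))) - MM.expectation (\<lambda>\<eta>. f (X (fst \<eta>), V (snd \<eta>)))\<bar>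
          \<le> max 2 c * pdist (M \<Otimes>\<^sub>M M) (\<lambda>\<eta>. (X (fst \<eta>), U n (snd \<eta>))) (\<lambda>\<eta>. (X (fst \<eta>), V (snd \<eta>)))"
        by (rule MM.expectation_lipschitz_pdist) (use f1 lip in \<open>auto simp: dist_norm\<close>)
      ultimately show ?thesis by (simp add: pairlaw \<rho>)
    qed
    have l0: "(\<lambda>n. max 2 c * pdist M (U n) V) \<longlonglongrightarrow> 0" using tendsto_mult_right_zero[OF lim] by simp
    have "(\<lambda>n. integral\<^sup>L (distr M borel X \<Otimes>\<^sub>M \<rho> n) f - (\<integral>\<eta>. f (X \<eta>, V \<eta>) \<partial>M)) \<longlonglongrightarrow> 0"
      by (rule Lim_null_comparison[OF _ l0]) (use diag in auto)
    moreover have "(\<lambda>n. integral\<^sup>L (distr M borel X \<Otimes>\<^sub>M \<rho> n) f - integral\<^sup>L (distr M borel X \<Otimes>\<^sub>M distr M borel V) f) \<longlonglongrightarrow> 0"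
      by (rule Lim_null_comparison[OF _ l0]) (use prod in auto)
    ultimately have "(\<integral>\<eta>. f (X \<eta>, V \<eta>) \<partial>M) = integral\<^sup>L (distr M borel X \<Otimes>\<^sub>M distr M borel V) f"
      by (simp add: LIM_zero_iff LIMSEQ_unique)
    then show "integral\<^sup>L (distr M (borel \<Otimes>\<^sub>M borel) (\<lambda>\<eta>. (X \<eta>, V \<eta>))) f = integral\<^sup>L (distr M borel X \<Otimes>\<^sub>M distr M borel V) f"
      by (simp add: integral_distr)
  qed (rule sets_XV)
qed

text \<open>The two filters live on different probability spaces, so only the laws of their
  approximations can be compared.\<close>

lemma law_limit_unique:
  fixes U :: "nat \<Rightarrow> 'a \<Rightarrow> 'c::euclidean_space" and U' :: "nat \<Rightarrow> 'b \<Rightarrow> 'c"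
  assumes "prob_space M" "prob_space M'"
    and [measurable]: "\<And>n. U n \<in> borel_measurable M" "V \<in> borel_measurable M"
      "\<And>n. U' n \<in> borel_measurable M'" "V' \<in> borel_measurable M'"
    and eq: "\<And>n. distr M borel (U n) = distr M' borel (U' n)"
    and lim: "(\<lambda>n. pdist M (U n) V) \<longlonglongrightarrow> 0" "(\<lambda>n. pdist M' (U' n) V') \<longlonglongrightarrow> 0"
  shows "distr M borel V = distr M' borel V'"
proof (rule borel_measure_eqI_lipschitz)
  interpret m: prob_space M by fact
  interpret m': prob_space M' by fact
  show "prob_space (distr M borel V)" "prob_space (distr M' borel V')"
    by (auto intro: m.prob_space_distr m'.prob_space_distr)
  fix f :: "'c \<Rightarrow> real" and c :: real
  assume f[measurable]: "f \<in> borel_measurable borel" and f1: "\<And>x. \<bar>f x\<bar> \<le> 1"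
    and lip: "\<And>x y. \<bar>f x - f y\<bar> \<le> c * dist x y" and c: "0 \<le> c"
  have 1: "(\<lambda>n. max 2 c * pdist M (U n) V) \<longlonglongrightarrow> 0" "(\<lambda>n. max 2 c * pdist M' (U' n) V') \<longlonglongrightarrow> 0"
    using tendsto_mult_right_zero[OF lim(1)] tendsto_mult_right_zero[OF lim(2)] by simp_all
  have "(\<lambda>n. m.expectation (\<lambda>\<eta>. f (U n \<eta>)) - m.expectation (\<lambda>\<eta>. f (V \<eta>))) \<longlonglongrightarrow> 0"
    by (rule Lim_null_comparison[OF _ 1(1)])
      (use f1 lip in \<open>auto intro!: always_eventually m.expectation_lipschitz_pdist simp: dist_norm\<close>)
  moreover have "(\<lambda>n. m'.expectation (\<lambda>\<eta>. f (U' n \<eta>)) - m'.expectation (\<lambda>\<eta>. f (V' \<eta>))) \<longlonglongrightarrow> 0"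
    by (rule Lim_null_comparison[OF _ 1(2)])
      (use f1 lip in \<open>auto intro!: always_eventually m'.expectation_lipschitz_pdist simp: dist_norm\<close>)
  moreover have "m.expectation (\<lambda>\<eta>. f (U n \<eta>)) = m'.expectation (\<lambda>\<eta>. f (U' n \<eta>))" for n
    using arg_cong[OF eq[of n], of "\<lambda>\<mu>. integral\<^sup>L \<mu> f"] by (simp add: integral_distr)
  ultimately have "m.expectation (\<lambda>\<eta>. f (V \<eta>)) = m'.expectation (\<lambda>\<eta>. f (V' \<eta>))"
    by (simp add: LIM_zero_iff LIMSEQ_unique)
  then show "integral\<^sup>L (distr M borel V) f = integral\<^sup>L (distr M' borel V') f" by (simp add: integral_distr)
qed auto

section \<open>Weighted sums of Brownian increments\<close>

lemma borel_measurable_matrix_vector [measurable (raw)]: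
  fixes A :: "real^'n^'m"
  assumes "f \<in> borel_measurable M" shows "(\<lambda>x. A *v f x) \<in> borel_measurable M"
  using measurable_compose[OF assms, of "(*v) A" borel] gaussian_map_measurable[of 0 A] by simp

lemma pos_semidef_scaled_identity: "0 \<le> c \<Longrightarrow> pos_semidef (c *\<^sub>R mat 1)"
  by (simp add: pos_semidef_def transpose_scalar scaleR_matrix_vector_assoc[symmetric])

lemma (in prob_space) second_moment_orthogonal_sum:
  fixes f :: "'i \<Rightarrow> 'a \<Rightarrow> real"
  assumes "finite I" and i: "\<And>i j. i \<in> I \<Longrightarrow> j \<in> I \<Longrightarrow> integrable M (\<lambda>\<eta>. f i \<eta> * f j \<eta>)"
    and o: "\<And>i j. i \<in> I \<Longrightarrow> j \<in> I \<Longrightarrow> i \<noteq> j \<Longrightarrow> expectation (\<lambda>\<eta>. f i \<eta> * f j \<eta>) = 0"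
  shows "integrable M (\<lambda>\<eta>. (\<Sum>i\<in>I. f i \<eta>)\<^sup>2)"
    "expectation (\<lambda>\<eta>. (\<Sum>i\<in>I. f i \<eta>)\<^sup>2) = (\<Sum>i\<in>I. expectation (\<lambda>\<eta>. (f i \<eta>)\<^sup>2))"
proof -
  have eq: "(\<Sum>i\<in>I. f i \<eta>)\<^sup>2 = (\<Sum>i\<in>I. \<Sum>j\<in>I. f i \<eta> * f j \<eta>)" for \<eta>
    by (simp add: power2_eq_square sum_product)
  show "integrable M (\<lambda>\<eta>. (\<Sum>i\<in>I. f i \<eta>)\<^sup>2)"
    unfolding eq by (intro Bochner_Integration.integrable_sum i)
  have "expectation (\<lambda>\<eta>. (\<Sum>i\<in>I. f i \<eta>)\<^sup>2) = (\<Sum>i\<in>I. \<Sum>j\<in>I. expectation (\<lambda>\<eta>. f i \<eta> * f j \<eta>))"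
    unfolding eq by (subst Bochner_Integration.integral_sum, auto intro!: Bochner_Integration.integrable_sum i sum.cong)
      (subst Bochner_Integration.integral_sum, auto intro!: i)
  also have "\<dots> = (\<Sum>i\<in>I. \<Sum>j\<in>I. if j = i then expectation (\<lambda>\<eta>. f i \<eta> * f i \<eta>) else 0)"
    using o by (intro sum.cong refl) auto
  also have "\<dots> = (\<Sum>i\<in>I. expectation (\<lambda>\<eta>. (f i \<eta>)\<^sup>2))"
    using \<open>finite I\<close> by (simp add: power2_eq_square)
  finally show "expectation (\<lambda>\<eta>. (\<Sum>i\<in>I. f i \<eta>)\<^sup>2) = (\<Sum>i\<in>I. expectation (\<lambda>\<eta>. (f i \<eta>)\<^sup>2))" .
qed

section \<open>Independence and joint laws of Brownian increments on a grid\<close>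

lemma space_gen_algebra [simp]: "space (gen_algebra M T Y) = space M"
  by (simp add: gen_algebra_def space_measure_of_conv)

lemma sets_gen_algebra: "sets (gen_algebra M T Y) = sigma_sets (space M) (\<Union>t\<in>T. {Y t -` A \<inter> space M | A. A \<in> sets borel})"
  unfolding gen_algebra_def by (rule sets_measure_of) auto

lemma measurable_gen_algebra: "t \<in> T \<Longrightarrow> Y t \<in> borel_measurable (gen_algebra M T Y)"
  by (rule measurableI) (auto simp: sets_gen_algebra)

definition noise_sum :: "(real \<Rightarrow> 'p \<Rightarrow> real^'d) \<Rightarrow> (real \<Rightarrow> 'p \<Rightarrow> real^'k) \<Rightarrow> nat \<Rightarrow> real \<Rightarrow>
    (nat \<Rightarrow> real^'d^'n) \<Rightarrow> (nat \<Rightarrow> real^'k^'n) \<Rightarrow> 'p \<Rightarrow> real^'n" where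
  "noise_sum B W N t P R \<eta> = (\<Sum>j<N. P j *v (B (real (Suc j) * t / real N) \<eta> - B (real j * t / real N) \<eta>)
      + R j *v (W (real (Suc j) * t / real N) \<eta> - W (real j * t / real N) \<eta>))"

text \<open>A description of the law of a shifted \<open>noise_sum\<close> by its coefficients
  alone. Since no probability space enters it, equal coefficients give equal laws for two different
  filters.\<close>

definition noise_law :: "nat \<Rightarrow> real \<Rightarrow> (nat \<Rightarrow> real^'d^'n) \<Rightarrow> (nat \<Rightarrow> real^'k^'n) \<Rightarrow> real^'n \<Rightarrow> (real^'n) measure" where
  "noise_law N t P R c = distr (PiM {..<N} (\<lambda>_. gaussian 0 ((t / real N) *\<^sub>R mat 1))
        \<Otimes>\<^sub>M PiM {..<N} (\<lambda>_. gaussian 0 ((t / real N) *\<^sub>R mat 1))) borel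
      (\<lambda>(b, w). (\<Sum>j<N. P j *v b j + R j *v w j) + c)"

text \<open>The increments on the grid as one element of a product space; the restriction makes the
  function extensional, as \<open>PiM\<close> demands.\<close>

definition increments :: "(real \<Rightarrow> 'p \<Rightarrow> 'b::real_vector) \<Rightarrow> nat \<Rightarrow> real \<Rightarrow> 'p \<Rightarrow> nat \<Rightarrow> 'b" where
  "increments B' N t \<eta> = (\<lambda>j\<in>{..<N}. B' (real (Suc j) * t / real N) \<eta> - B' (real j * t / real N) \<eta>)"

locale brownian_noise = prob_space M for M :: "'p measure" +
  fixes X0 :: "'p \<Rightarrow> real^'d" and B :: "real \<Rightarrow> 'p \<Rightarrow> real^'d" and W :: "real \<Rightarrow> 'p \<Rightarrow> real^'k"
  assumes X0 [measurable]: "X0 \<in> borel_measurable M"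
    and B: "brownian_motion M B" and W: "brownian_motion M W"
    and independent: "indep3 M (gen_algebra M {0} (\<lambda>_. X0)) (gen_algebra M {0..} B) (gen_algebra M {0..} W)"

context prob_space begin

lemma brownian_measurable: "brownian_motion M B \<Longrightarrow> 0 \<le> t \<Longrightarrow> B t \<in> borel_measurable M"
  by (auto simp: brownian_motion_def continuous_process_def)

lemma brownian_increment_moments:
  fixes B :: "real \<Rightarrow> 'a \<Rightarrow> real^'n"
  assumes B: "brownian_motion M B" and st: "0 \<le> s" "s \<le> t"
  shows "integrable M (\<lambda>\<eta>. a \<bullet> (B t \<eta> - B s \<eta>))" "expectation (\<lambda>\<eta>. a \<bullet> (B t \<eta> - B s \<eta>)) = 0"
    "integrable M (\<lambda>\<eta>. (a \<bullet> (B t \<eta> - B s \<eta>)) * (b \<bullet> (B t \<eta> - B s \<eta>)))"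
    "expectation (\<lambda>\<eta>. (a \<bullet> (B t \<eta> - B s \<eta>)) * (b \<bullet> (B t \<eta> - B s \<eta>))) = (t - s) * (a \<bullet> b)"
proof -
  have [measurable]: "B t \<in> borel_measurable M" "B s \<in> borel_measurable M" using B st by (auto intro: brownian_measurable)
  have d: "distr M borel (\<lambda>\<omega>. B t \<omega> - B s \<omega>) = gaussian 0 ((t - s) *\<^sub>R mat 1)"
    using B st by (simp add: brownian_motion_def)
  note G = gaussian_moments[OF pos_semidef_scaled_identity[of "t - s"], where m = 0]
  have meas: "(\<lambda>\<omega>. B t \<omega> - B s \<omega>) \<in> borel_measurable M" by measurable
  show "integrable M (\<lambda>\<eta>. a \<bullet> (B t \<eta> - B s \<eta>))"
    using G(1)[of a] st by (simp add: d[symmetric] integrable_distr_eq)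
  show "expectation (\<lambda>\<eta>. a \<bullet> (B t \<eta> - B s \<eta>)) = 0"
    using G(2)[of a] st by (simp add: d[symmetric] integral_distr)
  show "integrable M (\<lambda>\<eta>. (a \<bullet> (B t \<eta> - B s \<eta>)) * (b \<bullet> (B t \<eta> - B s \<eta>)))"
    using G(3)[of a b] st by (simp add: d[symmetric] integrable_distr_eq)
  show "expectation (\<lambda>\<eta>. (a \<bullet> (B t \<eta> - B s \<eta>)) * (b \<bullet> (B t \<eta> - B s \<eta>))) = (t - s) * (a \<bullet> b)"
    using G(4)[of a b] st by (simp add: d[symmetric] integral_distr scaleR_matrix_vector_assoc[symmetric])
qed

lemma brownian_increments_grid:
  assumes B: "brownian_motion M B" and t: "0 \<le> t"
  shows "indep_vars (\<lambda>_. borel) (\<lambda>j \<eta>. B (real (Suc j) * t / real N) \<eta> - B (real j * t / real N) \<eta>) {..<N}"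
proof -
  let ?\<tau> = "\<lambda>j. real j * t / real N"
  have "\<forall>(n::nat) \<tau>. 0 \<le> \<tau> 0 \<longrightarrow> (\<forall>i<n. \<tau> i \<le> \<tau> (Suc i)) \<longrightarrow>
      indep_vars (\<lambda>_. borel) (\<lambda>i \<omega>. B (\<tau> (Suc i)) \<omega> - B (\<tau> i) \<omega>) {..<n}"
    using B by (simp add: brownian_motion_def)
  then have "0 \<le> ?\<tau> 0 \<longrightarrow> (\<forall>i<N. ?\<tau> i \<le> ?\<tau> (Suc i)) \<longrightarrow>
      indep_vars (\<lambda>_. borel) (\<lambda>i \<omega>. B (?\<tau> (Suc i)) \<omega> - B (?\<tau> i) \<omega>) {..<N}"
    by (drule_tac x = N in spec) (drule_tac x = ?\<tau> in spec)
  moreover have "\<forall>i<N. ?\<tau> i \<le> ?\<tau> (Suc i)"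
    using t by (auto intro!: divide_right_mono mult_right_mono simp del: of_nat_Suc)
  ultimately show ?thesis by (simp del: of_nat_Suc)
qed

lemma brownian_grid_law:
  fixes B :: "real \<Rightarrow> 'a \<Rightarrow> real^'n"
  assumes B: "brownian_motion M B" and t: "0 \<le> t" and N: "0 < N"
  shows "distr M (PiM {..<N} (\<lambda>_. borel)) (\<lambda>\<eta>. \<lambda>j\<in>{..<N}. B (real (Suc j) * t / real N) \<eta> - B (real j * t / real N) \<eta>)
      = PiM {..<N} (\<lambda>_. gaussian 0 ((t / real N) *\<^sub>R mat 1))"
proof -
  let ?X = "\<lambda>j \<eta>. B (real (Suc j) * t / real N) \<eta> - B (real j * t / real N) \<eta>"
  have m: "?X j \<in> borel_measurable M" for j
    using t by (intro borel_measurable_diff brownian_measurable[OF B]) auto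
  have "distr M (PiM {..<N} (\<lambda>_. borel)) (\<lambda>\<eta>. \<lambda>j\<in>{..<N}. ?X j \<eta>) = PiM {..<N} (\<lambda>j. distr M borel (?X j))"
    using brownian_increments_grid[OF B t, of N] N m by (subst (asm) indep_vars_iff_distr_eq_PiM) auto
  also have "\<dots> = PiM {..<N} (\<lambda>_. gaussian 0 ((t / real N) *\<^sub>R mat 1))"
  proof (intro PiM_cong refl)
    fix j assume "j \<in> {..<N}"
    have "distr M borel (?X j) = gaussian 0 ((real (Suc j) * t / real N - real j * t / real N) *\<^sub>R mat 1)"
    proof -
      have inc: "\<forall>s\<ge>0. \<forall>t\<ge>s. distr M borel (\<lambda>\<omega>. B t \<omega> - B s \<omega>) = gaussian 0 ((t - s) *\<^sub>R mat 1)"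
        using B by (simp add: brownian_motion_def)
      have "0 \<le> real j * t / real N" "real j * t / real N \<le> real (Suc j) * t / real N"
        using t by (auto intro!: divide_right_mono mult_right_mono)
      then show ?thesis by (rule inc[rule_format])
    qed
    also have "real (Suc j) * t / real N - real j * t / real N = t / real N"
      by (simp add: diff_divide_distrib[symmetric] algebra_simps)
    finally show "distr M borel (?X j) = gaussian 0 ((t / real N) *\<^sub>R mat 1)" .
  qed
  finally show ?thesis .
qed

lemma brownian_increments_uncorrelated:
  fixes B :: "real \<Rightarrow> 'a \<Rightarrow> real^'n"
  assumes B: "brownian_motion M B" and t: "0 \<le> t" and ij: "i < N" "j < N" "i \<noteq> j"
  defines "X \<equiv> \<lambda>j \<eta>. B (real (Suc j) * t / real N) \<eta> - B (real j * t / real N) \<eta>"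
  shows "integrable M (\<lambda>\<eta>. (a \<bullet> X i \<eta>) * (b \<bullet> X j \<eta>))" "expectation (\<lambda>\<eta>. (a \<bullet> X i \<eta>) * (b \<bullet> X j \<eta>)) = 0"
proof -
  let ?f = "\<lambda>k \<eta>. (if k = i then a else b) \<bullet> X k \<eta>"
  have iv: "indep_vars (\<lambda>_. borel) ?f {i, j}"
  proof (rule indep_vars_compose2[where M' = "\<lambda>_. borel" and X = X and Y = "\<lambda>k x. (if k = i then a else b) \<bullet> x"])
    show "indep_vars (\<lambda>_. borel) X {i, j}"
      unfolding X_def by (rule indep_vars_subset[OF brownian_increments_grid[OF B t, of N]]) (use ij in auto)
  qed simp
  have int: "integrable M (\<lambda>\<eta>. c \<bullet> X k \<eta>)" "expectation (\<lambda>\<eta>. c \<bullet> X k \<eta>) = 0" for c k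
    unfolding X_def using t
    by (intro brownian_increment_moments[OF B]; auto intro!: divide_right_mono mult_right_mono)+
  show "integrable M (\<lambda>\<eta>. (a \<bullet> X i \<eta>) * (b \<bullet> X j \<eta>))"
    using indep_vars_integrable[OF _ iv] int(1) ij(3) by (auto cong: if_cong)
  show "expectation (\<lambda>\<eta>. (a \<bullet> X i \<eta>) * (b \<bullet> X j \<eta>)) = 0"
    using indep_vars_lebesgue_integral[OF _ iv] int ij(3) by (auto cong: if_cong)
qed

end

context brownian_noise begin

lemma independent_BW:
  assumes "a \<in> sets (gen_algebra M {0..} B)" "b \<in> sets (gen_algebra M {0..} W)"
  shows "prob (a \<inter> b) = prob a * prob b"
proof -
  have "prob (\<Inter>j\<in>{1,2::nat}. if j = 1 then a else b) = (\<Prod>j\<in>{1,2::nat}. prob (if j = 1 then a else b))"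
    using independent unfolding indep3_def by (rule indep_setsD) (use assms in auto)
  then show ?thesis by (simp add: Int_commute)
qed

text \<open>The three independent algebras are regrouped into the blocks \<open>{0}\<close> and
  \<open>{1,2}\<close>, which gives independence of \<open>X0\<close> from events that mix both
  Brownian motions.\<close>

lemma independent_X0_BW:
  assumes "a \<in> sets borel"
    and "b \<in> sigma_sets (space M) (sets (gen_algebra M {0..} B) \<union> sets (gen_algebra M {0..} W))"
  shows "prob ((X0 -` a \<inter> space M) \<inter> b) = prob (X0 -` a \<inter> space M) * prob b"
proof -
  let ?G = "\<lambda>i::nat. sets ([gen_algebra M {0} (\<lambda>_. X0), gen_algebra M {0..} B, gen_algebra M {0..} W] ! i)"
  let ?I = "\<lambda>j::nat. if j = 0 then {0} else {1,2::nat}"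
  have U: "(\<Union>j\<in>{0,1}. ?I j) = {..<3}" by auto
  have "indep_sets (\<lambda>j. sigma_sets (space M) (\<Union>i\<in>?I j. ?G i)) {0,1::nat}"
  proof (rule indep_sets_collect_sigma)
    show "indep_sets ?G (\<Union>j\<in>{0,1}. ?I j)" using independent unfolding U indep3_def .
    show "Int_stable (?G i)" for i by (rule sets.Int_stable)
    show "disjoint_family_on ?I {0,1}" by (auto simp: disjoint_family_on_def)
  qed
  then have "prob (\<Inter>j\<in>{0,1::nat}. if j = 0 then X0 -` a \<inter> space M else b)
      = (\<Prod>j\<in>{0,1::nat}. prob (if j = 0 then X0 -` a \<inter> space M else b))"
  proof (rule indep_setsD)
    have "X0 -` a \<inter> space M \<in> sets (gen_algebra M {0} (\<lambda>_. X0))"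
      using assms(1) by (auto simp: sets_gen_algebra)
    then show "\<forall>j\<in>{0,1}. (if j = 0 then X0 -` a \<inter> space M else b) \<in> sigma_sets (space M) (\<Union>i\<in>?I j. ?G i)"
      using assms(2) by auto
  qed auto
  then show ?thesis by (simp add: Int_commute)
qed

lemma increments_measurable_gen:
  fixes B' :: "real \<Rightarrow> 'p \<Rightarrow> real^'n"
  assumes "0 \<le> t" shows "increments B' N t \<in> gen_algebra M {0..} B' \<rightarrow>\<^sub>M PiM {..<N} (\<lambda>_. borel)"
  unfolding increments_def using assms
  by (intro measurable_restrict borel_measurable_diff measurable_gen_algebra) auto

lemma increments_measurable:
  fixes B' :: "real \<Rightarrow> 'p \<Rightarrow> real^'n"
  assumes "brownian_motion M B'" "0 \<le> t" shows "increments B' N t \<in> M \<rightarrow>\<^sub>M PiM {..<N} (\<lambda>_. borel)"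
  unfolding increments_def using assms
  by (intro measurable_restrict borel_measurable_diff brownian_measurable) auto

text \<open>The product is assembled in two stages, first the two Brownian grids with each other,
  then \<open>X0\<close> with the pair, each time by checking rectangles.\<close>

lemma joint_increment_law:
  assumes t: "0 \<le> t" and N: "0 < N"
  shows "distr M (borel \<Otimes>\<^sub>M (PiM {..<N} (\<lambda>_. borel) \<Otimes>\<^sub>M PiM {..<N} (\<lambda>_. borel)))
       (\<lambda>\<eta>. (X0 \<eta>, increments B N t \<eta>, increments W N t \<eta>)) =
     distr M borel X0 \<Otimes>\<^sub>M (PiM {..<N} (\<lambda>_. gaussian 0 ((t / real N) *\<^sub>R mat 1))
        \<Otimes>\<^sub>M PiM {..<N} (\<lambda>_. gaussian 0 ((t / real N) *\<^sub>R mat 1)))"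
proof -
  let ?PB = "PiM {..<N} (\<lambda>_. borel) :: (nat \<Rightarrow> real^'d) measure"
  let ?PW = "PiM {..<N} (\<lambda>_. borel) :: (nat \<Rightarrow> real^'k) measure"
  define b where "b = increments B N t"
  define w where "w = increments W N t"
  have [measurable]: "b \<in> M \<rightarrow>\<^sub>M ?PB" "w \<in> M \<rightarrow>\<^sub>M ?PW"
    unfolding b_def w_def by (intro increments_measurable B W t)+
  interpret b: prob_space "distr M ?PB b" by (rule prob_space_distr) simp
  interpret w: prob_space "distr M ?PW w" by (rule prob_space_distr) simp
  interpret x: prob_space "distr M borel X0" by (rule prob_space_distr) simp
  interpret bw: prob_space "distr M (?PB \<Otimes>\<^sub>M ?PW) (\<lambda>\<eta>. (b \<eta>, w \<eta>))" by (rule prob_space_distr) simp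
  have bl: "distr M ?PB b = PiM {..<N} (\<lambda>_. gaussian 0 ((t / real N) *\<^sub>R mat 1))"
    "distr M ?PW w = PiM {..<N} (\<lambda>_. gaussian 0 ((t / real N) *\<^sub>R mat 1))"
    unfolding b_def w_def increments_def by (intro brownian_grid_law B W t N)+
  have 1: "distr M ?PB b \<Otimes>\<^sub>M distr M ?PW w = distr M (?PB \<Otimes>\<^sub>M ?PW) (\<lambda>\<eta>. (b \<eta>, w \<eta>))"
  proof (rule pair_measure_eqI)
    show "sigma_finite_measure (distr M ?PB b)" "sigma_finite_measure (distr M ?PW w)" by standard+
    fix D E assume "D \<in> sets (distr M ?PB b)" "E \<in> sets (distr M ?PW w)"
    then have [measurable]: "D \<in> sets ?PB" "E \<in> sets ?PW" by auto
    have "b -` D \<inter> space M \<in> sets (gen_algebra M {0..} B)" "w -` E \<inter> space M \<in> sets (gen_algebra M {0..} W)"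
      using measurable_sets[OF increments_measurable_gen[OF t, of B N] \<open>D \<in> sets ?PB\<close>]
        measurable_sets[OF increments_measurable_gen[OF t, of W N] \<open>E \<in> sets ?PW\<close>] by (auto simp: b_def w_def)
    note independent_BW[OF this]
    also have "(b -` D \<inter> space M) \<inter> (w -` E \<inter> space M) = (\<lambda>\<eta>. (b \<eta>, w \<eta>)) -` (D \<times> E) \<inter> space M" by auto
    finally show "emeasure (distr M ?PB b) D * emeasure (distr M ?PW w) E
        = emeasure (distr M (?PB \<Otimes>\<^sub>M ?PW) (\<lambda>\<eta>. (b \<eta>, w \<eta>))) (D \<times> E)"
      by (simp add: emeasure_distr emeasure_eq_measure ennreal_mult)
  qed simp
  have 2: "distr M borel X0 \<Otimes>\<^sub>M distr M (?PB \<Otimes>\<^sub>M ?PW) (\<lambda>\<eta>. (b \<eta>, w \<eta>))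
      = distr M (borel \<Otimes>\<^sub>M (?PB \<Otimes>\<^sub>M ?PW)) (\<lambda>\<eta>. (X0 \<eta>, b \<eta>, w \<eta>))"
  proof (rule pair_measure_eqI)
    show "sigma_finite_measure (distr M borel X0)"
      "sigma_finite_measure (distr M (?PB \<Otimes>\<^sub>M ?PW) (\<lambda>\<eta>. (b \<eta>, w \<eta>)))" by standard+
    fix D E assume "D \<in> sets (distr M borel X0)" "E \<in> sets (distr M (?PB \<Otimes>\<^sub>M ?PW) (\<lambda>\<eta>. (b \<eta>, w \<eta>)))"
    then have [measurable]: "D \<in> sets borel" and E [measurable]: "E \<in> sets (?PB \<Otimes>\<^sub>M ?PW)" by auto
    define S where "S = sigma (space M) (sets (gen_algebra M {0..} B) \<union> sets (gen_algebra M {0..} W))"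
    have P: "sets (gen_algebra M {0..} B) \<union> sets (gen_algebra M {0..} W) \<subseteq> Pow (space M)"
      using sets.space_closed[of "gen_algebra M {0..} B"] sets.space_closed[of "gen_algebra M {0..} W"] by auto
    have S: "space S = space M" "sets S = sigma_sets (space M) (sets (gen_algebra M {0..} B) \<union> sets (gen_algebra M {0..} W))"
      unfolding S_def using P by (auto simp: space_measure_of_conv intro!: sets_measure_of)
    have "b \<in> S \<rightarrow>\<^sub>M ?PB"
      by (rule measurable_mono[THEN subsetD, of ?PB ?PB "gen_algebra M {0..} B" S, OF order_refl refl _ _])
        (use increments_measurable_gen[OF t, of B N] in \<open>auto simp: S b_def\<close>)
    moreover have "w \<in> S \<rightarrow>\<^sub>M ?PW"
      by (rule measurable_mono[THEN subsetD, of ?PW ?PW "gen_algebra M {0..} W" S, OF order_refl refl _ _])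
        (use increments_measurable_gen[OF t, of W N] in \<open>auto simp: S w_def\<close>)
    ultimately have "(\<lambda>\<eta>. (b \<eta>, w \<eta>)) \<in> S \<rightarrow>\<^sub>M (?PB \<Otimes>\<^sub>M ?PW)" by measurable
    from measurable_sets[OF this E]
    have "(\<lambda>\<eta>. (b \<eta>, w \<eta>)) -` E \<inter> space M \<in> sigma_sets (space M) (sets (gen_algebra M {0..} B) \<union> sets (gen_algebra M {0..} W))"
      by (simp add: S)
    note independent_X0_BW[OF \<open>D \<in> sets borel\<close> this]
    also have "(X0 -` D \<inter> space M) \<inter> ((\<lambda>\<eta>. (b \<eta>, w \<eta>)) -` E \<inter> space M) = (\<lambda>\<eta>. (X0 \<eta>, b \<eta>, w \<eta>)) -` (D \<times> E) \<inter> space M" by auto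
    finally show "emeasure (distr M borel X0) D * emeasure (distr M (?PB \<Otimes>\<^sub>M ?PW) (\<lambda>\<eta>. (b \<eta>, w \<eta>))) E
        = emeasure (distr M (borel \<Otimes>\<^sub>M (?PB \<Otimes>\<^sub>M ?PW)) (\<lambda>\<eta>. (X0 \<eta>, b \<eta>, w \<eta>))) (D \<times> E)"
      by (simp add: emeasure_distr emeasure_eq_measure ennreal_mult)
  qed simp
  show ?thesis using 2 unfolding 1[symmetric] bl by (simp add: b_def w_def)
qed

lemma noise_sum_measurable [measurable]:
  assumes "0 \<le> t" shows "noise_sum B W N t P R \<in> borel_measurable M"
  unfolding noise_sum_def
  by (intro borel_measurable_sum borel_measurable_add borel_measurable_matrix_vector borel_measurable_diff
      brownian_measurable[OF B] brownian_measurable[OF W]) (use assms in auto)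

lemma noise_sum_law:
  fixes P :: "nat \<Rightarrow> real^'d^'n" and R :: "nat \<Rightarrow> real^'k^'n"
  assumes t: "0 \<le> t" and N: "0 < N"
  shows "distr M (borel \<Otimes>\<^sub>M borel) (\<lambda>\<eta>. (X0 \<eta>, noise_sum B W N t P R \<eta> + c)) = distr M borel X0 \<Otimes>\<^sub>M noise_law N t P R c"
    "distr M borel (\<lambda>\<eta>. noise_sum B W N t P R \<eta> + c) = noise_law N t P R c"
proof -
  let ?GB = "PiM {..<N} (\<lambda>_. gaussian 0 ((t / real N) *\<^sub>R mat 1)) :: (nat \<Rightarrow> real^'d) measure"
  let ?GW = "PiM {..<N} (\<lambda>_. gaussian 0 ((t / real N) *\<^sub>R mat 1)) :: (nat \<Rightarrow> real^'k) measure"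
  let ?PB = "PiM {..<N} (\<lambda>_. borel) :: (nat \<Rightarrow> real^'d) measure"
  let ?PW = "PiM {..<N} (\<lambda>_. borel) :: (nat \<Rightarrow> real^'k) measure"
  let ?f = "\<lambda>(b, w). (\<Sum>j<N. P j *v b j + R j *v w j) + c"
  have [measurable]: "?f \<in> borel_measurable (?PB \<Otimes>\<^sub>M ?PW)" by measurable
  have sG: "sets (?GB \<Otimes>\<^sub>M ?GW) = sets (?PB \<Otimes>\<^sub>M ?PW)"
    by (intro sets_pair_measure_cong sets_PiM_cong) simp_all
  have [measurable]: "?f \<in> borel_measurable (?GB \<Otimes>\<^sub>M ?GW)"
    by (subst measurable_cong_sets[OF sG refl]) measurable
  have [measurable]: "increments B N t \<in> M \<rightarrow>\<^sub>M ?PB" "increments W N t \<in> M \<rightarrow>\<^sub>M ?PW"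
    by (intro increments_measurable B W t)+
  interpret gb: product_prob_space "\<lambda>_::nat. gaussian 0 ((t / real N) *\<^sub>R mat 1) :: (real^'d) measure" "{..<N}"
    by (intro product_prob_spaceI prob_space_gaussian)
  interpret gw: product_prob_space "\<lambda>_::nat. gaussian 0 ((t / real N) *\<^sub>R mat 1) :: (real^'k) measure" "{..<N}"
    by (intro product_prob_spaceI prob_space_gaussian)
  interpret gbw: pair_prob_space ?GB ?GW ..
  interpret x: prob_space "distr M borel X0" by (rule prob_space_distr) simp
  interpret law: prob_space "noise_law N t P R c"
    unfolding noise_law_def by (rule gbw.prob_space_distr) simp
  have ns: "noise_sum B W N t P R \<eta> + c = ?f (increments B N t \<eta>, increments W N t \<eta>)" for \<eta>
    by (simp add: noise_sum_def increments_def)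
  have "distr M (borel \<Otimes>\<^sub>M borel) (\<lambda>\<eta>. (X0 \<eta>, noise_sum B W N t P R \<eta> + c))
     = distr (distr M (borel \<Otimes>\<^sub>M (?PB \<Otimes>\<^sub>M ?PW)) (\<lambda>\<eta>. (X0 \<eta>, increments B N t \<eta>, increments W N t \<eta>)))
        (borel \<Otimes>\<^sub>M borel) (\<lambda>(x, y). (x, ?f y))"
    by (subst distr_distr) (auto simp: ns o_def)
  also have "\<dots> = distr (distr M borel X0 \<Otimes>\<^sub>M (?GB \<Otimes>\<^sub>M ?GW)) (borel \<Otimes>\<^sub>M borel) (\<lambda>(x, y). (x, ?f y))"
    by (simp add: joint_increment_law[OF t N])
  also have "\<dots> = distr (distr M borel X0) borel (\<lambda>x. x) \<Otimes>\<^sub>M distr (?GB \<Otimes>\<^sub>M ?GW) borel ?f"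
    by (rule pair_measure_distr[symmetric])
      (use law.sigma_finite_measure_axioms in \<open>auto simp: noise_law_def\<close>)
  also have "\<dots> = distr M borel X0 \<Otimes>\<^sub>M noise_law N t P R c"
    by (simp add: noise_law_def distr_distr o_def)
  finally show 1: "distr M (borel \<Otimes>\<^sub>M borel) (\<lambda>\<eta>. (X0 \<eta>, noise_sum B W N t P R \<eta> + c)) = distr M borel X0 \<Otimes>\<^sub>M noise_law N t P R c" .
  have [measurable]: "noise_sum B W N t P R \<in> borel_measurable M" by (rule noise_sum_measurable[OF t])
  have "distr M borel (\<lambda>\<eta>. noise_sum B W N t P R \<eta> + c) = 
      distr (distr M (borel \<Otimes>\<^sub>M borel) (\<lambda>\<eta>. (X0 \<eta>, noise_sum B W N t P R \<eta> + c))) borel snd"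
    by (subst distr_distr) (auto simp: o_def)
  also have "\<dots> = distr (distr M borel X0 \<Otimes>\<^sub>M noise_law N t P R c) (noise_law N t P R c) snd"
    unfolding 1 by (intro distr_cong) (simp_all add: noise_law_def)
  also have "\<dots> = noise_law N t P R c"
    by (rule distr_pair_snd) (rule x.prob_space_axioms law.prob_space_axioms)+
  finally show "distr M borel (\<lambda>\<eta>. noise_sum B W N t P R \<eta> + c) = noise_law N t P R c" .
qed

text \<open>Increments of the two motions are measurable with respect to independent algebras, so
  the expectation factors and one factor is zero.\<close>

lemma brownian_cross_uncorrelated:
  assumes "0 \<le> s" "s \<le> t" "0 \<le> s'" "s' \<le> t'"
  shows "integrable M (\<lambda>\<eta>. (a \<bullet> (B t \<eta> - B s \<eta>)) * (b \<bullet> (W t' \<eta> - W s' \<eta>)))"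
    "expectation (\<lambda>\<eta>. (a \<bullet> (B t \<eta> - B s \<eta>)) * (b \<bullet> (W t' \<eta> - W s' \<eta>))) = 0"
proof -
  let ?f = "\<lambda>\<eta>. a \<bullet> (B t \<eta> - B s \<eta>)" and ?g = "\<lambda>\<eta>. b \<bullet> (W t' \<eta> - W s' \<eta>)"
  have f: "?f \<in> borel_measurable (gen_algebra M {0..} B)" and g: "?g \<in> borel_measurable (gen_algebra M {0..} W)"
    using assms by (intro borel_measurable_inner borel_measurable_diff measurable_gen_algebra; simp)+
  have int: "integrable M ?f" "integrable M ?g" "expectation ?f = 0"
    using assms by (auto intro: brownian_increment_moments[OF B] brownian_increment_moments[OF W])
  have "indep_var borel ?f borel ?g"
    unfolding indep_var_eq
  proof (intro conjI indep_setI)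
    show "random_variable borel ?f" "random_variable borel ?g" using int by auto
    have sf: "sigma_sets (space M) {?f -` A \<inter> space M |A. A \<in> sets borel} \<subseteq> sets (gen_algebra M {0..} B)"
      using measurable_sets[OF f] by (intro sets.sigma_sets_subset[of _ "gen_algebra M {0..} B", simplified]) auto
    have sg: "sigma_sets (space M) {?g -` A \<inter> space M |A. A \<in> sets borel} \<subseteq> sets (gen_algebra M {0..} W)"
      using measurable_sets[OF g] by (intro sets.sigma_sets_subset[of _ "gen_algebra M {0..} W", simplified]) auto
    show "sigma_sets (space M) {?f -` A \<inter> space M |A. A \<in> sets borel} \<subseteq> events"
      using int(1) by (intro sets.sigma_sets_subset) (auto intro!: measurable_sets dest: borel_measurable_integrable)
    show "sigma_sets (space M) {?g -` A \<inter> space M |A. A \<in> sets borel} \<subseteq> events"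
      using int(2) by (intro sets.sigma_sets_subset) (auto intro!: measurable_sets dest: borel_measurable_integrable)
    fix c d assume "c \<in> sigma_sets (space M) {?f -` A \<inter> space M |A. A \<in> sets borel}"
      "d \<in> sigma_sets (space M) {?g -` A \<inter> space M |A. A \<in> sets borel}"
    then show "prob (c \<inter> d) = prob c * prob d" using sf sg by (intro independent_BW) auto
  qed
  from indep_var_lebesgue_integral[OF this int(1,2)] indep_var_integrable[OF this int(1,2)] int(3)
  show "integrable M (\<lambda>\<eta>. ?f \<eta> * ?g \<eta>)" "expectation (\<lambda>\<eta>. ?f \<eta> * ?g \<eta>) = 0" by simp_all
qed

lemma noise_sum_moments:
  fixes P :: "nat \<Rightarrow> real^'d^'n" and R :: "nat \<Rightarrow> real^'k^'n"
  assumes t: "0 \<le> t" and N: "0 < N"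
  shows "integrable M (\<lambda>\<eta>. v \<bullet> noise_sum B W N t P R \<eta>)" "expectation (\<lambda>\<eta>. v \<bullet> noise_sum B W N t P R \<eta>) = 0"
    "integrable M (\<lambda>\<eta>. (v \<bullet> noise_sum B W N t P R \<eta>)\<^sup>2)"
    "expectation (\<lambda>\<eta>. (v \<bullet> noise_sum B W N t P R \<eta>)\<^sup>2) =
      (t / real N) * (\<Sum>j<N. (norm (transpose (P j) *v v))\<^sup>2 + (norm (transpose (R j) *v v))\<^sup>2)"
proof -
  let ?s = "\<lambda>j. real j * t / real N"
  have s: "0 \<le> ?s j" "?s j \<le> ?s (Suc j)" for j using t by (auto intro!: divide_right_mono mult_right_mono)
  have ds: "?s (Suc j) - ?s j = t / real N" for j by (simp add: diff_divide_distrib[symmetric] algebra_simps)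
  \<comment> \<open>Indexing by a grid cell and a flag for the motion turns all increments into a
    single orthogonal family, to which Pythagoras applies.\<close>
  define f where "f p \<eta> = (if snd p then (transpose (P (fst p)) *v v) \<bullet> (B (?s (Suc (fst p))) \<eta> - B (?s (fst p)) \<eta>)
      else (transpose (R (fst p)) *v v) \<bullet> (W (?s (Suc (fst p))) \<eta> - W (?s (fst p)) \<eta>))" for p :: "nat \<times> bool" and \<eta>
  let ?I = "{..<N} \<times> (UNIV :: bool set)"
  have split: "(\<Sum>p\<in>?I. g p) = (\<Sum>j<N. g (j, True) + g (j, False))" for g :: "nat \<times> bool \<Rightarrow> real"
    by (subst sum.cartesian_product') (simp add: UNIV_bool add.commute)
  have eq: "v \<bullet> noise_sum B W N t P R \<eta> = (\<Sum>p\<in>?I. f p \<eta>)" for \<eta>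
    unfolding split noise_sum_def f_def
    by (simp add: inner_sum_right inner_add_right inner_matrix_transpose)
  have f1: "integrable M (f p)" "expectation (f p) = 0" for p
    unfolding f_def[abs_def] using brownian_increment_moments(1,2)[OF B s] brownian_increment_moments(1,2)[OF W s]
    by (cases "snd p"; simp)+
  have f2: "integrable M (\<lambda>\<eta>. f p \<eta> * f q \<eta>)" and fo: "p \<noteq> q \<Longrightarrow> expectation (\<lambda>\<eta>. f p \<eta> * f q \<eta>) = 0"
    if "p \<in> ?I" "q \<in> ?I" for p q
  proof -
    have c: "integrable M (\<lambda>\<eta>. f p \<eta> * f q \<eta>) \<and> (p \<noteq> q \<longrightarrow> expectation (\<lambda>\<eta>. f p \<eta> * f q \<eta>) = 0)"
    proof (cases "snd p = snd q")
      case True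
      then show ?thesis
        using that brownian_increment_moments(3)[OF B s] brownian_increment_moments(3)[OF W s]
          brownian_increments_uncorrelated[OF B t, of "fst p" N "fst q"]
          brownian_increments_uncorrelated[OF W t, of "fst p" N "fst q"]
        unfolding f_def by (cases "fst p = fst q"; cases "snd q") (auto simp: prod_eq_iff)
    next
      case False
      then show ?thesis
        using brownian_cross_uncorrelated[OF s s, of "transpose (P (fst p)) *v v" "fst p" "transpose (R (fst q)) *v v" "fst q"]
          brownian_cross_uncorrelated[OF s s, of "transpose (P (fst q)) *v v" "fst q" "transpose (R (fst p)) *v v" "fst p"]
        unfolding f_def by (cases "snd p"; cases "snd q") (simp_all add: mult.commute)
    qed
    show "integrable M (\<lambda>\<eta>. f p \<eta> * f q \<eta>)" using c by blast
    show "p \<noteq> q \<Longrightarrow> expectation (\<lambda>\<eta>. f p \<eta> * f q \<eta>) = 0" using c by blast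
  qed
  show "integrable M (\<lambda>\<eta>. v \<bullet> noise_sum B W N t P R \<eta>)" unfolding eq by (intro Bochner_Integration.integrable_sum f1)
  show "expectation (\<lambda>\<eta>. v \<bullet> noise_sum B W N t P R \<eta>) = 0" unfolding eq by (simp add: f1)
  show "integrable M (\<lambda>\<eta>. (v \<bullet> noise_sum B W N t P R \<eta>)\<^sup>2)"
    unfolding eq by (rule second_moment_orthogonal_sum) (use f2 fo in auto)
  have "expectation (\<lambda>\<eta>. (v \<bullet> noise_sum B W N t P R \<eta>)\<^sup>2) = (\<Sum>p\<in>?I. expectation (\<lambda>\<eta>. (f p \<eta>)\<^sup>2))"
    unfolding eq by (rule second_moment_orthogonal_sum) (use f2 fo in auto)
  also have "\<dots> = (\<Sum>j<N. (t / real N) * ((norm (transpose (P j) *v v))\<^sup>2 + (norm (transpose (R j) *v v))\<^sup>2))"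
    unfolding split f_def
    using brownian_increment_moments(4)[OF B s] brownian_increment_moments(4)[OF W s]
    by (simp add: power2_eq_square[of "_ \<bullet> _"] ds power2_norm_eq_inner distrib_left del: of_nat_Suc)
  finally show "expectation (\<lambda>\<eta>. (v \<bullet> noise_sum B W N t P R \<eta>)\<^sup>2) =
      (t / real N) * (\<Sum>j<N. (norm (transpose (P j) *v v))\<^sup>2 + (norm (transpose (R j) *v v))\<^sup>2)"
    by (simp add: sum_distrib_left)
qed

end

section \<open>Refinement of grids and Riemann sums\<close>

lemma sum_lessThan_mult_div:
  fixes f :: "nat \<Rightarrow> 'b::comm_monoid_add"
  shows "(\<Sum>j<m * k. f j) = (\<Sum>i<m. \<Sum>j<k. f (i * k + j))"
proof -
  have "(\<Sum>j<m * k. f j) = (\<Sum>i<m. sum f {i * k..<i * k + k})" by (rule sum.nat_group[symmetric])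
  also have "\<dots> = (\<Sum>i<m. \<Sum>j<k. f (i * k + j))"
  proof (rule sum.cong[OF refl])
    fix i show "sum f {i * k..<i * k + k} = (\<Sum>j<k. f (i * k + j))"
      using sum.shift_bounds_nat_ivl[of f 0 "i * k" k] by (simp add: atLeast0LessThan add.commute)
  qed
  finally show ?thesis .
qed

lemma grid_telescope:
  fixes g :: "real \<Rightarrow> 'b::ab_group_add"
  assumes "0 < r" "0 < N"
  shows "g (real (Suc j) * t / real N) - g (real j * t / real N) =
    (\<Sum>i<r. g (real (Suc (j * r + i)) * t / real (N * r)) - g (real (j * r + i) * t / real (N * r)))"
proof -
  have "(\<Sum>i<r. g (real (Suc (j * r + i)) * t / real (N * r)) - g (real (j * r + i) * t / real (N * r))) =
     (\<Sum>i<r. (\<lambda>i. g (real (j * r + i) * t / real (N * r))) (Suc i) - (\<lambda>i. g (real (j * r + i) * t / real (N * r))) i)" by simp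
  also have "\<dots> = g (real (j * r + r) * t / real (N * r)) - g (real (j * r) * t / real (N * r))"
    by (subst sum_lessThan_telescope) simp
  also have "real (j * r + r) * t / real (N * r) = real (Suc j) * t / real N"
    using assms by (simp add: field_simps)
  also have "real (j * r) * t / real (N * r) = real j * t / real N"
    using assms by (simp add: field_simps)
  finally show ?thesis by simp
qed

text \<open>A coarse sum is a fine sum whose coefficients are constant on the coarse cells, by
  telescoping. Sums on two unrelated grids can thus be subtracted on a common refinement.\<close>

lemma noise_sum_refine:
  assumes "0 < r" "0 < N"
  shows "noise_sum B W N t P R \<eta> = noise_sum B W (N * r) t (\<lambda>j. P (j div r)) (\<lambda>j. R (j div r)) \<eta>"
proof -
  interpret b: linear "(*v) (P j)" for j by simp
  interpret w: linear "(*v) (R j)" for j by simp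
  show ?thesis
    unfolding noise_sum_def sum_lessThan_mult_div
    using assms grid_telescope[OF assms, of "\<lambda>s. B s \<eta>"] grid_telescope[OF assms, of "\<lambda>s. W s \<eta>"]
    by (simp add: sum.distrib b.sum w.sum)
qed

lemma noise_sum_diff:
  "noise_sum B W N t P R \<eta> - noise_sum B W N t P' R' \<eta> = noise_sum B W N t (\<lambda>j. P j - P' j) (\<lambda>j. R j - R' j) \<eta>"
  by (simp add: noise_sum_def sum_subtractf[symmetric] matrix_vector_mult_diff_rdistrib algebra_simps)

abbreviation grid_cell :: "real \<Rightarrow> nat \<Rightarrow> nat \<Rightarrow> real set" where
  "grid_cell t N j \<equiv> {real j * t / real N..real (Suc j) * t / real N}"

lemma grid_cell_subset:
  assumes "0 \<le> t" "j < N" shows "grid_cell t N j \<subseteq> {0..t}"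
proof -
  have "real (Suc j) * t / real N \<le> t"
  proof -
    have "real (Suc j) * t \<le> real N * t" using assms by (intro mult_right_mono) auto
    then show ?thesis using assms by (simp add: field_simps)
  qed
  moreover have "0 \<le> real j * t / real N" using assms by simp
  ultimately show ?thesis by (auto simp del: of_nat_Suc)
qed

lemma grid_le: "0 \<le> t \<Longrightarrow> real j * t / real N \<le> real (Suc j) * t / real N"
  by (intro divide_right_mono mult_right_mono) auto

lemma grid_width: "real (Suc j) * t / real N - real j * t / real N = t / real N"
  by (simp add: diff_divide_distrib[symmetric] algebra_simps)

lemma integral_grid_sum:
  fixes g :: "real \<Rightarrow> 'c::banach"
  assumes t: "0 \<le> t" and N: "0 < N" and g: "g integrable_on {0..t}"
  shows "integral {0..t} g = (\<Sum>j<N. integral (grid_cell t N j) g)"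
proof -
  have "k \<le> N \<Longrightarrow> integral {0..real k * t / real N} g = (\<Sum>j<k. integral (grid_cell t N j) g)" for k
  proof (induction k)
    case (Suc k)
    have sub: "{0..real (Suc k) * t / real N} \<subseteq> {0..t}"
      using grid_cell_subset[OF t, of k N] Suc.prems grid_le[OF t, of k N] by (auto simp del: of_nat_Suc)
    have "integral {0..real k * t / real N} g + integral (grid_cell t N k) g = integral {0..real (Suc k) * t / real N} g"
      by (rule Henstock_Kurzweil_Integration.integral_combine)
        (use t in \<open>auto intro!: grid_le integrable_on_subinterval[OF g sub] simp del: of_nat_Suc\<close>)
    with Suc show ?case by simp
  qed simp
  from this[of N] show ?thesis using N by simp
qed

text \<open>The integrand \<open>f i j\<close> may differ from cell to cell and the grid may depend
  on the index in any way; only uniform closeness to \<open>g\<close> on the cells matters.\<close>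

lemma riemann_step_tendsto:
  fixes g :: "real \<Rightarrow> 'c::banach" and f :: "'i \<Rightarrow> nat \<Rightarrow> real \<Rightarrow> 'c"
  assumes t: "0 \<le> t" and g: "continuous_on {0..t} g"
    and N: "eventually (\<lambda>i. 0 < N i) Fl"
    and f: "\<And>i j. j < N i \<Longrightarrow> f i j integrable_on grid_cell t (N i) j"
    and close: "\<And>e. 0 < e \<Longrightarrow> eventually (\<lambda>i. \<forall>j<N i. \<forall>s\<in>grid_cell t (N i) j. norm (f i j s - g s) \<le> e) Fl"
  shows "((\<lambda>i. \<Sum>j<N i. integral (grid_cell t (N i) j) (f i j)) \<longlongrightarrow> integral {0..t} g) Fl"
proof (rule tendstoI)
  fix e :: real assume e: "0 < e"
  \<comment> \<open>The total error is at most \<open>d * t\<close>; \<open>t + 1\<close> avoids a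
    division by zero at \<open>t = 0\<close> and the factor 2 makes the inequality strict.\<close>
  define d where "d = e / (t + 1) / 2"
  have d: "0 < d" using e t by (simp add: d_def)
  have gi: "g integrable_on {0..t}" by (rule integrable_continuous_real[OF g])
  show "\<forall>\<^sub>F i in Fl. dist (\<Sum>j<N i. integral (grid_cell t (N i) j) (f i j)) (integral {0..t} g) < e"
    using N close[OF d]
  proof eventually_elim
    case (elim i)
    have gj: "g integrable_on grid_cell t (N i) j" if "j < N i" for j
      by (rule integrable_on_subinterval[OF gi grid_cell_subset[OF t that]])
    have "norm ((\<Sum>j<N i. integral (grid_cell t (N i) j) (f i j)) - integral {0..t} g)
        = norm (\<Sum>j<N i. integral (grid_cell t (N i) j) (\<lambda>s. f i j s - g s))"
      by (subst integral_grid_sum[OF t elim(1) gi], subst sum_subtractf[symmetric])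
        (auto intro!: arg_cong[where f = norm] sum.cong integral_diff[symmetric] f gj simp del: of_nat_Suc)
    also have "\<dots> \<le> (\<Sum>j<N i. d * (t / real (N i)))"
    proof (rule sum_norm_le)
      fix j assume j: "j \<in> {..<N i}"
      have "norm (integral (grid_cell t (N i) j) (\<lambda>s. f i j s - g s)) \<le> integral (grid_cell t (N i) j) (\<lambda>_. d)"
        using j elim(2) by (intro integral_norm_bound_integral integrable_diff f gj) auto
      also have "\<dots> = d * (t / real (N i))"
        using grid_le[OF t, of j "N i"] grid_width[of j t "N i"] by (simp del: of_nat_Suc)
      finally show "norm (integral (grid_cell t (N i) j) (\<lambda>s. f i j s - g s)) \<le> d * (t / real (N i))" .
    qed
    also have "\<dots> = d * t" using elim(1) by simp
    also have "\<dots> < e" 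
    proof -
      have "d * t < d * (t + 1) * 2" using d t by (simp add: algebra_simps add_nonneg_pos)
      moreover have "d * (t + 1) * 2 = e" using t by (simp add: d_def field_simps)
      ultimately show ?thesis by simp
    qed
    finally show ?case by (simp add: dist_norm)
  qed
qed

lemma uniform_modulus:
  fixes p :: "real \<Rightarrow> 'a::metric_space"
  assumes "continuous_on {0..t} p" "0 < e"
  obtains d where "0 < d" "\<And>s s'. s \<in> {0..t} \<Longrightarrow> s' \<in> {0..t} \<Longrightarrow> \<bar>s - s'\<bar> < d \<Longrightarrow> dist (p s) (p s') < e"
proof -
  have "uniformly_continuous_on {0..t} p" by (intro compact_uniformly_continuous assms) auto
  then have "\<exists>d>0. \<forall>x\<in>{0..t}. \<forall>x'\<in>{0..t}. dist x' x < d \<longrightarrow> dist (p x') (p x) < e"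
    using assms(2) unfolding uniformly_continuous_on_def by blast
  then show ?thesis using that by (auto simp: dist_real_def)
qed

lemma eventually_grid_fine: "0 < d \<Longrightarrow> eventually (\<lambda>N. t / real N < d) sequentially"
proof -
  assume "0 < d"
  have "(\<lambda>N. t / real N) \<longlonglongrightarrow> 0" by (rule lim_const_over_n)
  from order_tendstoD(2)[OF this \<open>0 < d\<close>] show ?thesis .
qed

text \<open>One factor is frozen at a tag of the cell while the other is integrated exactly. Such
  mixed sums arise when a gain or a flow is frozen on a grid but a path is not.\<close>

lemma riemann_tag_tendsto:
  fixes p :: "real \<Rightarrow> 'a::euclidean_space" and q :: "real \<Rightarrow> 'b::euclidean_space" and h :: "'a \<Rightarrow> 'b \<Rightarrow> 'c::banach"
  assumes h: "bounded_bilinear h" and t: "0 \<le> t" and p: "continuous_on {0..t} p" and q: "continuous_on {0..t} q"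
    and c: "\<And>N j. j < N \<Longrightarrow> c N j \<in> grid_cell t N j"
  shows "(\<lambda>N. \<Sum>j<N. integral (grid_cell t N j) (\<lambda>s. h (p (c N j)) (q s))) \<longlonglongrightarrow> integral {0..t} (\<lambda>s. h (p s) (q s))"
proof (rule riemann_step_tendsto[OF t])
  interpret h: bounded_bilinear h by fact
  show "continuous_on {0..t} (\<lambda>s. h (p s) (q s))" by (intro h.continuous_on p q)
  show "eventually (\<lambda>N. 0 < N) sequentially" by (rule eventually_gt_at_top)
  show "(\<lambda>s. h (p (c N j)) (q s)) integrable_on grid_cell t N j" if "j < N" for N j
    by (intro integrable_continuous_real h.continuous_on continuous_on_const
        continuous_on_subset[OF q grid_cell_subset[OF t that]])
  fix e :: real assume e: "0 < e"
  obtain k where k: "0 < k" "\<And>a b. norm (h a b) \<le> norm a * norm b * k" using h.pos_bounded by blast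
  have "bounded (q ` {0..t})" by (intro compact_imp_bounded compact_continuous_image q) auto
  then obtain b where b: "0 < b" "\<And>s. s \<in> {0..t} \<Longrightarrow> norm (q s) \<le> b" by (auto simp: bounded_pos)
  obtain d where d: "0 < d" "\<And>s s'. s \<in> {0..t} \<Longrightarrow> s' \<in> {0..t} \<Longrightarrow> \<bar>s - s'\<bar> < d \<Longrightarrow> dist (p s) (p s') < e / (b * k)"
    by (rule uniform_modulus[OF p, of "e / (b * k)"]) (use e b k in auto)
  show "eventually (\<lambda>N. \<forall>j<N. \<forall>s\<in>grid_cell t N j. norm (h (p (c N j)) (q s) - h (p s) (q s)) \<le> e) sequentially"
    using eventually_grid_fine[OF d(1), of t]
  proof eventually_elim
    case (elim N)
    show ?case
    proof (intro allI impI ballI)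
      fix j s assume j: "j < N" and s: "s \<in> grid_cell t N j"
      have mem: "s \<in> {0..t}" "c N j \<in> {0..t}" using grid_cell_subset[OF t j] s c[OF j] by auto
      have "\<bar>c N j - s\<bar> \<le> t / real N" using s c[OF j] grid_width[of j t N] by (auto simp: abs_le_iff simp del: of_nat_Suc)
      then have "norm (p (c N j) - p s) \<le> e / (b * k)" using d(2)[OF mem(2,1)] elim by (simp add: dist_norm)
      moreover have "norm (h (p (c N j) - p s) (q s)) \<le> norm (p (c N j) - p s) * norm (q s) * k" by (rule k)
      moreover have "\<dots> \<le> e / (b * k) * b * k"
        using calculation(1) b(2)[OF mem(1)] b(1) k(1) e by (intro mult_right_mono mult_mono) auto
      moreover have "e / (b * k) * b * k = e" using b k by simp
      ultimately show "norm (h (p (c N j)) (q s) - h (p s) (q s)) \<le> e" by (simp add: h.diff_left)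
    qed
  qed
qed

text \<open>The variance of the absolute value is nonnegative.\<close>

lemma (in prob_space) expectation_abs_le_sqrt:
  fixes X :: "'a \<Rightarrow> real"
  assumes [measurable]: "X \<in> borel_measurable M" and i: "integrable M (\<lambda>\<eta>. (X \<eta>)\<^sup>2)"
  shows "integrable M X" "expectation (\<lambda>\<eta>. \<bar>X \<eta>\<bar>) \<le> sqrt (expectation (\<lambda>\<eta>. (X \<eta>)\<^sup>2))"
proof -
  show iX: "integrable M X"
  proof (rule Bochner_Integration.integrable_bound)
    show "integrable M (\<lambda>\<eta>. 1 + (X \<eta>)\<^sup>2)" using i by simp
    have "\<bar>y\<bar> \<le> 1 + y\<^sup>2" for y :: real
    proof -
      have "2 * \<bar>y\<bar> \<le> y\<^sup>2 + 1" using sum_squares_bound[of "\<bar>y\<bar>" 1] by simp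
      then show ?thesis using abs_ge_zero[of y] by linarith
    qed
    then show "AE \<eta> in M. norm (X \<eta>) \<le> norm (1 + (X \<eta>)\<^sup>2)" by auto
  qed simp
  define a where "a = expectation (\<lambda>\<eta>. \<bar>X \<eta>\<bar>)"
  have ia: "integrable M (\<lambda>\<eta>. \<bar>X \<eta>\<bar>)" using iX by simp
  have "0 \<le> expectation (\<lambda>\<eta>. (\<bar>X \<eta>\<bar> - a)\<^sup>2)" by (rule Bochner_Integration.integral_nonneg) simp
  also have "\<dots> = expectation (\<lambda>\<eta>. ((X \<eta>)\<^sup>2 + a\<^sup>2) - (2 * a) * \<bar>X \<eta>\<bar>)"
    by (simp add: power2_diff mult.commute mult.left_commute)
  also have "\<dots> = expectation (\<lambda>\<eta>. (X \<eta>)\<^sup>2) + a\<^sup>2 - (2 * a) * a"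
    using i ia by (simp add: prob_space a_def)
  finally have "a\<^sup>2 \<le> expectation (\<lambda>\<eta>. (X \<eta>)\<^sup>2)" by (simp add: power2_eq_square)
  then show "expectation (\<lambda>\<eta>. \<bar>X \<eta>\<bar>) \<le> sqrt (expectation (\<lambda>\<eta>. (X \<eta>)\<^sup>2))"
    using real_le_rsqrt unfolding a_def by blast
qed

text \<open>The observation path enters only through the constants \<open>c n\<close>, of which nothing is known;
  they converge because \<open>T\<close> is Cauchy in mean square and \<open>T + c\<close> converges.\<close>

lemma (in prob_space) L2_limit_with_drift:
  fixes T :: "nat \<Rightarrow> 'a \<Rightarrow> real" and c :: "nat \<Rightarrow> real"
  assumes T [measurable]: "\<And>n. T n \<in> borel_measurable M" and \<xi> [measurable]: "\<xi> \<in> borel_measurable M"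
    and sq: "\<And>n. integrable M (\<lambda>\<eta>. (T n \<eta>)\<^sup>2)" and mean0: "\<And>n. expectation (T n) = 0"
    and sqd: "\<And>m n. integrable M (\<lambda>\<eta>. (T m \<eta> - T n \<eta>)\<^sup>2)"
    and Cauchy: "\<And>e. 0 < e \<Longrightarrow> \<exists>n0. \<forall>m\<ge>n0. \<forall>n\<ge>n0. expectation (\<lambda>\<eta>. (T m \<eta> - T n \<eta>)\<^sup>2) < e"
    and lim: "AE \<eta> in M. (\<lambda>n. T n \<eta> + c n) \<longlonglongrightarrow> \<xi> \<eta>"
    and var: "(\<lambda>n. expectation (\<lambda>\<eta>. (T n \<eta>)\<^sup>2)) \<longlonglongrightarrow> \<sigma>"
  shows "integrable M \<xi>" "integrable M (\<lambda>\<eta>. (\<xi> \<eta> - expectation \<xi>)\<^sup>2)" "expectation (\<lambda>\<eta>. (\<xi> \<eta> - expectation \<xi>)\<^sup>2) = \<sigma>"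
proof -
  define S where "S n \<eta> = T n \<eta> + c n" for n \<eta>
  have [measurable]: "S n \<in> borel_measurable M" for n unfolding S_def by measurable
  have pS: "(\<lambda>n. pdist M (S n) \<xi>) \<longlonglongrightarrow> 0"
    by (rule pdist_tendsto_AE) (use lim in \<open>auto simp: S_def\<close>)
  have cC: "Cauchy c"
  proof (rule CauchyI)
    fix e' :: real assume "0 < e'"
    \<comment> \<open>For \<open>e \<le> 1\<close> a bound on the truncated difference bounds the
      difference itself.\<close>
    define e where "e = min e' 1"
    have e: "0 < e" "e \<le> 1" using \<open>0 < e'\<close> by (auto simp: e_def)
    obtain n0 where n0: "\<And>m n. n0 \<le> m \<Longrightarrow> n0 \<le> n \<Longrightarrow> expectation (\<lambda>\<eta>. (T m \<eta> - T n \<eta>)\<^sup>2) < (e / 3)\<^sup>2"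
      using Cauchy[of "(e / 3)\<^sup>2"] e by auto
    obtain n1 where n1: "\<And>n. n1 \<le> n \<Longrightarrow> pdist M (S n) \<xi> < e / 3"
      using order_tendstoD(2)[OF pS, of "e / 3"] e by (auto simp: eventually_sequentially)
    have "norm (c m - c n) < e'" if mn: "max n0 n1 \<le> m" "max n0 n1 \<le> n" for m n
    proof -
      have "pdist M (S m) (S n) \<le> pdist M (S m) \<xi> + pdist M \<xi> (S n)" by (rule pdist_triangle) auto
      also have "pdist M \<xi> (S n) = pdist M (S n) \<xi>" by (simp add: pdist_def abs_minus_commute)
      finally have p: "pdist M (S m) (S n) < 2 * e / 3" using n1[of m] n1[of n] mn by simp
      have "sqrt (expectation (\<lambda>\<eta>. (T m \<eta> - T n \<eta>)\<^sup>2)) < e / 3"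
        using n0[of m n] mn e real_sqrt_less_mono[of _ "(e / 3)\<^sup>2"] by fastforce
      then have a: "expectation (\<lambda>\<eta>. \<bar>T m \<eta> - T n \<eta>\<bar>) < e / 3"
        using expectation_abs_le_sqrt(2)[OF _ sqd[of m n]] by fastforce
      have iT: "integrable M (\<lambda>\<eta>. \<bar>T m \<eta> - T n \<eta>\<bar>)"
        using expectation_abs_le_sqrt(1)[OF _ sqd[of m n]] by simp
      \<comment> \<open>The difference of the constants is not random, so it equals its expectation
        and may be split pointwise into the differences of \<open>S\<close> and of
        \<open>T\<close>.\<close>
      have "min 1 \<bar>c m - c n\<bar> = expectation (\<lambda>_. min 1 \<bar>c m - c n\<bar>)" by (simp add: prob_space)
      also have "\<dots> \<le> expectation (\<lambda>\<eta>. min 1 (norm (S m \<eta> - S n \<eta>)) + \<bar>T m \<eta> - T n \<eta>\<bar>)"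
      proof (rule integral_mono)
        show "integrable M (\<lambda>\<eta>. min 1 (norm (S m \<eta> - S n \<eta>)) + \<bar>T m \<eta> - T n \<eta>\<bar>)"
          by (intro Bochner_Integration.integrable_add integrable_pdist iT) measurable
        fix \<eta>
        have "c m - c n = (S m \<eta> - S n \<eta>) - (T m \<eta> - T n \<eta>)" by (simp add: S_def)
        then have "\<bar>c m - c n\<bar> \<le> \<bar>S m \<eta> - S n \<eta>\<bar> + \<bar>T m \<eta> - T n \<eta>\<bar>"
          using abs_triangle_ineq4[of "S m \<eta> - S n \<eta>" "T m \<eta> - T n \<eta>"] by simp
        then show "min 1 \<bar>c m - c n\<bar> \<le> min 1 (norm (S m \<eta> - S n \<eta>)) + \<bar>T m \<eta> - T n \<eta>\<bar>"
          by (auto simp: min_def)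
      qed simp
      also have "\<dots> = pdist M (S m) (S n) + expectation (\<lambda>\<eta>. \<bar>T m \<eta> - T n \<eta>\<bar>)"
        unfolding pdist_def by (intro Bochner_Integration.integral_add integrable_pdist iT) measurable
      finally have "min 1 \<bar>c m - c n\<bar> < e" using p a by simp
      then show ?thesis using e by (auto simp: min_def e_def split: if_splits)
    qed
    then show "\<exists>M. \<forall>m\<ge>M. \<forall>n\<ge>M. norm (c m - c n) < e'" by blast
  qed
  then obtain d where d: "c \<longlonglongrightarrow> d" using Cauchy_convergent_iff convergentD by blast
  define Z where "Z \<eta> = \<xi> \<eta> - d" for \<eta>
  have [measurable]: "Z \<in> borel_measurable M" unfolding Z_def by measurable
  have TZ: "AE \<eta> in M. (\<lambda>n. T n \<eta>) \<longlonglongrightarrow> Z \<eta>"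
    using lim
  proof eventually_elim
    case (elim \<eta>)
    from tendsto_diff[OF this d] show ?case by (simp add: Z_def)
  qed
  \<comment> \<open>Fatou's lemma in the index \<open>m\<close> passes the mean-square Cauchy bound
    to the almost sure limit \<open>Z\<close>.\<close>
  have conv: "\<exists>n0. \<forall>n\<ge>n0. (\<integral>\<^sup>+\<eta>. ennreal ((Z \<eta> - T n \<eta>)\<^sup>2) \<partial>M) \<le> ennreal e" if e: "0 < e" for e
  proof -
    obtain n0 where n0: "\<And>m n. n0 \<le> m \<Longrightarrow> n0 \<le> n \<Longrightarrow> expectation (\<lambda>\<eta>. (T m \<eta> - T n \<eta>)\<^sup>2) < e"
      using Cauchy[OF e] by auto
    have "(\<integral>\<^sup>+\<eta>. ennreal ((Z \<eta> - T n \<eta>)\<^sup>2) \<partial>M) \<le> ennreal e" if n: "n0 \<le> n" for n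
    proof -
      have "(\<integral>\<^sup>+\<eta>. ennreal ((Z \<eta> - T n \<eta>)\<^sup>2) \<partial>M) = (\<integral>\<^sup>+\<eta>. liminf (\<lambda>m. ennreal ((T m \<eta> - T n \<eta>)\<^sup>2)) \<partial>M)"
      proof (rule nn_integral_cong_AE)
        show "AE \<eta> in M. ennreal ((Z \<eta> - T n \<eta>)\<^sup>2) = liminf (\<lambda>m. ennreal ((T m \<eta> - T n \<eta>)\<^sup>2))"
          using TZ
        proof eventually_elim
          case (elim \<eta>)
          have "(\<lambda>m. ennreal ((T m \<eta> - T n \<eta>)\<^sup>2)) \<longlonglongrightarrow> ennreal ((Z \<eta> - T n \<eta>)\<^sup>2)"
            by (intro tendsto_intros elim)
          from lim_imp_Liminf[OF _ this] show ?case by simp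
        qed
      qed
      also have "\<dots> \<le> liminf (\<lambda>m. \<integral>\<^sup>+\<eta>. ennreal ((T m \<eta> - T n \<eta>)\<^sup>2) \<partial>M)"
        by (rule nn_integral_liminf) measurable
      also have "\<dots> \<le> ennreal e"
      proof (rule Liminf_le)
        show "\<forall>\<^sub>F m in sequentially. (\<integral>\<^sup>+\<eta>. ennreal ((T m \<eta> - T n \<eta>)\<^sup>2) \<partial>M) \<le> ennreal e"
          using eventually_ge_at_top[of n0]
        proof eventually_elim
          case (elim m)
          have "(\<integral>\<^sup>+\<eta>. ennreal ((T m \<eta> - T n \<eta>)\<^sup>2) \<partial>M) = ennreal (expectation (\<lambda>\<eta>. (T m \<eta> - T n \<eta>)\<^sup>2))"
            by (rule nn_integral_eq_integral[OF sqd]) auto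
          then show ?case using n0[OF elim n] by (simp add: ennreal_leI)
        qed
      qed simp
      finally show ?thesis .
    qed
    then show ?thesis by blast
  qed
  have sqZ: "integrable M (\<lambda>\<eta>. (Z \<eta> - T n \<eta>)\<^sup>2) \<and> expectation (\<lambda>\<eta>. (Z \<eta> - T n \<eta>)\<^sup>2) \<le> e"
    if "(\<integral>\<^sup>+\<eta>. ennreal ((Z \<eta> - T n \<eta>)\<^sup>2) \<partial>M) \<le> ennreal e" "0 < e" for n e
  proof -
    have i: "integrable M (\<lambda>\<eta>. (Z \<eta> - T n \<eta>)\<^sup>2)"
      by (rule integrableI_nonneg) (use that in \<open>auto intro: le_less_trans\<close>)
    moreover have "ennreal (expectation (\<lambda>\<eta>. (Z \<eta> - T n \<eta>)\<^sup>2)) \<le> ennreal e"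
      using nn_integral_eq_integral[OF i] that by simp
    ultimately show ?thesis using that by (simp add: ennreal_le_iff)
  qed
  have iZ2: "integrable M (\<lambda>\<eta>. (Z \<eta>)\<^sup>2)"
  proof -
    obtain n where "(\<integral>\<^sup>+\<eta>. ennreal ((Z \<eta> - T n \<eta>)\<^sup>2) \<partial>M) \<le> ennreal 1" using conv[of 1] by auto
    then have "integrable M (\<lambda>\<eta>. (Z \<eta> - T n \<eta>)\<^sup>2)" using sqZ[of n 1] by simp
    then have "integrable M (\<lambda>\<eta>. 2 * (Z \<eta> - T n \<eta>)\<^sup>2 + 2 * (T n \<eta>)\<^sup>2)" using sq[of n] by simp
    then show ?thesis
    proof (rule Bochner_Integration.integrable_bound)
      have "(Z \<eta>)\<^sup>2 \<le> 2 * (Z \<eta> - T n \<eta>)\<^sup>2 + 2 * (T n \<eta>)\<^sup>2" for \<eta>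
        using sum_squares_bound[of "Z \<eta> - T n \<eta>" "T n \<eta>"] by (simp add: power2_eq_square algebra_simps)
      then show "AE \<eta> in M. norm ((Z \<eta>)\<^sup>2) \<le> norm (2 * (Z \<eta> - T n \<eta>)\<^sup>2 + 2 * (T n \<eta>)\<^sup>2)" by auto
    qed measurable
  qed
  have iZ: "integrable M Z" by (rule expectation_abs_le_sqrt(1)[OF _ iZ2]) simp
  have iT: "integrable M (T n)" for n by (rule expectation_abs_le_sqrt(1)[OF _ sq]) simp
  have EZ: "expectation Z = 0"
  proof (rule ccontr)
    assume "expectation Z \<noteq> 0"
    then have pos: "0 < (\<bar>expectation Z\<bar> / 2)\<^sup>2" by simp
    obtain n where n: "(\<integral>\<^sup>+\<eta>. ennreal ((Z \<eta> - T n \<eta>)\<^sup>2) \<partial>M) \<le> ennreal ((\<bar>expectation Z\<bar> / 2)\<^sup>2)"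
      using conv[OF pos] by auto
    have s: "integrable M (\<lambda>\<eta>. (Z \<eta> - T n \<eta>)\<^sup>2)" "expectation (\<lambda>\<eta>. (Z \<eta> - T n \<eta>)\<^sup>2) \<le> (\<bar>expectation Z\<bar> / 2)\<^sup>2"
      using sqZ[OF n pos] by auto
    have "\<bar>expectation Z\<bar> = \<bar>expectation (\<lambda>\<eta>. Z \<eta> - T n \<eta>)\<bar>" using iZ iT mean0 by simp
    also have "\<dots> \<le> expectation (\<lambda>\<eta>. \<bar>Z \<eta> - T n \<eta>\<bar>)" by (rule integral_abs_bound)
    also have "\<dots> \<le> sqrt (expectation (\<lambda>\<eta>. (Z \<eta> - T n \<eta>)\<^sup>2))" by (rule expectation_abs_le_sqrt(2)[OF _ s(1)]) simp
    also have "\<dots> \<le> \<bar>expectation Z\<bar> / 2" using s(2) by (intro real_le_lsqrt) auto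
    finally show False using \<open>expectation Z \<noteq> 0\<close> by simp
  qed
  \<comment> \<open>A weighted arithmetic-geometric mean inequality for
    \<open>(a - b) * (a + b)\<close> compares second moments without a product of
    \<open>L\<^sup>2\<close> norms; the weight \<open>r\<close> is chosen below.\<close>
  have bound: "\<bar>expectation (\<lambda>\<eta>. (Z \<eta>)\<^sup>2) - expectation (\<lambda>\<eta>. (T n \<eta>)\<^sup>2)\<bar>
      \<le> r * (expectation (\<lambda>\<eta>. (Z \<eta>)\<^sup>2) + expectation (\<lambda>\<eta>. (T n \<eta>)\<^sup>2)) + expectation (\<lambda>\<eta>. (Z \<eta> - T n \<eta>)\<^sup>2) / r"
    if r: "0 < r" and iD: "integrable M (\<lambda>\<eta>. (Z \<eta> - T n \<eta>)\<^sup>2)" for r n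
  proof -
    have am: "x * y \<le> (x\<^sup>2 + y\<^sup>2) / 2" for x y :: real
      using sum_squares_bound[of x y] by simp
    have pw: "\<bar>a\<^sup>2 - b\<^sup>2\<bar> \<le> r * (a\<^sup>2 + b\<^sup>2) + (a - b)\<^sup>2 / r" for a b :: real
    proof -
      have "\<bar>a\<^sup>2 - b\<^sup>2\<bar> = \<bar>a - b\<bar> * \<bar>a + b\<bar>" by (simp add: abs_mult[symmetric] power2_eq_square algebra_simps)
      also have "\<dots> = (\<bar>a - b\<bar> / sqrt r) * (sqrt r * \<bar>a + b\<bar>)" using r by simp
      also have "\<dots> \<le> ((\<bar>a - b\<bar> / sqrt r)\<^sup>2 + (sqrt r * \<bar>a + b\<bar>)\<^sup>2) / 2"
        by (rule am)
      also have "\<dots> = (a - b)\<^sup>2 / r / 2 + r * (a + b)\<^sup>2 / 2"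
        using r by (simp add: power_divide power_mult_distrib add_divide_distrib)
      also have "r * (a + b)\<^sup>2 / 2 \<le> r * (a\<^sup>2 + b\<^sup>2)"
      proof -
        have "(a + b)\<^sup>2 \<le> 2 * (a\<^sup>2 + b\<^sup>2)" using sum_squares_bound[of a b] by (simp add: power2_sum)
        from mult_left_mono[OF this, of r] r show ?thesis by simp
      qed
      also have "(a - b)\<^sup>2 / r / 2 \<le> (a - b)\<^sup>2 / r"
      proof -
        have half: "y / 2 \<le> y" if "0 \<le> y" for y :: real using that by simp
        show ?thesis by (rule half) (use r in simp)
      qed
      finally show ?thesis by simp
    qed
    have "\<bar>expectation (\<lambda>\<eta>. (Z \<eta>)\<^sup>2) - expectation (\<lambda>\<eta>. (T n \<eta>)\<^sup>2)\<bar> = \<bar>expectation (\<lambda>\<eta>. (Z \<eta>)\<^sup>2 - (T n \<eta>)\<^sup>2)\<bar>"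
      using iZ2 sq by simp
    also have "\<dots> \<le> expectation (\<lambda>\<eta>. \<bar>(Z \<eta>)\<^sup>2 - (T n \<eta>)\<^sup>2\<bar>)" by (rule integral_abs_bound)
    also have "\<dots> \<le> expectation (\<lambda>\<eta>. r * ((Z \<eta>)\<^sup>2 + (T n \<eta>)\<^sup>2) + (Z \<eta> - T n \<eta>)\<^sup>2 / r)"
      by (rule integral_mono) (use iZ2 sq iD pw in auto)
    also have "\<dots> = r * (expectation (\<lambda>\<eta>. (Z \<eta>)\<^sup>2) + expectation (\<lambda>\<eta>. (T n \<eta>)\<^sup>2)) + expectation (\<lambda>\<eta>. (Z \<eta> - T n \<eta>)\<^sup>2) / r"
      using iZ2 sq iD by simp
    finally show ?thesis .
  qed
  have VZ: "expectation (\<lambda>\<eta>. (Z \<eta>)\<^sup>2) = \<sigma>"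
  proof (rule LIMSEQ_unique[OF _ var])
    show "(\<lambda>n. expectation (\<lambda>\<eta>. (T n \<eta>)\<^sup>2)) \<longlonglongrightarrow> expectation (\<lambda>\<eta>. (Z \<eta>)\<^sup>2)"
    proof (rule LIMSEQ_I)
      fix e :: real assume e: "0 < e"
      obtain b where b: "0 < b" "\<And>n. norm (expectation (\<lambda>\<eta>. (T n \<eta>)\<^sup>2)) \<le> b"
        using convergent_imp_Bseq[OF convergentI[OF var]] by (auto simp: Bseq_def)
      define z where "z = expectation (\<lambda>\<eta>. (Z \<eta>)\<^sup>2) + b"
      have z: "0 < z" using b by (simp add: z_def add_nonneg_pos)
      \<comment> \<open>Since \<open>z\<close> bounds the sum of the two second moments, the first
        term of \<open>bound\<close> is at most \<open>e / 3\<close>; mean-square closeness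
        \<open>r * (e / 3)\<close> does the same for the second.\<close>
      define r where "r = e / (3 * z)"
      have r: "0 < r" using e z by (simp add: r_def)
      obtain n0 where n0: "\<And>n. n0 \<le> n \<Longrightarrow> (\<integral>\<^sup>+\<eta>. ennreal ((Z \<eta> - T n \<eta>)\<^sup>2) \<partial>M) \<le> ennreal (r * (e / 3))"
        using conv[of "r * (e / 3)"] r e by auto
      have "norm (expectation (\<lambda>\<eta>. (T n \<eta>)\<^sup>2) - expectation (\<lambda>\<eta>. (Z \<eta>)\<^sup>2)) < e" if n: "n0 \<le> n" for n
      proof -
        have s: "integrable M (\<lambda>\<eta>. (Z \<eta> - T n \<eta>)\<^sup>2)" "expectation (\<lambda>\<eta>. (Z \<eta> - T n \<eta>)\<^sup>2) \<le> r * (e / 3)"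
          using sqZ[OF n0[OF n]] r e by auto
        have "r * (expectation (\<lambda>\<eta>. (Z \<eta>)\<^sup>2) + expectation (\<lambda>\<eta>. (T n \<eta>)\<^sup>2)) \<le> r * z"
          using b(2)[of n] r by (intro mult_left_mono) (auto simp: z_def)
        also have "r * z = e / 3" using z by (simp add: r_def)
        finally have 1: "r * (expectation (\<lambda>\<eta>. (Z \<eta>)\<^sup>2) + expectation (\<lambda>\<eta>. (T n \<eta>)\<^sup>2)) \<le> e / 3" .
        have 2: "expectation (\<lambda>\<eta>. (Z \<eta> - T n \<eta>)\<^sup>2) / r \<le> e / 3" using s(2) r by (simp add: field_simps)
        show ?thesis using order_trans[OF bound[OF r s(1)] add_mono[OF 1 2]] e by (simp add: abs_minus_commute)
      qed
      then show "\<exists>no. \<forall>n\<ge>no. norm (expectation (\<lambda>\<eta>. (T n \<eta>)\<^sup>2) - expectation (\<lambda>\<eta>. (Z \<eta>)\<^sup>2)) < e" by blast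
    qed
  qed
  have \<xi>Z: "\<xi> = (\<lambda>\<eta>. Z \<eta> + d)" by (simp add: Z_def fun_eq_iff)
  show "integrable M \<xi>" unfolding \<xi>Z using iZ by simp
  have "expectation \<xi> = d" unfolding \<xi>Z using iZ EZ by (simp add: prob_space)
  then have "(\<lambda>\<eta>. (\<xi> \<eta> - expectation \<xi>)\<^sup>2) = (\<lambda>\<eta>. (Z \<eta>)\<^sup>2)" by (simp add: Z_def fun_eq_iff)
  then show "integrable M (\<lambda>\<eta>. (\<xi> \<eta> - expectation \<xi>)\<^sup>2)" "expectation (\<lambda>\<eta>. (\<xi> \<eta> - expectation \<xi>)\<^sup>2) = \<sigma>"
    using iZ2 VZ by simp_all
qed

lemma norm_transpose: "norm (transpose A) = norm (A :: real^'n^'m)"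
proof -
  have "(\<Sum>i\<in>UNIV. (norm (transpose A $ i))\<^sup>2) = (\<Sum>i\<in>UNIV. (norm (A $ i))\<^sup>2)"
    by (simp add: power2_norm_eq_inner inner_vec_def transpose_def) (rule sum.swap)
  then show ?thesis by (simp add: norm_vec_def L2_set_def)
qed

lemma transpose_diff: "transpose (A - B) = transpose A - transpose (B :: 'a::group_add^'n^'m)"
  by (simp add: transpose_def vec_eq_iff)

lemma grid_cell_refine:
  assumes "0 \<le> t" "0 < N" "0 < r"
  shows "grid_cell t (N * r) j \<subseteq> grid_cell t N (j div r)"
proof -
  have a: "real (j div r) * real r \<le> real j" "real (Suc j) \<le> real (Suc (j div r)) * real r"
  proof -
    have "(j div r) * r \<le> j" by simp
    then show "real (j div r) * real r \<le> real j" by (metis of_nat_le_iff of_nat_mult)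
    have "j < Suc (j div r) * r" using assms(3) by (metis dividend_less_div_times mult_Suc add.commute)
    then have "Suc j \<le> Suc (j div r) * r" by simp
    then show "real (Suc j) \<le> real (Suc (j div r)) * real r" by (metis of_nat_le_iff of_nat_mult)
  qed
  have "real (j div r) * t / real N \<le> real j * t / real (N * r)"
  proof -
    have "real (j div r) * t / real N = (real (j div r) * real r) * t / real (N * r)" using assms by simp
    also have "\<dots> \<le> real j * t / real (N * r)" using a(1) assms by (intro divide_right_mono mult_right_mono) auto
    finally show ?thesis .
  qed
  moreover have "real (Suc j) * t / real (N * r) \<le> real (Suc (j div r)) * t / real N"
  proof -
    have "real (Suc j) * t / real (N * r) \<le> (real (Suc (j div r)) * real r) * t / real (N * r)"
      using a(2) assms by (intro divide_right_mono mult_right_mono) auto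
    also have "\<dots> = real (Suc (j div r)) * t / real N" using assms by simp
    finally show ?thesis .
  qed
  ultimately show ?thesis by (auto simp del: of_nat_Suc)
qed

lemma div_less_grid: "j < N * r \<Longrightarrow> j div r < (N :: nat)"
  by (simp add: less_mult_imp_div_less)

text \<open>Ito isometry for step coefficients that converge uniformly: differences are measured on
  a common refinement, where \<open>noise_sum_moments\<close> applies to the differences of the
  coefficients, and the variances are Riemann sums of the limiting integrand.\<close>

lemma (in brownian_noise) noise_sum_step_limit:
  fixes P :: "nat \<Rightarrow> nat \<Rightarrow> real^'d^'n" and R :: "nat \<Rightarrow> nat \<Rightarrow> real^'k^'n" and v :: "real^'n"
  assumes t: "0 \<le> t" and N: "\<And>n. 0 < N n"
    and Pf: "continuous_on {0..t} Pf" and Rf: "continuous_on {0..t} Rf"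
    and close: "\<And>e. 0 < e \<Longrightarrow> \<exists>n0. \<forall>n\<ge>n0. \<forall>j<N n. \<forall>s\<in>grid_cell t (N n) j. norm (P n j - Pf s) \<le> e \<and> norm (R n j - Rf s) \<le> e"
  defines "T \<equiv> \<lambda>n \<eta>. v \<bullet> noise_sum B W (N n) t (P n) (R n) \<eta>"
  shows "integrable M (\<lambda>\<eta>. (T m \<eta> - T n \<eta>)\<^sup>2)"
    "0 < e \<Longrightarrow> \<exists>n0. \<forall>m\<ge>n0. \<forall>n\<ge>n0. expectation (\<lambda>\<eta>. (T m \<eta> - T n \<eta>)\<^sup>2) < e"
    "(\<lambda>n. expectation (\<lambda>\<eta>. (T n \<eta>)\<^sup>2)) \<longlonglongrightarrow>
      integral {0..t} (\<lambda>s. (norm (transpose (Pf s) *v v))\<^sup>2 + (norm (transpose (Rf s) *v v))\<^sup>2)"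
proof -
  \<comment> \<open>Coefficient differences on the grid with \<open>N m * N n\<close> cells, which
    refines both grids.\<close>
  define DP where "DP m n j = P m (j div N n) - P n (j div N m)" for m n j
  define DR where "DR m n j = R m (j div N n) - R n (j div N m)" for m n j
  have diff: "T m \<eta> - T n \<eta> = v \<bullet> noise_sum B W (N m * N n) t (DP m n) (DR m n) \<eta>" for m n \<eta>
  proof -
    have "noise_sum B W (N n) t (P n) (R n) \<eta> = noise_sum B W (N m * N n) t (\<lambda>j. P n (j div N m)) (\<lambda>j. R n (j div N m)) \<eta>"
      using noise_sum_refine[OF N N, of B W n t "P n" "R n" \<eta> m] by (simp add: mult.commute)
    moreover have "noise_sum B W (N m) t (P m) (R m) \<eta> = noise_sum B W (N m * N n) t (\<lambda>j. P m (j div N n)) (\<lambda>j. R m (j div N n)) \<eta>"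
      by (rule noise_sum_refine[OF N N])
    ultimately show ?thesis
      by (simp add: T_def inner_diff_right[symmetric] noise_sum_diff DP_def[abs_def] DR_def[abs_def])
  qed
  have NN: "0 < N m * N n" for m n using N by simp
  show "integrable M (\<lambda>\<eta>. (T m \<eta> - T n \<eta>)\<^sup>2)"
    unfolding diff by (rule noise_sum_moments(3)[OF t NN])
  obtain k1 where k1: "0 < k1" "\<And>(A :: real^'n^'d) x. norm (A *v x) \<le> norm A * norm x * k1"
    using bounded_bilinear.pos_bounded[OF bounded_bilinear_matrix_vector_mult] by blast
  obtain k2 where k2: "0 < k2" "\<And>(A :: real^'n^'k) x. norm (A *v x) \<le> norm A * norm x * k2"
    using bounded_bilinear.pos_bounded[OF bounded_bilinear_matrix_vector_mult] by blast
  define c where "c = max k1 k2 * norm v"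
  have c0: "0 \<le> c" using k1 by (simp add: c_def)
  have cP: "norm (transpose A *v v) \<le> c * norm A" for A :: "real^'d^'n"
  proof -
    have "norm (transpose A *v v) \<le> norm A * norm v * k1" using k1(2)[of "transpose A" v] by (simp add: norm_transpose)
    also have "\<dots> \<le> norm A * norm v * max k1 k2" by (intro mult_left_mono) auto
    finally show ?thesis by (simp add: c_def mult_ac)
  qed
  have cR: "norm (transpose A *v v) \<le> c * norm A" for A :: "real^'k^'n"
  proof -
    have "norm (transpose A *v v) \<le> norm A * norm v * k2" using k2(2)[of "transpose A" v] by (simp add: norm_transpose)
    also have "\<dots> \<le> norm A * norm v * max k1 k2" by (intro mult_left_mono) auto
    finally show ?thesis by (simp add: c_def mult_ac)
  qed
  show "\<exists>n0. \<forall>m\<ge>n0. \<forall>n\<ge>n0. expectation (\<lambda>\<eta>. (T m \<eta> - T n \<eta>)\<^sup>2) < e" if e: "0 < e" for e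
  proof -
    \<comment> \<open>The variance is at most \<open>8 * t * c\<^sup>2 * d\<^sup>2\<close>;
      \<open>d \<le> 1\<close> permits replacing \<open>d\<^sup>2\<close> by \<open>d\<close>, and
      the added ones exclude a zero denominator.\<close>
    define d where "d = min 1 (e / (8 * (t + 1) * (c\<^sup>2 + 1)))"
    have d: "0 < d" "d \<le> 1" "d \<le> e / (8 * (t + 1) * (c\<^sup>2 + 1))"
      using e t by (auto simp: d_def intro!: divide_pos_pos mult_pos_pos add_nonneg_pos)
    obtain n0 where n0: "\<And>n j s. n0 \<le> n \<Longrightarrow> j < N n \<Longrightarrow> s \<in> grid_cell t (N n) j \<Longrightarrow> norm (P n j - Pf s) \<le> d \<and> norm (R n j - Rf s) \<le> d"
      using close[OF d(1)] by blast
    have "expectation (\<lambda>\<eta>. (T m \<eta> - T n \<eta>)\<^sup>2) < e" if mn: "n0 \<le> m" "n0 \<le> n" for m n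
    proof -
      have DPR: "norm (DP m n j) \<le> 2 * d \<and> norm (DR m n j) \<le> 2 * d" if j: "j < N m * N n" for j
      proof -
        let ?s = "real j * t / real (N m * N n)"
        have mem: "?s \<in> grid_cell t (N m * N n) j"
          using grid_le[OF t, of j "N m * N n"] by (simp del: of_nat_Suc of_nat_mult)
        then have mem': "?s \<in> grid_cell t (N n * N m) j" by (simp only: mult.commute[of "N n" "N m"])
        have 1: "?s \<in> grid_cell t (N m) (j div N n)" "?s \<in> grid_cell t (N n) (j div N m)"
          by (rule subsetD[OF grid_cell_refine[OF t N N] mem]) (rule subsetD[OF grid_cell_refine[OF t N N] mem'])
        have 2: "j div N n < N m" "j div N m < N n"
          using div_less_grid[of j "N m" "N n"] div_less_grid[of j "N n" "N m"] j by (auto simp: mult.commute)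
        note a = n0[OF mn(1) 2(1) 1(1)] and b = n0[OF mn(2) 2(2) 1(2)]
        show ?thesis unfolding DP_def DR_def
          using a b norm_triangle_ineq4[of "P m (j div N n) - Pf ?s" "P n (j div N m) - Pf ?s"]
            norm_triangle_ineq4[of "R m (j div N n) - Rf ?s" "R n (j div N m) - Rf ?s"] by simp
      qed
      have "expectation (\<lambda>\<eta>. (T m \<eta> - T n \<eta>)\<^sup>2) = (t / real (N m * N n)) *
          (\<Sum>j<N m * N n. (norm (transpose (DP m n j) *v v))\<^sup>2 + (norm (transpose (DR m n j) *v v))\<^sup>2)"
        unfolding diff by (rule noise_sum_moments(4)[OF t NN])
      also have "\<dots> \<le> (t / real (N m * N n)) * (\<Sum>j<N m * N n. (c * (2 * d))\<^sup>2 + (c * (2 * d))\<^sup>2)"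
      proof (intro mult_left_mono sum_mono add_mono power_mono)
        fix j assume j: "j \<in> {..<N m * N n}"
        show "norm (transpose (DP m n j) *v v) \<le> c * (2 * d)"
          using DPR[of j] j c0 by (intro order_trans[OF cP] mult_left_mono) auto
        show "norm (transpose (DR m n j) *v v) \<le> c * (2 * d)"
          using DPR[of j] j c0 by (intro order_trans[OF cR] mult_left_mono) auto
      qed (use t in auto)
      also have "\<dots> = t * (8 * c\<^sup>2 * d\<^sup>2)" using N[of m] N[of n] by (simp add: power2_eq_square)
      also have "\<dots> \<le> t * (8 * c\<^sup>2 * d)"
      proof -
        have "d\<^sup>2 \<le> d" using d by (simp add: power2_eq_square mult_left_le)
        then show ?thesis using t by (intro mult_left_mono) auto
      qed
      also have "\<dots> < 8 * (t + 1) * (c\<^sup>2 + 1) * d"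
        using d(1) t by (simp add: algebra_simps add_pos_nonneg)
      also have "\<dots> \<le> e"
      proof -
        have p: "0 < 8 * (t + 1) * (c\<^sup>2 + 1)" using t by (intro mult_pos_pos) (auto intro: add_nonneg_pos)
        show ?thesis using d(3) unfolding pos_le_divide_eq[OF p] by (simp add: mult_ac)
      qed
      finally show ?thesis .
    qed
    then show ?thesis by blast
  qed
  define g where "g s = (norm (transpose (Pf s) *v v))\<^sup>2 + (norm (transpose (Rf s) *v v))\<^sup>2" for s
  define f where "f n j = (norm (transpose (P n j) *v v))\<^sup>2 + (norm (transpose (R n j) *v v))\<^sup>2" for n j
  have gc: "continuous_on {0..t} g" unfolding g_def by (intro matrix_continuous_intros Pf Rf)
  have "(\<lambda>n. \<Sum>j<N n. integral (grid_cell t (N n) j) (\<lambda>_. f n j)) \<longlonglongrightarrow> integral {0..t} g"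
  proof (rule riemann_step_tendsto[OF t gc])
    fix e :: real assume e: "0 < e"
    have "bounded (Pf ` {0..t})" "bounded (Rf ` {0..t})"
      by (intro compact_imp_bounded compact_continuous_image Pf Rf; simp)+
    then obtain p q where pq: "0 < p" "\<And>s. s \<in> {0..t} \<Longrightarrow> norm (Pf s) \<le> p" "0 < q" "\<And>s. s \<in> {0..t} \<Longrightarrow> norm (Rf s) \<le> q"
      by (auto simp: bounded_pos)
    \<comment> \<open>Each summand is a Lipschitz constant of the square on the range of the
      coefficients, widened by \<open>d \<le> 1\<close>; the last 1 keeps \<open>b\<close>
      positive.\<close>
    define b where "b = c\<^sup>2 * (2 * p + 1) + c\<^sup>2 * (2 * q + 1) + 1"
    have b: "0 < b" using pq by (simp add: b_def add_nonneg_pos)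
    define d where "d = min 1 (e / b)"
    have d: "0 < d" "d \<le> 1" "d \<le> e / b" using e b by (auto simp: d_def)
    obtain n0 where n0: "\<And>n j s. n0 \<le> n \<Longrightarrow> j < N n \<Longrightarrow> s \<in> grid_cell t (N n) j \<Longrightarrow> norm (P n j - Pf s) \<le> d \<and> norm (R n j - Rf s) \<le> d"
      using close[OF d(1)] by blast
    have sq: "\<bar>x\<^sup>2 - y\<^sup>2\<bar> \<le> c\<^sup>2 * (2 * z + 1) * d" if "\<bar>x - y\<bar> \<le> c * d" "0 \<le> y" "y \<le> c * z" for x y z :: real
    proof -
      have "\<bar>x\<^sup>2 - y\<^sup>2\<bar> = \<bar>x - y\<bar> * \<bar>x + y\<bar>" by (simp add: abs_mult[symmetric] power2_eq_square algebra_simps)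
      also have "\<dots> \<le> (c * d) * (c * (2 * z + 1))"
      proof (rule mult_mono)
        have "c * d \<le> c" using d c0 by (simp add: mult_left_le)
        then show "\<bar>x + y\<bar> \<le> c * (2 * z + 1)" using that by (simp add: algebra_simps abs_le_iff)
      qed (use that c0 d in auto)
      finally show ?thesis by (simp add: power2_eq_square mult_ac)
    qed
    show "\<forall>\<^sub>F n in sequentially. \<forall>j<N n. \<forall>s\<in>grid_cell t (N n) j. norm (f n j - g s) \<le> e"
      using eventually_ge_at_top[of n0]
    proof eventually_elim
      case (elim n)
      show ?case
      proof (intro allI impI ballI)
        fix j s assume j: "j < N n" and s: "s \<in> grid_cell t (N n) j"
        have st: "s \<in> {0..t}" using grid_cell_subset[OF t j] s by auto
        note nn = n0[OF elim j s]
        have "\<bar>norm (transpose (P n j) *v v) - norm (transpose (Pf s) *v v)\<bar> \<le> norm (transpose (P n j - Pf s) *v v)"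
          using norm_triangle_ineq3[of "transpose (P n j) *v v" "transpose (Pf s) *v v"]
          by (simp add: transpose_diff matrix_vector_mult_diff_rdistrib)
        also have "\<dots> \<le> c * d" using nn c0 by (intro order_trans[OF cP] mult_left_mono) auto
        finally have 1: "\<bar>(norm (transpose (P n j) *v v))\<^sup>2 - (norm (transpose (Pf s) *v v))\<^sup>2\<bar> \<le> c\<^sup>2 * (2 * p + 1) * d"
          using pq(2)[OF st] c0 by (intro sq) (auto intro: order_trans[OF cP] mult_left_mono)
        have "\<bar>norm (transpose (R n j) *v v) - norm (transpose (Rf s) *v v)\<bar> \<le> norm (transpose (R n j - Rf s) *v v)"
          using norm_triangle_ineq3[of "transpose (R n j) *v v" "transpose (Rf s) *v v"]
          by (simp add: transpose_diff matrix_vector_mult_diff_rdistrib)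
        also have "\<dots> \<le> c * d" using nn c0 by (intro order_trans[OF cR] mult_left_mono) auto
        finally have 2: "\<bar>(norm (transpose (R n j) *v v))\<^sup>2 - (norm (transpose (Rf s) *v v))\<^sup>2\<bar> \<le> c\<^sup>2 * (2 * q + 1) * d"
          using pq(4)[OF st] c0 by (intro sq) (auto intro: order_trans[OF cR] mult_left_mono)
        have "norm (f n j - g s) \<le> c\<^sup>2 * (2 * p + 1) * d + c\<^sup>2 * (2 * q + 1) * d"
          using 1 2 by (simp add: f_def g_def)
        also have "\<dots> \<le> b * d" using d by (simp add: b_def algebra_simps)
        also have "\<dots> \<le> e" using d(3) b by (simp add: pos_le_divide_eq mult.commute)
        finally show "norm (f n j - g s) \<le> e" .
      qed
    qed
  qed (use N in auto)
  moreover have "(\<Sum>j<N n. integral (grid_cell t (N n) j) (\<lambda>_. f n j)) = expectation (\<lambda>\<eta>. (T n \<eta>)\<^sup>2)" for n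
  proof -
    have "integral (grid_cell t (N n) j) (\<lambda>_. f n j) = (t / real (N n)) * f n j" for j
      using grid_le[OF t, of j "N n"] grid_width[of j t "N n"] by (simp del: of_nat_Suc)
    then show ?thesis unfolding T_def noise_sum_moments(4)[OF t N] f_def by (simp add: sum_distrib_left)
  qed
  ultimately show "(\<lambda>n. expectation (\<lambda>\<eta>. (T n \<eta>)\<^sup>2)) \<longlonglongrightarrow>
      integral {0..t} (\<lambda>s. (norm (transpose (Pf s) *v v))\<^sup>2 + (norm (transpose (Rf s) *v v))\<^sup>2)"
    by (simp add: g_def[abs_def])
qed

section \<open>The filter along an observation path\<close>

lemma (in prob_space) pdist_diff:
  fixes X Y :: "'a \<Rightarrow> 'b::euclidean_space"
  assumes [measurable]: "X \<in> borel_measurable M" "Y \<in> borel_measurable M" "X' \<in> borel_measurable M" "Y' \<in> borel_measurable M"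
  shows "pdist M (\<lambda>\<eta>. X \<eta> - X' \<eta>) (\<lambda>\<eta>. Y \<eta> - Y' \<eta>) \<le> pdist M X Y + pdist M X' Y'"
proof -
  have "pdist M (\<lambda>\<eta>. X \<eta> + (- X' \<eta>)) (\<lambda>\<eta>. Y \<eta> + (- Y' \<eta>)) \<le> pdist M X Y + pdist M (\<lambda>\<eta>. - X' \<eta>) (\<lambda>\<eta>. - Y' \<eta>)"
    by (intro pdist_add) measurable
  also have "pdist M (\<lambda>\<eta>. - X' \<eta>) (\<lambda>\<eta>. - Y' \<eta>) = pdist M X' Y'"
    by (simp add: pdist_def norm_minus_commute)
  finally show ?thesis by simp
qed

lemma (in prob_space) pdist_matrix_vector:
  fixes X Y :: "'a \<Rightarrow> real^'n" and A :: "real^'n^'m"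
  assumes [measurable]: "X \<in> borel_measurable M" "Y \<in> borel_measurable M"
  shows "pdist M (\<lambda>\<eta>. A *v X \<eta>) (\<lambda>\<eta>. A *v Y \<eta>) \<le> max 1 (onorm ((*v) A)) * pdist M X Y"
proof (rule pdist_lipschitz)
  fix \<eta>
  have "norm (A *v X \<eta> - A *v Y \<eta>) \<le> onorm ((*v) A) * norm (X \<eta> - Y \<eta>)"
    using onorm[OF matrix_vector_mul_bounded_linear[of A], of "X \<eta> - Y \<eta>"] by (simp add: mv.diff_right)
  also have "\<dots> \<le> max 1 (onorm ((*v) A)) * norm (X \<eta> - Y \<eta>)" by (intro mult_right_mono) auto
  finally show "norm (A *v X \<eta> - A *v Y \<eta>) \<le> max 1 (onorm ((*v) A)) * norm (X \<eta> - Y \<eta>)" .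
qed auto

lemma integral_matrix_vector_const:
  fixes D :: "real \<Rightarrow> real^'n^'m"
  assumes "D integrable_on S" shows "integral S (\<lambda>s. D s *v w) = integral S D *v w"
  using integral_linear[OF assms bounded_bilinear.bounded_linear_left[OF bounded_bilinear_matrix_vector_mult, of w]]
  by (simp add: o_def)

lemma integral_const_matrix_vector:
  fixes q :: "real \<Rightarrow> real^'n" and A :: "real^'n^'m"
  assumes "q integrable_on S" shows "integral S (\<lambda>s. A *v q s) = A *v integral S q"
  using integral_linear[OF assms matrix_vector_mul_bounded_linear[of A]] by (simp add: o_def)

text \<open>The path of the filter for one fixed observation path \<open>z\<close>, with \<open>K\<close> the gain along it.\<close>

locale filter_path = brownian_noise M X0 B W
  for M :: "'p measure" and X0 :: "'p \<Rightarrow> real^'d" and B :: "real \<Rightarrow> 'p \<Rightarrow> real^'d" and W :: "real \<Rightarrow> 'p \<Rightarrow> real^'k" +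
  fixes F S :: "real^'d^'d" and H :: "real^'d^'k" and G :: "real^'k^'k"
    and K :: "real \<Rightarrow> real^'k^'d" and z :: "real \<Rightarrow> real^'k" and x :: "real \<Rightarrow> 'p \<Rightarrow> real^'d"
    and \<Phi> \<Theta> :: "real \<Rightarrow> real^'d^'d"
  assumes K: "continuous_on {0..} K"
    and x_measurable: "\<And>t. 0 \<le> t \<Longrightarrow> x t \<in> borel_measurable M"
    and x_continuous: "\<And>\<eta>. \<eta> \<in> space M \<Longrightarrow> continuous_on {0..} (\<lambda>t. x t \<eta>)"
    and x_0: "\<And>\<eta>. \<eta> \<in> space M \<Longrightarrow> x 0 \<eta> = X0 \<eta>"
    and equation: "\<And>t. 0 \<le> t \<Longrightarrow> \<exists>I. stoch_integral M K
        (\<lambda>s \<eta>. integral {0..s} (\<lambda>r. H *v x r \<eta>) + G *v W s \<eta> - z s) t I \<and>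
        (AE \<eta> in M. x t \<eta> = X0 \<eta> + integral {0..t} (\<lambda>s. F *v x s \<eta>) + S *v B t \<eta> - I \<eta>)"
    and \<Phi>_0: "\<Phi> 0 = mat 1" and \<Theta>_0: "\<Theta> 0 = mat 1"
    and \<Phi>': "\<Phi> hhd (\<lambda>t. (F - K t ** H) ** \<Phi> t)" and \<Theta>': "\<Theta> hhd (\<lambda>t. - (\<Theta> t ** (F - K t ** H)))"
    and \<Phi>\<Theta>: "\<And>t. 0 \<le> t \<Longrightarrow> \<Phi> t ** \<Theta> t = mat 1"
begin

definition drift :: "real \<Rightarrow> real^'d^'d" where "drift s = F - K s ** H"

text \<open>The forcing of the closed-loop equation, formally
  \<open>S B - \<integral> K (G dW - dz)\<close>. Reading it off the path of \<open>x\<close> makes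
  it available for every outcome and every time, without a stochastic integral as a process.\<close>

definition path_noise :: "real \<Rightarrow> 'p \<Rightarrow> real^'d" where
  "path_noise s \<eta> = x s \<eta> - X0 \<eta> - integral {0..s} (\<lambda>r. drift r *v x r \<eta>)"

text \<open>This is \<open>\<xi>\<^sub>t\<close>, by variation of constants the integral of
  \<open>\<Phi> t ** \<Theta> s\<close> against \<open>path_noise\<close>.\<close>

definition noise_part :: "real \<Rightarrow> 'p \<Rightarrow> real^'d" where
  "noise_part t \<eta> = x t \<eta> - \<Phi> t *v X0 \<eta>"

definition noise_step :: "real \<Rightarrow> nat \<Rightarrow> nat \<Rightarrow> 'p \<Rightarrow> real^'d" where
  "noise_step t N j \<eta> = S *v (B (real (Suc j) * t / real N) \<eta> - B (real j * t / real N) \<eta>)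
     - K (real j * t / real N) *v (G *v (W (real (Suc j) * t / real N) \<eta> - W (real j * t / real N) \<eta>)
        - (z (real (Suc j) * t / real N) - z (real j * t / real N)))"

definition noise_approx :: "real \<Rightarrow> nat \<Rightarrow> 'p \<Rightarrow> real^'d" where
  "noise_approx t N \<eta> = (\<Sum>j<N. noise_step t N j \<eta>)"

lemma drift_continuous: "continuous_on {0..} drift"
  unfolding drift_def by (intro matrix_continuous_intros K)

lemma \<Phi>_continuous: "continuous_on {0..} \<Phi>" and \<Theta>_continuous: "continuous_on {0..} \<Theta>"
  by (rule halfline_derivative_continuous[OF \<Phi>'], rule halfline_derivative_continuous[OF \<Theta>'])

text \<open>The integral is a pointwise limit of sums in which \<open>D\<close> is integrated
  exactly and \<open>x\<close> is sampled at grid points, where it is measurable.\<close>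

lemma x_integral_measurable:
  fixes D :: "real \<Rightarrow> real^'d^'n"
  assumes t: "0 \<le> t" and D: "continuous_on {0..t} D"
  shows "(\<lambda>\<eta>. integral {0..t} (\<lambda>s. D s *v x s \<eta>)) \<in> borel_measurable M"
proof (rule borel_measurable_LIMSEQ_metric)
  show "(\<lambda>\<eta>. \<Sum>j<N. integral (grid_cell t N j) D *v x (real j * t / real N) \<eta>) \<in> borel_measurable M" for N
    using t by (intro borel_measurable_sum borel_measurable_matrix_vector x_measurable) auto
  fix \<eta> assume \<eta>: "\<eta> \<in> space M"
  have "(\<lambda>N. \<Sum>j<N. integral (grid_cell t N j) (\<lambda>s. D s *v x (real j * t / real N) \<eta>))
      \<longlonglongrightarrow> integral {0..t} (\<lambda>s. D s *v x s \<eta>)"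
    by (rule riemann_tag_tendsto[OF bounded_bilinear.flip[OF bounded_bilinear_matrix_vector_mult] t _ D])
      (use grid_le[OF t] continuous_on_subset[OF x_continuous[OF \<eta>]] in auto)
  moreover have "(\<Sum>j<N. integral (grid_cell t N j) (\<lambda>s. D s *v x (real j * t / real N) \<eta>)) =
      (\<Sum>j<N. integral (grid_cell t N j) D *v x (real j * t / real N) \<eta>)" for N
    by (intro sum.cong refl integral_matrix_vector_const integrable_continuous_real
        continuous_on_subset[OF D grid_cell_subset[OF t]]) auto
  ultimately show "(\<lambda>N. \<Sum>j<N. integral (grid_cell t N j) D *v x (real j * t / real N) \<eta>)
      \<longlonglongrightarrow> integral {0..t} (\<lambda>s. D s *v x s \<eta>)" by simp
qed

lemma path_noise_measurable: "0 \<le> t \<Longrightarrow> path_noise t \<in> borel_measurable M"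
  unfolding path_noise_def
  by (intro borel_measurable_diff x_measurable X0 x_integral_measurable continuous_on_subset[OF drift_continuous]) auto

lemma noise_step_measurable: "0 \<le> t \<Longrightarrow> noise_step t N j \<in> borel_measurable M"
  unfolding noise_step_def
  by (intro borel_measurable_diff borel_measurable_matrix_vector brownian_measurable[OF B] brownian_measurable[OF W]) auto

lemma noise_approx_measurable: "0 \<le> t \<Longrightarrow> noise_approx t N \<in> borel_measurable M"
  unfolding noise_approx_def by (intro borel_measurable_sum noise_step_measurable)

lemma noise_part_measurable: "0 \<le> t \<Longrightarrow> noise_part t \<in> borel_measurable M"
  unfolding noise_part_def by (intro borel_measurable_diff borel_measurable_matrix_vector x_measurable X0)

lemma path_noise_0: "\<eta> \<in> space M \<Longrightarrow> path_noise 0 \<eta> = 0"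
  by (simp add: path_noise_def x_0)

text \<open>The innovation contains the integral of \<open>H x\<close>. Its sums \<open>R\<close>
  converge to \<open>I\<close> in probability by definition of the stochastic integral, while the
  sums \<open>Q\<close> of the \<open>H x\<close> part converge along every path. The noise
  increments are what remains when the second is removed from the first.\<close>

lemma noise_approx_tendsto:
  assumes t: "0 \<le> t"
  shows "(\<lambda>N. pdist M (noise_approx t N) (path_noise t)) \<longlonglongrightarrow> 0"
proof -
  define J where "J s \<eta> = integral {0..s} (\<lambda>r. H *v x r \<eta>) + G *v W s \<eta> - z s" for s \<eta>
  obtain I where I: "stoch_integral M K J t I"
    and eq: "AE \<eta> in M. x t \<eta> = X0 \<eta> + integral {0..t} (\<lambda>s. F *v x s \<eta>) + S *v B t \<eta> - I \<eta>"
    using equation[OF t] unfolding J_def by blast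
  have [measurable]: "I \<in> borel_measurable M" using I by (simp add: stoch_integral_def)
  define R where "R N \<eta> = (\<Sum>j<N. K (real j * t / real N) *v (J (real (Suc j) * t / real N) \<eta> - J (real j * t / real N) \<eta>))" for N \<eta>
  define Q where "Q N \<eta> = (\<Sum>j<N. K (real j * t / real N) *v integral (grid_cell t N j) (\<lambda>r. H *v x r \<eta>))" for N \<eta>
  define Q' where "Q' \<eta> = integral {0..t} (\<lambda>s. K s *v (H *v x s \<eta>))" for \<eta>
  have Hc: "continuous_on {0..s} (\<lambda>r. H *v x r \<eta>)" if "\<eta> \<in> space M" for \<eta> s
    by (intro matrix_continuous_intros continuous_on_subset[OF x_continuous[OF that]]) auto
  have incr: "integral {0..real (Suc j) * t / real N} (\<lambda>r. H *v x r \<eta>) - integral {0..real j * t / real N} (\<lambda>r. H *v x r \<eta>)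
      = integral (grid_cell t N j) (\<lambda>r. H *v x r \<eta>)" if "\<eta> \<in> space M" for j N \<eta>
  proof -
    have "integral {0..real j * t / real N} (\<lambda>r. H *v x r \<eta>) + integral (grid_cell t N j) (\<lambda>r. H *v x r \<eta>)
      = integral {0..real (Suc j) * t / real N} (\<lambda>r. H *v x r \<eta>)"
      by (rule Henstock_Kurzweil_Integration.integral_combine)
        (use t in \<open>auto intro!: grid_le integrable_continuous_real Hc that simp del: of_nat_Suc\<close>)
    then show ?thesis by (simp add: algebra_simps)
  qed
  have Jm: "0 \<le> s \<Longrightarrow> J s \<in> borel_measurable M" for s
    unfolding J_def
    by (intro borel_measurable_diff borel_measurable_add borel_measurable_matrix_vector brownian_measurable[OF W]
        x_integral_measurable) auto
  have Rm [measurable]: "R N \<in> borel_measurable M" for N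
    unfolding R_def using t by (intro borel_measurable_sum borel_measurable_matrix_vector borel_measurable_diff Jm) auto
  have iHm: "(\<lambda>\<eta>. integral (grid_cell t N j) (\<lambda>r. H *v x r \<eta>)) \<in> borel_measurable M" for N j
  proof -
    have "(\<lambda>\<eta>. integral {0..real (Suc j) * t / real N} (\<lambda>r. H *v x r \<eta>) - integral {0..real j * t / real N} (\<lambda>r. H *v x r \<eta>))
        \<in> borel_measurable M"
      using t by (intro borel_measurable_diff x_integral_measurable) auto
    then show ?thesis by (subst measurable_cong[OF incr[symmetric]]) auto
  qed
  have Qm [measurable]: "Q N \<in> borel_measurable M" for N
    unfolding Q_def by (intro borel_measurable_sum borel_measurable_matrix_vector iHm)
  have Q'm [measurable]: "Q' \<in> borel_measurable M"
    unfolding Q'_def matrix_vector_mul_assoc using t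
    by (intro x_integral_measurable matrix_continuous_intros continuous_on_subset[OF K]) auto
  have RI: "(\<lambda>N. pdist M (R N) I) \<longlonglongrightarrow> 0"
  proof (rule LIMSEQ_I)
    fix e :: real assume e: "0 < e"
    have "0 < e / 3" using e by simp
    obtain d where d: "0 < d" "\<forall>(n::nat) \<tau>. \<tau> 0 = 0 \<longrightarrow> \<tau> n = t \<longrightarrow> (\<forall>i<n. \<tau> i \<le> \<tau> (Suc i) \<and> \<tau> (Suc i) - \<tau> i < d) \<longrightarrow>
        measure M {\<eta> \<in> space M. norm ((\<Sum>i<n. K (\<tau> i) *v (J (\<tau> (Suc i)) \<eta> - J (\<tau> i) \<eta>)) - I \<eta>) > e / 3} < e / 3"
      using I[unfolded stoch_integral_def, THEN conjunct2, rule_format, OF \<open>0 < e / 3\<close>] by (elim exE conjE)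
    obtain n0 where n0: "\<And>N. n0 \<le> N \<Longrightarrow> t / real N < d"
      using eventually_grid_fine[OF d(1), of t] by (auto simp: eventually_sequentially)
    have "norm (pdist M (R N) I - 0) < e" if N: "max n0 1 \<le> N" for N
    proof -
      let ?\<tau> = "\<lambda>j. real j * t / real N"
      have "measure M {\<eta> \<in> space M. norm ((\<Sum>i<N. K (?\<tau> i) *v (J (?\<tau> (Suc i)) \<eta> - J (?\<tau> i) \<eta>)) - I \<eta>) > e / 3} < e / 3"
      proof (rule d(2)[rule_format])
        show "?\<tau> 0 = 0" by simp
        show "?\<tau> N = t" using N by simp
        show "?\<tau> i \<le> ?\<tau> (Suc i) \<and> ?\<tau> (Suc i) - ?\<tau> i < d" for i
          unfolding grid_width using n0[of N] N grid_le[OF t] by simp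
      qed
      then have "pdist M (R N) I \<le> 2 * (e / 3)"
        by (intro pdist_le_of_measure) (auto simp: R_def)
      then show ?thesis using e pdist_nonneg[of "R N" I] by simp
    qed
    then show "\<exists>no. \<forall>N\<ge>no. norm (pdist M (R N) I - 0) < e" by blast
  qed
  have QQ: "(\<lambda>N. pdist M (Q N) Q') \<longlonglongrightarrow> 0"
  proof (rule pdist_tendsto_AE)
    show "AE \<eta> in M. (\<lambda>N. Q N \<eta>) \<longlonglongrightarrow> Q' \<eta>"
    proof (rule AE_I2)
      fix \<eta> assume \<eta>: "\<eta> \<in> space M"
      have "(\<lambda>N. \<Sum>j<N. integral (grid_cell t N j) (\<lambda>s. K (real j * t / real N) *v (H *v x s \<eta>))) \<longlonglongrightarrow> Q' \<eta>"
        unfolding Q'_def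
        by (rule riemann_tag_tendsto[OF bounded_bilinear_matrix_vector_mult t])
          (use grid_le[OF t] Hc[OF \<eta>] continuous_on_subset[OF K] in auto)
      moreover have "(\<Sum>j<N. integral (grid_cell t N j) (\<lambda>s. K (real j * t / real N) *v (H *v x s \<eta>))) = Q N \<eta>" for N
        unfolding Q_def
        by (intro sum.cong refl integral_const_matrix_vector integrable_continuous_real
            continuous_on_subset[OF Hc[OF \<eta>] grid_cell_subset[OF t]]) auto
      ultimately show "(\<lambda>N. Q N \<eta>) \<longlonglongrightarrow> Q' \<eta>" by simp
    qed
  qed auto
  have approx: "noise_approx t N \<eta> = S *v B t \<eta> + (Q N \<eta> - R N \<eta>)" if N: "0 < N" and \<eta>: "\<eta> \<in> space M" for N \<eta>
  proof -
    have "(\<Sum>j<N. B (real (Suc j) * t / real N) \<eta> - B (real j * t / real N) \<eta>) = B t \<eta>"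
      using sum_lessThan_telescope[of "\<lambda>j. B (real j * t / real N) \<eta>" N] N B \<eta>
      by (simp add: brownian_motion_def del: of_nat_Suc)
    then have "S *v B t \<eta> = (\<Sum>j<N. S *v (B (real (Suc j) * t / real N) \<eta> - B (real j * t / real N) \<eta>))"
      by (simp add: mv.sum_right[symmetric])
    moreover have "Q N \<eta> - R N \<eta> = (\<Sum>j<N. - (K (real j * t / real N) *v (G *v (W (real (Suc j) * t / real N) \<eta> - W (real j * t / real N) \<eta>)
        - (z (real (Suc j) * t / real N) - z (real j * t / real N)))))"
      unfolding Q_def R_def sum_subtractf[symmetric]
    proof (rule sum.cong[OF refl])
      fix j
      have "J (real (Suc j) * t / real N) \<eta> - J (real j * t / real N) \<eta> = integral (grid_cell t N j) (\<lambda>r. H *v x r \<eta>) +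
          (G *v (W (real (Suc j) * t / real N) \<eta> - W (real j * t / real N) \<eta>) - (z (real (Suc j) * t / real N) - z (real j * t / real N)))"
        unfolding J_def incr[OF \<eta>, symmetric] by (simp add: mv.diff_right)
      then show "K (real j * t / real N) *v integral (grid_cell t N j) (\<lambda>r. H *v x r \<eta>) -
          K (real j * t / real N) *v (J (real (Suc j) * t / real N) \<eta> - J (real j * t / real N) \<eta>) =
          - (K (real j * t / real N) *v (G *v (W (real (Suc j) * t / real N) \<eta> - W (real j * t / real N) \<eta>)
            - (z (real (Suc j) * t / real N) - z (real j * t / real N))))"
        by (simp only: mv.add_right) simp
    qed
    ultimately show ?thesis
      unfolding noise_approx_def noise_step_def by (simp add: sum.distrib[symmetric] del: of_nat_Suc)
  qed
  have limit: "AE \<eta> in M. path_noise t \<eta> = S *v B t \<eta> + (Q' \<eta> - I \<eta>)"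
    using eq AE_space
  proof eventually_elim
    case (elim \<eta>)
    have xc: "continuous_on {0..t} (\<lambda>s. x s \<eta>)" by (rule continuous_on_subset[OF x_continuous[OF elim(2)]]) auto
    have Kc: "continuous_on {0..t} K" by (rule continuous_on_subset[OF K]) auto
    have "integral {0..t} (\<lambda>r. drift r *v x r \<eta>) = integral {0..t} (\<lambda>s. F *v x s \<eta>) - Q' \<eta>"
      unfolding Q'_def drift_def
      by (subst Henstock_Kurzweil_Integration.integral_diff[symmetric])
        (auto intro!: integrable_continuous_real matrix_continuous_intros xc Kc
          simp: matrix_vector_mult_diff_rdistrib matrix_vector_mul_assoc)
    then show ?case by (simp add: path_noise_def elim)
  qed
  have le: "pdist M (noise_approx t N) (path_noise t) \<le> pdist M (Q N) Q' + pdist M (R N) I" if "0 < N" for N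
  proof -
    have "AE \<eta> in M. noise_approx t N \<eta> - path_noise t \<eta> = (Q N \<eta> - R N \<eta>) - (Q' \<eta> - I \<eta>)"
      using limit AE_space by eventually_elim (simp add: approx[OF that])
    then have "pdist M (noise_approx t N) (path_noise t) = pdist M (\<lambda>\<eta>. Q N \<eta> - R N \<eta>) (\<lambda>\<eta>. Q' \<eta> - I \<eta>)"
      by (intro pdist_cong_AE noise_approx_measurable path_noise_measurable t) measurable
    also have "\<dots> \<le> pdist M (Q N) Q' + pdist M (R N) I" by (rule pdist_diff) auto
    finally show ?thesis .
  qed
  show ?thesis
  proof (rule Lim_null_comparison)
    show "(\<lambda>N. pdist M (Q N) Q' + pdist M (R N) I) \<longlonglongrightarrow> 0" using tendsto_add[OF QQ RI] by simp
    show "\<forall>\<^sub>F N in sequentially. norm (pdist M (noise_approx t N) (path_noise t)) \<le> pdist M (Q N) Q' + pdist M (R N) I"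
      using eventually_gt_at_top[of 0] by eventually_elim (use le in \<open>simp add: pdist_nonneg\<close>)
  qed
qed

text \<open>Summation by parts. Inserting the closed-loop equation, the sum of
  \<open>\<Theta>\<close> against the increments of \<open>path_noise\<close> telescopes to
  \<open>\<Theta> t x t - X0\<close> up to \<open>P m - Q m\<close>, and both of these converge to
  the same integral because the derivative of \<open>\<Theta>\<close> is minus
  \<open>\<Theta>\<close> times the drift matrix. No regularity of \<open>path_noise\<close> is
  used.\<close>

lemma path_sum_tendsto:
  assumes t: "0 \<le> t" and \<eta>: "\<eta> \<in> space M"
  shows "(\<lambda>m. \<Sum>i<m. (\<Phi> t ** \<Theta> (real i * t / real m)) *v (path_noise (real (Suc i) * t / real m) \<eta> - path_noise (real i * t / real m) \<eta>))
      \<longlonglongrightarrow> noise_part t \<eta>"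
proof -
  let ?x = "\<lambda>s. x s \<eta>"
  have xc: "continuous_on {0..s} ?x" for s by (rule continuous_on_subset[OF x_continuous[OF \<eta>]]) auto
  have Ac: "continuous_on {0..s} drift" for s by (rule continuous_on_subset[OF drift_continuous]) auto
  have Tc: "continuous_on {0..s} \<Theta>" for s by (rule continuous_on_subset[OF \<Theta>_continuous]) auto
  have Axi: "(\<lambda>r. drift r *v ?x r) integrable_on {0..s}" for s
    by (intro integrable_continuous_real matrix_continuous_intros xc Ac)
  define P where "P m = (\<Sum>i<m. integral (grid_cell t m i) (\<lambda>s. (\<Theta> s ** drift s) *v ?x (real (Suc i) * t / real m)))" for m
  define Q where "Q m = (\<Sum>i<m. integral (grid_cell t m i) (\<lambda>s. \<Theta> (real i * t / real m) *v (drift s *v ?x s)))" for m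
  have P: "P \<longlonglongrightarrow> integral {0..t} (\<lambda>s. (\<Theta> s ** drift s) *v ?x s)"
    unfolding P_def
    by (rule riemann_tag_tendsto[OF bounded_bilinear.flip[OF bounded_bilinear_matrix_vector_mult] t xc])
      (use grid_le[OF t] in \<open>auto intro!: matrix_continuous_intros Tc Ac simp del: of_nat_Suc\<close>)
  have Q: "Q \<longlonglongrightarrow> integral {0..t} (\<lambda>s. \<Theta> s *v (drift s *v ?x s))"
    unfolding Q_def
    by (rule riemann_tag_tendsto[OF bounded_bilinear_matrix_vector_mult t Tc])
      (use grid_le[OF t] in \<open>auto intro!: matrix_continuous_intros xc Ac simp del: of_nat_Suc\<close>)
  have PQ: "(\<lambda>m. P m - Q m) \<longlonglongrightarrow> 0"
    using tendsto_diff[OF P Q] by (simp add: matrix_vector_mul_assoc)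
  have sum: "(\<Sum>i<m. \<Theta> (real i * t / real m) *v (path_noise (real (Suc i) * t / real m) \<eta> - path_noise (real i * t / real m) \<eta>))
      = \<Theta> t *v ?x t - X0 \<eta> + (P m - Q m)" if m: "0 < m" for m
  proof -
    let ?s = "\<lambda>i. real i * t / real m"
    have step: "\<Theta> (?s i) *v (path_noise (?s (Suc i)) \<eta> - path_noise (?s i) \<eta>) =
        (\<Theta> (?s (Suc i)) *v ?x (?s (Suc i)) - \<Theta> (?s i) *v ?x (?s i))
        + (integral (grid_cell t m i) (\<lambda>s. (\<Theta> s ** drift s) *v ?x (?s (Suc i)))
           - integral (grid_cell t m i) (\<lambda>s. \<Theta> (?s i) *v (drift s *v ?x s)))" if i: "i < m" for i
    proof -
      have cell: "grid_cell t m i \<subseteq> {0..t}" by (rule grid_cell_subset[OF t i])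
      have s0: "0 \<le> ?s i" "?s i \<le> ?s (Suc i)" using t grid_le[OF t] by auto
      have "integral {0..?s i} (\<lambda>r. drift r *v ?x r) + integral (grid_cell t m i) (\<lambda>r. drift r *v ?x r)
          = integral {0..?s (Suc i)} (\<lambda>r. drift r *v ?x r)"
        by (rule Henstock_Kurzweil_Integration.integral_combine[OF s0 Axi])
      then have "path_noise (?s (Suc i)) \<eta> - path_noise (?s i) \<eta> = ?x (?s (Suc i)) - ?x (?s i)
          - integral (grid_cell t m i) (\<lambda>r. drift r *v ?x r)"
        by (simp add: path_noise_def algebra_simps del: of_nat_Suc)
      moreover have "\<Theta> (?s i) *v integral (grid_cell t m i) (\<lambda>r. drift r *v ?x r)
          = integral (grid_cell t m i) (\<lambda>s. \<Theta> (?s i) *v (drift s *v ?x s))"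
        by (rule integral_const_matrix_vector[symmetric, OF integrable_on_subinterval[OF Axi cell]])
      moreover have "((\<lambda>s. - (\<Theta> s ** drift s)) has_integral (\<Theta> (?s (Suc i)) - \<Theta> (?s i))) (grid_cell t m i)"
        using \<Theta>' s0 unfolding drift_def by (intro halfline_derivative_integral)
      then have "((\<lambda>s. \<Theta> s ** drift s) has_integral - (\<Theta> (?s (Suc i)) - \<Theta> (?s i))) (grid_cell t m i)"
        by (drule_tac has_integral_neg) simp
      then have "integral (grid_cell t m i) (\<lambda>s. (\<Theta> s ** drift s) *v ?x (?s (Suc i))) = - (\<Theta> (?s (Suc i)) - \<Theta> (?s i)) *v ?x (?s (Suc i))"
        by (subst integral_matrix_vector_const) (auto simp: integral_unique)
      ultimately show ?thesis
        by (simp add: mv.diff_right mv.diff_left mv.minus_left del: of_nat_Suc)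
    qed
    have "(\<Sum>i<m. \<Theta> (?s i) *v (path_noise (?s (Suc i)) \<eta> - path_noise (?s i) \<eta>)) =
        (\<Sum>i<m. \<Theta> (?s (Suc i)) *v ?x (?s (Suc i)) - \<Theta> (?s i) *v ?x (?s i)) + (P m - Q m)"
      unfolding P_def Q_def sum_subtractf[symmetric] sum.distrib[symmetric]
      by (intro sum.cong refl step) auto
    also have "(\<Sum>i<m. \<Theta> (?s (Suc i)) *v ?x (?s (Suc i)) - \<Theta> (?s i) *v ?x (?s i)) = \<Theta> t *v ?x t - X0 \<eta>"
      using sum_lessThan_telescope[of "\<lambda>i. \<Theta> (?s i) *v ?x (?s i)" m] m
      by (simp add: \<Theta>_0 x_0[OF \<eta>] del: of_nat_Suc)
    finally show ?thesis .
  qed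
  have "(\<lambda>m. \<Phi> t *v (\<Theta> t *v ?x t - X0 \<eta> + (P m - Q m))) \<longlonglongrightarrow> \<Phi> t *v (\<Theta> t *v ?x t - X0 \<eta> + 0)"
    by (intro mv.tendsto tendsto_intros PQ)
  also have "\<Phi> t *v (\<Theta> t *v ?x t - X0 \<eta> + 0) = noise_part t \<eta>"
    by (simp add: noise_part_def mv.diff_right matrix_vector_mul_assoc \<Phi>\<Theta>[OF t])
  finally have lim: "(\<lambda>m. \<Phi> t *v (\<Theta> t *v ?x t - X0 \<eta> + (P m - Q m))) \<longlonglongrightarrow> noise_part t \<eta>" .
  show ?thesis
  proof (rule Lim_transform_eventually[OF lim])
    show "\<forall>\<^sub>F m in sequentially. \<Phi> t *v (\<Theta> t *v ?x t - X0 \<eta> + (P m - Q m)) =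
      (\<Sum>i<m. (\<Phi> t ** \<Theta> (real i * t / real m)) *v (path_noise (real (Suc i) * t / real m) \<eta> - path_noise (real i * t / real m) \<eta>))"
      using eventually_gt_at_top[of 0]
    proof eventually_elim
      case (elim m)
      show ?case unfolding sum[OF elim, symmetric] by (simp add: mv.sum_right matrix_vector_mul_assoc del: of_nat_Suc)
    qed
  qed
qed

end

lemma norm_Pair_le_sum: "norm (a, b) \<le> norm a + norm b"
  using sqrt_sum_squares_le_sum[of "norm a" "norm b"] by (simp add: norm_Pair)

context filter_path begin

text \<open>Riemann sums of \<open>\<xi>\<^sub>t = \<integral>\<^sub>0\<^sup>t \<Phi>\<^sub>t \<Theta>\<^sub>s d(path_noise)\<^sub>s\<close> on two scales: \<open>\<Theta>\<close> is frozen on a coarse grid of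
  \<open>m\<close> cells, each split into \<open>k\<close> fine cells on which \<open>K\<close> is frozen. For fixed \<open>m\<close> the limit \<open>k \<rightarrow> \<infinity>\<close>
  recovers the increments of \<open>path_noise\<close>, for which only convergence in probability is available;
  then \<open>m \<rightarrow> \<infinity>\<close> is taken pathwise.\<close>

definition step_B :: "real \<Rightarrow> nat \<Rightarrow> nat \<Rightarrow> nat \<Rightarrow> real^'d^'d" where
  "step_B t m k j = \<Phi> t ** \<Theta> (real (j div k) * t / real m) ** S"

definition step_W :: "real \<Rightarrow> nat \<Rightarrow> nat \<Rightarrow> nat \<Rightarrow> real^'k^'d" where
  "step_W t m k j = - (\<Phi> t ** \<Theta> (real (j div k) * t / real m) ** K (real j * t / real (m * k)) ** G)"

definition step_z :: "real \<Rightarrow> nat \<Rightarrow> nat \<Rightarrow> real^'d" where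
  "step_z t m k = (\<Sum>j<m * k. (\<Phi> t ** \<Theta> (real (j div k) * t / real m) ** K (real j * t / real (m * k))) *v
     (z (real (Suc j) * t / real (m * k)) - z (real j * t / real (m * k))))"

definition full_step :: "real \<Rightarrow> nat \<Rightarrow> nat \<Rightarrow> 'p \<Rightarrow> real^'d" where
  "full_step t m k \<eta> = noise_sum B W (m * k) t (step_B t m k) (step_W t m k) \<eta> + step_z t m k"

lemma full_step_measurable: "0 \<le> t \<Longrightarrow> full_step t m k \<in> borel_measurable M"
  unfolding full_step_def by (intro borel_measurable_add noise_sum_measurable) auto

text \<open>A grid with \<open>i * k\<close> cells up to the coarse point of index \<open>i\<close>
  is an initial segment of the grid with \<open>m * k\<close> cells up to \<open>t\<close>.\<close>

lemma noise_approx_grid: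
  assumes "0 < m" "0 < k"
  shows "noise_approx (real i * t / real m) (i * k) \<eta> = (\<Sum>j<i * k. noise_step t (m * k) j \<eta>)"
proof (cases "i = 0")
  case False
  have eq: "real l * (real i * t / real m) / real (i * k) = real l * t / real (m * k)" for l
    using False assms by (simp add: field_simps)
  show ?thesis unfolding noise_approx_def noise_step_def eq ..
qed (simp add: noise_approx_def)

lemma full_step_eq:
  assumes "0 < m" "0 < k"
  shows "full_step t m k \<eta> = (\<Sum>i<m. (\<Phi> t ** \<Theta> (real i * t / real m)) *v
     (noise_approx (real (Suc i) * t / real m) (Suc i * k) \<eta> - noise_approx (real i * t / real m) (i * k) \<eta>))"
proof -
  have d: "noise_approx (real (Suc i) * t / real m) (Suc i * k) \<eta> - noise_approx (real i * t / real m) (i * k) \<eta>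
      = (\<Sum>j<k. noise_step t (m * k) (i * k + j) \<eta>)" for i
    unfolding noise_approx_grid[OF assms] sum_lessThan_mult_div by simp
  have "(\<Sum>i<m. (\<Phi> t ** \<Theta> (real i * t / real m)) *v
     (noise_approx (real (Suc i) * t / real m) (Suc i * k) \<eta> - noise_approx (real i * t / real m) (i * k) \<eta>))
     = (\<Sum>i<m. \<Sum>j<k. (\<Phi> t ** \<Theta> (real ((i * k + j) div k) * t / real m)) *v noise_step t (m * k) (i * k + j) \<eta>)"
    unfolding d by (intro sum.cong refl) (simp add: mv.sum_right)
  also have "\<dots> = (\<Sum>j<m * k. (\<Phi> t ** \<Theta> (real (j div k) * t / real m)) *v noise_step t (m * k) j \<eta>)"
    by (rule sum_lessThan_mult_div[symmetric])
  also have "\<dots> = full_step t m k \<eta>"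
    unfolding full_step_def noise_sum_def step_z_def sum.distrib[symmetric]
  proof (rule sum.cong[OF refl])
    fix j
    show "(\<Phi> t ** \<Theta> (real (j div k) * t / real m)) *v noise_step t (m * k) j \<eta> =
      step_B t m k j *v (B (real (Suc j) * t / real (m * k)) \<eta> - B (real j * t / real (m * k)) \<eta>) +
      step_W t m k j *v (W (real (Suc j) * t / real (m * k)) \<eta> - W (real j * t / real (m * k)) \<eta>) +
      (\<Phi> t ** \<Theta> (real (j div k) * t / real m) ** K (real j * t / real (m * k))) *v
        (z (real (Suc j) * t / real (m * k)) - z (real j * t / real (m * k)))"
      unfolding noise_step_def step_B_def step_W_def
      by (simp add: mv.diff_right mv.add_right mv.minus_left matrix_vector_mul_assoc matrix_mul_assoc del: of_nat_Suc of_nat_mult)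
  qed
  finally show ?thesis by simp
qed

lemma noise_approx_tendsto_multiple:
  assumes t: "0 \<le> t" and m: "0 < m"
  shows "(\<lambda>k. pdist M (noise_approx (real i * t / real m) (i * k)) (path_noise (real i * t / real m))) \<longlonglongrightarrow> 0"
proof (cases "i = 0")
  \<comment> \<open>Only for positive \<open>i\<close> are the multiples of \<open>i\<close> a
    subsequence; at \<open>i = 0\<close> both random variables vanish.\<close>
  case True
  have "pdist M (noise_approx 0 0) (path_noise 0) = expectation (\<lambda>_. 0)"
    unfolding pdist_def by (rule Bochner_Integration.integral_cong) (simp_all add: noise_approx_def path_noise_0)
  with True show ?thesis by simp
next
  case False
  have "strict_mono (\<lambda>k. i * k)" using False by (auto simp: strict_mono_def)
  from LIMSEQ_subseq_LIMSEQ[OF noise_approx_tendsto this, of "real i * t / real m"] t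
  show ?thesis by (simp add: o_def)
qed

text \<open>The order of quantifiers reflects the two limits: the number of fine cells needed
  depends on the coarse grid, because finitely many limits in probability are combined with factors
  depending on \<open>m\<close>.\<close>

lemma full_step_approx:
  assumes t: "0 \<le> t" and e: "0 < e"
  shows "\<exists>m0. \<forall>m\<ge>m0. \<exists>k0. \<forall>k\<ge>k0. pdist M (full_step t m k) (noise_part t) < e"
proof -
  define V where "V m \<eta> = (\<Sum>i<m. (\<Phi> t ** \<Theta> (real i * t / real m)) *v
     (path_noise (real (Suc i) * t / real m) \<eta> - path_noise (real i * t / real m) \<eta>))" for m \<eta>
  have s0: "0 \<le> real i * t / real m" for i m using t by simp
  have pm: "path_noise (real i * t / real m) \<in> borel_measurable M" for i m by (rule path_noise_measurable[OF s0])
  have am: "noise_approx (real i * t / real m) N \<in> borel_measurable M" for i m N by (rule noise_approx_measurable[OF s0])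
  have Vm: "V m \<in> borel_measurable M" for m
    unfolding V_def by (intro borel_measurable_sum borel_measurable_matrix_vector borel_measurable_diff pm)
  have "(\<lambda>m. pdist M (V m) (noise_part t)) \<longlonglongrightarrow> 0"
    using path_sum_tendsto[OF t] by (intro pdist_tendsto_AE Vm noise_part_measurable t AE_I2) (simp add: V_def)
  then have "\<forall>\<^sub>F m in sequentially. pdist M (V m) (noise_part t) < e / 2"
    by (rule order_tendstoD) (use e in simp)
  then obtain m0 where m0: "\<And>m. m0 \<le> m \<Longrightarrow> pdist M (V m) (noise_part t) < e / 2"
    by (auto simp: eventually_sequentially)
  have "\<exists>k0. \<forall>k\<ge>k0. pdist M (full_step t m k) (noise_part t) < e" if mm: "max m0 1 \<le> m" for m
  proof -
    have m: "0 < m" using mm by simp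
    define a where "a i = max 1 (onorm ((*v) (\<Phi> t ** \<Theta> (real i * t / real m))))" for i
    define q where "q i k = pdist M (noise_approx (real i * t / real m) (i * k)) (path_noise (real i * t / real m))" for i k
    have UV: "pdist M (full_step t m k) (V m) \<le> (\<Sum>i<m. a i * (q (Suc i) k + q i k))" if k: "0 < k" for k
    proof -
      have "pdist M (full_step t m k) (V m) \<le> (\<Sum>i<m. pdist M (\<lambda>\<eta>. (\<Phi> t ** \<Theta> (real i * t / real m)) *v
         (noise_approx (real (Suc i) * t / real m) (Suc i * k) \<eta> - noise_approx (real i * t / real m) (i * k) \<eta>))
         (\<lambda>\<eta>. (\<Phi> t ** \<Theta> (real i * t / real m)) *v
           (path_noise (real (Suc i) * t / real m) \<eta> - path_noise (real i * t / real m) \<eta>)))"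
        unfolding full_step_eq[OF m k, abs_def] V_def[abs_def]
        by (intro pdist_sum borel_measurable_matrix_vector borel_measurable_diff pm am) auto
      also have "\<dots> \<le> (\<Sum>i<m. a i * (q (Suc i) k + q i k))"
      proof (rule sum_mono)
        fix i
        have "pdist M (\<lambda>\<eta>. (\<Phi> t ** \<Theta> (real i * t / real m)) *v
         (noise_approx (real (Suc i) * t / real m) (Suc i * k) \<eta> - noise_approx (real i * t / real m) (i * k) \<eta>))
         (\<lambda>\<eta>. (\<Phi> t ** \<Theta> (real i * t / real m)) *v
           (path_noise (real (Suc i) * t / real m) \<eta> - path_noise (real i * t / real m) \<eta>))
         \<le> a i * pdist M (\<lambda>\<eta>. noise_approx (real (Suc i) * t / real m) (Suc i * k) \<eta> - noise_approx (real i * t / real m) (i * k) \<eta>)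
            (\<lambda>\<eta>. path_noise (real (Suc i) * t / real m) \<eta> - path_noise (real i * t / real m) \<eta>)"
          unfolding a_def by (intro pdist_matrix_vector borel_measurable_diff pm am)
        also have "\<dots> \<le> a i * (q (Suc i) k + q i k)"
          unfolding q_def by (intro mult_left_mono pdist_diff pm am) (simp add: a_def)
        finally show "pdist M (\<lambda>\<eta>. (\<Phi> t ** \<Theta> (real i * t / real m)) *v
         (noise_approx (real (Suc i) * t / real m) (Suc i * k) \<eta> - noise_approx (real i * t / real m) (i * k) \<eta>))
         (\<lambda>\<eta>. (\<Phi> t ** \<Theta> (real i * t / real m)) *v
           (path_noise (real (Suc i) * t / real m) \<eta> - path_noise (real i * t / real m) \<eta>)) \<le> a i * (q (Suc i) k + q i k)" .
      qed
      finally show ?thesis .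
    qed
    have q0: "q i \<longlonglongrightarrow> 0" for i unfolding q_def by (rule noise_approx_tendsto_multiple[OF t m])
    have "(\<lambda>k. \<Sum>i<m. a i * (q (Suc i) k + q i k)) \<longlonglongrightarrow> (\<Sum>i<m. a i * (0 + 0))"
      by (intro tendsto_intros q0)
    then have "(\<lambda>k. \<Sum>i<m. a i * (q (Suc i) k + q i k)) \<longlonglongrightarrow> 0" by simp
    then have "\<forall>\<^sub>F k in sequentially. (\<Sum>i<m. a i * (q (Suc i) k + q i k)) < e / 2"
      by (rule order_tendstoD) (use e in simp)
    then obtain k0 where k0: "\<And>k. k0 \<le> k \<Longrightarrow> (\<Sum>i<m. a i * (q (Suc i) k + q i k)) < e / 2"
      by (auto simp: eventually_sequentially)
    have "pdist M (full_step t m k) (noise_part t) < e" if k: "max k0 1 \<le> k" for k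
    proof -
      have "pdist M (full_step t m k) (noise_part t) \<le> pdist M (full_step t m k) (V m) + pdist M (V m) (noise_part t)"
        by (intro pdist_triangle Vm full_step_measurable noise_part_measurable t)
      moreover have "pdist M (full_step t m k) (V m) < e / 2" using UV[of k] k0[of k] k by simp
      moreover have "pdist M (V m) (noise_part t) < e / 2" using m0[of m] mm by simp
      ultimately show ?thesis by simp
    qed
    then show ?thesis by blast
  qed
  then show ?thesis by blast
qed

text \<open>The bound is uniform in \<open>k\<close>: both evaluation points and \<open>s\<close>
  lie in one coarse cell, so its width alone controls the error. A diagonal choice of
  \<open>k\<close> is therefore harmless for the variance.\<close>

lemma step_close:
  assumes t: "0 \<le> t" and e: "0 < e"
  shows "\<exists>m0. \<forall>m\<ge>m0. \<forall>k>0. \<forall>j<m * k. \<forall>s\<in>grid_cell t (m * k) j.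
    norm (step_B t m k j - \<Phi> t ** \<Theta> s ** S) \<le> e \<and> norm (step_W t m k j - (- (\<Phi> t ** \<Theta> s ** K s ** G))) \<le> e"
proof -
  have Tc: "continuous_on {0..t} \<Theta>" by (rule continuous_on_subset[OF \<Theta>_continuous]) auto
  have Kc: "continuous_on {0..t} K" by (rule continuous_on_subset[OF K]) auto
  define p where "p s = \<Phi> t ** \<Theta> s ** S" for s
  define r where "r y = - (\<Phi> t ** \<Theta> (fst y) ** K (snd y) ** G)" for y
  obtain d1 where d1: "0 < d1" "\<And>s s'. s \<in> {0..t} \<Longrightarrow> s' \<in> {0..t} \<Longrightarrow> \<bar>s - s'\<bar> < d1 \<Longrightarrow> dist (p s) (p s') < e"
    by (rule uniform_modulus[of t p e]) (auto simp: p_def intro!: matrix_continuous_intros Tc e)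
  have "continuous_on ({0..t} \<times> {0..t}) r"
    unfolding r_def
    by (intro mm.continuous_on continuous_on_minus continuous_on_const
        continuous_on_compose2[OF Tc continuous_on_fst[OF continuous_on_id]]
        continuous_on_compose2[OF Kc continuous_on_snd[OF continuous_on_id]]) auto
  then have "uniformly_continuous_on ({0..t} \<times> {0..t}) r"
    by (intro compact_uniformly_continuous compact_Times) auto
  then have "\<exists>d>0. \<forall>x\<in>{0..t} \<times> {0..t}. \<forall>x'\<in>{0..t} \<times> {0..t}. dist x' x < d \<longrightarrow> dist (r x') (r x) < e"
    using e unfolding uniformly_continuous_on_def by blast
  then obtain d2 where d2: "0 < d2" "\<And>x x'. x \<in> {0..t} \<times> {0..t} \<Longrightarrow> x' \<in> {0..t} \<times> {0..t} \<Longrightarrow> dist x' x < d2 \<Longrightarrow> dist (r x') (r x) < e"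
    by blast
  \<comment> \<open>The arguments of \<open>\<Theta>\<close> and \<open>K\<close> in
    \<open>r\<close> move separately, so each gets half of the modulus.\<close>
  have "0 < min d1 (d2 / 2)" using d1 d2 by simp
  from eventually_grid_fine[OF this, of t] obtain m0 where m0: "\<And>m. m0 \<le> m \<Longrightarrow> t / real m < min d1 (d2 / 2)"
    by (auto simp: eventually_sequentially)
  have "norm (step_B t m k j - p s) \<le> e \<and> norm (step_W t m k j - r (s, s)) \<le> e"
    if m: "max m0 1 \<le> m" and k: "0 < k" and j: "j < m * k" and s: "s \<in> grid_cell t (m * k) j" for m k j s
  proof -
    have m0': "0 < m" using m by simp
    let ?a = "real (j div k) * t / real m" and ?b = "real j * t / real (m * k)"
    have cell: "s \<in> grid_cell t m (j div k)" by (rule subsetD[OF grid_cell_refine[OF t m0' k] s])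
    have b: "?b \<in> grid_cell t (m * k) j" using grid_le[OF t, of j "m * k"] by (simp del: of_nat_Suc of_nat_mult)
    have b': "?b \<in> grid_cell t m (j div k)" by (rule subsetD[OF grid_cell_refine[OF t m0' k] b])
    have a: "?a \<in> grid_cell t m (j div k)" using grid_le[OF t, of "j div k" m] by simp
    have jd: "j div k < m" by (rule div_less_grid[OF j])
    have mem: "s \<in> {0..t}" "?a \<in> {0..t}" "?b \<in> {0..t}"
      using grid_cell_subset[OF t jd] cell a b' by blast+
    have w: "\<bar>u - v\<bar> < min d1 (d2 / 2)" if "u \<in> grid_cell t m (j div k)" "v \<in> grid_cell t m (j div k)" for u v
    proof -
      have "\<bar>u - v\<bar> \<le> t / real m" using that grid_width[of "j div k" t m] by (auto simp: abs_le_iff simp del: of_nat_Suc)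
      also have "\<dots> < min d1 (d2 / 2)" using m0[of m] m by simp
      finally show ?thesis .
    qed
    have "dist (p ?a) (p s) < e" using d1(2)[OF mem(2,1)] w[OF a cell] by simp
    moreover have "dist (?a, ?b) (s, s) < d2"
    proof -
      have "dist (?a, ?b) (s, s) \<le> \<bar>?a - s\<bar> + \<bar>?b - s\<bar>"
        using norm_Pair_le_sum[of "?a - s" "?b - s"] by (simp add: dist_norm del: of_nat_mult)
      then show ?thesis using w[OF a cell] w[OF b' cell] by simp
    qed
    then have "dist (r (?a, ?b)) (r (s, s)) < e" using mem by (intro d2(2)) auto
    ultimately show ?thesis
      by (simp add: step_B_def step_W_def p_def r_def dist_norm less_imp_le del: of_nat_mult)
  qed
  then show ?thesis unfolding p_def r_def fst_conv snd_conv by blast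
qed

text \<open>A diagonal sequence of grids: \<open>n < m n\<close> forces the coarse mesh to zero, and
  geometric errors are summable, which upgrades convergence in probability to almost sure
  convergence.\<close>

context
  fixes t :: real and m k :: "nat \<Rightarrow> nat"
  assumes t: "0 \<le> t" and m: "\<And>n. n < m n" and k: "\<And>n. 0 < k n"
    and approx: "\<And>n. pdist M (full_step t (m n) (k n)) (noise_part t) < (1 / 2) ^ n"
begin

lemma mk_pos: "0 < m n * k n"
  using m[of n] k[of n] by simp

lemma full_step_pdist_tendsto: "(\<lambda>n. pdist M (full_step t (m n) (k n)) (noise_part t)) \<longlonglongrightarrow> 0"
  by (rule Lim_null_comparison[of _ "\<lambda>n. (1 / 2) ^ n"])
    (use approx in \<open>auto simp: pdist_nonneg less_imp_le intro!: always_eventually LIMSEQ_realpow_zero\<close>)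

text \<open>Each approximation is built from the Brownian motions and constants, hence independent
  of \<open>X0\<close>, and independence passes to the limit.\<close>

lemma X0_noise_part_law:
  "distr M (borel \<Otimes>\<^sub>M borel) (\<lambda>\<eta>. (X0 \<eta>, noise_part t \<eta>)) = distr M borel X0 \<Otimes>\<^sub>M distr M borel (noise_part t)"
proof (rule joint_law_limit)
  show "prob_space M" by (rule prob_space_axioms)
  show "distr M (borel \<Otimes>\<^sub>M borel) (\<lambda>\<eta>. (X0 \<eta>, full_step t (m n) (k n) \<eta>)) =
      distr M borel X0 \<Otimes>\<^sub>M noise_law (m n * k n) t (step_B t (m n) (k n)) (step_W t (m n) (k n)) (step_z t (m n) (k n))" for n
    unfolding full_step_def by (rule noise_sum_law(1)[OF t mk_pos])
  show "noise_law (m n * k n) t (step_B t (m n) (k n)) (step_W t (m n) (k n)) (step_z t (m n) (k n)) =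
      distr M borel (full_step t (m n) (k n))" for n
    unfolding full_step_def[abs_def] by (rule noise_sum_law(2)[OF t mk_pos, symmetric])
qed (auto intro: full_step_pdist_tendsto full_step_measurable noise_part_measurable t)

text \<open>The observation path contributes only the constants \<open>step_z\<close>, so
  \<open>L2_limit_with_drift\<close> identifies the variance as the limit of the centred
  sums.\<close>

lemma noise_part_variance:
  fixes v :: "real^'d"
  defines "\<xi> \<equiv> \<lambda>\<eta>. v \<bullet> noise_part t \<eta>"
  shows "integrable M \<xi>" "integrable M (\<lambda>\<eta>. (\<xi> \<eta> - expectation \<xi>)\<^sup>2)"
    "expectation (\<lambda>\<eta>. (\<xi> \<eta> - expectation \<xi>)\<^sup>2) =
      integral {0..t} (\<lambda>s. (norm (transpose (\<Phi> t ** \<Theta> s ** S) *v v))\<^sup>2 + (norm (transpose (- (\<Phi> t ** \<Theta> s ** K s ** G)) *v v))\<^sup>2)"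
proof -
  have Tc: "continuous_on {0..t} \<Theta>" by (rule continuous_on_subset[OF \<Theta>_continuous]) auto
  have Kc: "continuous_on {0..t} K" by (rule continuous_on_subset[OF K]) auto
  let ?P = "\<lambda>n. step_B t (m n) (k n)" and ?R = "\<lambda>n. step_W t (m n) (k n)" and ?N = "\<lambda>n. m n * k n"
  let ?Pf = "\<lambda>s. \<Phi> t ** \<Theta> s ** S" and ?Rf = "\<lambda>s. - (\<Phi> t ** \<Theta> s ** K s ** G)"
  define T where "T n \<eta> = v \<bullet> noise_sum B W (?N n) t (?P n) (?R n) \<eta>" for n \<eta>
  have Pc: "continuous_on {0..t} ?Pf" "continuous_on {0..t} ?Rf" by (intro matrix_continuous_intros Tc Kc)+
  have close: "\<exists>n0. \<forall>n\<ge>n0. \<forall>j<?N n. \<forall>s\<in>grid_cell t (?N n) j. norm (?P n j - ?Pf s) \<le> e \<and> norm (?R n j - ?Rf s) \<le> e"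
    if e: "0 < e" for e
  proof -
    obtain m0 where m0: "\<forall>m\<ge>m0. \<forall>k>0. \<forall>j<m * k. \<forall>s\<in>grid_cell t (m * k) j.
      norm (step_B t m k j - ?Pf s) \<le> e \<and> norm (step_W t m k j - ?Rf s) \<le> e"
      using step_close[OF t e] by blast
    have "\<forall>j<?N n. \<forall>s\<in>grid_cell t (?N n) j. norm (?P n j - ?Pf s) \<le> e \<and> norm (?R n j - ?Rf s) \<le> e" if "m0 \<le> n" for n
      using m0[rule_format, of "m n" "k n"] m[of n] k[of n] that by auto
    then show ?thesis by blast
  qed
  note lim = noise_sum_step_limit[OF t mk_pos Pc close, where v = v, folded T_def]
  have "AE \<eta> in M. (\<lambda>n. full_step t (m n) (k n) \<eta>) \<longlonglongrightarrow> noise_part t \<eta>"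
  proof (rule pdist_summable_AE_tendsto)
    show "summable (\<lambda>n. pdist M (full_step t (m n) (k n)) (noise_part t))"
      by (rule summable_comparison_test'[where g = "\<lambda>n. (1 / 2 :: real) ^ n" and N = 0])
        (use approx in \<open>auto simp: pdist_nonneg less_imp_le intro!: summable_geometric\<close>)
  qed (auto intro: full_step_measurable noise_part_measurable t)
  then have ae: "AE \<eta> in M. (\<lambda>n. T n \<eta> + v \<bullet> step_z t (m n) (k n)) \<longlonglongrightarrow> \<xi> \<eta>"
  proof eventually_elim
    case (elim \<eta>)
    then have "(\<lambda>n. v \<bullet> full_step t (m n) (k n) \<eta>) \<longlonglongrightarrow> \<xi> \<eta>" unfolding \<xi>_def by (intro tendsto_intros)
    then show ?case by (simp add: full_step_def T_def inner_add_right)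
  qed
  have Tm: "T n \<in> borel_measurable M" for n
    unfolding T_def by (intro borel_measurable_inner borel_measurable_const noise_sum_measurable t)
  have \<xi>m: "\<xi> \<in> borel_measurable M"
    unfolding \<xi>_def by (intro borel_measurable_inner borel_measurable_const noise_part_measurable t)
  have T2: "integrable M (\<lambda>\<eta>. (T n \<eta>)\<^sup>2)" "expectation (T n) = 0" for n
    unfolding T_def using noise_sum_moments(2,3)[OF t mk_pos] by auto
  note res = L2_limit_with_drift[OF Tm \<xi>m T2 lim(1) lim(2) ae lim(3)]
  show "integrable M \<xi>" by (rule res(1))
  show "integrable M (\<lambda>\<eta>. (\<xi> \<eta> - expectation \<xi>)\<^sup>2)" by (rule res(2))
  show "expectation (\<lambda>\<eta>. (\<xi> \<eta> - expectation \<xi>)\<^sup>2) =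
      integral {0..t} (\<lambda>s. (norm (transpose (?Pf s) *v v))\<^sup>2 + (norm (transpose (?Rf s) *v v))\<^sup>2)" by (rule res(3))
qed

end

end

section \<open>The Riccati equation\<close>

text \<open>Positive definiteness is part of the notion, so that symmetry for uniqueness and
  positivity for \<open>beta_c\<close> come with it.\<close>

definition riccati_solution ::
  "real^'d^'d \<Rightarrow> real^'d^'k \<Rightarrow> real^'k^'k \<Rightarrow> real^'d^'d \<Rightarrow> (real \<Rightarrow> real^'d^'d) \<Rightarrow> bool" where
  "riccati_solution F H \<Gamma> \<Sigma> C \<longleftrightarrow>
     (C hhd (\<lambda>t. F ** C t + C t ** transpose F + \<Sigma> - C t ** transpose H ** matrix_inv \<Gamma> ** H ** C t)) \<and>
     (\<forall>t\<ge>0. pos_def (C t))"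

lemma transpose_add: "transpose (A + B) = transpose A + transpose (B :: 'a::semigroup_add^'n^'m)"
  by (simp add: transpose_def vec_eq_iff)

text \<open>The difference of two solutions satisfies a linear equation with the two closed-loop
  matrices on its two sides. Conjugating it by the corresponding inverse flows gives a constant
  matrix, which is zero initially; no Lipschitz bound is involved.\<close>

lemma riccati_solution_unique:
  fixes F \<Sigma> :: "real^'d^'d" and H :: "real^'d^'k"
  assumes \<Gamma>: "pos_def \<Gamma>" and 1: "riccati_solution F H \<Gamma> \<Sigma> C\<^sub>1" and 2: "riccati_solution F H \<Gamma> \<Sigma> C\<^sub>2"
    and eq0: "C\<^sub>1 0 = C\<^sub>2 0" and t: "0 \<le> t"
  shows "C\<^sub>1 t = C\<^sub>2 t"
proof -
  define N where "N = transpose H ** matrix_inv \<Gamma> ** H"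
  have N: "transpose N = N"
    using pos_def_matrix_inv[OF \<Gamma>] by (simp add: N_def matrix_transpose_mul matrix_mul_assoc pos_def_def)
  have sym: "transpose (C\<^sub>1 s) = C\<^sub>1 s" "transpose (C\<^sub>2 s) = C\<^sub>2 s" if "0 \<le> s" for s
    using 1 2 that by (auto simp: riccati_solution_def pos_def_def)
  define f where "f C = F ** C + C ** transpose F + \<Sigma> - C ** N ** C" for C :: "real^'d^'d"
  have f: "F ** C + C ** transpose F + \<Sigma> - C ** transpose H ** matrix_inv \<Gamma> ** H ** C = f C" for C
    by (simp add: f_def N_def matrix_mul_assoc)
  have d: "C\<^sub>1 hhd (\<lambda>t. f (C\<^sub>1 t))" "C\<^sub>2 hhd (\<lambda>t. f (C\<^sub>2 t))" using 1 2 unfolding riccati_solution_def f by auto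
  note c = halfline_derivative_continuous[OF d(1)] halfline_derivative_continuous[OF d(2)]
  define A\<^sub>1 where "A\<^sub>1 t = F - C\<^sub>1 t ** N" for t
  define A\<^sub>2 where "A\<^sub>2 t = F - C\<^sub>2 t ** N" for t
  have "continuous_on {0..} A\<^sub>1" "continuous_on {0..} A\<^sub>2"
    unfolding A\<^sub>1_def A\<^sub>2_def by (intro matrix_continuous_intros c)+
  note A = this
  obtain \<Phi>\<^sub>1 \<Theta>\<^sub>1 where f\<Theta>1: "\<Phi>\<^sub>1 0 = mat 1" "\<Theta>\<^sub>1 0 = mat 1" "\<Phi>\<^sub>1 hhd (\<lambda>t. A\<^sub>1 t ** \<Phi>\<^sub>1 t)"
    "\<Theta>\<^sub>1 hhd (\<lambda>t. - (\<Theta>\<^sub>1 t ** A\<^sub>1 t))" "\<And>t. 0 \<le> t \<Longrightarrow> \<Theta>\<^sub>1 t ** \<Phi>\<^sub>1 t = mat 1"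
    "\<And>t. 0 \<le> t \<Longrightarrow> \<Phi>\<^sub>1 t ** \<Theta>\<^sub>1 t = mat 1"
  proof (rule fundamental_solution[OF A(1)], goal_cases)
    case (1 \<Phi> \<Theta>)
    show ?case by (rule that[of \<Phi> \<Theta>]) (fact 1)+
  qed
  note \<Theta>1 = f\<Theta>1(4) f\<Theta>1(6)[OF t]
  obtain \<Phi>\<^sub>2 \<Theta>\<^sub>2 where f\<Theta>2: "\<Phi>\<^sub>2 0 = mat 1" "\<Theta>\<^sub>2 0 = mat 1" "\<Phi>\<^sub>2 hhd (\<lambda>t. A\<^sub>2 t ** \<Phi>\<^sub>2 t)"
    "\<Theta>\<^sub>2 hhd (\<lambda>t. - (\<Theta>\<^sub>2 t ** A\<^sub>2 t))" "\<And>t. 0 \<le> t \<Longrightarrow> \<Theta>\<^sub>2 t ** \<Phi>\<^sub>2 t = mat 1"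
    "\<And>t. 0 \<le> t \<Longrightarrow> \<Phi>\<^sub>2 t ** \<Theta>\<^sub>2 t = mat 1"
  proof (rule fundamental_solution[OF A(2)], goal_cases)
    case (1 \<Phi> \<Theta>)
    show ?case by (rule that[of \<Phi> \<Theta>]) (fact 1)+
  qed
  note \<Theta>2 = f\<Theta>2(4) f\<Theta>2(6)[OF t]
  define E where "E s = \<Theta>\<^sub>1 s ** ((C\<^sub>1 s - C\<^sub>2 s) ** transpose (\<Theta>\<^sub>2 s))" for s
  have "E hhd (\<lambda>_. 0)"
  proof (intro allI impI)
    fix s :: real assume s: "0 \<le> s"
    \<comment> \<open>The mixed product \<open>C\<^sub>1 N C\<^sub>2\<close> is subtracted by the
      left factor and restored by the right one.\<close>
    have dd: "f (C\<^sub>1 s) - f (C\<^sub>2 s) = A\<^sub>1 s ** (C\<^sub>1 s - C\<^sub>2 s) + (C\<^sub>1 s - C\<^sub>2 s) ** transpose (A\<^sub>2 s)"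
      using sym[OF s] N
      by (simp add: f_def A\<^sub>1_def A\<^sub>2_def matrix_transpose_mul mm.diff_left mm.diff_right
          transpose_diff matrix_mul_assoc)
    have "((\<lambda>s. C\<^sub>1 s - C\<^sub>2 s) has_vector_derivative (f (C\<^sub>1 s) - f (C\<^sub>2 s))) (at s within {0..})"
      using d s by (intro has_vector_derivative_diff) auto
    moreover have "((\<lambda>s. transpose (\<Theta>\<^sub>2 s)) has_vector_derivative transpose (- (\<Theta>\<^sub>2 s ** A\<^sub>2 s))) (at s within {0..})"
      using \<Theta>2 s by (intro bounded_linear.has_vector_derivative[OF bounded_linear_transpose]) auto
    moreover have "(\<Theta>\<^sub>1 has_vector_derivative - (\<Theta>\<^sub>1 s ** A\<^sub>1 s)) (at s within {0..})" using \<Theta>1 s by auto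
    ultimately have "(E has_vector_derivative
       \<Theta>\<^sub>1 s ** ((C\<^sub>1 s - C\<^sub>2 s) ** transpose (- (\<Theta>\<^sub>2 s ** A\<^sub>2 s)) + (f (C\<^sub>1 s) - f (C\<^sub>2 s)) ** transpose (\<Theta>\<^sub>2 s))
       + - (\<Theta>\<^sub>1 s ** A\<^sub>1 s) ** ((C\<^sub>1 s - C\<^sub>2 s) ** transpose (\<Theta>\<^sub>2 s))) (at s within {0..})"
      unfolding E_def by (intro mm.has_vector_derivative)
    also have "\<Theta>\<^sub>1 s ** ((C\<^sub>1 s - C\<^sub>2 s) ** transpose (- (\<Theta>\<^sub>2 s ** A\<^sub>2 s)) + (f (C\<^sub>1 s) - f (C\<^sub>2 s)) ** transpose (\<Theta>\<^sub>2 s))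
       + - (\<Theta>\<^sub>1 s ** A\<^sub>1 s) ** ((C\<^sub>1 s - C\<^sub>2 s) ** transpose (\<Theta>\<^sub>2 s)) = 0"
      unfolding dd
      by (simp add: transpose_minus matrix_transpose_mul mm.minus_left mm.minus_right mm.add_left mm.add_right matrix_mul_assoc)
    finally show "(E has_vector_derivative 0) (at s within {0..})" .
  qed
  from halfline_derivative_zero[OF this t] have E0: "E t = 0" by (simp add: E_def eq0 mm.zero_left mm.zero_right)
  have "\<Phi>\<^sub>1 t ** E t ** transpose (\<Phi>\<^sub>2 t) = (\<Phi>\<^sub>1 t ** \<Theta>\<^sub>1 t) ** (C\<^sub>1 t - C\<^sub>2 t) ** transpose (\<Phi>\<^sub>2 t ** \<Theta>\<^sub>2 t)"
    by (simp add: E_def matrix_mul_assoc matrix_transpose_mul)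
  then show ?thesis using \<Theta>1(2) \<Theta>2(2) E0 by (simp add: mm.zero_left mm.zero_right)
qed

text \<open>The stabilizing gain \<open>L\<close> of detectability is suboptimal, so the covariance
  it would produce, with source \<open>\<Sigma> + L \<Gamma> L\<^sup>T\<close>, dominates
  \<open>C\<close>. An upper bound for \<open>C\<close> and a lower bound for
  \<open>\<Sigma>\<close> bound the quotient \<open>beta_c\<close> from below. The constant depends
  on the solution only through its initial value.\<close>

lemma riccati_beta_lower_bound:
  fixes F \<Sigma> C\<^sub>0 :: "real^'d^'d" and H :: "real^'d^'k"
  assumes "c_detectable H F" and \<Sigma>: "pos_def \<Sigma>" and \<Gamma>: "pos_def \<Gamma>"
  shows "\<exists>b>0. \<forall>C. riccati_solution F H \<Gamma> \<Sigma> C \<longrightarrow> C 0 = C\<^sub>0 \<longrightarrow> (\<forall>t\<ge>0. b \<le> beta_c H \<Gamma> \<Sigma> (C t))"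
proof -
  obtain L :: "real^'k^'d" where L: "\<And>c. c \<in> eigenvalues (complex_matrix (F - L ** H)) \<Longrightarrow> Re c < 0"
    using assms(1) unfolding c_detectable_def by blast
  define Q where "Q = \<Sigma> + L ** \<Gamma> ** transpose L"
  obtain k where k: "0 < k" "\<And>w. w \<bullet> (Q *v w) \<le> k * (w \<bullet> w)" using form_le_norm[of Q] by blast
  obtain c where c: "0 < c" "\<And>w. w \<bullet> (C\<^sub>0 *v w) \<le> c * (w \<bullet> w)" using form_le_norm[of C\<^sub>0] by blast
  obtain s where s: "0 < s" "\<And>w. s * (w \<bullet> w) \<le> w \<bullet> (\<Sigma> *v w)" using pos_def_bounded_below[OF \<Sigma>] by blast
  have "\<exists>b>0. \<forall>C C'. (C hhd C') \<longrightarrow> (\<forall>t\<ge>0. transpose (C t) = C t)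
    \<longrightarrow> (\<forall>t\<ge>0. \<forall>w. w \<bullet> (C' t *v w) \<le> 2 * (w \<bullet> ((F - L ** H) *v (C t *v w))) + k * (w \<bullet> w))
    \<longrightarrow> (\<forall>w. w \<bullet> (C 0 *v w) \<le> c * (w \<bullet> w)) \<longrightarrow> (\<forall>t\<ge>0. \<forall>w. w \<bullet> (C t *v w) \<le> b * (w \<bullet> w))"
    by (rule lyapunov_upper_bound) (use L k(1) c(1) in auto)
  then obtain b where b: "0 < b" and ub: "\<forall>C C'. (C hhd C') \<longrightarrow> (\<forall>t\<ge>0. transpose (C t) = C t)
    \<longrightarrow> (\<forall>t\<ge>0. \<forall>w. w \<bullet> (C' t *v w) \<le> 2 * (w \<bullet> ((F - L ** H) *v (C t *v w))) + k * (w \<bullet> w))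
    \<longrightarrow> (\<forall>w. w \<bullet> (C 0 *v w) \<le> c * (w \<bullet> w)) \<longrightarrow> (\<forall>t\<ge>0. \<forall>w. w \<bullet> (C t *v w) \<le> b * (w \<bullet> w))"
    by (elim exE conjE)
  have "s / b \<le> beta_c H \<Gamma> \<Sigma> (C t)" if C: "riccati_solution F H \<Gamma> \<Sigma> C" and C0: "C 0 = C\<^sub>0" and t: "0 \<le> t" for C t
  proof -
    let ?f = "\<lambda>t. F ** C t + C t ** transpose F + \<Sigma> - C t ** transpose H ** matrix_inv \<Gamma> ** H ** C t"
    have pd: "pos_def (C t)" if "0 \<le> t" for t using C that by (simp add: riccati_solution_def)
    then have sym: "transpose (C t) = C t" if "0 \<le> t" for t using that by (simp add: pos_def_def)
    have G: "transpose (matrix_inv \<Gamma>) = matrix_inv \<Gamma>" using pos_def_matrix_inv[OF \<Gamma>] by (simp add: pos_def_def)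
    have le: "w \<bullet> (?f t *v w) \<le> 2 * (w \<bullet> ((F - L ** H) *v (C t *v w))) + k * (w \<bullet> w)" if t: "0 \<le> t" for t w
    proof -
      define u where "u = H *v (C t *v w)"
      define y where "y = transpose L *v w"
      define p where "p = matrix_inv \<Gamma> *v u"
      have \<Gamma>p: "\<Gamma> *v p = u"
        using matrix_inv_left_right(2)[OF pos_def_invertible[OF \<Gamma>]] by (simp add: p_def matrix_vector_mul_assoc)
      have \<Gamma>s: "transpose \<Gamma> = \<Gamma>" using \<Gamma> by (simp add: pos_def_def)
      have FC: "w \<bullet> ((C t ** transpose F) *v w) = w \<bullet> ((F ** C t) *v w)"
        using inner_matrix_transpose[of w "C t ** transpose F" w] sym[OF t]
        by (simp add: matrix_transpose_mul inner_commute)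
      have CNC: "w \<bullet> ((C t ** transpose H ** matrix_inv \<Gamma> ** H ** C t) *v w) = u \<bullet> p"
      proof -
        have "w \<bullet> ((C t ** transpose H ** matrix_inv \<Gamma> ** H ** C t) *v w) = w \<bullet> ((C t ** transpose H) *v p)"
          by (simp add: p_def u_def matrix_vector_mul_assoc matrix_mul_assoc)
        also have "\<dots> = (transpose (C t ** transpose H) *v w) \<bullet> p" by (rule inner_matrix_transpose)
        also have "transpose (C t ** transpose H) *v w = u" by (simp add: matrix_transpose_mul sym[OF t] u_def matrix_vector_mul_assoc)
        finally show ?thesis .
      qed
      have Lyu: "w \<bullet> ((L ** H) *v (C t *v w)) = y \<bullet> u"
        using inner_matrix_transpose[of w L u] by (simp add: u_def y_def matrix_vector_mul_assoc matrix_mul_assoc)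
      have LGL: "w \<bullet> ((L ** \<Gamma> ** transpose L) *v w) = y \<bullet> (\<Gamma> *v y)"
        using inner_matrix_transpose[of w L "\<Gamma> *v y"] by (simp add: y_def matrix_vector_mul_assoc matrix_mul_assoc)
      \<comment> \<open>The square of the difference of the optimal and the constant gain, tested at
        \<open>w\<close>, trades the quadratic term \<open>u \<bullet> p\<close> for the term
        \<open>2 * (y \<bullet> u)\<close>, which is linear in \<open>C\<close>.\<close>
      have "0 \<le> (p - y) \<bullet> (\<Gamma> *v (p - y))" using pos_def_imp_semidef[OF \<Gamma>] by (simp add: pos_semidef_def)
      also have "\<dots> = u \<bullet> p - 2 * (y \<bullet> u) + y \<bullet> (\<Gamma> *v y)"
        using inner_symmetric_matrix[OF \<Gamma>s, of p y] by (simp add: mv.diff_right inner_diff_left inner_diff_right \<Gamma>p inner_commute)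
      finally have sq: "0 \<le> u \<bullet> p - 2 * (y \<bullet> u) + y \<bullet> (\<Gamma> *v y)" .
      have "w \<bullet> (?f t *v w) = 2 * (w \<bullet> (F *v (C t *v w))) + w \<bullet> (\<Sigma> *v w) - u \<bullet> p"
        using FC CNC by (simp add: mv.diff_left mv.add_left inner_diff_right inner_add_right matrix_vector_mul_assoc)
      also have "\<dots> \<le> 2 * (w \<bullet> ((F - L ** H) *v (C t *v w))) + (w \<bullet> (\<Sigma> *v w) + y \<bullet> (\<Gamma> *v y))"
        using sq Lyu by (simp add: mv.diff_left inner_diff_right)
      also have "w \<bullet> (\<Sigma> *v w) + y \<bullet> (\<Gamma> *v y) = w \<bullet> (Q *v w)" by (simp add: Q_def mv.add_left inner_add_right LGL)
      also have "w \<bullet> (Q *v w) \<le> k * (w \<bullet> w)" by (rule k)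
      finally show ?thesis by simp
    qed
    have h: "C hhd ?f" "\<forall>t\<ge>0. transpose (C t) = C t"
      "\<forall>t\<ge>0. \<forall>w. w \<bullet> (?f t *v w) \<le> 2 * (w \<bullet> ((F - L ** H) *v (C t *v w))) + k * (w \<bullet> w)"
      "\<forall>w. w \<bullet> (C 0 *v w) \<le> c * (w \<bullet> w)"
      using C sym le c C0 by (auto simp: riccati_solution_def)
    have Cb: "w \<bullet> (C t *v w) \<le> b * (w \<bullet> w)" for w
      using ub[THEN spec[of _ C], THEN spec[of _ ?f], THEN mp, OF h(1), THEN mp, OF h(2), THEN mp, OF h(3), THEN mp, OF h(4)] t
      by blast
    show ?thesis by (rule beta_c_ge[OF pd[OF t] \<Gamma> \<Sigma> s(2) Cb s(1) b])
  qed
  moreover have "0 < s / b" using s b by simp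
  ultimately show ?thesis by blast
qed

text \<open>The covariance in its variation of constants form; \<open>\<Phi>\<close> is the flow of the closed-loop matrix
  \<open>F - K H\<close> with the Kalman gain \<open>K\<close> of \<open>C\<close>, and \<open>\<Theta>\<close> is its inverse.\<close>

locale covariance_flow =
  fixes F \<Sigma> :: "real^'d^'d" and H :: "real^'d^'k" and \<Gamma> :: "real^'k^'k"
    and C \<Phi> \<Theta> :: "real \<Rightarrow> real^'d^'d"
  assumes \<Sigma>: "pos_def \<Sigma>" and \<Gamma>: "pos_def \<Gamma>" and C_continuous: "continuous_on {0..} C"
    and C_sym: "\<And>t. 0 \<le> t \<Longrightarrow> transpose (C t) = C t" and C0: "pos_def (C 0)"
    and \<Phi>0: "\<Phi> 0 = mat 1" and \<Theta>0: "\<Theta> 0 = mat 1"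
    and \<Phi>': "\<Phi> hhd (\<lambda>t. (F - kalman_gain H \<Gamma> (C t) ** H) ** \<Phi> t)"
    and \<Theta>': "\<Theta> hhd (\<lambda>t. - (\<Theta> t ** (F - kalman_gain H \<Gamma> (C t) ** H)))"
    and \<Theta>\<Phi>: "\<And>t. 0 \<le> t \<Longrightarrow> \<Theta> t ** \<Phi> t = mat 1" and \<Phi>\<Theta>: "\<And>t. 0 \<le> t \<Longrightarrow> \<Phi> t ** \<Theta> t = mat 1"
    and C_form: "\<And>t a. 0 \<le> t \<Longrightarrow> a \<bullet> (C t *v a) = (transpose (\<Phi> t) *v a) \<bullet> (C 0 *v (transpose (\<Phi> t) *v a))
      + integral {0..t} (\<lambda>s. (norm (transpose (\<Phi> t ** \<Theta> s ** sqrtm \<Sigma>) *v a))\<^sup>2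
        + (norm (transpose (- (\<Phi> t ** \<Theta> s ** kalman_gain H \<Gamma> (C s) ** sqrtm \<Gamma>)) *v a))\<^sup>2)"
begin

text \<open>The instantaneous covariance of the noise in the closed-loop equation,
  \<open>\<Sigma> + K \<Gamma> K\<^sup>T\<close> for the Kalman gain.\<close>

definition noise_cov :: "real \<Rightarrow> real^'d^'d" where
  "noise_cov s = \<Sigma> + C s ** transpose H ** matrix_inv \<Gamma> ** H ** C s"

text \<open>The covariance carried back to time 0, \<open>\<Theta> C \<Theta>\<^sup>T\<close>. Its
  derivative contains no drift, so it can only grow from \<open>C 0\<close>, and this supplies the
  uniform lower bound needed to differentiate its inverse.\<close>

definition pullback_cov :: "real \<Rightarrow> real^'d^'d" where
  "pullback_cov t = C 0 + integral {0..t} (\<lambda>s. \<Theta> s ** noise_cov s ** transpose (\<Theta> s))"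

lemma noise_cov_continuous: "continuous_on {0..} noise_cov"
  unfolding noise_cov_def by (intro matrix_continuous_intros C_continuous)

lemma \<Theta>_continuous: "continuous_on {0..} \<Theta>"
  by (rule halfline_derivative_continuous[OF \<Theta>'])

lemma pullback_integrand_continuous: "continuous_on {0..} (\<lambda>s. \<Theta> s ** noise_cov s ** transpose (\<Theta> s))"
  by (intro matrix_continuous_intros noise_cov_continuous \<Theta>_continuous)

lemma pullback_cov_derivative: "pullback_cov hhd (\<lambda>s. \<Theta> s ** noise_cov s ** transpose (\<Theta> s))"
  unfolding pullback_cov_def using integral_has_halfline_derivative[OF pullback_integrand_continuous]
  by (auto intro!: derivative_eq_intros)

lemma norm_square_sqrtm: 
  fixes A :: "real^'m^'m"
  assumes "pos_semidef A" shows "(norm (transpose (P ** sqrtm A) *v b))\<^sup>2 = (transpose P *v b) \<bullet> (A *v (transpose P *v b))"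
proof -
  define y where "y = transpose P *v b"
  have "transpose (P ** sqrtm A) *v b = sqrtm A *v y"
    by (simp add: matrix_transpose_mul transpose_sqrtm[OF assms] y_def matrix_vector_mul_assoc)
  then have "(norm (transpose (P ** sqrtm A) *v b))\<^sup>2 = y \<bullet> (sqrtm A *v (sqrtm A *v y))"
    by (simp add: power2_norm_eq_inner inner_symmetric_matrix[OF transpose_sqrtm[OF assms]])
  then show ?thesis by (simp add: matrix_vector_mul_assoc[of "sqrtm A" "sqrtm A"] sqrtm(2)[OF assms] y_def)
qed

lemma noise_cov_sym: "0 \<le> s \<Longrightarrow> transpose (noise_cov s) = noise_cov s"
  using \<Sigma> pos_def_matrix_inv[OF \<Gamma>] C_sym[of s]
  by (simp add: noise_cov_def transpose_add matrix_transpose_mul pos_def_def matrix_mul_assoc)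

lemma noise_cov_nonneg: "0 \<le> s \<Longrightarrow> 0 \<le> b \<bullet> (noise_cov s *v b)"
  using gain_form_nonneg[OF \<Gamma> C_sym, of s b H] pos_def_imp_semidef[OF \<Sigma>]
  by (simp add: noise_cov_def mv.add_left inner_add_right pos_semidef_def)

text \<open>For the Kalman gain \<open>K \<Gamma> K\<^sup>T\<close> equals
  \<open>C H\<^sup>T \<Gamma>\<^sup>-\<^sup>1 H C\<close>; the square roots disappear because only
  squared norms occur.\<close>

lemma integrand_eq:
  assumes s: "0 \<le> s"
  shows "(norm (transpose (\<Phi> t ** \<Theta> s ** sqrtm \<Sigma>) *v a))\<^sup>2
        + (norm (transpose (- (\<Phi> t ** \<Theta> s ** kalman_gain H \<Gamma> (C s) ** sqrtm \<Gamma>)) *v a))\<^sup>2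
      = (transpose (\<Phi> t) *v a) \<bullet> ((\<Theta> s ** noise_cov s ** transpose (\<Theta> s)) *v (transpose (\<Phi> t) *v a))"
proof -
  define b where "b = transpose (\<Theta> s) *v (transpose (\<Phi> t) *v a)"
  have b: "transpose (\<Phi> t ** \<Theta> s) *v a = b" by (simp add: b_def matrix_transpose_mul matrix_vector_mul_assoc)
  have G: "transpose (matrix_inv \<Gamma>) = matrix_inv \<Gamma>" using pos_def_matrix_inv[OF \<Gamma>] by (simp add: pos_def_def)
  have inv: "matrix_inv \<Gamma> ** \<Gamma> = mat 1" by (rule matrix_inv_left_right(1)[OF pos_def_invertible[OF \<Gamma>]])
  let ?K = "kalman_gain H \<Gamma> (C s)"
  have KGK: "?K ** \<Gamma> ** transpose ?K = C s ** transpose H ** matrix_inv \<Gamma> ** H ** C s"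
  proof -
    have "?K ** \<Gamma> ** transpose ?K = C s ** transpose H ** (matrix_inv \<Gamma> ** \<Gamma>) ** (matrix_inv \<Gamma> ** H ** C s)"
      using C_sym[OF s] G by (simp add: kalman_gain_def matrix_transpose_mul matrix_mul_assoc)
    then show ?thesis by (simp add: inv matrix_mul_assoc)
  qed
  have "(norm (transpose (- (\<Phi> t ** \<Theta> s ** ?K ** sqrtm \<Gamma>)) *v a))\<^sup>2 = (norm (transpose ((\<Phi> t ** \<Theta> s ** ?K) ** sqrtm \<Gamma>) *v a))\<^sup>2"
    by (simp add: transpose_minus mv.minus_left)
  also have "\<dots> = (transpose (\<Phi> t ** \<Theta> s ** ?K) *v a) \<bullet> (\<Gamma> *v (transpose (\<Phi> t ** \<Theta> s ** ?K) *v a))"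
    by (rule norm_square_sqrtm[OF pos_def_imp_semidef[OF \<Gamma>]])
  also have "transpose (\<Phi> t ** \<Theta> s ** ?K) *v a = transpose ?K *v b"
    unfolding b[symmetric] by (simp add: matrix_transpose_mul matrix_vector_mul_assoc matrix_mul_assoc)
  also have "(transpose ?K *v b) \<bullet> (\<Gamma> *v (transpose ?K *v b)) = b \<bullet> ((?K ** \<Gamma> ** transpose ?K) *v b)"
    using inner_matrix_transpose[of b ?K "\<Gamma> *v (transpose ?K *v b)"] by (simp add: matrix_vector_mul_assoc matrix_mul_assoc)
  finally have 2: "(norm (transpose (- (\<Phi> t ** \<Theta> s ** ?K ** sqrtm \<Gamma>)) *v a))\<^sup>2
      = b \<bullet> ((C s ** transpose H ** matrix_inv \<Gamma> ** H ** C s) *v b)" by (simp only: KGK)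
  have 1: "(norm (transpose (\<Phi> t ** \<Theta> s ** sqrtm \<Sigma>) *v a))\<^sup>2 = b \<bullet> (\<Sigma> *v b)"
    unfolding norm_square_sqrtm[OF pos_def_imp_semidef[OF \<Sigma>]] b ..
  have "(transpose (\<Phi> t) *v a) \<bullet> ((\<Theta> s ** noise_cov s ** transpose (\<Theta> s)) *v (transpose (\<Phi> t) *v a)) = b \<bullet> (noise_cov s *v b)"
    using inner_matrix_transpose[of "transpose (\<Phi> t) *v a" "\<Theta> s" "noise_cov s *v b"]
    by (simp add: b_def matrix_vector_mul_assoc matrix_mul_assoc)
  then show ?thesis by (simp add: 1 2 noise_cov_def mv.add_left inner_add_right)
qed

lemma integral_form:
  fixes N :: "real \<Rightarrow> real^'d^'d"
  assumes "continuous_on {0..t} N"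
  shows "integral {0..t} (\<lambda>s. y \<bullet> (N s *v y)) = y \<bullet> (integral {0..t} N *v y)"
proof -
  have "bounded_linear (\<lambda>A :: real^'d^'d. y \<bullet> (A *v y))"
    by (intro bounded_linear_compose[OF bounded_linear_inner_right mv.bounded_linear_left])
  from integral_linear[OF integrable_continuous_real[OF assms] this] show ?thesis by (simp add: o_def)
qed

lemma C_form': "0 \<le> t \<Longrightarrow> a \<bullet> (C t *v a) = (transpose (\<Phi> t) *v a) \<bullet> (pullback_cov t *v (transpose (\<Phi> t) *v a))"
proof -
  assume t: "0 \<le> t"
  have "integral {0..t} (\<lambda>s. (norm (transpose (\<Phi> t ** \<Theta> s ** sqrtm \<Sigma>) *v a))\<^sup>2
        + (norm (transpose (- (\<Phi> t ** \<Theta> s ** kalman_gain H \<Gamma> (C s) ** sqrtm \<Gamma>)) *v a))\<^sup>2)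
      = integral {0..t} (\<lambda>s. (transpose (\<Phi> t) *v a) \<bullet> ((\<Theta> s ** noise_cov s ** transpose (\<Theta> s)) *v (transpose (\<Phi> t) *v a)))"
    by (intro integral_cong integrand_eq) auto
  also have "\<dots> = (transpose (\<Phi> t) *v a) \<bullet> (integral {0..t} (\<lambda>s. \<Theta> s ** noise_cov s ** transpose (\<Theta> s)) *v (transpose (\<Phi> t) *v a))"
    by (intro integral_form continuous_on_subset[OF pullback_integrand_continuous]) auto
  finally show ?thesis
    unfolding C_form[OF t] pullback_cov_def by (simp add: mv.add_left inner_add_right)
qed

lemma pullback_cov_sym: "0 \<le> t \<Longrightarrow> transpose (pullback_cov t) = pullback_cov t"
proof -
  assume t: "0 \<le> t"
  have "transpose (integral {0..t} (\<lambda>s. \<Theta> s ** noise_cov s ** transpose (\<Theta> s)))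
      = integral {0..t} (\<lambda>s. transpose (\<Theta> s ** noise_cov s ** transpose (\<Theta> s)))"
    using integral_linear[OF integrable_continuous_real bounded_linear_transpose, of 0 t "\<lambda>s. \<Theta> s ** noise_cov s ** transpose (\<Theta> s)"]
      continuous_on_subset[OF pullback_integrand_continuous, of "{0..t}"] by (simp add: o_def)
  also have "\<dots> = integral {0..t} (\<lambda>s. \<Theta> s ** noise_cov s ** transpose (\<Theta> s))"
    by (intro integral_cong) (simp add: matrix_transpose_mul noise_cov_sym matrix_mul_assoc)
  finally show ?thesis using C_sym[of 0] by (simp add: pullback_cov_def transpose_add)
qed

lemma pullback_cov_ge: "0 \<le> t \<Longrightarrow> y \<bullet> (C 0 *v y) \<le> y \<bullet> (pullback_cov t *v y)"
proof -
  assume t: "0 \<le> t"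
  have "0 \<le> integral {0..t} (\<lambda>s. y \<bullet> ((\<Theta> s ** noise_cov s ** transpose (\<Theta> s)) *v y))"
  proof (rule integral_nonneg)
    show "(\<lambda>s. y \<bullet> ((\<Theta> s ** noise_cov s ** transpose (\<Theta> s)) *v y)) integrable_on {0..t}"
      by (intro integrable_continuous_real matrix_continuous_intros
          continuous_on_subset[OF noise_cov_continuous] continuous_on_subset[OF \<Theta>_continuous]) auto
    fix s assume "s \<in> {0..t}"
    then have "0 \<le> (transpose (\<Theta> s) *v y) \<bullet> (noise_cov s *v (transpose (\<Theta> s) *v y))" by (intro noise_cov_nonneg) auto
    then show "0 \<le> y \<bullet> ((\<Theta> s ** noise_cov s ** transpose (\<Theta> s)) *v y)"
      using inner_matrix_transpose[of y "\<Theta> s" "noise_cov s *v (transpose (\<Theta> s) *v y)"]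
      by (simp add: matrix_vector_mul_assoc matrix_mul_assoc)
  qed
  also have "\<dots> = y \<bullet> (integral {0..t} (\<lambda>s. \<Theta> s ** noise_cov s ** transpose (\<Theta> s)) *v y)"
    by (intro integral_form continuous_on_subset[OF pullback_integrand_continuous]) auto
  finally show ?thesis by (simp add: pullback_cov_def mv.add_left inner_add_right)
qed

lemma C_eq: "0 \<le> t \<Longrightarrow> C t = \<Phi> t ** pullback_cov t ** transpose (\<Phi> t)"
proof (rule symmetric_matrix_eqI)
  assume t: "0 \<le> t"
  show "transpose (C t) = C t" by (rule C_sym[OF t])
  show "transpose (\<Phi> t ** pullback_cov t ** transpose (\<Phi> t)) = \<Phi> t ** pullback_cov t ** transpose (\<Phi> t)"
    by (simp add: matrix_transpose_mul pullback_cov_sym[OF t] matrix_mul_assoc)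
  fix a
  show "a \<bullet> (C t *v a) = a \<bullet> ((\<Phi> t ** pullback_cov t ** transpose (\<Phi> t)) *v a)"
    using inner_matrix_transpose[of a "\<Phi> t" "pullback_cov t *v (transpose (\<Phi> t) *v a)"]
    by (simp add: C_form'[OF t] matrix_vector_mul_assoc matrix_mul_assoc)
qed

text \<open>The form of \<open>C\<close> at \<open>a\<close> is that of \<open>pullback_cov\<close>
  at \<open>\<Phi>\<^sup>T a\<close>, which is nonzero by invertibility of the flow.\<close>

lemma C_pos_def: "0 \<le> t \<Longrightarrow> pos_def (C t)"
  unfolding pos_def_def
proof (intro conjI allI impI)
  assume t: "0 \<le> t"
  show "transpose (C t) = C t" by (rule C_sym[OF t])
  fix a :: "real^'d" assume "a \<noteq> 0"
  have "transpose (\<Theta> t) *v (transpose (\<Phi> t) *v a) = a"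
    using \<Phi>\<Theta>[OF t] by (simp add: matrix_vector_mul_assoc matrix_transpose_mul[symmetric])
  then have "transpose (\<Phi> t) *v a \<noteq> 0" using \<open>a \<noteq> 0\<close> by auto
  then have "0 < (transpose (\<Phi> t) *v a) \<bullet> (C 0 *v (transpose (\<Phi> t) *v a))" using C0 unfolding pos_def_def by blast
  also have "\<dots> \<le> a \<bullet> (C t *v a)" unfolding C_form'[OF t] by (rule pullback_cov_ge[OF t])
  finally show "0 < a \<bullet> (C t *v a)" .
qed

text \<open>In the product rule the closed-loop drift contributes the quadratic gain term twice with
  a minus sign and \<open>noise_cov\<close> gives it back once.\<close>

lemma C_riccati: "riccati_solution F H \<Gamma> \<Sigma> C"
  unfolding riccati_solution_def
proof (intro conjI allI impI)
  fix t :: real assume t: "0 \<le> t"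
  show "pos_def (C t)" by (rule C_pos_def[OF t])
  let ?A = "F - kalman_gain H \<Gamma> (C t) ** H"
  have "((\<lambda>t. transpose (\<Phi> t)) has_vector_derivative transpose (?A ** \<Phi> t)) (at t within {0..})"
    using \<Phi>' t by (intro bounded_linear.has_vector_derivative[OF bounded_linear_transpose]) auto
  moreover have "(\<Phi> has_vector_derivative ?A ** \<Phi> t) (at t within {0..})" using \<Phi>' t by auto
  moreover have "(pullback_cov has_vector_derivative \<Theta> t ** noise_cov t ** transpose (\<Theta> t)) (at t within {0..})"
    using pullback_cov_derivative t by auto
  ultimately have "((\<lambda>t. \<Phi> t ** pullback_cov t ** transpose (\<Phi> t)) has_vector_derivative
     (\<Phi> t ** pullback_cov t ** transpose (?A ** \<Phi> t) +
      (\<Phi> t ** (\<Theta> t ** noise_cov t ** transpose (\<Theta> t)) + (?A ** \<Phi> t) ** pullback_cov t) ** transpose (\<Phi> t))) (at t within {0..})"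
    by (intro mm.has_vector_derivative)
  also have "(\<Phi> t ** pullback_cov t ** transpose (?A ** \<Phi> t) +
      (\<Phi> t ** (\<Theta> t ** noise_cov t ** transpose (\<Theta> t)) + (?A ** \<Phi> t) ** pullback_cov t) ** transpose (\<Phi> t))
     = C t ** transpose ?A + (\<Phi> t ** \<Theta> t) ** noise_cov t ** transpose (\<Phi> t ** \<Theta> t) + ?A ** C t"
    by (simp add: C_eq[OF t] matrix_transpose_mul matrix_mul_assoc matrix_add_rdistrib)
  also have "\<dots> = F ** C t + C t ** transpose F + \<Sigma> - C t ** transpose H ** matrix_inv \<Gamma> ** H ** C t"
    using pos_def_matrix_inv[OF \<Gamma>] C_sym[OF t]
    by (simp add: \<Phi>\<Theta>[OF t] noise_cov_def kalman_gain_def transpose_diff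
        matrix_transpose_mul mm.diff_left mm.diff_right pos_def_def matrix_mul_assoc)
  finally show "(C has_vector_derivative F ** C t + C t ** transpose F + \<Sigma> - C t ** transpose H ** matrix_inv \<Gamma> ** H ** C t) (at t within {0..})"
    by (rule has_vector_derivative_transform[rotated 2]) (use t C_eq in auto)
qed

lemma beta_c_continuous: "continuous_on {0..} (\<lambda>t. beta_c H \<Gamma> \<Sigma> (C t))"
  by (rule min_quotient_continuous[OF C_continuous noise_cov_continuous C_pos_def])
    (use beta_c_pos_def[OF C_pos_def \<Gamma> \<Sigma>, where H = H] in \<open>auto simp: noise_cov_def\<close>)

text \<open>The weighted square of \<open>\<Phi> v\<close> is the form of the inverse of
  \<open>pullback_cov\<close> at the fixed vector \<open>v\<close>. Its rate of decrease is the
  \<open>noise_cov\<close> form at \<open>w = C\<^sup>-\<^sup>1 \<Phi> v\<close>, which the Rayleigh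
  description of \<open>beta_c\<close> compares with the \<open>C\<close> form at \<open>w\<close>,
  that is, with the weighted square itself.\<close>

lemma weighted_contraction:
  assumes t: "0 \<le> t"
  shows "wnorm_sq (C t) (\<Phi> t *v v) \<le> exp (- integral {0..t} (\<lambda>s. beta_c H \<Gamma> \<Sigma> (C s))) * wnorm_sq (C 0) v"
proof -
  obtain l where l: "0 < l" "\<And>w. l * (w \<bullet> w) \<le> w \<bullet> (C 0 *v w)" using pos_def_bounded_below[OF C0] by blast
  have lM: "l * (w \<bullet> w) \<le> w \<bullet> (pullback_cov s *v w)" if "0 \<le> s" for s w
    using l(2) pullback_cov_ge[OF that] by (rule order_trans)
  have pd: "pos_def (pullback_cov s)" if s: "0 \<le> s" for s
    unfolding pos_def_def
  proof (intro conjI allI impI)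
    show "transpose (pullback_cov s) = pullback_cov s" by (rule pullback_cov_sym[OF s])
    fix w :: "real^'d" assume "w \<noteq> 0"
    then have "0 < l * (w \<bullet> w)" using l by simp
    also have "\<dots> \<le> w \<bullet> (pullback_cov s *v w)" by (rule lM[OF s])
    finally show "0 < w \<bullet> (pullback_cov s *v w)" .
  qed
  define x where "x s = matrix_inv (pullback_cov s) *v v" for s
  have x: "pullback_cov s *v x s = v" if "0 \<le> s" for s
    using matrix_inv_left_right(2)[OF pos_def_invertible[OF pd[OF that]]] by (simp add: x_def matrix_vector_mul_assoc)
  define w where "w s = transpose (\<Theta> s) *v x s" for s
  have Cw: "C s *v w s = \<Phi> s *v v" if s: "0 \<le> s" for s
  proof -
    have "C s *v w s = \<Phi> s *v (pullback_cov s *v (transpose (\<Theta> s ** \<Phi> s) *v x s))"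
      unfolding C_eq[OF s] w_def by (simp add: matrix_vector_mul_assoc matrix_mul_assoc matrix_transpose_mul)
    then show ?thesis by (simp add: \<Theta>\<Phi>[OF s] x[OF s])
  qed
  have wCw: "w s \<bullet> (C s *v w s) = v \<bullet> x s" if s: "0 \<le> s" for s
  proof -
    have "w s \<bullet> (C s *v w s) = w s \<bullet> (\<Phi> s *v v)" by (simp only: Cw[OF s])
    also have "\<dots> = x s \<bullet> (\<Theta> s *v (\<Phi> s *v v))" unfolding w_def by (rule inner_matrix_transpose[symmetric])
    also have "\<dots> = v \<bullet> x s" by (simp add: matrix_vector_mul_assoc \<Theta>\<Phi>[OF s] inner_commute)
    finally show ?thesis .
  qed
  have wn: "wnorm_sq (C s) (\<Phi> s *v v) = v \<bullet> x s" if s: "0 \<le> s" for s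
  proof -
    have "matrix_inv (C s) *v (\<Phi> s *v v) = w s"
      unfolding Cw[OF s, symmetric] using matrix_inv_left_right(1)[OF pos_def_invertible[OF C_pos_def[OF s]]]
      by (simp add: matrix_vector_mul_assoc)
    then show ?thesis using wCw[OF s] by (simp add: wnorm_sq_def Cw[OF s] inner_commute)
  qed
  have "v \<bullet> x t \<le> exp (- integral {0..t} (\<lambda>s. beta_c H \<Gamma> \<Sigma> (C s))) * (v \<bullet> x 0)"
  proof (rule halfline_gronwall[OF _ beta_c_continuous _ t])
    show "(\<lambda>t. v \<bullet> x t) hhd (\<lambda>t. - (x t \<bullet> ((\<Theta> t ** noise_cov t ** transpose (\<Theta> t)) *v x t)))"
      by (rule matrix_inverse_form_derivative[OF pullback_cov_derivative pullback_cov_sym l(1) lM x])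
    fix s :: real assume s: "0 \<le> s"
    have "x s \<bullet> ((\<Theta> s ** noise_cov s ** transpose (\<Theta> s)) *v x s) = w s \<bullet> (noise_cov s *v w s)"
      using inner_matrix_transpose[of "x s" "\<Theta> s" "noise_cov s *v w s"]
      by (simp add: w_def matrix_vector_mul_assoc matrix_mul_assoc)
    also have "\<dots> \<ge> beta_c H \<Gamma> \<Sigma> (C s) * (w s \<bullet> (C s *v w s))"
      using beta_c_pos_def(1)[OF C_pos_def[OF s] \<Gamma> \<Sigma>, where H = H] by (simp add: noise_cov_def)
    finally show "- (x s \<bullet> ((\<Theta> s ** noise_cov s ** transpose (\<Theta> s)) *v x s)) \<le> - beta_c H \<Gamma> \<Sigma> (C s) * (v \<bullet> x s)"
      unfolding wCw[OF s] by simp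
  qed
  then show ?thesis using wn[OF t] wn[of 0] \<Phi>0 by simp
qed

end

section \<open>Contraction of the mean-field filter\<close>

text \<open>Both filters must be discretized on the same grids, since only then do their
  approximations have literally equal laws.\<close>

lemma common_indices:
  fixes p q :: "nat \<Rightarrow> nat \<Rightarrow> real"
  assumes p: "\<And>e. 0 < e \<Longrightarrow> \<exists>m0. \<forall>m\<ge>m0. \<exists>k0. \<forall>k\<ge>k0. p m k < e"
    and q: "\<And>e. 0 < e \<Longrightarrow> \<exists>m0. \<forall>m\<ge>m0. \<exists>k0. \<forall>k\<ge>k0. q m k < e"
  obtains m k :: "nat \<Rightarrow> nat" where "\<And>n. n < m n" "\<And>n. 0 < k n"
    "\<And>n. p (m n) (k n) < (1 / 2) ^ n" "\<And>n. q (m n) (k n) < (1 / 2) ^ n"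
proof -
  have "\<exists>m k. n < m \<and> 0 < k \<and> p m k < (1 / 2) ^ n \<and> q m k < (1 / 2) ^ n" for n :: nat
  proof -
    have e: "0 < (1 / 2 :: real) ^ n" by simp
    obtain m1 where m1: "\<forall>m\<ge>m1. \<exists>k0. \<forall>k\<ge>k0. p m k < (1 / 2) ^ n" using p[OF e] by blast
    obtain m2 where m2: "\<forall>m\<ge>m2. \<exists>k0. \<forall>k\<ge>k0. q m k < (1 / 2) ^ n" using q[OF e] by blast
    define m where "m = max (max m1 m2) (Suc n)"
    have "m1 \<le> m" "m2 \<le> m" by (simp_all add: m_def)
    with m1 m2 obtain k1 k2 where k1: "\<forall>k\<ge>k1. p m k < (1 / 2) ^ n" and k2: "\<forall>k\<ge>k2. q m k < (1 / 2) ^ n" by blast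
    show ?thesis
      using k1 k2 by (intro exI[of _ m] exI[of _ "max (max k1 k2) 1"]) (auto simp: m_def)
  qed
  then show ?thesis using that by metis
qed

lemma (in prob_space) expectation_mult_of_product_law:
  fixes f :: "'b::topological_space \<Rightarrow> real" and g :: "'c::topological_space \<Rightarrow> real"
  assumes law: "distr M (borel \<Otimes>\<^sub>M borel) (\<lambda>\<eta>. (X \<eta>, V \<eta>)) = distr M borel X \<Otimes>\<^sub>M distr M borel V"
    and [measurable]: "X \<in> borel_measurable M" "V \<in> borel_measurable M" "f \<in> borel_measurable borel" "g \<in> borel_measurable borel"
    and i: "integrable M (\<lambda>\<eta>. f (X \<eta>))" "integrable M (\<lambda>\<eta>. g (V \<eta>))"
  shows "integrable M (\<lambda>\<eta>. f (X \<eta>) * g (V \<eta>))"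
    "expectation (\<lambda>\<eta>. f (X \<eta>) * g (V \<eta>)) = expectation (\<lambda>\<eta>. f (X \<eta>)) * expectation (\<lambda>\<eta>. g (V \<eta>))"
proof -
  have "distr M borel (\<lambda>\<eta>. f (X \<eta>)) \<Otimes>\<^sub>M distr M borel (\<lambda>\<eta>. g (V \<eta>))
      = distr (distr M borel X) borel f \<Otimes>\<^sub>M distr (distr M borel V) borel g"
    by (simp add: distr_distr o_def)
  also have "\<dots> = distr (distr M borel X \<Otimes>\<^sub>M distr M borel V) (borel \<Otimes>\<^sub>M borel) (\<lambda>(x, y). (f x, g y))"
  proof (rule pair_measure_distr)
    interpret g: prob_space "distr (distr M borel V) borel g"
      by (intro prob_space.prob_space_distr prob_space_distr) auto
    show "sigma_finite_measure (distr (distr M borel V) borel g)" ..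
  qed auto
  also have "\<dots> = distr M (borel \<Otimes>\<^sub>M borel) (\<lambda>\<eta>. (f (X \<eta>), g (V \<eta>)))"
    unfolding law[symmetric] by (subst distr_distr) (auto simp: o_def)
  finally have "indep_var borel (\<lambda>\<eta>. f (X \<eta>)) borel (\<lambda>\<eta>. g (V \<eta>))"
    unfolding indep_var_distribution_eq by auto
  from indep_var_lebesgue_integral[OF this i] indep_var_integrable[OF this i]
  show "integrable M (\<lambda>\<eta>. f (X \<eta>) * g (V \<eta>))"
    "expectation (\<lambda>\<eta>. f (X \<eta>) * g (V \<eta>)) = expectation (\<lambda>\<eta>. f (X \<eta>)) * expectation (\<lambda>\<eta>. g (V \<eta>))" by auto
qed

text \<open>In direction \<open>a\<close> the state is the sum of
  \<open>\<Phi>\<^sup>T a \<bullet> X0\<close> and \<open>a \<bullet> \<xi>\<^sub>t\<close>;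
  independence removes the cross term of the variance.\<close>

lemma (in filter_path) Cov_path:
  assumes t: "0 \<le> t" and P2: "distr M borel X0 \<in> P2" "distr M borel (x t) \<in> P2"
  shows "a \<bullet> (Cov (distr M borel (x t)) *v a) =
      (transpose (\<Phi> t) *v a) \<bullet> (Cov (distr M borel X0) *v (transpose (\<Phi> t) *v a))
      + integral {0..t} (\<lambda>s. (norm (transpose (\<Phi> t ** \<Theta> s ** S) *v a))\<^sup>2
        + (norm (transpose (- (\<Phi> t ** \<Theta> s ** K s ** G)) *v a))\<^sup>2)"
proof -
  obtain m k where mk: "\<And>n. n < m n" "\<And>n. 0 < k n" "\<And>n. pdist M (full_step t (m n) (k n)) (noise_part t) < (1 / 2) ^ n"
    using common_indices[OF full_step_approx[OF t] full_step_approx[OF t]] by metis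
  have [measurable]: "x t \<in> borel_measurable M" "noise_part t \<in> borel_measurable M"
    using x_measurable noise_part_measurable t by auto
  define b where "b = transpose (\<Phi> t) *v a"
  define U where "U \<eta> = b \<bullet> X0 \<eta>" for \<eta>
  define V where "V \<eta> = a \<bullet> noise_part t \<eta>" for \<eta>
  define u where "u = b \<bullet> mean (distr M borel X0)"
  have UV: "a \<bullet> x t \<eta> = U \<eta> + V \<eta>" for \<eta>
    using inner_matrix_transpose[of a "\<Phi> t" "X0 \<eta>"] by (simp add: U_def V_def b_def noise_part_def inner_diff_right)
  note var = noise_part_variance[OF t mk, where v = a, folded V_def]
  have iU: "integrable M U" using P2_integrable(2)[OF P2(1), of b] by (simp add: U_def[abs_def] integrable_distr_eq)
  have EU: "expectation U = u" unfolding u_def mean_inner[OF P2(1)] by (simp add: U_def[abs_def] integral_distr)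
  have U2: "integrable M (\<lambda>\<eta>. (U \<eta> - u)\<^sup>2)"
    "expectation (\<lambda>\<eta>. (U \<eta> - u)\<^sup>2) = b \<bullet> (Cov (distr M borel X0) *v b)"
    using P2_integrable(3)[OF P2(1), of b "mean (distr M borel X0)" b] Cov_form[OF P2(1), of b b]
    by (simp_all add: U_def u_def integrable_distr_eq integral_distr inner_diff_right power2_eq_square)
  define w where "w = expectation V"
  have cross: "integrable M (\<lambda>\<eta>. (U \<eta> - u) * (V \<eta> - w))" "expectation (\<lambda>\<eta>. (U \<eta> - u) * (V \<eta> - w)) = 0"
    using expectation_mult_of_product_law[OF X0_noise_part_law[OF t mk], of "\<lambda>y. b \<bullet> y - u" "\<lambda>y. a \<bullet> y - w"]
      iU var(1) EU by (simp_all add: U_def[abs_def] V_def[abs_def] w_def prob_space)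
  have "a \<bullet> mean (distr M borel (x t)) = u + w"
    unfolding mean_inner[OF P2(2)] using iU var(1) EU by (simp add: integral_distr UV w_def)
  then have "a \<bullet> (Cov (distr M borel (x t)) *v a) = expectation (\<lambda>\<eta>. ((U \<eta> - u) + (V \<eta> - w))\<^sup>2)"
    unfolding Cov_form[OF P2(2)] by (simp add: integral_distr inner_diff_right UV power2_eq_square algebra_simps)
  also have "\<dots> = expectation (\<lambda>\<eta>. (U \<eta> - u)\<^sup>2 + (V \<eta> - w)\<^sup>2 + 2 * ((U \<eta> - u) * (V \<eta> - w)))"
    by (simp only: power2_sum mult.assoc)
  also have "\<dots> = expectation (\<lambda>\<eta>. (U \<eta> - u)\<^sup>2) + expectation (\<lambda>\<eta>. (V \<eta> - w)\<^sup>2)"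
    using U2(1) var(2) cross unfolding w_def by simp
  finally show ?thesis unfolding U2(2) w_def var(3) b_def .
qed

lemma mfenkf_filter_path:
  assumes f: "mfenkf F H \<Sigma> \<Gamma> N Z M \<nu> X0 B W X \<pi>" and \<omega>: "\<omega> \<in> space N"
    and flow: "\<Phi> 0 = mat 1" "\<Theta> 0 = mat 1"
      "\<Phi> hhd (\<lambda>t. (F - kalman_gain H \<Gamma> (Cov (\<pi> t \<omega>)) ** H) ** \<Phi> t)"
      "\<Theta> hhd (\<lambda>t. - (\<Theta> t ** (F - kalman_gain H \<Gamma> (Cov (\<pi> t \<omega>)) ** H)))"
      "\<And>t. 0 \<le> t \<Longrightarrow> \<Phi> t ** \<Theta> t = mat 1"
  shows "filter_path M X0 B W F (sqrtm \<Sigma>) H (sqrtm \<Gamma>) (\<lambda>s. kalman_gain H \<Gamma> (Cov (\<pi> s \<omega>))) (\<lambda>s. Z s \<omega>)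
      (\<lambda>t \<eta>. X t (\<omega>, \<eta>)) \<Phi> \<Theta>"
proof -
  interpret prob_space M using f by (simp add: mfenkf_def)
  show ?thesis
  proof
    show "X0 \<in> borel_measurable M" "brownian_motion M B" "brownian_motion M W"
      "indep3 M (gen_algebra M {0} (\<lambda>_. X0)) (gen_algebra M {0..} B) (gen_algebra M {0..} W)"
      using f by (simp_all add: mfenkf_def)
    have "continuous_on {0..} (\<lambda>s. Cov (\<pi> s \<omega>))" using f \<omega> by (simp add: mfenkf_def)
    then show "continuous_on {0..} (\<lambda>s. kalman_gain H \<Gamma> (Cov (\<pi> s \<omega>)))"
      unfolding kalman_gain_def by (intro matrix_continuous_intros)
    have cp: "continuous_process (N \<Otimes>\<^sub>M M) X" using f by (simp add: mfenkf_def)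
    show "(\<lambda>\<eta>. X t (\<omega>, \<eta>)) \<in> borel_measurable M" if "0 \<le> t" for t
    proof -
      have "X t \<in> borel_measurable (N \<Otimes>\<^sub>M M)" using cp that by (simp add: continuous_process_def)
      from measurable_compose[OF measurable_Pair1'[OF \<omega>] this] show ?thesis .
    qed
    show "continuous_on {0..} (\<lambda>t. X t (\<omega>, \<eta>))" if "\<eta> \<in> space M" for \<eta>
      using cp \<omega> that by (simp add: continuous_process_def space_pair_measure)
    show "X 0 (\<omega>, \<eta>) = X0 \<eta>" if "\<eta> \<in> space M" for \<eta>
      using f \<omega> that by (simp add: mfenkf_def)
    show "\<exists>I. stoch_integral M (\<lambda>s. kalman_gain H \<Gamma> (Cov (\<pi> s \<omega>)))
          (\<lambda>s \<eta>. integral {0..s} (\<lambda>r. H *v X r (\<omega>, \<eta>)) + sqrtm \<Gamma> *v W s \<eta> - Z s \<omega>) t I \<and>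
        (AE \<eta> in M. X t (\<omega>, \<eta>) = X0 \<eta> + integral {0..t} (\<lambda>s. F *v X s (\<omega>, \<eta>)) + sqrtm \<Sigma> *v B t \<eta> - I \<eta>)" if "0 \<le> t" for t
      using f \<omega> that unfolding mfenkf_def by blast
    show "\<Phi> 0 = mat 1" "\<Theta> 0 = mat 1"
      "\<Phi> hhd (\<lambda>t. (F - kalman_gain H \<Gamma> (Cov (\<pi> t \<omega>)) ** H) ** \<Phi> t)"
      "\<Theta> hhd (\<lambda>t. - (\<Theta> t ** (F - kalman_gain H \<Gamma> (Cov (\<pi> t \<omega>)) ** H)))" by (fact flow)+
    show "\<Phi> t ** \<Theta> t = mat 1" if "0 \<le> t" for t by (rule flow(5)[OF that])
  qed
qed

lemma mfenkf_laws:
  assumes f: "mfenkf F H \<Sigma> \<Gamma> N Z M \<nu> X0 B W X \<pi>" and \<omega>: "\<omega> \<in> space N"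
  shows "distr M borel X0 = \<nu>" "\<And>t. 0 \<le> t \<Longrightarrow> distr M borel (\<lambda>\<eta>. X t (\<omega>, \<eta>)) = \<pi> t \<omega>"
    "\<And>t. 0 \<le> t \<Longrightarrow> \<pi> t \<omega> \<in> P2" "\<pi> 0 \<omega> = \<nu>" "\<nu> \<in> P2"
proof -
  show "distr M borel X0 = \<nu>" using f by (simp add: mfenkf_def)
  have p: "\<pi> t \<omega> = distr M borel (\<lambda>\<eta>. X t (\<omega>, \<eta>)) \<and> \<pi> t \<omega> \<in> P2" if "0 \<le> t" for t
  proof -
    have "\<forall>t\<ge>0. \<pi> t \<omega> = distr M borel (\<lambda>\<eta>. X t (\<omega>, \<eta>)) \<and> \<pi> t \<omega> \<in> P2"
      using f \<omega> unfolding mfenkf_def by blast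
    then show ?thesis using that by blast
  qed
  then show "\<And>t. 0 \<le> t \<Longrightarrow> distr M borel (\<lambda>\<eta>. X t (\<omega>, \<eta>)) = \<pi> t \<omega>" "\<And>t. 0 \<le> t \<Longrightarrow> \<pi> t \<omega> \<in> P2" by metis+
  have "distr M borel (\<lambda>\<eta>. X 0 (\<omega>, \<eta>)) = distr M borel X0"
    using f \<omega> by (intro distr_cong) (auto simp: mfenkf_def)
  then show "\<pi> 0 \<omega> = \<nu>" using p[of 0] \<open>distr M borel X0 = \<nu>\<close> by simp
  then show "\<nu> \<in> P2" using p[of 0] by auto
qed

text \<open>Here the self-consistency is closed: \<open>Cov_path\<close> holds for any continuous
  gain, and the gain that drives this path is made of the covariance of its own law, so the formula
  becomes the assumption \<open>C_form\<close>.\<close>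

lemma mfenkf_flow:
  assumes f: "mfenkf F H \<Sigma> \<Gamma> N Z M \<nu> X0 B W X \<pi>" and \<omega>: "\<omega> \<in> space N"
    and pd: "pos_def \<Sigma>" "pos_def \<Gamma>" "pos_def (Cov \<nu>)"
  obtains \<Phi> \<Theta> where "covariance_flow F \<Sigma> H \<Gamma> (\<lambda>t. Cov (\<pi> t \<omega>)) \<Phi> \<Theta>"
proof -
  have Cc: "continuous_on {0..} (\<lambda>s. Cov (\<pi> s \<omega>))" using f \<omega> by (simp add: mfenkf_def)
  have "continuous_on {0..} (\<lambda>t. F - kalman_gain H \<Gamma> (Cov (\<pi> t \<omega>)) ** H)"
    unfolding kalman_gain_def by (intro matrix_continuous_intros Cc)
  then show ?thesis
  proof (rule fundamental_solution, goal_cases)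
    case (1 \<Phi> \<Theta>)
    interpret filter_path M X0 B W F "sqrtm \<Sigma>" H "sqrtm \<Gamma>" "\<lambda>s. kalman_gain H \<Gamma> (Cov (\<pi> s \<omega>))" "\<lambda>s. Z s \<omega>"
      "\<lambda>t \<eta>. X t (\<omega>, \<eta>)" \<Phi> \<Theta>
      by (rule mfenkf_filter_path[OF f \<omega> 1(1-4) 1(6)])
    note laws = mfenkf_laws[OF f \<omega>]
    have "covariance_flow F \<Sigma> H \<Gamma> (\<lambda>t. Cov (\<pi> t \<omega>)) \<Phi> \<Theta>"
    proof
      fix t a assume t: "(0::real) \<le> t"
      show "a \<bullet> (Cov (\<pi> t \<omega>) *v a) = (transpose (\<Phi> t) *v a) \<bullet> (Cov (\<pi> 0 \<omega>) *v (transpose (\<Phi> t) *v a))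
        + integral {0..t} (\<lambda>s. (norm (transpose (\<Phi> t ** \<Theta> s ** sqrtm \<Sigma>) *v a))\<^sup>2
        + (norm (transpose (- (\<Phi> t ** \<Theta> s ** kalman_gain H \<Gamma> (Cov (\<pi> s \<omega>)) ** sqrtm \<Gamma>)) *v a))\<^sup>2)"
        using Cov_path[OF t, of a] laws(3)[OF t] laws(5) unfolding laws(1) laws(2)[OF t] laws(4) by simp
    qed (use pd Cc transpose_Cov laws(4) 1 in auto)
    then show ?case by (rule that)
  qed
qed

section \<open>Couplings and the weighted Wasserstein distance\<close>

lemma couplings_product:
  assumes "prob_space \<mu>" "sets \<mu> = sets borel" "prob_space \<nu>" "sets \<nu> = sets borel"
  shows "\<mu> \<Otimes>\<^sub>M \<nu> \<in> couplings \<mu> \<nu>"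
proof -
  interpret \<mu>: prob_space \<mu> by fact
  interpret \<nu>: prob_space \<nu> by fact
  interpret pair_prob_space \<mu> \<nu> ..
  have "distr (\<mu> \<Otimes>\<^sub>M \<nu>) borel fst = distr (\<mu> \<Otimes>\<^sub>M \<nu>) \<mu> fst" "distr (\<mu> \<Otimes>\<^sub>M \<nu>) borel snd = distr (\<mu> \<Otimes>\<^sub>M \<nu>) \<nu> snd"
    using assms by (intro distr_cong; simp)+
  then show ?thesis
    using \<nu>.distr_pair_fst[of \<mu>] distr_pair_snd[OF assms(1,3)] assms(2,4) prob_space_axioms
    by (simp add: couplings_def cong: sets_pair_measure_cong)
qed

lemma wnorm_sq_nonneg: "pos_def C \<Longrightarrow> 0 \<le> wnorm_sq C v"
  using pos_def_imp_semidef[OF pos_def_matrix_inv[of C]] by (simp add: wnorm_sq_def pos_semidef_def)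

lemma wnorm_sq_measurable [measurable]: "wnorm_sq C \<in> borel_measurable borel"
  unfolding wnorm_sq_def by measurable

lemma couplings_integrable_wnorm_sq:
  assumes \<mu>: "\<mu> \<in> P2" and \<nu>: "\<nu> \<in> P2" and \<gamma>: "\<gamma> \<in> couplings \<mu> \<nu>" and C: "pos_def C"
  shows "integrable \<gamma> (\<lambda>(x, y). wnorm_sq C (x - y))"
proof -
  from \<gamma> have s [measurable_cong]: "sets \<gamma> = sets (borel \<Otimes>\<^sub>M borel)" and d: "distr \<gamma> borel fst = \<mu>" "distr \<gamma> borel snd = \<nu>"
    by (auto simp: couplings_def)
  obtain k where k: "0 < k" "\<And>w. w \<bullet> (matrix_inv C *v w) \<le> k * (w \<bullet> w)" using form_le_norm by blast
  have "integrable (distr \<gamma> borel fst) (\<lambda>x. (norm x)\<^sup>2)" "integrable (distr \<gamma> borel snd) (\<lambda>x. (norm x)\<^sup>2)"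
    unfolding d using \<mu> \<nu> by (simp_all add: P2_def)
  then have i: "integrable \<gamma> (\<lambda>p. (norm (fst p))\<^sup>2)" "integrable \<gamma> (\<lambda>p. (norm (snd p))\<^sup>2)"
    by (simp_all add: integrable_distr_eq)
  have "integrable \<gamma> (\<lambda>p. k * (2 * (norm (fst p))\<^sup>2 + 2 * (norm (snd p))\<^sup>2))" using i by simp
  then show ?thesis
  proof (rule Bochner_Integration.integrable_bound)
    show "(\<lambda>(x, y). wnorm_sq C (x - y)) \<in> borel_measurable \<gamma>" by measurable
    have "wnorm_sq C (x - y) \<le> k * (2 * (norm x)\<^sup>2 + 2 * (norm y)\<^sup>2)" for x y
    proof -
      have "(norm (x - y))\<^sup>2 \<le> (norm x + norm y)\<^sup>2" using norm_triangle_ineq4[of x y] by (intro power_mono) auto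
      also have "\<dots> \<le> 2 * (norm x)\<^sup>2 + 2 * (norm y)\<^sup>2" using sum_squares_bound[of "norm x" "norm y"] by (simp add: power2_sum)
      finally have "k * (norm (x - y))\<^sup>2 \<le> k * (2 * (norm x)\<^sup>2 + 2 * (norm y)\<^sup>2)" using k by (intro mult_left_mono) auto
      then show ?thesis using k(2)[of "x - y"] by (simp add: wnorm_sq_def power2_norm_eq_inner)
    qed
    then show "AE p in \<gamma>. norm (case p of (x, y) \<Rightarrow> wnorm_sq C (x - y)) \<le> norm (k * (2 * (norm (fst p))\<^sup>2 + 2 * (norm (snd p))\<^sup>2))"
      using k wnorm_sq_nonneg[OF C] by (auto simp: abs_mult)
  qed
qed

lemma W2_nonneg:
  assumes "\<mu> \<in> P2" "\<nu> \<in> P2" "pos_def C" shows "0 \<le> W2 \<mu> \<nu> C"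
proof -
  have "\<mu> \<Otimes>\<^sub>M \<nu> \<in> couplings \<mu> \<nu>" using assms by (intro couplings_product) (auto simp: P2_def)
  then show ?thesis
    unfolding W2_def using wnorm_sq_nonneg[OF assms(3)]
    by (intro cINF_greatest) (auto intro!: real_sqrt_ge_zero Bochner_Integration.integral_nonneg)
qed

text \<open>Moving both marginals with the same independent noise \<open>e\<close> cancels it in the
  difference, so every coupling of the initial laws yields one of the final laws whose points differ
  by \<open>A (x - y)\<close>. The infimum is taken at the end; no optimal coupling is
  required.\<close>

lemma W2_affine_noise_contraction:
  fixes \<mu> \<nu> \<rho> :: "(real^'d) measure" and A C C' :: "real^'d^'d"
  assumes \<mu>: "\<mu> \<in> P2" and \<nu>: "\<nu> \<in> P2" and \<rho>: "prob_space \<rho>" "sets \<rho> = sets borel"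
    and C: "pos_def C" and C': "pos_def C'" and c: "0 < c"
    and contr: "\<And>v. wnorm_sq C' (A *v v) \<le> c\<^sup>2 * wnorm_sq C v"
  shows "W2 (distr (\<mu> \<Otimes>\<^sub>M \<rho>) borel (\<lambda>(x, e). A *v x + e)) (distr (\<nu> \<Otimes>\<^sub>M \<rho>) borel (\<lambda>(x, e). A *v x + e)) C'
    \<le> c * W2 \<mu> \<nu> C"
proof -
  let ?\<mu>' = "distr (\<mu> \<Otimes>\<^sub>M \<rho>) borel (\<lambda>(x, e). A *v x + e)" and ?\<nu>' = "distr (\<nu> \<Otimes>\<^sub>M \<rho>) borel (\<lambda>(x, e). A *v x + e)"
  interpret \<rho>: prob_space \<rho> by fact
  note [measurable_cong] = \<rho>(2)
  have sig: "sigma_finite_measure (distr \<rho> borel (\<lambda>e. e))"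
  proof -
    interpret e: prob_space "distr \<rho> borel (\<lambda>e. e)" by (rule \<rho>.prob_space_distr) simp
    show ?thesis ..
  qed
  have id: "distr \<rho> borel (\<lambda>e. e) = \<rho>" by (rule distr_id2) (simp add: \<rho>)
  \<comment> \<open>A real infimum is a lower bound of its family only if the family is bounded
    below.\<close>
  have bdd: "bdd_below ((\<lambda>\<gamma>. sqrt (\<integral>(x, y). wnorm_sq C' (x - y) \<partial>\<gamma>)) ` couplings ?\<mu>' ?\<nu>')"
    using wnorm_sq_nonneg[OF C']
    by (intro bdd_belowI2[of _ 0]) (auto intro!: real_sqrt_ge_zero Bochner_Integration.integral_nonneg)
  have step: "W2 ?\<mu>' ?\<nu>' C' \<le> c * sqrt (\<integral>(x, y). wnorm_sq C (x - y) \<partial>\<gamma>)" if \<gamma>: "\<gamma> \<in> couplings \<mu> \<nu>" for \<gamma>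
  proof -
    from \<gamma> have ps: "prob_space \<gamma>" and s [measurable_cong]: "sets \<gamma> = sets (borel \<Otimes>\<^sub>M borel)"
      and d: "distr \<gamma> borel fst = \<mu>" "distr \<gamma> borel snd = \<nu>" by (auto simp: couplings_def)
    interpret \<gamma>: prob_space \<gamma> by fact
    interpret pair_prob_space \<gamma> \<rho> ..
    let ?T = "\<lambda>p. (A *v fst (fst p) + snd p, A *v snd (fst p) + snd p)"
    have Tm [measurable]: "?T \<in> \<gamma> \<Otimes>\<^sub>M \<rho> \<rightarrow>\<^sub>M borel \<Otimes>\<^sub>M borel" by measurable
    define \<gamma>' where "\<gamma>' = distr (\<gamma> \<Otimes>\<^sub>M \<rho>) (borel \<Otimes>\<^sub>M borel) ?T"
    have marg: "distr (\<gamma> \<Otimes>\<^sub>M \<rho>) borel (\<lambda>p. A *v f (fst p) + snd p) = distr (distr \<gamma> borel f \<Otimes>\<^sub>M \<rho>) borel (\<lambda>(x, e). A *v x + e)"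
      if f [measurable]: "f \<in> borel \<Otimes>\<^sub>M borel \<rightarrow>\<^sub>M borel" for f :: "(real^'d) \<times> (real^'d) \<Rightarrow> real^'d"
    proof -
      have "distr \<gamma> borel f \<Otimes>\<^sub>M distr \<rho> borel (\<lambda>e. e) = distr (\<gamma> \<Otimes>\<^sub>M \<rho>) (borel \<Otimes>\<^sub>M borel) (\<lambda>(x, e). (f x, e))"
        by (rule pair_measure_distr) (use sig in auto)
      then show ?thesis unfolding id by (simp add: distr_distr o_def case_prod_beta')
    qed
    have "\<gamma>' \<in> couplings ?\<mu>' ?\<nu>'"
      unfolding couplings_def
    proof (intro CollectI conjI)
      show "prob_space \<gamma>'" unfolding \<gamma>'_def by (rule prob_space_distr) simp
      show "sets \<gamma>' = sets (borel \<Otimes>\<^sub>M borel)" by (simp add: \<gamma>'_def)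
      show "distr \<gamma>' borel fst = ?\<mu>'" using marg[of fst] d by (simp add: \<gamma>'_def distr_distr o_def)
      show "distr \<gamma>' borel snd = ?\<nu>'" using marg[of snd] d by (simp add: \<gamma>'_def distr_distr o_def)
    qed
    then have "W2 ?\<mu>' ?\<nu>' C' \<le> sqrt (\<integral>(x, y). wnorm_sq C' (x - y) \<partial>\<gamma>')"
      unfolding W2_def by (rule cINF_lower[OF bdd])
    also have "(\<integral>(x, y). wnorm_sq C' (x - y) \<partial>\<gamma>') = (\<integral>p. wnorm_sq C' (A *v (fst (fst p) - snd (fst p))) \<partial>(\<gamma> \<Otimes>\<^sub>M \<rho>))"
      unfolding \<gamma>'_def by (subst integral_distr) (auto simp: mv.diff_right case_prod_beta')
    also have "\<dots> = (\<integral>p. wnorm_sq C' (A *v (fst p - snd p)) \<partial>distr (\<gamma> \<Otimes>\<^sub>M \<rho>) \<gamma> fst)"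
      by (subst integral_distr) auto
    also have "\<dots> = (\<integral>p. wnorm_sq C' (A *v (fst p - snd p)) \<partial>\<gamma>)" by (simp add: \<rho>.distr_pair_fst)
    also have "sqrt \<dots> \<le> sqrt (c\<^sup>2 * (\<integral>(x, y). wnorm_sq C (x - y) \<partial>\<gamma>))"
    proof (rule real_sqrt_le_mono)
      have i: "integrable \<gamma> (\<lambda>p. c\<^sup>2 * wnorm_sq C (fst p - snd p))"
        using couplings_integrable_wnorm_sq[OF \<mu> \<nu> \<gamma> C] by (simp add: case_prod_beta')
      have "(\<integral>p. wnorm_sq C' (A *v (fst p - snd p)) \<partial>\<gamma>) \<le> (\<integral>p. c\<^sup>2 * wnorm_sq C (fst p - snd p) \<partial>\<gamma>)"
      proof (rule integral_mono[OF _ i contr])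
        show "integrable \<gamma> (\<lambda>p. wnorm_sq C' (A *v (fst p - snd p)))"
        proof (rule Bochner_Integration.integrable_bound[OF i])
          show "AE p in \<gamma>. norm (wnorm_sq C' (A *v (fst p - snd p))) \<le> norm (c\<^sup>2 * wnorm_sq C (fst p - snd p))"
            using contr wnorm_sq_nonneg[OF C'] wnorm_sq_nonneg[OF C] by (auto simp: abs_mult)
        qed measurable
      qed
      then show "(\<integral>p. wnorm_sq C' (A *v (fst p - snd p)) \<partial>\<gamma>) \<le> c\<^sup>2 * (\<integral>(x, y). wnorm_sq C (x - y) \<partial>\<gamma>)"
        by (simp add: case_prod_beta')
    qed
    also have "\<dots> = c * sqrt (\<integral>(x, y). wnorm_sq C (x - y) \<partial>\<gamma>)" using c by (simp add: real_sqrt_mult)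
    finally show ?thesis .
  qed
  have "couplings \<mu> \<nu> \<noteq> {}" using couplings_product[of \<mu> \<nu>] \<mu> \<nu> by (auto simp: P2_def)
  then have "W2 ?\<mu>' ?\<nu>' C' / c \<le> W2 \<mu> \<nu> C"
    unfolding W2_def[of \<mu> \<nu>] using step c by (intro cINF_greatest) (simp_all add: pos_divide_le_eq mult.commute)
  then show ?thesis using c by (simp add: pos_divide_le_eq mult.commute)
qed

text \<open>With equal covariances the gains, the flow and all grid coefficients agree, and both
  filters see the same observation path. Their discretized noises thus have the same law, and so do
  the limits; this common law is \<open>\<rho>\<close>.\<close>

lemma mfenkf_coupled_representation:
  assumes f\<^sub>1: "mfenkf F H \<Sigma> \<Gamma> N Z M\<^sub>1 \<mu> X0\<^sub>1 B\<^sub>1 W\<^sub>1 X\<^sub>1 \<pi>\<^sub>1" and f\<^sub>2: "mfenkf F H \<Sigma> \<Gamma> N Z M\<^sub>2 \<nu> X0\<^sub>2 B\<^sub>2 W\<^sub>2 X\<^sub>2 \<pi>\<^sub>2"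
    and \<omega>: "\<omega> \<in> space N" and t: "0 \<le> t"
    and eq: "\<And>s. 0 \<le> s \<Longrightarrow> Cov (\<pi>\<^sub>1 s \<omega>) = Cov (\<pi>\<^sub>2 s \<omega>)"
    and flow: "covariance_flow F \<Sigma> H \<Gamma> (\<lambda>t. Cov (\<pi>\<^sub>1 t \<omega>)) \<Phi> \<Theta>"
  obtains \<rho> where "prob_space \<rho>" "sets \<rho> = sets borel"
    "\<pi>\<^sub>1 t \<omega> = distr (\<mu> \<Otimes>\<^sub>M \<rho>) borel (\<lambda>(x, e). \<Phi> t *v x + e)" "\<pi>\<^sub>2 t \<omega> = distr (\<nu> \<Otimes>\<^sub>M \<rho>) borel (\<lambda>(x, e). \<Phi> t *v x + e)"
proof -
  interpret covariance_flow F \<Sigma> H \<Gamma> "\<lambda>t. Cov (\<pi>\<^sub>1 t \<omega>)" \<Phi> \<Theta> by (rule flow)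
  let ?K\<^sub>1 = "\<lambda>s. kalman_gain H \<Gamma> (Cov (\<pi>\<^sub>1 s \<omega>))" and ?K\<^sub>2 = "\<lambda>s. kalman_gain H \<Gamma> (Cov (\<pi>\<^sub>2 s \<omega>))"
  interpret p1: filter_path M\<^sub>1 X0\<^sub>1 B\<^sub>1 W\<^sub>1 F "sqrtm \<Sigma>" H "sqrtm \<Gamma>" ?K\<^sub>1 "\<lambda>s. Z s \<omega>" "\<lambda>t \<eta>. X\<^sub>1 t (\<omega>, \<eta>)" \<Phi> \<Theta>
    by (rule mfenkf_filter_path[OF f\<^sub>1 \<omega> \<Phi>0 \<Theta>0 \<Phi>' \<Theta>' \<Phi>\<Theta>])
  have \<Phi>'2: "\<Phi> hhd (\<lambda>t. (F - ?K\<^sub>2 t ** H) ** \<Phi> t)" and \<Theta>'2: "\<Theta> hhd (\<lambda>t. - (\<Theta> t ** (F - ?K\<^sub>2 t ** H)))"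
    using \<Phi>' \<Theta>' eq by simp_all
  interpret p2: filter_path M\<^sub>2 X0\<^sub>2 B\<^sub>2 W\<^sub>2 F "sqrtm \<Sigma>" H "sqrtm \<Gamma>" ?K\<^sub>2 "\<lambda>s. Z s \<omega>" "\<lambda>t \<eta>. X\<^sub>2 t (\<omega>, \<eta>)" \<Phi> \<Theta>
    by (rule mfenkf_filter_path[OF f\<^sub>2 \<omega> \<Phi>0 \<Theta>0 \<Phi>'2 \<Theta>'2 \<Phi>\<Theta>])
  obtain m k where mk: "\<And>n. n < m n" "\<And>n. 0 < k n"
    "\<And>n. pdist M\<^sub>1 (p1.full_step t (m n) (k n)) (p1.noise_part t) < (1 / 2) ^ n"
    "\<And>n. pdist M\<^sub>2 (p2.full_step t (m n) (k n)) (p2.noise_part t) < (1 / 2) ^ n"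
    proof (rule common_indices[OF p1.full_step_approx[OF t] p2.full_step_approx[OF t]], goal_cases)
    case (3 m k)
    show ?case by (rule that[of m k]) (fact 3)+
  qed assumption+
  have steps: "p1.step_W t a b = p2.step_W t a b" "p1.step_z t a b = p2.step_z t a b" for a b
    unfolding p1.step_W_def p2.step_W_def p1.step_z_def p2.step_z_def
    using eq t by (auto intro!: ext sum.cong)
  have laws: "distr M\<^sub>1 borel (p1.full_step t (m n) (k n)) = distr M\<^sub>2 borel (p2.full_step t (m n) (k n))" for n
  proof -
    have pos: "0 < m n * k n" using mk(1)[of n] mk(2)[of n] by simp
    show ?thesis
      unfolding p1.full_step_def[abs_def] p2.full_step_def[abs_def] p1.noise_sum_law(2)[OF t pos] p2.noise_sum_law(2)[OF t pos]
      by (simp only: steps)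
  qed
  define \<rho> where "\<rho> = distr M\<^sub>1 borel (p1.noise_part t)"
  have \<rho>2: "\<rho> = distr M\<^sub>2 borel (p2.noise_part t)"
    unfolding \<rho>_def
    by (rule law_limit_unique[OF p1.prob_space_axioms p2.prob_space_axioms _ _ _ _ laws
          p1.full_step_pdist_tendsto[OF t mk(1-3)] p2.full_step_pdist_tendsto[OF t mk(1,2,4)]])
      (intro p1.full_step_measurable p2.full_step_measurable p1.noise_part_measurable p2.noise_part_measurable t)+
  \<comment> \<open>The state is \<open>\<Phi> t X0\<close> plus \<open>noise_part\<close> by
    definition of the latter, so its law is an image of the joint law; the claim is stated for a
    generic filter to serve both.\<close>
  have law: "distr M borel (\<lambda>\<eta>. x t \<eta>) = distr (distr M borel X0 \<Otimes>\<^sub>M distr M borel (filter_path.noise_part X0 x \<Phi> t)) borel (\<lambda>(x, e). \<Phi> t *v x + e)"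
    if "filter_path M X0 B W F S H G K z x \<Phi> \<Theta>"
      and law: "distr M (borel \<Otimes>\<^sub>M borel) (\<lambda>\<eta>. (X0 \<eta>, filter_path.noise_part X0 x \<Phi> t \<eta>)) =
        distr M borel X0 \<Otimes>\<^sub>M distr M borel (filter_path.noise_part X0 x \<Phi> t)"
    for M :: "'x measure" and X0 B W F S H G K z x
  proof -
    interpret filter_path M X0 B W F S H G K z x \<Phi> \<Theta> by fact
    have [measurable]: "X0 \<in> borel_measurable M" "x t \<in> borel_measurable M"
      by (fact X0) (rule x_measurable[OF t])
    show ?thesis unfolding law[symmetric]
      by (subst distr_distr) (auto simp: o_def noise_part_def)
  qed
  have "prob_space \<rho>" unfolding \<rho>_def by (rule p1.prob_space_distr) (rule p1.noise_part_measurable[OF t])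
  moreover have "sets \<rho> = sets borel" by (simp add: \<rho>_def)
  moreover have "\<pi>\<^sub>1 t \<omega> = distr (\<mu> \<Otimes>\<^sub>M \<rho>) borel (\<lambda>(x, e). \<Phi> t *v x + e)"
    using law[OF p1.filter_path_axioms p1.X0_noise_part_law[OF t mk(1-3)]] mfenkf_laws(1)[OF f\<^sub>1 \<omega>] mfenkf_laws(2)[OF f\<^sub>1 \<omega> t]
    by (simp add: \<rho>_def)
  moreover have "\<pi>\<^sub>2 t \<omega> = distr (\<nu> \<Otimes>\<^sub>M \<rho>) borel (\<lambda>(x, e). \<Phi> t *v x + e)"
    using law[OF p2.filter_path_axioms p2.X0_noise_part_law[OF t mk(1,2,4)]] mfenkf_laws(1)[OF f\<^sub>2 \<omega>] mfenkf_laws(2)[OF f\<^sub>2 \<omega> t]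
    by (simp add: \<rho>2)
  ultimately show ?thesis by (rule that)
qed

text \<open>Equal initial covariances give, by uniqueness for the Riccati equation, one gain and one
  flow for both filters; then the bound on the flow is exactly the hypothesis of the coupling
  argument.\<close>

lemma mfenkf_contraction:
  assumes f\<^sub>1: "mfenkf F H \<Sigma> \<Gamma> N Z M\<^sub>1 \<mu> X0\<^sub>1 B\<^sub>1 W\<^sub>1 X\<^sub>1 \<pi>\<^sub>1" and f\<^sub>2: "mfenkf F H \<Sigma> \<Gamma> N Z M\<^sub>2 \<nu> X0\<^sub>2 B\<^sub>2 W\<^sub>2 X\<^sub>2 \<pi>\<^sub>2"
    and \<omega>: "\<omega> \<in> space N" and t: "0 \<le> t" and pd: "pos_def \<Sigma>" "pos_def \<Gamma>" "pos_def (Cov \<mu>)"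
    and cov: "Cov \<nu> = Cov \<mu>"
  shows "W2 (\<pi>\<^sub>1 t \<omega>) (\<pi>\<^sub>2 t \<omega>) (Cov (\<pi>\<^sub>1 t \<omega>))
    \<le> exp (- (1/2) * integral {0..t} (\<lambda>s. beta_c H \<Gamma> \<Sigma> (Cov (\<pi>\<^sub>1 s \<omega>)))) * W2 \<mu> \<nu> (Cov \<mu>)"
proof -
  obtain \<Phi> \<Theta> where flow: "covariance_flow F \<Sigma> H \<Gamma> (\<lambda>t. Cov (\<pi>\<^sub>1 t \<omega>)) \<Phi> \<Theta>" by (rule mfenkf_flow[OF f\<^sub>1 \<omega> pd])
  obtain \<Phi>\<^sub>2 \<Theta>\<^sub>2 where flow2: "covariance_flow F \<Sigma> H \<Gamma> (\<lambda>t. Cov (\<pi>\<^sub>2 t \<omega>)) \<Phi>\<^sub>2 \<Theta>\<^sub>2"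
    by (rule mfenkf_flow[OF f\<^sub>2 \<omega> pd(1,2)]) (use pd(3) cov in simp_all)
  interpret covariance_flow F \<Sigma> H \<Gamma> "\<lambda>t. Cov (\<pi>\<^sub>1 t \<omega>)" \<Phi> \<Theta> by (rule flow)
  have eq: "Cov (\<pi>\<^sub>1 s \<omega>) = Cov (\<pi>\<^sub>2 s \<omega>)" if "0 \<le> s" for s
    by (rule riccati_solution_unique[OF pd(2) C_riccati covariance_flow.C_riccati[OF flow2] _ that])
      (simp add: mfenkf_laws(4)[OF f\<^sub>1 \<omega>] mfenkf_laws(4)[OF f\<^sub>2 \<omega>] cov)
  obtain \<rho> where \<rho>: "prob_space \<rho>" "sets \<rho> = sets borel"
    "\<pi>\<^sub>1 t \<omega> = distr (\<mu> \<Otimes>\<^sub>M \<rho>) borel (\<lambda>(x, e). \<Phi> t *v x + e)" "\<pi>\<^sub>2 t \<omega> = distr (\<nu> \<Otimes>\<^sub>M \<rho>) borel (\<lambda>(x, e). \<Phi> t *v x + e)"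
    by (rule mfenkf_coupled_representation[OF f\<^sub>1 f\<^sub>2 \<omega> t eq flow])
  show ?thesis
    unfolding \<rho>(3,4)
  proof (subst \<rho>(3)[symmetric], rule W2_affine_noise_contraction)
    show "\<mu> \<in> P2" "\<nu> \<in> P2" using mfenkf_laws(5)[OF f\<^sub>1 \<omega>] mfenkf_laws(5)[OF f\<^sub>2 \<omega>] by auto
    show "prob_space \<rho>" "sets \<rho> = sets borel" by fact+
    show "pos_def (Cov \<mu>)" by fact
    show "pos_def (Cov (\<pi>\<^sub>1 t \<omega>))" by (rule C_pos_def[OF t])
    show "0 < exp (- (1/2) * integral {0..t} (\<lambda>s. beta_c H \<Gamma> \<Sigma> (Cov (\<pi>\<^sub>1 s \<omega>))))" by simp
    fix v
    show "wnorm_sq (Cov (\<pi>\<^sub>1 t \<omega>)) (\<Phi> t *v v)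
        \<le> (exp (- (1/2) * integral {0..t} (\<lambda>s. beta_c H \<Gamma> \<Sigma> (Cov (\<pi>\<^sub>1 s \<omega>)))))\<^sup>2 * wnorm_sq (Cov \<mu>) v"
      using weighted_contraction[OF t, of v] mfenkf_laws(4)[OF f\<^sub>1 \<omega>] by (simp add: exp_double[symmetric])
  qed
qed

theorem theorem3p13:
  fixes F \<Sigma> :: "real^'d^'d" and H :: "real^'d^'k" and \<Gamma> :: "real^'k^'k"
  assumes "c_detectable H F" and "pos_def \<Sigma>" and "pos_def \<Gamma>"
  shows "(\<forall>C. pos_def C \<longrightarrow> 0 < beta_c H \<Gamma> \<Sigma> C) \<and>
    (\<exists>\<beta>\<^sub>0 :: real^'d^'d \<Rightarrow> real. (\<forall>C. pos_def C \<longrightarrow> 0 < \<beta>\<^sub>0 C) \<and>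
      (\<forall>(N :: 'o measure) Xs Bs Ws Z \<mu>
         (M\<^sub>1 :: 'p measure) X0\<^sub>1 B\<^sub>1 W\<^sub>1 X\<^sub>1 \<pi>
         (M\<^sub>2 :: 'q measure) X0\<^sub>2 B\<^sub>2 W\<^sub>2 X\<^sub>2 \<pi>G.
        signal_observation F H \<Sigma> \<Gamma> N Xs Bs Ws Z \<longrightarrow>
        \<mu> \<in> P2 \<longrightarrow> pos_def (Cov \<mu>) \<longrightarrow>
        mfenkf F H \<Sigma> \<Gamma> N Z M\<^sub>1 \<mu> X0\<^sub>1 B\<^sub>1 W\<^sub>1 X\<^sub>1 \<pi> \<longrightarrow>
        mfenkf F H \<Sigma> \<Gamma> N Z M\<^sub>2 (gaussian_proj \<mu>) X0\<^sub>2 B\<^sub>2 W\<^sub>2 X\<^sub>2 \<pi>G \<longrightarrow>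
        (\<forall>\<omega>\<in>space N. \<forall>t\<ge>0.
          (\<forall>\<omega>'\<in>space N. Cov (\<pi> t \<omega>') = Cov (\<pi> t \<omega>)) \<and>
          pos_def (Cov (\<pi> t \<omega>)) \<and>
          (\<lambda>s. beta_c H \<Gamma> \<Sigma> (Cov (\<pi> s \<omega>))) integrable_on {0..t} \<and>
          W2 (\<pi> t \<omega>) (\<pi>G t \<omega>) (Cov (\<pi> t \<omega>))
            \<le> exp (- (1/2) * integral {0..t} (\<lambda>s. beta_c H \<Gamma> \<Sigma> (Cov (\<pi> s \<omega>))))
               * W2 \<mu> (gaussian_proj \<mu>) (Cov \<mu>) \<and>
          \<beta>\<^sub>0 (Cov \<mu>) \<le> beta_c H \<Gamma> \<Sigma> (Cov (\<pi> t \<omega>)) \<and>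
          W2 (\<pi> t \<omega>) (\<pi>G t \<omega>) (Cov (\<pi> t \<omega>))
            \<le> exp (- (1/2) * \<beta>\<^sub>0 (Cov \<mu>) * t) * W2 \<mu> (gaussian_proj \<mu>) (Cov \<mu>))))"
proof
  note \<Sigma> = assms(2) and \<Gamma> = assms(3)
  show "\<forall>C. pos_def C \<longrightarrow> 0 < beta_c H \<Gamma> \<Sigma> C" using beta_c_pos[OF _ \<Gamma> \<Sigma>] by blast
  \<comment> \<open>The rate is chosen as a function of the initial covariance alone, before any
    probability space, filter or observation path is fixed.\<close>
  define \<beta> where "\<beta> C\<^sub>0 = (SOME b. b > 0 \<and> (\<forall>C. riccati_solution F H \<Gamma> \<Sigma> C \<longrightarrow> C 0 = C\<^sub>0 \<longrightarrow> (\<forall>t\<ge>0. b \<le> beta_c H \<Gamma> \<Sigma> (C t))))" for C\<^sub>0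
  have \<beta>: "\<beta> C\<^sub>0 > 0 \<and> (\<forall>C. riccati_solution F H \<Gamma> \<Sigma> C \<longrightarrow> C 0 = C\<^sub>0 \<longrightarrow> (\<forall>t\<ge>0. \<beta> C\<^sub>0 \<le> beta_c H \<Gamma> \<Sigma> (C t)))" for C\<^sub>0
    unfolding \<beta>_def by (rule someI_ex) (rule riccati_beta_lower_bound[OF assms])
  show "\<exists>\<beta>\<^sub>0 :: real^'d^'d \<Rightarrow> real. (\<forall>C. pos_def C \<longrightarrow> 0 < \<beta>\<^sub>0 C) \<and>
      (\<forall>(N :: 'o measure) Xs Bs Ws Z \<mu>
         (M\<^sub>1 :: 'p measure) X0\<^sub>1 B\<^sub>1 W\<^sub>1 X\<^sub>1 \<pi>
         (M\<^sub>2 :: 'q measure) X0\<^sub>2 B\<^sub>2 W\<^sub>2 X\<^sub>2 \<pi>G.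
        signal_observation F H \<Sigma> \<Gamma> N Xs Bs Ws Z \<longrightarrow>
        \<mu> \<in> P2 \<longrightarrow> pos_def (Cov \<mu>) \<longrightarrow>
        mfenkf F H \<Sigma> \<Gamma> N Z M\<^sub>1 \<mu> X0\<^sub>1 B\<^sub>1 W\<^sub>1 X\<^sub>1 \<pi> \<longrightarrow>
        mfenkf F H \<Sigma> \<Gamma> N Z M\<^sub>2 (gaussian_proj \<mu>) X0\<^sub>2 B\<^sub>2 W\<^sub>2 X\<^sub>2 \<pi>G \<longrightarrow>
        (\<forall>\<omega>\<in>space N. \<forall>t\<ge>0.
          (\<forall>\<omega>'\<in>space N. Cov (\<pi> t \<omega>') = Cov (\<pi> t \<omega>)) \<and>
          pos_def (Cov (\<pi> t \<omega>)) \<and>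
          (\<lambda>s. beta_c H \<Gamma> \<Sigma> (Cov (\<pi> s \<omega>))) integrable_on {0..t} \<and>
          W2 (\<pi> t \<omega>) (\<pi>G t \<omega>) (Cov (\<pi> t \<omega>))
            \<le> exp (- (1/2) * integral {0..t} (\<lambda>s. beta_c H \<Gamma> \<Sigma> (Cov (\<pi> s \<omega>))))
               * W2 \<mu> (gaussian_proj \<mu>) (Cov \<mu>) \<and>
          \<beta>\<^sub>0 (Cov \<mu>) \<le> beta_c H \<Gamma> \<Sigma> (Cov (\<pi> t \<omega>)) \<and>
          W2 (\<pi> t \<omega>) (\<pi>G t \<omega>) (Cov (\<pi> t \<omega>))
            \<le> exp (- (1/2) * \<beta>\<^sub>0 (Cov \<mu>) * t) * W2 \<mu> (gaussian_proj \<mu>) (Cov \<mu>)))"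
  proof (intro exI[of _ \<beta>] conjI allI impI ballI)
    show "0 < \<beta> C" for C using \<beta> by blast
    fix N :: "'o measure" and Xs Bs Ws Z \<mu> and M\<^sub>1 :: "'p measure" and X0\<^sub>1 B\<^sub>1 W\<^sub>1 X\<^sub>1 \<pi>
      and M\<^sub>2 :: "'q measure" and X0\<^sub>2 B\<^sub>2 W\<^sub>2 X\<^sub>2 \<pi>G \<omega> and t :: real
    assume \<mu>: "\<mu> \<in> P2" and Cov_pd: "pos_def (Cov \<mu>)"
      and f\<^sub>1: "mfenkf F H \<Sigma> \<Gamma> N Z M\<^sub>1 \<mu> X0\<^sub>1 B\<^sub>1 W\<^sub>1 X\<^sub>1 \<pi>"
      and f\<^sub>2: "mfenkf F H \<Sigma> \<Gamma> N Z M\<^sub>2 (gaussian_proj \<mu>) X0\<^sub>2 B\<^sub>2 W\<^sub>2 X\<^sub>2 \<pi>G"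
      and \<omega>: "\<omega> \<in> space N" and t: "0 \<le> t"
    obtain \<Phi> \<Theta> where flow: "covariance_flow F \<Sigma> H \<Gamma> (\<lambda>t. Cov (\<pi> t \<omega>)) \<Phi> \<Theta>" by (rule mfenkf_flow[OF f\<^sub>1 \<omega> \<Sigma> \<Gamma> Cov_pd])
    interpret covariance_flow F \<Sigma> H \<Gamma> "\<lambda>t. Cov (\<pi> t \<omega>)" \<Phi> \<Theta> by (rule flow)
    note C_0 = mfenkf_laws(4)[OF f\<^sub>1 \<omega>]
    show "Cov (\<pi> t \<omega>') = Cov (\<pi> t \<omega>)" if \<omega>': "\<omega>' \<in> space N" for \<omega>'
    proof -
      obtain \<Phi>' \<Theta>' where "covariance_flow F \<Sigma> H \<Gamma> (\<lambda>t. Cov (\<pi> t \<omega>')) \<Phi>' \<Theta>'" by (rule mfenkf_flow[OF f\<^sub>1 \<omega>' \<Sigma> \<Gamma> Cov_pd])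
      from riccati_solution_unique[OF \<Gamma> covariance_flow.C_riccati[OF this] C_riccati _ t]
      show ?thesis by (simp add: C_0 mfenkf_laws(4)[OF f\<^sub>1 \<omega>'])
    qed
    show "pos_def (Cov (\<pi> t \<omega>))" by (rule C_pos_def[OF t])
    show i: "(\<lambda>s. beta_c H \<Gamma> \<Sigma> (Cov (\<pi> s \<omega>))) integrable_on {0..t}"
      by (intro integrable_continuous_real continuous_on_subset[OF beta_c_continuous]) auto
    have psd: "pos_semidef (Cov \<mu>)" by (rule pos_def_imp_semidef[OF Cov_pd])
    have G: "gaussian_proj \<mu> \<in> P2" "Cov (gaussian_proj \<mu>) = Cov \<mu>"
      unfolding gaussian_proj_def by (rule gaussian_P2[OF psd]) (rule Cov_gaussian[OF psd])
    show main: "W2 (\<pi> t \<omega>) (\<pi>G t \<omega>) (Cov (\<pi> t \<omega>))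
            \<le> exp (- (1/2) * integral {0..t} (\<lambda>s. beta_c H \<Gamma> \<Sigma> (Cov (\<pi> s \<omega>)))) * W2 \<mu> (gaussian_proj \<mu>) (Cov \<mu>)"
      by (rule mfenkf_contraction[OF f\<^sub>1 f\<^sub>2 \<omega> t \<Sigma> \<Gamma> Cov_pd G(2)])
    have lower: "\<beta> (Cov \<mu>) \<le> beta_c H \<Gamma> \<Sigma> (Cov (\<pi> s \<omega>))" if "0 \<le> s" for s
      using \<beta>[of "Cov \<mu>"] C_riccati that C_0 by auto
    then show "\<beta> (Cov \<mu>) \<le> beta_c H \<Gamma> \<Sigma> (Cov (\<pi> t \<omega>))" using t .
    have "integral {0..t} (\<lambda>_. \<beta> (Cov \<mu>)) \<le> integral {0..t} (\<lambda>s. beta_c H \<Gamma> \<Sigma> (Cov (\<pi> s \<omega>)))"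
      using lower by (intro integral_le i) auto
    then have "exp (- (1/2) * integral {0..t} (\<lambda>s. beta_c H \<Gamma> \<Sigma> (Cov (\<pi> s \<omega>)))) \<le> exp (- (1/2) * \<beta> (Cov \<mu>) * t)"
      using t by (simp add: mult.commute)
    from order_trans[OF main mult_right_mono[OF this W2_nonneg[OF \<mu> G(1) Cov_pd]]]
    show "W2 (\<pi> t \<omega>) (\<pi>G t \<omega>) (Cov (\<pi> t \<omega>)) \<le> exp (- (1/2) * \<beta> (Cov \<mu>) * t) * W2 \<mu> (gaussian_proj \<mu>) (Cov \<mu>)" .
  qed
qed

end
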